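(* Let $0<T<\infty$ and let $f\in L^2([0,T],ds)$. Then there exists a jointly measurable functional $(t,u,X)\mapsto I_t(f;u,X)$ on $[0,T]\times[0,\infty)\times\Omega$ such that the following statements hold: (i) For a.e. $u\in[0,\infty)$ and for $(\Pi^{(u)}\bullet R)(dX)$-a.e. $X$, the function $t\mapsto I_t(f;u,X)$ is continuous; (ii) For each $t\in[0,T]$, $$\int_0^tf(s)\,dX_s=I_t(f;g(X),X)\quad\mathscr{W}\text{-a.e.};$$ (iii) For each $t\in[0,T]$ and for a.e. $u\in[0,\infty)$, $$I_t(f;u,X)=\int_0^{u\wedge t}f(s)\,dX_s+\int_0^{(t-u)\vee0}f(s+u)\,d(\theta_uX)_s\quad(\Pi^{(u)}\bullet R)\text{-a.e.}$$
   Context: Path space. $\Omega = C([0,\infty)\to\mathbb{R})$, $X=(X_s)_{s\ge 0}$ is the coordinate process, $\mathcal{F}_\infty=\sigma(X_s:s\ge 0)$. $g(X)=\sup\{s\ge0:X_s=0\}$ is the last exit time from $0$; $\theta_uX$ is the shifted path $(\theta_uX)_s=X_{u+s}$, $s\ge0$. Measures. $\Pi^{(u)}$ ($u>0$) is the law on $C([0,u]\to\mathbb{R})$ of the Brownian bridge from $0$ to $0$ of length $u$. $R^+$ is the law on $(\Omega,\mathcal{F}_\infty)$ of the 3-dimensional Bessel process starting from $0$, $R^-$ is the law of $(-X_t)$ under $R^+$, and $R=\frac{R^++R^-}{2}$ (law of the symmetrized 3-dimensional Bessel process). For $u>0$, $X^{(u)}=(X_t:0\le t\le u)$ and $Y=(Y_t:t\ge0)$,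 the concatenation $X^{(u)}\bullet Y$ is the path with $(X^{(u)}\bullet Y)_t = X_t$ if $0\le t<u$; $=Y_{t-u}$ if $t\ge u$ and $X_u=Y_0$; $=X_u$ if $t\ge u$ and $X_u\ne Y_0$. $\Pi^{(u)}\bullet R$ is the law on $(\Omega,\mathcal{F}_\infty)$ of $X^{(u)}\bullet Y$ under $\Pi^{(u)}(dX^{(u)})\otimes R(dY)$; thus under $\Pi^{(u)}\bullet R$, $(X_s:s\le u)$ has law $\Pi^{(u)}$ and $\theta_uX$ has law $R$. The $\sigma$-finite measure $\mathscr{W}$ on $(\Omega,\mathcal{F}_\infty)$ is $$\mathscr{W}=\int_0^\infty \frac{du}{\sqrt{2\pi u}}\,\left(\Pi^{(u)}\bullet R\right).$$ Functions. $f\in L^2([0,T],ds)$ is real-valued and extended by $0$ outside $[0,T]$. $L^2(ds)=L^2([0,\infty),ds)$, $L^1\left(\frac{ds}{1+\sqrt{s}}\right)=\{f:\int_0^\infty|f(s)|\frac{ds}{1+\sqrt{s}}<\infty\}$, $L^1\left(\frac{ds}{\sqrt{s}}\right)=\{f:\int_0^\infty|f(s)|\frac{ds}{\sqrt{s}}<\infty\}$. "a.e. $u$" refers to Lebesgue measure. A step function is $f=\sum_{k=1}^n c_k 1_{[t_{k-1},t_k)}$ with $c_k\in\mathbb{R}$, $0=t_0<t_1<\cdots<t_n<\infty$; for a process $Y$, $\int_0^\infty f(s)\,dY_s:=\sum_{k=1}^n c_k(Y_{t_k}-Y_{t_{k-1}})$. Throughout, $\int_0^tf(s)\,dY_s$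 denotes the Wiener integral of $1_{[0,t)}f$. Wiener integrals. (1) Under $\mathscr{W}$: for $h\in L^2(ds)\cap L^1\left(\frac{ds}{1+\sqrt{s}}\right)$, $\int_0^\infty h(s)\,dX_s$ is the ($\mathscr{W}$-a.e. unique, independent of the sequence) limit of $\int_0^\infty h_n(s)\,dX_s$ locally in $\mathscr{W}$-measure for step functions $h_n\to h$ in both $L^2(ds)$ and $L^1\left(\frac{ds}{1+\sqrt{s}}\right)$; here $Z_n\to Z$ locally in $\mathscr{W}$-measure means $\mathscr{W}(A\cap\{|Z_n-Z|\ge\varepsilon\})\to0$ for all $\varepsilon>0$ and all $A\in\mathcal{F}_\infty$ with $\mathscr{W}(A)<\infty$. In (ii), $\int_0^tf(s)\,dX_s$, $t\in[0,T]$, denotes a continuous modification under $\mathscr{W}$ of $\int_0^\infty1_{[0,t)}(s)f(s)\,dX_s$, $t\in[0,T]$ (so the two are equal $\mathscr{W}$-a.e. for each $t$). (2) Brownian bridge: for $h\in L^2([0,u],ds)$, $\int_0^uh(s)\,dX_s$ is the $L^2(\Pi^{(u)})$-limit of $\int_0^uh_n(s)\,dX_s$ for step functions $h_n\to h$ in $L^2([0,u],ds)$. (3) Symmetrized 3-dimensional Bessel process: for $h\in L^2(ds)\cap L^1\left(\frac{ds}{\sqrt{s}}\right)$, $\int_0^\infty h(s)\,dX_s$ is the limit in $R$-probability of $\int_0^\infty h_n(s)\,dX_s$ for step functions $h_n\to h$ in both $L^2(ds)$ and $L^1\left(\frac{ds}{\sqrt{s}}\right)$. The limits in (2) and (3)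 exist and do not depend on the approximating sequence. For $f$ as in the claim, $f(\cdot+u)\in L^1\left(\frac{ds}{\sqrt{s}}\right)$ for a.e. $u$, so the second integral in (iii) is defined for a.e. $u$. In (iii) the first integral is a Wiener integral for the Brownian bridge $(X_s:s\le u)$ and the second one for the symmetrized 3-dimensional Bessel process $\theta_uX$. *)

theory Defs
  imports "HOL-Probability.Probability"
begin

text \<open>Paths indexed by a set \<open>S\<close> of times are functions on \<^typ>\<open>real\<close> that are continuous on \<open>S\<close>
  and \<^const>\<open>extensional\<close> (equal to \<^const>\<open>undefined\<close> off \<open>S\<close>), with the
  sigma-algebra generated by the coordinate maps.\<close>

definition path_space :: "real set \<Rightarrow> (real \<Rightarrow> 'a::euclidean_space) measure" where
  "path_space S = restrict_space (Pi\<^sub>M S (\<lambda>_. borel)) {w. continuous_on S w}"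

abbreviation Omega :: "(real \<Rightarrow> real) measure" where
  "Omega \<equiv> path_space {0..}"

section \<open>Laws\<close>

text \<open>\<open>\<mu>\<close> is the law of a standard Brownian motion in \<^typ>\<open>'a\<close> started at 0: independent
  increments, with \<open>w t - w s\<close> distributed as \<open>N(0, (t - s) Id)\<close>.\<close>

definition wiener_measure :: "(real \<Rightarrow> 'a::euclidean_space) measure \<Rightarrow> bool" where
  "wiener_measure \<mu> \<longleftrightarrow>
     prob_space \<mu> \<and> sets \<mu> = sets (path_space {0..}) \<and>
     (AE w in \<mu>. w 0 = 0) \<and>
     (\<forall>s t. 0 \<le> s \<and> s < t \<longrightarrow>
        distributed \<mu> lborel (\<lambda>w. w t - w s)
          (\<lambda>x. ennreal ((2 * pi * (t - s)) powr (- real DIM('a) / 2)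
                        * exp (- (norm x)\<^sup>2 / (2 * (t - s)))))) \<and>
     (\<forall>(\<tau> :: nat \<Rightarrow> real) n. 0 \<le> \<tau> 0 \<and> (\<forall>i<n. \<tau> i \<le> \<tau> (Suc i)) \<longrightarrow>
        prob_space.indep_vars \<mu> (\<lambda>_. borel) (\<lambda>i w. w (\<tau> (Suc i)) - w (\<tau> i)) {..<n})"

text \<open>Brownian bridge from 0 to 0 of length \<open>u\<close>: the law of \<open>B t - (t / u) B u\<close>, \<open>0 \<le> t \<le> u\<close>,
  for a Brownian motion \<open>B\<close>.\<close>

definition brownian_bridge_law :: "real \<Rightarrow> (real \<Rightarrow> real) measure \<Rightarrow> bool" where
  "brownian_bridge_law u P \<longleftrightarrow>
     (\<exists>\<mu>. wiener_measure \<mu> \<and>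
          P = distr \<mu> (path_space {0..u}) (\<lambda>w. \<lambda>t\<in>{0..u}. w t - t / u * w u))"

text \<open>Three-dimensional Bessel process from 0: the law of the Euclidean norm of a Brownian motion
  in three dimensions.\<close>

definition bessel3_law :: "(real \<Rightarrow> real) measure \<Rightarrow> bool" where
  "bessel3_law P \<longleftrightarrow>
     (\<exists>\<mu> :: (real \<Rightarrow> real ^ 3) measure. wiener_measure \<mu> \<and>
          P = distr \<mu> Omega (\<lambda>w. \<lambda>t\<in>{0..}. norm (w t)))"

definition neg_law :: "(real \<Rightarrow> real) measure \<Rightarrow> (real \<Rightarrow> real) measure" where
  "neg_law P = distr P Omega (\<lambda>w. \<lambda>t\<in>{0..}. - w t)"

definition symmetrize :: "(real \<Rightarrow> real) measure \<Rightarrow> (real \<Rightarrow> real) measure" where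
  "symmetrize P =
     measure_of (space Omega) (sets Omega) (\<lambda>A. (emeasure P A + emeasure (neg_law P) A) / 2)"

definition concat_path :: "real \<Rightarrow> (real \<Rightarrow> real) \<Rightarrow> (real \<Rightarrow> real) \<Rightarrow> real \<Rightarrow> real" where
  "concat_path u x y =
     (\<lambda>t\<in>{0..}. if t < u then x t else if x u = y 0 then y (t - u) else x u)"

definition concat_law ::
    "real \<Rightarrow> (real \<Rightarrow> real) measure \<Rightarrow> (real \<Rightarrow> real) measure \<Rightarrow> (real \<Rightarrow> real) measure" where
  "concat_law u P Q = distr (P \<Otimes>\<^sub>M Q) Omega (\<lambda>(x, y). concat_path u x y)"

text \<open>The sigma-finite measure \<open>A \<mapsto> \<integral>\<^sub>0\<^sup>\<infinity> (concat_law u (B u) R)(A) du / sqrt (2 \<pi> u)\<close>, written with the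
  Giry monad \<^const>\<open>Giry_Monad.bind\<close>, which does not require its first argument to be finite.\<close>

definition W_measure ::
    "(real \<Rightarrow> (real \<Rightarrow> real) measure) \<Rightarrow> (real \<Rightarrow> real) measure \<Rightarrow> (real \<Rightarrow> real) measure" where
  "W_measure B R =
     Giry_Monad.bind
       (density (restrict_space lborel {0<..}) (\<lambda>u. ennreal (1 / sqrt (2 * pi * u))))
       (\<lambda>u. concat_law u (B u) R)"

text \<open>The value is unspecified for a path whose zero set is empty or unbounded; such paths form a
  null set for the measure above.\<close>

definition last_exit :: "(real \<Rightarrow> real) \<Rightarrow> real" where
  "last_exit w = Sup {s. 0 \<le> s \<and> w s = 0}"

definition shift_path :: "real \<Rightarrow> (real \<Rightarrow> real) \<Rightarrow> real \<Rightarrow> real" where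
  "shift_path u w = (\<lambda>s\<in>{0..}. w (u + s))"

section \<open>Wiener integrals\<close>

text \<open>The triple \<open>(n, \<tau>, c)\<close> encodes the step function with value \<open>c k\<close> on \<open>[\<tau> k, \<tau> (k + 1))\<close>
  for \<open>k < n\<close>.\<close>

type_synonym step = "nat \<times> (nat \<Rightarrow> real) \<times> (nat \<Rightarrow> real)"

definition is_step :: "step \<Rightarrow> bool" where
  "is_step = (\<lambda>(n, \<tau>, c). \<tau> 0 = 0 \<and> (\<forall>k<n. \<tau> k < \<tau> (Suc k)))"

definition step_end :: "step \<Rightarrow> real" where
  "step_end = (\<lambda>(n, \<tau>, c). \<tau> n)"

definition step_fun :: "step \<Rightarrow> real \<Rightarrow> real" where
  "step_fun = (\<lambda>(n, \<tau>, c) s. \<Sum>k<n. c k * indicator {\<tau> k..<\<tau> (Suc k)} s)"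

definition step_integral :: "step \<Rightarrow> (real \<Rightarrow> real) \<Rightarrow> real" where
  "step_integral = (\<lambda>(n, \<tau>, c) Y. \<Sum>k<n. c k * (Y (\<tau> (Suc k)) - Y (\<tau> k)))"

definition L2_tendsto :: "real set \<Rightarrow> (nat \<Rightarrow> step) \<Rightarrow> (real \<Rightarrow> real) \<Rightarrow> bool" where
  "L2_tendsto S \<phi> h \<longleftrightarrow>
     (\<lambda>n. \<integral>\<^sup>+s\<in>S. ennreal ((step_fun (\<phi> n) s - h s)\<^sup>2) \<partial>lebesgue) \<longlonglongrightarrow> 0"

text \<open>Convergence in \<open>L\<^sup>1(\<rho>(s) ds)\<close> on the half-line.\<close>

definition L1_tendsto :: "(real \<Rightarrow> real) \<Rightarrow> (nat \<Rightarrow> step) \<Rightarrow> (real \<Rightarrow> real) \<Rightarrow> bool" where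
  "L1_tendsto \<rho> \<phi> h \<longleftrightarrow>
     (\<lambda>n. \<integral>\<^sup>+s\<in>{0..}. ennreal (\<bar>step_fun (\<phi> n) s - h s\<bar> * \<rho> s) \<partial>lebesgue) \<longlonglongrightarrow> 0"

text \<open>Each of the three integrals is an almost-everywhere class of random variables. The predicates
  \<open>is_wiener_*\<close> single out its members; the constants \<open>wiener_*\<close> pick an arbitrary one, and are
  meaningful only for integrands in the respective domain (\<open>L\<^sup>2 \<inter> L\<^sup>1(ds / (1 + sqrt s))\<close>,
  \<open>L\<^sup>2([0, u])\<close> and \<open>L\<^sup>2 \<inter> L\<^sup>1(ds / sqrt s)\<close>).\<close>

definition is_wiener_W ::
    "(real \<Rightarrow> real) measure \<Rightarrow> (real \<Rightarrow> real) \<Rightarrow> ((real \<Rightarrow> real) \<Rightarrow> real) \<Rightarrow> bool" where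
  "is_wiener_W W h Z \<longleftrightarrow>
     Z \<in> borel_measurable W \<and>
     (\<forall>\<phi>. (\<forall>n. is_step (\<phi> n)) \<and> L2_tendsto {0..} \<phi> h \<and> L1_tendsto (\<lambda>s. 1 / (1 + sqrt s)) \<phi> h \<longrightarrow>
        (\<forall>\<epsilon>>0. \<forall>A\<in>sets W. emeasure W A < \<infinity> \<longrightarrow>
           (\<lambda>n. emeasure W (A \<inter> {x \<in> space W. \<epsilon> \<le> \<bar>step_integral (\<phi> n) x - Z x\<bar>})) \<longlonglongrightarrow> 0))"

definition wiener_W ::
    "(real \<Rightarrow> real) measure \<Rightarrow> (real \<Rightarrow> real) \<Rightarrow> (real \<Rightarrow> real) \<Rightarrow> real" where
  "wiener_W W h = (SOME Z. is_wiener_W W h Z)"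

text \<open>Paths under the bridge law are only defined up to time \<open>u\<close>, hence the bound on
  \<^const>\<open>step_end\<close>.\<close>

definition is_wiener_bridge ::
    "(real \<Rightarrow> real) measure \<Rightarrow> real \<Rightarrow> (real \<Rightarrow> real) \<Rightarrow> ((real \<Rightarrow> real) \<Rightarrow> real) \<Rightarrow> bool" where
  "is_wiener_bridge P u h Z \<longleftrightarrow>
     Z \<in> borel_measurable P \<and> integrable P (\<lambda>x. (Z x)\<^sup>2) \<and>
     (\<forall>\<phi>. (\<forall>n. is_step (\<phi> n) \<and> step_end (\<phi> n) \<le> u) \<and> L2_tendsto {0..u} \<phi> h \<longrightarrow>
        (\<lambda>n. \<integral>\<^sup>+x. ennreal ((step_integral (\<phi> n) x - Z x)\<^sup>2) \<partial>P) \<longlonglongrightarrow> 0)"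

definition wiener_bridge ::
    "(real \<Rightarrow> real) measure \<Rightarrow> real \<Rightarrow> (real \<Rightarrow> real) \<Rightarrow> (real \<Rightarrow> real) \<Rightarrow> real" where
  "wiener_bridge P u h = (SOME Z. is_wiener_bridge P u h Z)"

definition is_wiener_bessel ::
    "(real \<Rightarrow> real) measure \<Rightarrow> (real \<Rightarrow> real) \<Rightarrow> ((real \<Rightarrow> real) \<Rightarrow> real) \<Rightarrow> bool" where
  "is_wiener_bessel R h Z \<longleftrightarrow>
     Z \<in> borel_measurable R \<and>
     (\<forall>\<phi>. (\<forall>n. is_step (\<phi> n)) \<and> L2_tendsto {0..} \<phi> h \<and> L1_tendsto (\<lambda>s. 1 / sqrt s) \<phi> h \<longrightarrow>
        (\<forall>\<epsilon>>0. (\<lambda>n. measure R {x \<in> space R. \<epsilon> \<le> \<bar>step_integral (\<phi> n) x - Z x\<bar>}) \<longlonglongrightarrow> 0))"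

definition wiener_bessel ::
    "(real \<Rightarrow> real) measure \<Rightarrow> (real \<Rightarrow> real) \<Rightarrow> (real \<Rightarrow> real) \<Rightarrow> real" where
  "wiener_bessel R h = (SOME Z. is_wiener_bessel R h Z)"

text \<open>A continuous modification of \<open>t \<mapsto> \<integral>\<^sub>0\<^sup>t f(s) dX\<^sub>s\<close>, \<open>0 \<le> t \<le> T\<close>, and a choice of one.\<close>

definition is_wiener_W_process ::
    "(real \<Rightarrow> real) measure \<Rightarrow> real \<Rightarrow> (real \<Rightarrow> real) \<Rightarrow> (real \<Rightarrow> (real \<Rightarrow> real) \<Rightarrow> real) \<Rightarrow> bool" where
  "is_wiener_W_process W T f J \<longleftrightarrow>
     (\<forall>t\<in>{0..T}. J t \<in> borel_measurable W) \<and>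
     (\<forall>x\<in>space W. continuous_on {0..T} (\<lambda>t. J t x)) \<and>
     (\<forall>t\<in>{0..T}. AE x in W. J t x = wiener_W W (\<lambda>s. indicator {0..<t} s * f s) x)"

definition wiener_W_process ::
    "(real \<Rightarrow> real) measure \<Rightarrow> real \<Rightarrow> (real \<Rightarrow> real) \<Rightarrow> real \<Rightarrow> (real \<Rightarrow> real) \<Rightarrow> real" where
  "wiener_W_process W T f = (SOME J. is_wiener_W_process W T f J)"

end

theory Submission
  imports Defs
begin

text \<open>The functional can be chosen independent of \<open>u\<close>: approximate \<open>f\<close> by step functions \<open>\<phi> n\<close> so
  fast that, for almost every \<open>u\<close>, the paths \<open>t \<mapsto> \<integral>\<^sub>0\<^sup>t \<phi> n dX\<close> converge uniformly on \<open>[0, T]\<close> almost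
  surely under \<open>\<Pi>\<^sup>(\<^sup>u\<^sup>) \<bullet> R\<close>, and let \<open>I\<close> be the limit. Uniform convergence follows from Borel-Cantelli and
  a maximal inequality for step integrals under the concatenated law, with right-hand side controlled
  by the \<open>L\<^sup>2\<close> norm of the integrand and the \<open>L\<^sup>1(ds / sqrt s)\<close> norm of its shift by \<open>u\<close>.

  No stochastic calculus is needed for the Bessel part: along a partition, the increments of
  \<open>\<bar>B\<bar>\<close>, for a Brownian motion \<open>B\<close> in three dimensions, are martingale differences plus nonnegative
  compensators (convexity of the norm), and the mean of the compensators telescopes to a
  multiple of \<open>sqrt t\<close>. The bridge is \<open>B t - (t / u) B u\<close>, whose correction term is elementary.

  Integrating over \<open>u\<close> with weight \<open>1 / sqrt u\<close> turns the shifted \<open>L\<^sup>1(ds / sqrt s)\<close> norms into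
  the \<open>L\<^sup>1(ds / (1 + sqrt s))\<close> norm, which gives local convergence in \<open>\<W>\<close>-measure. That limits are unique
  uses sets of finite measure exhausting the path space, obtained from the transience of the
  Bessel process.\<close>

section \<open>Step functions and their integrals\<close>

text \<open>The obstacle is that \<open>f\<close> is only square integrable: its shift by
  \<open>u\<close> lies in \<open>L1(ds / sqrt s)\<close> for almost every \<open>u\<close>, but
  need not do so for every \<open>u\<close>. The sequence \<open>\<phi>\<close> has to be fixed
  before \<open>u\<close> and must serve almost all \<open>u\<close> at once. Its rate
  \<open>8^-n\<close> in \<open>L2\<close> is set against thresholds \<open>2^-n\<close> for the
  increments: the \<open>L2\<close> part of the maximal inequality then costs \<open>16^-n\<close>,
  the \<open>L1\<close> part \<open>4^-n\<close> after averaging over \<open>u\<close>. As the limit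
  is computed from the path alone, it can be identified both under each \<open>C u\<close>, where it
  splits into a bridge and a Bessel integral, and under the mixture \<open>W\<close>.

  Time enters by stopping the integrator instead of cutting the integrand:
  \<open>step_integral \<phi> (stopped t X)\<close> makes sense path by path, is continuous in
  \<open>t\<close>, and at grid times is a partial sum, to which inequalities for random walks
  apply.

  The Wiener integrals are picked by \<open>SOME\<close>. Each time the almost sure limit along
  steps is first shown to satisfy the defining predicate, so that the choice is meaningful, and then
  compared with the chosen member.\<close>

lemma step_integral_triple:
  "step_integral (n, \<tau>, c) Y = (\<Sum>k<n. c k * (Y (\<tau> (Suc k)) - Y (\<tau> k)))"
  by (simp add: step_integral_def)

lemma is_step_mono:
  assumes "is_step (n, \<tau>, c)" "i \<le> j" "j \<le> n"
  shows "\<tau> i \<le> \<tau> j"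
  using assms(2,3)
proof (induction j rule: dec_induct)
  case (step j)
  then have "\<tau> j < \<tau> (Suc j)"
    using assms(1) by (auto simp: is_step_def)
  with step show ?case by auto
qed simp

lemma is_step_strict_mono:
  assumes "is_step (n, \<tau>, c)" "i < j" "j \<le> n"
  shows "\<tau> i < \<tau> j"
proof -
  have "\<tau> i < \<tau> (Suc i)"
    using assms by (auto simp: is_step_def)
  also have "\<dots> \<le> \<tau> j"
    using is_step_mono[OF assms(1), of "Suc i" j] assms by auto
  finally show ?thesis .
qed

lemma is_step_nonneg:
  assumes "is_step (n, \<tau>, c)" "i \<le> n"
  shows "0 \<le> \<tau> i"
  using is_step_mono[OF assms(1), of 0 i] assms by (auto simp: is_step_def)

text \<open>Evaluation at \<open>s\<close> is integration against the path that jumps from 0 to 1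
  after \<open>s\<close>. An identity between step integrals that holds for all integrators
  therefore gives the corresponding identity between step functions, and the constructions below are
  checked on integrals only.\<close>

lemma step_fun_eq_step_integral:
  assumes "is_step \<phi>"
  shows "step_fun \<phi> s = step_integral \<phi> (\<lambda>b. if s < b then 1 else 0)"
proof -
  obtain n \<tau> c where \<phi>: "\<phi> = (n, \<tau>, c)" by (cases \<phi>)
  have "c k * indicator {\<tau> k..<\<tau> (Suc k)} s =
      c k * ((if s < \<tau> (Suc k) then 1 else 0) - (if s < \<tau> k then 1 else 0))" if "k < n" for k
  proof -
    have "\<tau> k < \<tau> (Suc k)"
      using that assms by (auto simp: \<phi> is_step_def)
    then show ?thesis by (simp add: indicator_def)
  qed
  then show ?thesis
    unfolding \<phi> step_fun_def step_integral_triple prod.case by (intro sum.cong) auto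
qed

lemma step_integral_cong:
  assumes "is_step \<phi>" "\<And>b. 0 \<le> b \<Longrightarrow> b \<le> step_end \<phi> \<Longrightarrow> Y b = Y' b"
  shows "step_integral \<phi> Y = step_integral \<phi> Y'"
proof -
  obtain n \<tau> c where \<phi>: "\<phi> = (n, \<tau>, c)" by (cases \<phi>)
  have "Y (\<tau> k) = Y' (\<tau> k)" if "k \<le> n" for k
    using assms is_step_nonneg[of n \<tau> c k] is_step_mono[of n \<tau> c k n] that
    by (auto simp: \<phi> step_end_def)
  then show ?thesis
    unfolding \<phi> step_integral_triple by (intro sum.cong) auto
qed

lemma step_integral_add:
  "step_integral \<phi> (\<lambda>b. Y b + Z b) = step_integral \<phi> Y + step_integral \<phi> Z"
  by (cases \<phi>) (simp add: step_integral_triple sum.distrib[symmetric] algebra_simps)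

lemma step_integral_mult_right:
  "step_integral \<phi> (\<lambda>b. a * Y b) = a * step_integral \<phi> Y"
  by (cases \<phi>) (simp add: step_integral_triple sum_distrib_left algebra_simps)

lemma step_integral_uminus:
  "step_integral \<phi> (\<lambda>b. - Y b) = - step_integral \<phi> Y"
  using step_integral_mult_right[of \<phi> "-1" Y] by simp

lemma step_integral_const: "step_integral \<phi> (\<lambda>b. a) = 0"
  by (cases \<phi>) (simp add: step_integral_triple)

lemma step_fun_neg: "is_step \<phi> \<Longrightarrow> s < 0 \<Longrightarrow> step_fun \<phi> s = 0"
proof -
  assume *: "is_step \<phi>" "s < 0"
  have "step_fun \<phi> s = step_integral \<phi> (\<lambda>b. 1)"
    unfolding step_fun_eq_step_integral[OF *(1)] using *
    by (intro step_integral_cong) auto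
  then show ?thesis by (simp add: step_integral_const)
qed

lemma step_fun_beyond: "is_step \<phi> \<Longrightarrow> step_end \<phi> \<le> s \<Longrightarrow> step_fun \<phi> s = 0"
proof -
  assume *: "is_step \<phi>" "step_end \<phi> \<le> s"
  have "step_fun \<phi> s = step_integral \<phi> (\<lambda>b. 0)"
    unfolding step_fun_eq_step_integral[OF *(1)] using *
    by (intro step_integral_cong) auto
  then show ?thesis by (simp add: step_integral_const)
qed

lemma step_end_nonneg: "is_step \<phi> \<Longrightarrow> 0 \<le> step_end \<phi>"
  by (cases \<phi>) (auto simp: step_end_def intro: is_step_nonneg)

lemma step_fun_cell:
  assumes "is_step (n, \<tau>, c)" "k < n" "\<tau> k \<le> s" "s < \<tau> (Suc k)"
  shows "step_fun (n, \<tau>, c) s = c k"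
proof -
  have "c j * indicator {\<tau> j..<\<tau> (Suc j)} s = (if j = k then c k else 0)" if "j < n" for j
  proof (cases "j = k")
    case False
    then consider "Suc j \<le> k" | "Suc k \<le> j" by linarith
    then have "s \<notin> {\<tau> j..<\<tau> (Suc j)}"
    proof cases
      case 1 then show ?thesis using is_step_mono[OF assms(1) 1] assms by auto
    next
      case 2 then show ?thesis using is_step_mono[OF assms(1) 2] assms that by auto
    qed
    with False show ?thesis by simp
  qed (use assms in auto)
  then have "step_fun (n, \<tau>, c) s = (\<Sum>j<n. if j = k then c k else 0)"
    unfolding step_fun_def prod.case by (intro sum.cong) auto
  with assms(2) show ?thesis by simp
qed

lemma telescope_cells:
  fixes y :: "nat \<Rightarrow> real"
  assumes "i \<le> l" "l \<le> N"
  shows "(\<Sum>j<N. (if i \<le> j \<and> j < l then 1 else 0) * (y (Suc j) - y j)) = y l - y i"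
proof -
  have "(\<Sum>j<N. (if i \<le> j \<and> j < l then 1 else 0) * (y (Suc j) - y j))
      = (\<Sum>j\<in>{i..<l}. y (Suc j) - y j)"
    using assms by (intro sum.mono_neutral_cong_right) auto
  also have "\<dots> = y l - y i"
    using assms by (simp add: sum_Suc_diff')
  finally show ?thesis .
qed

text \<open>An increment over a coarse cell telescopes over the grid cells inside it. The new
  coefficient is the value of \<open>\<phi>\<close> at the left end of a grid cell, which is the
  right one because cells are closed on the left. \<open>c'\<close> can be anything, since
  \<open>is_step\<close> constrains only the times.\<close>

lemma step_integral_refine:
  assumes "is_step \<phi>" "is_step (N, p, c')" and \<phi>: "\<phi> = (n, \<tau>, c)"
    and sub: "\<tau> ` {..n} \<subseteq> p ` {..N}"
  shows "step_integral (N, p, \<lambda>k. step_fun \<phi> (p k)) Y = step_integral \<phi> Y"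
proof -
  have "Y (\<tau> (Suc k)) - Y (\<tau> k) =
      (\<Sum>j<N. indicator {\<tau> k..<\<tau> (Suc k)} (p j) * (Y (p (Suc j)) - Y (p j)))" if "k < n" for k
  proof -
    have "\<tau> k \<in> p ` {..N}" "\<tau> (Suc k) \<in> p ` {..N}"
      using that sub by auto
    then obtain i l where il: "i \<le> N" "l \<le> N" "\<tau> k = p i" "\<tau> (Suc k) = p l"
      by auto
    have "p i < p l"
      using assms(1) that by (auto simp: \<phi> is_step_def simp flip: il)
    then have "i < l"
      using is_step_mono[OF assms(2), of l i] il by (metis leD not_le_imp_less)
    have "indicator {p i..<p l} (p j) = (if i \<le> j \<and> j < l then 1 else 0 :: real)" if "j < N" for j
    proof -
      have "p i \<le> p j \<longleftrightarrow> i \<le> j"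
        using is_step_mono[OF assms(2), of i j] is_step_strict_mono[OF assms(2), of j i] il that
        by (cases "i \<le> j") auto
      moreover have "p j < p l \<longleftrightarrow> j < l"
        using is_step_mono[OF assms(2), of l j] is_step_strict_mono[OF assms(2), of j l] il that
        by (cases "l \<le> j") auto
      ultimately show ?thesis by (auto simp: indicator_def)
    qed
    then have "(\<Sum>j<N. indicator {p i..<p l} (p j) * (Y (p (Suc j)) - Y (p j))) =
        (\<Sum>j<N. (if i \<le> j \<and> j < l then 1 else 0) * (Y (p (Suc j)) - Y (p j)))"
      by (intro sum.cong) auto
    also have "\<dots> = Y (p l) - Y (p i)"
      using \<open>i < l\<close> il by (intro telescope_cells) auto
    finally show ?thesis unfolding il ..
  qed
  then have "step_integral \<phi> Y = (\<Sum>k<n. \<Sum>j<N. c k * (indicator {\<tau> k..<\<tau> (Suc k)} (p j) * (Y (p (Suc j)) - Y (p j))))"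
    unfolding \<phi> step_integral_triple sum_distrib_left[symmetric] by (intro sum.cong) auto
  also have "\<dots> = (\<Sum>j<N. step_fun \<phi> (p j) * (Y (p (Suc j)) - Y (p j)))"
    unfolding \<phi> step_fun_def prod.case sum_distrib_right mult.assoc by (rule sum.swap)
  finally show ?thesis by (simp add: step_integral_triple)
qed

text \<open>The grid is the sorted list of \<open>insert 0 Q\<close>, with 0 added because a step
  has to start there. The coefficients are quantified inside the existential so that one grid
  carries several step functions.\<close>

lemma ex_grid:
  assumes "finite Q" "Q \<subseteq> {0..}"
  shows "\<exists>N p. (\<forall>c. is_step (N, p, c)) \<and> Q \<subseteq> p ` {..N}"
proof -
  define xs where "xs = sorted_list_of_set (insert 0 Q)"
  have set: "set xs = insert 0 Q" and len: "xs \<noteq> []"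
    and sorted: "sorted_wrt (<) xs"
    using assms by (auto simp: xs_def simp del: sorted_list_of_set_insert_remove)
  have "xs ! 0 = 0"
  proof -
    obtain i where i: "i < length xs" "xs ! i = 0"
      using set by (metis in_set_conv_nth insertI1)
    have "xs ! 0 \<ge> 0"
      using set assms len by (metis atLeast_iff insert_iff length_greater_0_conv nth_mem order_refl subsetD)
    then show ?thesis
      using sorted_wrt_nth_less[OF sorted, of 0 i] i by (cases "i = 0") auto
  qed
  moreover have "xs ! k < xs ! Suc k" if "k < length xs - 1" for k
    using sorted_wrt_nth_less[OF sorted, of k "Suc k"] that by auto
  moreover have "Q \<subseteq> (!) xs ` {..length xs - 1}"
  proof
    fix q assume "q \<in> Q"
    then obtain i where "i < length xs" "xs ! i = q"
      using set by (metis in_set_conv_nth insertCI)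
    then show "q \<in> (!) xs ` {..length xs - 1}" by force
  qed
  ultimately show ?thesis
    by (intro exI[of _ "length xs - 1"] exI[of _ "(!) xs"]) (auto simp: is_step_def)
qed

text \<open>\<open>Q\<close> prescribes additional grid points: the times at which a path is
  stopped, or at which an integrand is cut or shifted.\<close>

lemma step_refine:
  assumes "is_step \<phi>" "finite Q" "Q \<subseteq> {0..}"
  obtains N p where "\<And>c. is_step (N, p, c)" "Q \<subseteq> p ` {..N}"
    "\<And>Y. step_integral \<phi> Y = step_integral (N, p, \<lambda>k. step_fun \<phi> (p k)) Y"
proof -
  obtain n \<tau> c where \<phi>: "\<phi> = (n, \<tau>, c)" by (cases \<phi>)
  have "\<tau> ` {..n} \<subseteq> {0..}"
    using assms(1) by (auto simp: \<phi> intro: is_step_nonneg)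
  then obtain N p where p: "\<And>c. is_step (N, p, c)" "\<tau> ` {..n} \<union> Q \<subseteq> p ` {..N}"
    using ex_grid[of "\<tau> ` {..n} \<union> Q"] assms by auto
  have *: "step_integral (N, p, \<lambda>k. step_fun \<phi> (p k)) Y = step_integral \<phi> Y" for Y
    using p by (intro step_integral_refine[OF assms(1) p(1) \<phi>]) auto
  have "Q \<subseteq> p ` {..N}"
    using p(2) by auto
  then show ?thesis
    by (rule that[OF p(1) _ *[symmetric]])
qed

text \<open>Both steps are rewritten on a common grid. The bound on \<open>step_end\<close> is
  carried along for the bridge, whose paths end at \<open>u\<close>: a difference of two steps that
  end by \<open>u\<close> can still be evaluated on them.\<close>

lemma step_diff:
  assumes "is_step \<phi>" "is_step \<psi>"
  obtains \<xi> where "is_step \<xi>" "\<And>s. step_fun \<xi> s = step_fun \<phi> s - step_fun \<psi> s"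
    "\<And>Y. step_integral \<xi> Y = step_integral \<phi> Y - step_integral \<psi> Y"
    "step_end \<xi> \<le> max (step_end \<phi>) (step_end \<psi>)"
proof -
  obtain n \<tau> c where \<phi>: "\<phi> = (n, \<tau>, c)" by (cases \<phi>)
  obtain n' \<tau>' c' where \<psi>: "\<psi> = (n', \<tau>', c')" by (cases \<psi>)
  have "\<tau> ` {..n} \<subseteq> {0..}" "\<tau>' ` {..n'} \<subseteq> {0..}"
    using assms by (auto simp: \<phi> \<psi> intro: is_step_nonneg)
  then obtain N p where p: "\<And>c. is_step (N, p, c)" "\<tau> ` {..n} \<union> \<tau>' ` {..n'} \<subseteq> p ` {..N}"
    using ex_grid[of "\<tau> ` {..n} \<union> \<tau>' ` {..n'}"] by auto
  have 1: "step_integral (N, p, \<lambda>k. step_fun \<phi> (p k)) Y = step_integral \<phi> Y" for Y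
    using p by (intro step_integral_refine[OF assms(1) p(1) \<phi>]) auto
  have 2: "step_integral (N, p, \<lambda>k. step_fun \<psi> (p k)) Y = step_integral \<psi> Y" for Y
    using p by (intro step_integral_refine[OF assms(2) p(1) \<psi>]) auto
  define e where "e = max (step_end \<phi>) (step_end \<psi>)"
  \<comment> \<open>The grid may extend beyond both steps, so the cells beyond \<open>e\<close> are dropped.\<close>
  have "e \<in> p ` {..N}"
    using p(2) by (auto simp: e_def \<phi> \<psi> step_end_def max_def)
  then obtain l where l: "l \<le> N" "p l = e" by auto
  define \<xi> where "\<xi> = (l, p, \<lambda>k. step_fun \<phi> (p k) - step_fun \<psi> (p k))"
  have step: "is_step \<xi>"
    using p(1)[of c] l by (auto simp: \<xi>_def is_step_def)
  have *: "step_integral \<xi> Y = step_integral \<phi> Y - step_integral \<psi> Y" for Y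
  proof -
    have "step_fun \<phi> (p k) = 0 \<and> step_fun \<psi> (p k) = 0" if "l \<le> k" "k < N" for k
    proof -
      have "e \<le> p k"
        using is_step_mono[OF p(1) that(1)] that l by auto
      then show ?thesis
        using assms by (auto simp: e_def step_fun_beyond)
    qed
    then have "(\<Sum>k<N. (step_fun \<phi> (p k) - step_fun \<psi> (p k)) * (Y (p (Suc k)) - Y (p k)))
       = (\<Sum>k<l. (step_fun \<phi> (p k) - step_fun \<psi> (p k)) * (Y (p (Suc k)) - Y (p k)))"
      using l by (intro sum.mono_neutral_right) auto
    then show ?thesis
      unfolding 1[symmetric] 2[symmetric] step_integral_triple \<xi>_def
      by (simp add: sum_subtractf[symmetric] left_diff_distrib)
  qed
  have "step_fun \<xi> s = step_fun \<phi> s - step_fun \<psi> s" for s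
    by (simp only: step_fun_eq_step_integral[OF step] * step_fun_eq_step_integral[OF assms(1)]
        step_fun_eq_step_integral[OF assms(2)])
  with * step l show ?thesis
    by (intro that[of \<xi>]) (auto simp: \<xi>_def step_end_def e_def)
qed

text \<open>Freezing the integrator at \<open>t\<close> has the effect of truncating the integrand
  at \<open>t\<close>, see \<open>step_restrict\<close>. With the step kept fixed and
  \<open>t\<close> moved into the path, continuity and measurability in \<open>t\<close> are
  inherited from the path.\<close>

definition stopped :: "real \<Rightarrow> (real \<Rightarrow> real) \<Rightarrow> real \<Rightarrow> real" where
  "stopped t Y = (\<lambda>b. Y (min b t))"

lemma step_integral_stopped_ge:
  "is_step \<phi> \<Longrightarrow> step_end \<phi> \<le> t \<Longrightarrow> step_integral \<phi> (stopped t Y) = step_integral \<phi> Y"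
  by (intro step_integral_cong) (auto simp: stopped_def)

text \<open>This is the bridge from stopped paths to random walks: a maximum over stopping times on
  the grid becomes a maximum over partial sums.\<close>

lemma step_integral_stopped_grid:
  assumes "is_step (N, p, c)" "l \<le> N"
  shows "step_integral (N, p, c) (stopped (p l) Y) = (\<Sum>k<l. c k * (Y (p (Suc k)) - Y (p k)))"
proof -
  have 1: "min (p k) (p l) = (if k \<le> l then p k else p l)" if "k \<le> N" for k
    using is_step_mono[OF assms(1), of k l] is_step_mono[OF assms(1), of l k] that assms by auto
  have "step_integral (N, p, c) (stopped (p l) Y) =
      (\<Sum>k<N. if k < l then c k * (Y (p (Suc k)) - Y (p k)) else 0)"
    unfolding step_integral_triple stopped_def by (intro sum.cong) (auto simp: 1)
  also have "\<dots> = (\<Sum>k<l. c k * (Y (p (Suc k)) - Y (p k)))"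
    using assms by (intro sum.mono_neutral_cong_right) auto
  finally show ?thesis .
qed

text \<open>Once \<open>t\<close> is a grid point, the cells beyond it are dropped instead of
  receiving coefficient 0. This makes \<open>step_end\<close> equal to \<open>t\<close>, as needed
  for integrals against paths on a bounded interval.\<close>

lemma step_restrict:
  assumes "is_step \<phi>" "0 \<le> t"
  obtains \<xi> where "is_step \<xi>" "\<And>s. step_fun \<xi> s = indicator {0..<t} s * step_fun \<phi> s"
    "\<And>Y. step_integral \<xi> Y = step_integral \<phi> (stopped t Y)" "step_end \<xi> = t"
proof -
  obtain N p where p: "\<And>c. is_step (N, p, c)" "{t} \<subseteq> p ` {..N}"
    "\<And>Y. step_integral \<phi> Y = step_integral (N, p, \<lambda>k. step_fun \<phi> (p k)) Y"
    by (rule step_refine[OF assms(1), of "{t}"]) (use assms in auto)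
  then obtain l where l: "l \<le> N" "p l = t" by auto
  define \<xi> where "\<xi> = (l, p, \<lambda>k. step_fun \<phi> (p k))"
  have step: "is_step \<xi>"
    using p(1)[of "\<lambda>_. 0"] l by (auto simp: \<xi>_def is_step_def)
  have eq: "step_integral \<xi> Y = step_integral \<phi> (stopped t Y)" for Y
    unfolding p(3) using step_integral_stopped_grid[OF p(1) l(1)] l(2)
    by (simp add: \<xi>_def step_integral_triple)
  have "step_fun \<xi> s = indicator {0..<t} s * step_fun \<phi> s" for s
  proof (cases "s < t")
    case True
    then have "step_fun \<xi> s = step_fun \<phi> s"
      unfolding step_fun_eq_step_integral[OF step] step_fun_eq_step_integral[OF assms(1)] eq
      by (simp add: stopped_def)
    with True show ?thesis
      using step_fun_neg[OF assms(1), of s] by (cases "s < 0") auto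
  next
    case False
    then show ?thesis
      using step_fun_beyond[OF step, of s] l by (simp add: \<xi>_def step_end_def)
  qed
  then show ?thesis
    using eq step l by (intro that[of \<xi>]) (auto simp: \<xi>_def step_end_def)
qed

text \<open>Shifting the integrand by \<open>u\<close> is dual to delaying the integrator by
  \<open>u\<close> and holding it at its initial value until then. The delayed path is the second
  piece of a concatenation.\<close>

lemma step_shift:
  assumes "is_step \<phi>" "0 \<le> u"
  obtains \<xi> where "is_step \<xi>" "\<And>s. step_fun \<xi> s = indicator {0..} s * step_fun \<phi> (s + u)"
    "\<And>Y. step_integral \<xi> Y = step_integral \<phi> (\<lambda>b. Y (max (b - u) 0))"
proof -
  obtain N p where p: "\<And>c. is_step (N, p, c)" "{u} \<subseteq> p ` {..N}"
    "\<And>Y. step_integral \<phi> Y = step_integral (N, p, \<lambda>k. step_fun \<phi> (p k)) Y"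
    by (rule step_refine[OF assms(1), of "{u}"]) (use assms in auto)
  then obtain l where l: "l \<le> N" "p l = u" by auto
  define \<xi> where "\<xi> = (N - l, \<lambda>k. p (k + l) - u, \<lambda>k. step_fun \<phi> (p (k + l)))"
  have step: "is_step \<xi>"
    using p(1)[of "\<lambda>_. 0"] l by (auto simp: \<xi>_def is_step_def less_diff_conv)
  have eq: "step_integral \<xi> Y = step_integral \<phi> (\<lambda>b. Y (max (b - u) 0))" for Y
  proof -
    let ?Y = "\<lambda>k. Y (max (p k - u) 0)"
    have low: "max (p k - u) 0 = 0" if "k \<le> l" for k
      using is_step_mono[OF p(1) that l(1)] l by auto
    have high: "max (p k - u) 0 = p k - u" if "l \<le> k" "k \<le> N" for k
      using is_step_mono[OF p(1) that] l by auto
    have "step_integral \<phi> (\<lambda>b. Y (max (b - u) 0)) =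
        (\<Sum>k<N. step_fun \<phi> (p k) * (?Y (Suc k) - ?Y k))"
      unfolding p(3) step_integral_triple ..
    also have "\<dots> = (\<Sum>k\<in>{l..<N}. step_fun \<phi> (p k) * (?Y (Suc k) - ?Y k))"
      by (intro sum.mono_neutral_right) (auto simp: low)
    also have "\<dots> = (\<Sum>k\<in>{l..<N}. step_fun \<phi> (p k) * (Y (p (Suc k) - u) - Y (p k - u)))"
      by (intro sum.cong) (auto simp: high)
    also have "\<dots> = (\<Sum>k<N - l. step_fun \<phi> (p (k + l)) * (Y (p (Suc (k + l)) - u) - Y (p (k + l) - u)))"
      by (rule sum.reindex_bij_witness[of _ "\<lambda>k. k + l" "\<lambda>k. k - l"]) auto
    finally show ?thesis by (simp add: \<xi>_def step_integral_triple)
  qed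
  have "step_fun \<xi> s = indicator {0..} s * step_fun \<phi> (s + u)" for s
  proof (cases "0 \<le> s")
    case True
    then have "(\<lambda>b. if s < max (b - u) 0 then 1 else 0 :: real) = (\<lambda>b. if s + u < b then 1 else 0)"
      by (auto simp: fun_eq_iff max_def)
    then have "step_fun \<xi> s = step_fun \<phi> (s + u)"
      by (simp only: step_fun_eq_step_integral[OF step] step_fun_eq_step_integral[OF assms(1)] eq)
    with True show ?thesis by simp
  qed (use step_fun_neg[OF step] in auto)
  then show ?thesis
    using eq step by (intro that[of \<xi>])
qed

text \<open>A stopped first piece plus a delayed increment of the second one. The case split at time
  \<open>u\<close> turns into \<open>min\<close> and \<open>max\<close>, which are continuous in
  \<open>t\<close> and in \<open>u\<close>; the remaining conditional covers only mismatched end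
  points.\<close>

lemma concat_path_eq:
  assumes "0 \<le> u" "0 \<le> t"
  shows "concat_path u x y t =
    x (min t u) + (if x u = y 0 then y (max (t - u) 0) - y 0 else 0)"
  using assms by (auto simp: concat_path_def min_def max_def)

text \<open>The decomposition of the theorem for step functions, exact for every path with matching
  ends. The two pieces add up to the concatenation up to the constant \<open>y 0\<close>, which step
  integrals do not see.\<close>

lemma step_integral_concat:
  assumes "is_step \<phi>" "0 \<le> u" "0 \<le> t" "x u = y 0"
  shows "step_integral \<phi> (stopped t (concat_path u x y)) =
    step_integral \<phi> (stopped (min t u) x) +
    step_integral \<phi> (\<lambda>b. stopped (max (t - u) 0) y (max (b - u) 0))"
proof -
  have "step_integral \<phi> (stopped t (concat_path u x y)) =
      step_integral \<phi> (\<lambda>b. (stopped (min t u) x b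
         + stopped (max (t - u) 0) y (max (b - u) 0)) + (- y 0))"
  proof (rule step_integral_cong[OF assms(1)])
    fix b :: real assume b: "0 \<le> b"
    have eqs: "max (min b t - u) 0 = min (max (b - u) 0) (max (t - u) 0)"
      "min (min b t) u = min b (min t u)"
      by linarith+
    have "0 \<le> min b t"
      using b assms by simp
    then show "stopped t (concat_path u x y) b = (stopped (min t u) x b
         + stopped (max (t - u) 0) y (max (b - u) 0)) + (- y 0)"
      by (simp only: stopped_def concat_path_eq[OF assms(2)] eqs assms(4) simp_thms if_True)
  qed
  then show ?thesis
    unfolding step_integral_add step_integral_const by simp
qed

lemma borel_measurable_step_fun [measurable]: "step_fun \<phi> \<in> borel_measurable borel"
proof -
  obtain n \<tau> c where \<phi>: "\<phi> = (n, \<tau>, c)" by (cases \<phi>)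
  show ?thesis
    unfolding \<phi> step_fun_def prod.case by measurable
qed

text \<open>\<open>F 0 = 0\<close> makes the formula insensitive to the complement of the cells.\<close>

lemma nn_integral_step_fun:
  fixes F :: "real \<Rightarrow> ennreal"
  assumes "is_step (n, \<tau>, c)" "F 0 = 0" and [measurable]: "\<rho> \<in> borel_measurable borel"
  shows "(\<integral>\<^sup>+s\<in>{0..}. F (step_fun (n, \<tau>, c) s) * \<rho> s \<partial>lborel) =
    (\<Sum>k<n. F (c k) * (\<integral>\<^sup>+s\<in>{\<tau> k..<\<tau> (Suc k)}. \<rho> s \<partial>lborel))"
proof -
  have *: "F (step_fun (n, \<tau>, c) s) * indicator {0..} s =
      (\<Sum>k<n. F (c k) * indicator {\<tau> k..<\<tau> (Suc k)} s)" for s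
  proof (cases "\<exists>k<n. s \<in> {\<tau> k..<\<tau> (Suc k)}")
    case True
    then obtain k where k: "k < n" "s \<in> {\<tau> k..<\<tau> (Suc k)}" by auto
    have sum: "(\<Sum>k<n. F (c k) * indicator {\<tau> k..<\<tau> (Suc k)} s) = (\<Sum>j<n. if j = k then F (c k) else 0)"
    proof (intro sum.cong refl)
      fix j assume j: "j \<in> {..<n}"
      show "F (c j) * indicator {\<tau> j..<\<tau> (Suc j)} s = (if j = k then F (c k) else 0)"
      proof (cases "j = k")
        case False
        then consider "Suc j \<le> k" | "Suc k \<le> j" by linarith
        then have "s \<notin> {\<tau> j..<\<tau> (Suc j)}"
        proof cases
          case 1 then show ?thesis using is_step_mono[OF assms(1) 1] k by auto
        next
          case 2 then show ?thesis using is_step_mono[OF assms(1) 2] k j by auto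
        qed
        with False show ?thesis by simp
      qed (use k in auto)
    qed
    have "0 \<le> s"
      using is_step_nonneg[OF assms(1), of k] k by auto
    then show ?thesis
      unfolding sum using k step_fun_cell[OF assms(1), of k s] by simp
  next
    case False
    then have "step_fun (n, \<tau>, c) s = 0"
      unfolding step_fun_def prod.case by (intro sum.neutral) auto
    moreover have "(\<Sum>k<n. F (c k) * indicator {\<tau> k..<\<tau> (Suc k)} s) = 0"
      using False by (intro sum.neutral) auto
    ultimately show ?thesis using assms by simp
  qed
  have "(\<integral>\<^sup>+s\<in>{0..}. F (step_fun (n, \<tau>, c) s) * \<rho> s \<partial>lborel) =
     (\<integral>\<^sup>+s. (F (step_fun (n, \<tau>, c) s) * indicator {0..} s) * \<rho> s \<partial>lborel)"
    by (simp add: ac_simps)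
  also have "\<dots> = (\<integral>\<^sup>+s. (\<Sum>k<n. F (c k) * (\<rho> s * indicator {\<tau> k..<\<tau> (Suc k)} s)) \<partial>lborel)"
    unfolding * sum_distrib_right by (intro nn_integral_cong sum.cong) (auto simp: ac_simps)
  also have "\<dots> = (\<Sum>k<n. (\<integral>\<^sup>+s. F (c k) * (\<rho> s * indicator {\<tau> k..<\<tau> (Suc k)} s) \<partial>lborel))"
    by (rule nn_integral_sum) measurable
  also have "\<dots> = (\<Sum>k<n. F (c k) * (\<integral>\<^sup>+s\<in>{\<tau> k..<\<tau> (Suc k)}. \<rho> s \<partial>lborel))"
    by (intro sum.cong nn_integral_cmult) measurable
  finally show ?thesis .
qed

section \<open>A maximal inequality for random walks\<close>

context prob_space
begin

text \<open>Fubini in place of a conditional expectation: past and present increments are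
  independent, their joint law is a product, and the inner integral vanishes for every frozen past
  \<open>v\<close>.\<close>

lemma expectation_past_zero:
  fixes D :: "nat \<Rightarrow> 'a \<Rightarrow> 'b::euclidean_space"
    and f :: "(nat \<Rightarrow> 'b) \<times> 'b \<Rightarrow> real"
  assumes ind: "indep_vars (\<lambda>_. borel) D {..<n}" and "m < n"
    and f [measurable]: "f \<in> borel_measurable (Pi\<^sub>M {..<m} (\<lambda>_. borel) \<Otimes>\<^sub>M borel)"
    and int: "integrable M (\<lambda>\<omega>. f (restrict (\<lambda>i. D i \<omega>) {..<m}, D m \<omega>))"
    and zero: "\<And>v. expectation (\<lambda>\<omega>. f (v, D m \<omega>)) = 0"
  shows "expectation (\<lambda>\<omega>. f (restrict (\<lambda>i. D i \<omega>) {..<m}, D m \<omega>)) = 0"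
proof -
  let ?S = "Pi\<^sub>M {..<m} (\<lambda>_. borel :: 'b measure)" and ?T = "Pi\<^sub>M {m} (\<lambda>_. borel :: 'b measure)"
  let ?X = "\<lambda>\<omega>. restrict (\<lambda>i. D i \<omega>) {..<m}" and ?Y = "\<lambda>\<omega>. restrict (\<lambda>i. D i \<omega>) {m}"
  have ind2: "indep_var ?S ?X ?T ?Y"
    using \<open>m < n\<close> by (intro indep_var_restrict[OF ind]) auto
  have [measurable]: "random_variable ?S ?X" "random_variable ?T ?Y"
    using ind2 by (auto dest: indep_var_rv1 indep_var_rv2)
  interpret X: prob_space "distr M ?S ?X" by (rule prob_space_distr) simp
  interpret Y: prob_space "distr M ?T ?Y" by (rule prob_space_distr) simp
  interpret P: pair_prob_space "distr M ?S ?X" "distr M ?T ?Y" ..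
  have eq: "distr M ?S ?X \<Otimes>\<^sub>M distr M ?T ?Y = distr M (?S \<Otimes>\<^sub>M ?T) (\<lambda>\<omega>. (?X \<omega>, ?Y \<omega>))"
    using ind2 by (simp add: indep_var_distribution_eq)
  \<comment> \<open>Independence of blocks of indices provides a function on \<open>{m}\<close>
    where \<open>f\<close> expects the value \<open>D m\<close>; \<open>g\<close> evaluates that
    function.\<close>
  define g where "g = (\<lambda>(v, z). f (v, z m))"
  have [measurable]: "g \<in> borel_measurable (?S \<Otimes>\<^sub>M ?T)"
    unfolding g_def by measurable
  have g: "g (?X \<omega>, ?Y \<omega>) = f (?X \<omega>, D m \<omega>)" for \<omega>
    by (simp add: g_def)
  have "expectation (\<lambda>\<omega>. f (?X \<omega>, D m \<omega>)) = integral\<^sup>L (distr M ?S ?X \<Otimes>\<^sub>M distr M ?T ?Y) g"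
    unfolding eq by (subst integral_distr) (simp_all add: g)
  also have "\<dots> = (\<integral>v. (\<integral>z. g (v, z) \<partial>distr M ?T ?Y) \<partial>distr M ?S ?X)"
    by (rule P.integral_fst'[symmetric]) (unfold eq, subst integrable_distr_eq, simp_all add: g int)
  also have "\<dots> = (\<integral>v. 0 \<partial>distr M ?S ?X)"
  proof (intro Bochner_Integration.integral_cong refl)
    fix v assume "v \<in> space (distr M ?S ?X)"
    then have v: "v \<in> space ?S" by simp
    have "(\<integral>z. g (v, z) \<partial>distr M ?T ?Y) = expectation (\<lambda>\<omega>. g (v, ?Y \<omega>))"
      using v by (subst integral_distr) auto
    also have "\<dots> = 0"
      using zero[of v] by (simp add: g_def)
    finally show "(\<integral>z. g (v, z) \<partial>distr M ?T ?Y) = 0" .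
  qed
  finally show ?thesis by simp
qed

end

text \<open>Freezing the sum once it enters \<open>St\<close> reduces Kolmogorov's inequality to an \<open>L\<^sup>2\<close> bound for the
  final value.\<close>

primrec frozen_sum ::
    "real set \<Rightarrow> (nat \<Rightarrow> 'b::euclidean_space \<Rightarrow> 'b \<Rightarrow> real) \<Rightarrow> nat \<Rightarrow> (nat \<Rightarrow> 'b) \<Rightarrow> real" where
  "frozen_sum St F 0 d = 0"
| "frozen_sum St F (Suc m) d =
    frozen_sum St F m d + (if frozen_sum St F m d \<in> St then 0 else F m (\<Sum>i<m. d i) (d m))"

lemma frozen_sum_cong:
  "(\<And>i. i < m \<Longrightarrow> d i = d' i) \<Longrightarrow> frozen_sum St F m d = frozen_sum St F m d'"
proof (induction m)
  case (Suc m)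
  then have "frozen_sum St F m d = frozen_sum St F m d'" "(\<Sum>i<m. d i) = (\<Sum>i<m. d' i)" "d m = d' m"
    by auto
  then show ?case by simp
qed simp

lemma frozen_sum_measurable [measurable]:
  fixes F :: "nat \<Rightarrow> 'b::euclidean_space \<Rightarrow> 'b \<Rightarrow> real"
  assumes F: "\<And>k. k < m \<Longrightarrow> (\<lambda>(x, y). F k x y) \<in> borel_measurable borel"
    and [measurable]: "St \<in> sets borel" and "{..<m} \<subseteq> I"
  shows "frozen_sum St F m \<in> borel_measurable (Pi\<^sub>M I (\<lambda>_. borel))"
  using F assms(3)
proof (induction m)
  case (Suc m)
  have [measurable]: "(\<lambda>(x, y). F m x y) \<in> borel_measurable (borel \<Otimes>\<^sub>M borel)"
    using Suc.prems(1)[of m] by (simp add: borel_prod)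
  have [measurable]: "frozen_sum St F m \<in> borel_measurable (Pi\<^sub>M I (\<lambda>_. borel))"
    by (rule Suc.IH) (use Suc.prems in auto)
  have [measurable]: "(\<lambda>d. d i) \<in> borel_measurable (Pi\<^sub>M I (\<lambda>_. borel))" if "i \<le> m" for i
    using Suc.prems that by (intro measurable_component_singleton) auto
  have "(\<lambda>d. (\<lambda>(x, y). F m x y) (\<Sum>i<m. d i, d m)) \<in> borel_measurable (Pi\<^sub>M I (\<lambda>_. borel))"
    by measurable
  then have [measurable]: "(\<lambda>d. F m (\<Sum>i<m. d i) (d m)) \<in> borel_measurable (Pi\<^sub>M I (\<lambda>_. borel))"
    by simp
  have "(\<lambda>d. frozen_sum St F m d + (if frozen_sum St F m d \<in> St then 0 else F m (\<Sum>i<m. d i) (d m)))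
      \<in> borel_measurable (Pi\<^sub>M I (\<lambda>_. borel))"
    by measurable
  then show ?case by (simp cong: measurable_cong)
next
  case 0
  have "frozen_sum St F 0 = (\<lambda>d. 0)" by (rule ext) simp
  then show ?case by simp
qed

context prob_space
begin

text \<open>In the expanded square the cross term has mean 0 by
  \<open>expectation_past_zero\<close>, because the decision to freeze depends on the past only;
  hence second moments add up. The bound \<open>h\<close> depends on the increment alone, which
  keeps them finite uniformly in the current position.\<close>

lemma frozen_sum_L2:
  fixes D :: "nat \<Rightarrow> 'a \<Rightarrow> 'b::euclidean_space"
    and F :: "nat \<Rightarrow> 'b \<Rightarrow> 'b \<Rightarrow> real" and h :: "nat \<Rightarrow> 'b \<Rightarrow> real"
  assumes ind: "indep_vars (\<lambda>_. borel) D {..<n}"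
    and F: "\<And>k. k < n \<Longrightarrow> (\<lambda>(x, y). F k x y) \<in> borel_measurable borel"
    and zero: "\<And>k x. k < n \<Longrightarrow> expectation (\<lambda>\<omega>. F k x (D k \<omega>)) = 0"
    and bound: "\<And>k x y. k < n \<Longrightarrow> \<bar>F k x y\<bar> \<le> h k y"
    and h: "\<And>k. k < n \<Longrightarrow> integrable M (\<lambda>\<omega>. (h k (D k \<omega>))\<^sup>2)"
    and St: "St \<in> sets borel" and "m \<le> n"
  shows "integrable M (\<lambda>\<omega>. (frozen_sum St F m (\<lambda>i. D i \<omega>))\<^sup>2) \<and>
    expectation (\<lambda>\<omega>. (frozen_sum St F m (\<lambda>i. D i \<omega>))\<^sup>2)
      \<le> (\<Sum>k<m. expectation (\<lambda>\<omega>. (h k (D k \<omega>))\<^sup>2))"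
  using \<open>m \<le> n\<close>
proof (induction m)
  case (Suc m)
  then have m: "m < n" by simp
  note [measurable] = St
  have D [measurable]: "random_variable borel (D k)" if "k < n" for k
    using ind that by (auto simp: indep_vars_def)
  define S where "S d = frozen_sum St F m d" for d :: "nat \<Rightarrow> 'b"
  define H where "H d = (if S d \<in> St then 0 else 1 :: real)" for d
  let ?d = "\<lambda>\<omega>. \<lambda>i\<in>{..<m}. D i \<omega>"
  have Sm [measurable]: "S \<in> borel_measurable (Pi\<^sub>M {..<m} (\<lambda>_. borel))"
    unfolding S_def using F m by (intro frozen_sum_measurable) auto
  have [measurable]: "H \<in> borel_measurable (Pi\<^sub>M {..<m} (\<lambda>_. borel))"
    unfolding H_def by measurable
  have Fm [measurable]: "(\<lambda>(x, y). F m x y) \<in> borel_measurable (borel \<Otimes>\<^sub>M borel)"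
    using F[OF m] by (simp add: borel_prod)
  define f where "f = (\<lambda>(d, y). S d * H d * (\<lambda>(x, y). F m x y) (\<Sum>i<m. d i, y))"
  have f [measurable]: "f \<in> borel_measurable (Pi\<^sub>M {..<m} (\<lambda>_. borel) \<Otimes>\<^sub>M borel)"
    unfolding f_def by measurable
  have Dm: "random_variable (Pi\<^sub>M {..<m} (\<lambda>_. borel)) ?d"
    using m by (intro measurable_restrict D) auto
  have SD [measurable]: "random_variable borel (\<lambda>\<omega>. S (\<lambda>i. D i \<omega>))"
  proof -
    have "(\<lambda>\<omega>. S (\<lambda>i. D i \<omega>)) = (\<lambda>\<omega>. S (?d \<omega>))"
      unfolding S_def by (intro ext frozen_sum_cong) auto
    then show ?thesis using measurable_compose[OF Dm Sm] by simp
  qed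
  have [measurable]: "random_variable borel (\<lambda>\<omega>. \<Sum>i<m. D i \<omega>)"
    using m by (intro borel_measurable_sum D) auto
  have "random_variable borel (\<lambda>\<omega>. (\<lambda>(x, y). F m x y) (\<Sum>i<m. D i \<omega>, D m \<omega>))"
    using m by measurable
  then have FD [measurable]: "random_variable borel (\<lambda>\<omega>. F m (\<Sum>i<m. D i \<omega>) (D m \<omega>))"
    by simp
  have fV: "f (?d \<omega>, D m \<omega>) = S (\<lambda>i. D i \<omega>) * H (\<lambda>i. D i \<omega>) * F m (\<Sum>i<m. D i \<omega>) (D m \<omega>)" for \<omega>
  proof -
    have "S (?d \<omega>) = S (\<lambda>i. D i \<omega>)"
      unfolding S_def by (intro frozen_sum_cong) auto
    then show ?thesis by (simp add: f_def H_def)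
  qed
  have IH1: "integrable M (\<lambda>\<omega>. (S (\<lambda>i. D i \<omega>))\<^sup>2)"
    and IH2: "expectation (\<lambda>\<omega>. (S (\<lambda>i. D i \<omega>))\<^sup>2) \<le> (\<Sum>k<m. expectation (\<lambda>\<omega>. (h k (D k \<omega>))\<^sup>2))"
    using Suc by (auto simp: S_def)
  have F2: "(F m x y)\<^sup>2 \<le> (h m y)\<^sup>2" for x y
    using bound[OF m, of x y] by (metis abs_le_square_iff abs_ge_self abs_of_nonneg order_trans abs_ge_zero)
  \<comment> \<open>Here \<open>e\<close> stands for the freezing indicator; the inequality gives an
    integrable bound for the cross term.\<close>
  have prod_bound: "\<bar>s * e * a\<bar> \<le> s\<^sup>2 + a\<^sup>2" if "e = 0 \<or> e = 1" for s e a :: real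
  proof -
    have "0 \<le> (\<bar>s\<bar> - \<bar>a\<bar>)\<^sup>2" by simp
    then have "2 * (\<bar>s\<bar> * \<bar>a\<bar>) \<le> s\<^sup>2 + a\<^sup>2" by (simp add: power2_diff)
    then have "\<bar>s\<bar> * \<bar>a\<bar> \<le> s\<^sup>2 + a\<^sup>2"
      using mult_nonneg_nonneg[of "\<bar>s\<bar>" "\<bar>a\<bar>"] by linarith
    then show ?thesis using that by (auto simp: abs_mult)
  qed
  have fV_meas: "random_variable borel (\<lambda>\<omega>. f (?d \<omega>, D m \<omega>))"
    unfolding fV H_def using m by measurable
  have int: "integrable M (\<lambda>\<omega>. f (?d \<omega>, D m \<omega>))"
  proof (rule Bochner_Integration.integrable_bound[OF Bochner_Integration.integrable_add[OF IH1 h[OF m]]])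
    show "AE \<omega> in M. norm (f (?d \<omega>, D m \<omega>)) \<le> norm ((S (\<lambda>i. D i \<omega>))\<^sup>2 + (h m (D m \<omega>))\<^sup>2)"
    proof (intro AE_I2)
      fix \<omega>
      have "\<bar>f (?d \<omega>, D m \<omega>)\<bar> \<le> (S (\<lambda>i. D i \<omega>))\<^sup>2 + (F m (\<Sum>i<m. D i \<omega>) (D m \<omega>))\<^sup>2"
        unfolding fV by (rule prod_bound) (simp add: H_def)
      also have "\<dots> \<le> (S (\<lambda>i. D i \<omega>))\<^sup>2 + (h m (D m \<omega>))\<^sup>2"
        using F2 by simp
      finally show "norm (f (?d \<omega>, D m \<omega>)) \<le> norm ((S (\<lambda>i. D i \<omega>))\<^sup>2 + (h m (D m \<omega>))\<^sup>2)"
        by simp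
    qed
  qed (rule fV_meas)
  have cross: "expectation (\<lambda>\<omega>. f (?d \<omega>, D m \<omega>)) = 0"
    by (rule expectation_past_zero[OF ind m f int]) (simp add: f_def zero[OF m])
  define R where "R \<omega> = (H (\<lambda>i. D i \<omega>) * F m (\<Sum>i<m. D i \<omega>) (D m \<omega>))\<^sup>2" for \<omega>
  have R_le: "R \<omega> \<le> (h m (D m \<omega>))\<^sup>2" for \<omega>
    using F2 by (auto simp: R_def H_def)
  have R_int: "integrable M R"
  proof (rule Bochner_Integration.integrable_bound[OF h[OF m]])
    show "random_variable borel R"
      unfolding R_def H_def using m by measurable
    show "AE \<omega> in M. norm (R \<omega>) \<le> norm ((h m (D m \<omega>))\<^sup>2)"
      using R_le by (auto simp: R_def)
  qed
  have expand: "(frozen_sum St F (Suc m) (\<lambda>i. D i \<omega>))\<^sup>2 =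
      (S (\<lambda>i. D i \<omega>))\<^sup>2 + 2 * f (?d \<omega>, D m \<omega>) + R \<omega>" for \<omega>
    unfolding fV R_def H_def S_def by (simp add: power2_sum)
  have "expectation R \<le> expectation (\<lambda>\<omega>. (h m (D m \<omega>))\<^sup>2)"
    using R_le by (intro integral_mono R_int h[OF m]) auto
  then show ?case
    unfolding expand using IH1 IH2 int R_int cross by simp
qed simp

lemma martingale_maximal:
  fixes D :: "nat \<Rightarrow> 'a \<Rightarrow> 'b::euclidean_space"
    and F :: "nat \<Rightarrow> 'b \<Rightarrow> 'b \<Rightarrow> real" and h :: "nat \<Rightarrow> 'b \<Rightarrow> real"
  assumes ind: "indep_vars (\<lambda>_. borel) D {..<n}"
    and F: "\<And>k. k < n \<Longrightarrow> (\<lambda>(x, y). F k x y) \<in> borel_measurable borel"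
    and zero: "\<And>k x. k < n \<Longrightarrow> expectation (\<lambda>\<omega>. F k x (D k \<omega>)) = 0"
    and bound: "\<And>k x y. k < n \<Longrightarrow> \<bar>F k x y\<bar> \<le> h k y"
    and h: "\<And>k. k < n \<Longrightarrow> integrable M (\<lambda>\<omega>. (h k (D k \<omega>))\<^sup>2)"
    and "0 < l"
  shows "prob {\<omega> \<in> space M. \<exists>m\<le>n. l \<le> \<bar>\<Sum>k<m. F k (\<Sum>i<k. D i \<omega>) (D k \<omega>)\<bar>}
    \<le> (\<Sum>k<n. expectation (\<lambda>\<omega>. (h k (D k \<omega>))\<^sup>2)) / l\<^sup>2"
proof -
  define St where "St = {x::real. l \<le> \<bar>x\<bar>}"
  have St [measurable]: "St \<in> sets borel" unfolding St_def by measurable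
  have either: "frozen_sum St F m d \<in> St \<or> frozen_sum St F m d = (\<Sum>k<m. F k (\<Sum>i<k. d i) (d k))" for m d
    by (induction m) auto
  have stay: "frozen_sum St F n' d \<in> St" if "frozen_sum St F m d \<in> St" "m \<le> n'" for m n' d
    using that(2,1) by (induction n' rule: dec_induct) auto
  note L2 = frozen_sum_L2[OF ind F zero bound h St order_refl]
  let ?S = "\<lambda>\<omega>. frozen_sum St F n (\<lambda>i. D i \<omega>)"
  have int: "integrable M (\<lambda>\<omega>. (?S \<omega>)\<^sup>2)" using L2 by simp
  have "prob {\<omega> \<in> space M. \<exists>m\<le>n. l \<le> \<bar>\<Sum>k<m. F k (\<Sum>i<k. D i \<omega>) (D k \<omega>)\<bar>}
     \<le> prob {\<omega> \<in> space M. l\<^sup>2 \<le> (?S \<omega>)\<^sup>2}"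
  proof (rule finite_measure_mono)
    show "{\<omega> \<in> space M. l\<^sup>2 \<le> (?S \<omega>)\<^sup>2} \<in> events"
      using borel_measurable_integrable[OF int] by measurable
    show "{\<omega> \<in> space M. \<exists>m\<le>n. l \<le> \<bar>\<Sum>k<m. F k (\<Sum>i<k. D i \<omega>) (D k \<omega>)\<bar>}
        \<subseteq> {\<omega> \<in> space M. l\<^sup>2 \<le> (?S \<omega>)\<^sup>2}"
    proof safe
      fix \<omega> m assume *: "m \<le> n" "l \<le> \<bar>\<Sum>k<m. F k (\<Sum>i<k. D i \<omega>) (D k \<omega>)\<bar>"
      have "frozen_sum St F m (\<lambda>i. D i \<omega>) \<in> St"
        using either[of m "\<lambda>i. D i \<omega>"] *(2) by (auto simp: St_def)
      from stay[OF this *(1)] have "l \<le> \<bar>?S \<omega>\<bar>" by (simp add: St_def)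
      then show "l\<^sup>2 \<le> (?S \<omega>)\<^sup>2"
        using \<open>0 < l\<close> by (metis abs_le_square_iff abs_of_pos)
    qed
  qed
  also have "\<dots> \<le> expectation (\<lambda>\<omega>. (?S \<omega>)\<^sup>2) / l\<^sup>2"
    using \<open>0 < l\<close> by (intro integral_Markov_inequality_measure[OF int, of "{}"]) auto
  also have "\<dots> \<le> (\<Sum>k<n. expectation (\<lambda>\<omega>. (h k (D k \<omega>))\<^sup>2)) / l\<^sup>2"
    using L2 by (intro divide_right_mono) auto
  finally show ?thesis .
qed

text \<open>Doob decomposition: convexity makes the compensator of \<open>\<phi>\<close> along the random walk increasing,
  so that its total variation is controlled in mean through \<open>expectation \<circ> \<phi>\<close>.\<close>

lemma lipschitz_convex_maximal:
  fixes D :: "nat \<Rightarrow> 'a \<Rightarrow> 'b::euclidean_space" and \<phi> :: "'b \<Rightarrow> real"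
  assumes ind: "indep_vars (\<lambda>_. borel) D {..<n}"
    and sym: "\<And>k. k < n \<Longrightarrow> distr M borel (\<lambda>\<omega>. - D k \<omega>) = distr M borel (D k)"
    and D2: "\<And>k. k < n \<Longrightarrow> integrable M (\<lambda>\<omega>. (norm (D k \<omega>))\<^sup>2)"
    and lip: "\<And>x y. \<bar>\<phi> x - \<phi> y\<bar> \<le> norm (x - y)"
    and conv: "\<And>x d. 2 * \<phi> x \<le> \<phi> (x + d) + \<phi> (x - d)"
    and "0 < l"
  defines "X \<equiv> \<lambda>k \<omega>. \<phi> (\<Sum>i<k. D i \<omega>)"
  shows "prob {\<omega> \<in> space M. \<exists>m\<le>n. 2 * l \<le> \<bar>\<Sum>k<m. c k * (X (Suc k) \<omega> - X k \<omega>)\<bar>}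
    \<le> (\<Sum>k<n. (c k)\<^sup>2 * (4 * expectation (\<lambda>\<omega>. (norm (D k \<omega>))\<^sup>2))) / l\<^sup>2
      + (\<Sum>k<n. \<bar>c k\<bar> * (expectation (X (Suc k)) - expectation (X k))) / l"
proof -
  have D [measurable]: "random_variable borel (D k)" if "k < n" for k
    using ind that by (auto simp: indep_vars_def)
  have "continuous_on UNIV \<phi>"
    unfolding continuous_on_iff dist_norm
  proof safe
    fix x :: 'b and e :: real assume "0 < e"
    then show "\<exists>d>0. \<forall>x'\<in>UNIV. norm (x' - x) < d \<longrightarrow> norm (\<phi> x' - \<phi> x) < e"
      using lip by (auto intro!: exI[of _ e] intro: le_less_trans)
  qed
  then have [measurable]: "\<phi> \<in> borel_measurable borel"
    by (rule borel_measurable_continuous_onI)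
  have D1: "integrable M (\<lambda>\<omega>. norm (D k \<omega>))" if "k < n" for k
    by (rule square_integrable_imp_integrable[OF _ D2[OF that]]) (use that in measurable)
  have phi_int: "integrable M (\<lambda>\<omega>. \<phi> (x + D k \<omega>))" if "k < n" for x k
  proof (rule Bochner_Integration.integrable_bound)
    show "integrable M (\<lambda>\<omega>. \<bar>\<phi> x\<bar> + norm (D k \<omega>))"
      using D1[OF that] by simp
    show "AE \<omega> in M. norm (\<phi> (x + D k \<omega>)) \<le> norm (\<bar>\<phi> x\<bar> + norm (D k \<omega>))"
    proof (intro AE_I2)
      fix \<omega> show "norm (\<phi> (x + D k \<omega>)) \<le> norm (\<bar>\<phi> x\<bar> + norm (D k \<omega>))"
        using lip[of "x + D k \<omega>" x] by simp
    qed
    show "random_variable borel (\<lambda>\<omega>. \<phi> (x + D k \<omega>))"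
      using that by measurable
  qed
  define W where "W k \<omega> = (\<Sum>i<k. D i \<omega>)" for k \<omega>
  have W [measurable]: "random_variable borel (W k)" if "k \<le> n" for k
    unfolding W_def using that by (intro borel_measurable_sum D) auto
  have X_eq: "X k \<omega> = \<phi> (W k \<omega>)" for k \<omega>
    by (simp add: X_def W_def)
  have X_int: "integrable M (X k)" if "k \<le> n" for k
  proof (rule Bochner_Integration.integrable_bound)
    show "integrable M (\<lambda>\<omega>. \<bar>\<phi> 0\<bar> + (\<Sum>i<k. norm (D i \<omega>)))"
      using D1 that by (intro Bochner_Integration.integrable_add Bochner_Integration.integrable_sum) auto
    show "AE \<omega> in M. norm (X k \<omega>) \<le> norm (\<bar>\<phi> 0\<bar> + (\<Sum>i<k. norm (D i \<omega>)))"
    proof (intro AE_I2)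
      fix \<omega>
      have "norm (W k \<omega>) \<le> (\<Sum>i<k. norm (D i \<omega>))"
        unfolding W_def by (rule norm_sum)
      then show "norm (X k \<omega>) \<le> norm (\<bar>\<phi> 0\<bar> + (\<Sum>i<k. norm (D i \<omega>)))"
        using lip[of "W k \<omega>" 0] unfolding X_eq by simp
    qed
    show "random_variable borel (X k)"
      unfolding X_eq[abs_def] using that by measurable
  qed
  \<comment> \<open>\<open>G k x\<close> is the conditional mean of \<open>\<phi>\<close> after step
    \<open>k\<close> for a walk at \<open>x\<close>, and \<open>G k x - \<phi> x\<close> is the
    increment of the compensator.\<close>
  define G where "G k x = expectation (\<lambda>\<omega>. \<phi> (x + D k \<omega>))" for k x
  have G_meas [measurable]: "G k \<in> borel_measurable borel" if "k < n" for k
    unfolding G_def using that by measurable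
  \<comment> \<open>By symmetry of the increment \<open>x + D k\<close> and \<open>x - D k\<close>
    have the same law, so averaging the midpoint convexity of \<open>\<phi>\<close> shows that the
    compensator increases.\<close>
  have G_ge: "\<phi> x \<le> G k x" if "k < n" for k x
  proof -
    have eq: "expectation (\<lambda>\<omega>. \<phi> (x - D k \<omega>)) = G k x"
    proof -
      have "expectation (\<lambda>\<omega>. \<phi> (x - D k \<omega>)) = (\<integral>y. \<phi> (x + y) \<partial>distr M borel (\<lambda>\<omega>. - D k \<omega>))"
        using that by (subst integral_distr) auto
      also have "\<dots> = G k x"
        unfolding sym[OF that] G_def using that by (subst integral_distr) auto
      finally show ?thesis .
    qed
    have int: "integrable M (\<lambda>\<omega>. \<phi> (x - D k \<omega>))"
    proof -
      have "integrable (distr M borel (\<lambda>\<omega>. - D k \<omega>)) (\<lambda>y. \<phi> (x + y))"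
        unfolding sym[OF that] using that phi_int[OF that] by (subst integrable_distr_eq) auto
      then show ?thesis
        using that by (subst (asm) integrable_distr_eq) auto
    qed
    have "2 * \<phi> x = expectation (\<lambda>\<omega>. 2 * \<phi> x)" by (simp add: prob_space)
    also have "\<dots> \<le> expectation (\<lambda>\<omega>. \<phi> (x + D k \<omega>) + \<phi> (x - D k \<omega>))"
      using conv phi_int[OF that] int by (intro integral_mono) auto
    also have "\<dots> = 2 * G k x"
      using phi_int[OF that] int by (simp add: eq) (simp add: G_def)
    finally show ?thesis by simp
  qed
  define b where "b k = expectation (\<lambda>\<omega>. norm (D k \<omega>))" for k
  have G_le: "\<bar>G k x - \<phi> x\<bar> \<le> b k" if "k < n" for k x
  proof -
    have "G k x - \<phi> x = expectation (\<lambda>\<omega>. \<phi> (x + D k \<omega>) - \<phi> x)"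
      using phi_int[OF that] by (simp add: G_def prob_space)
    also have "\<bar>\<dots>\<bar> \<le> expectation (\<lambda>\<omega>. \<bar>\<phi> (x + D k \<omega>) - \<phi> x\<bar>)"
      using integral_norm_bound[of M "\<lambda>\<omega>. \<phi> (x + D k \<omega>) - \<phi> x"] by simp
    also have "\<dots> \<le> b k"
      unfolding b_def using phi_int[OF that] D1[OF that] lip[of "x + D k _" x]
      by (intro integral_mono) auto
    finally show ?thesis .
  qed
  \<comment> \<open>\<open>F\<close> is the weighted martingale difference. The values
    \<open>\<phi> (x + y)\<close> and \<open>G k x\<close> lie within \<open>norm y\<close> and
    \<open>b k\<close> of \<open>\<phi> x\<close>, which gives the position-free bound
    \<open>h\<close>.\<close>
  define F where "F k x y = c k * (\<phi> (x + y) - G k x)" for k x y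
  define h where "h k y = \<bar>c k\<bar> * (norm y + b k)" for k and y :: 'b
  have F_meas: "(\<lambda>(x, y). F k x y) \<in> borel_measurable borel" if "k < n" for k
  proof -
    have "(\<lambda>(x, y). F k x y) \<in> borel_measurable (borel \<Otimes>\<^sub>M borel)"
      unfolding F_def using that by measurable
    then show ?thesis by (simp add: borel_prod)
  qed
  have F_zero: "expectation (\<lambda>\<omega>. F k x (D k \<omega>)) = 0" if "k < n" for k x
    using phi_int[OF that, of x] by (simp add: F_def G_def prob_space)
  have F_bound: "\<bar>F k x y\<bar> \<le> h k y" if "k < n" for k x y
  proof -
    have "\<bar>\<phi> (x + y) - G k x\<bar> \<le> norm y + b k"
      using lip[of "x + y" x] G_le[OF that, of x] by simp
    then show ?thesis by (simp add: F_def h_def abs_mult mult_left_mono)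
  qed
  have h2: "(h k y)\<^sup>2 \<le> (c k)\<^sup>2 * (2 * (norm y)\<^sup>2 + 2 * (b k)\<^sup>2)" for k y
  proof -
    have "(norm y + b k)\<^sup>2 \<le> 2 * (norm y)\<^sup>2 + 2 * (b k)\<^sup>2"
      using zero_le_power2[of "norm y - b k"] by (simp add: power2_sum power2_diff)
    then show ?thesis by (simp add: h_def power_mult_distrib mult_left_mono)
  qed
  have int2: "integrable M (\<lambda>\<omega>. (c k)\<^sup>2 * (2 * (norm (D k \<omega>))\<^sup>2 + 2 * (b k)\<^sup>2))" if "k < n" for k
    using D2[OF that] by simp
  have h_int: "integrable M (\<lambda>\<omega>. (h k (D k \<omega>))\<^sup>2)" if "k < n" for k
  proof (rule Bochner_Integration.integrable_bound[OF int2[OF that]])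
    show "AE \<omega> in M. norm ((h k (D k \<omega>))\<^sup>2) \<le> norm ((c k)\<^sup>2 * (2 * (norm (D k \<omega>))\<^sup>2 + 2 * (b k)\<^sup>2))"
      using h2[of k] by (intro AE_I2) (auto intro: order_trans)
    show "random_variable borel (\<lambda>\<omega>. (h k (D k \<omega>))\<^sup>2)"
      unfolding h_def using that by measurable
  qed
  have b2: "(b k)\<^sup>2 \<le> expectation (\<lambda>\<omega>. (norm (D k \<omega>))\<^sup>2)" if "k < n" for k
  proof -
    have "0 \<le> expectation (\<lambda>\<omega>. (norm (D k \<omega>) - b k)\<^sup>2)" by simp
    also have "\<dots> = expectation (\<lambda>\<omega>. (norm (D k \<omega>))\<^sup>2 - 2 * b k * norm (D k \<omega>) + (b k)\<^sup>2)"
      by (simp add: power2_diff algebra_simps)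
    also have "\<dots> = expectation (\<lambda>\<omega>. (norm (D k \<omega>))\<^sup>2) - 2 * b k * b k + (b k)\<^sup>2"
      using D1[OF that] D2[OF that] by (simp add: prob_space b_def)
    finally show ?thesis by (simp add: power2_eq_square)
  qed
  \<comment> \<open>The factor 4 consists of 2 from \<open>(norm y)\<^sup>2\<close> and 2 from
    \<open>(b k)\<^sup>2\<close> in \<open>h2\<close>, the latter compared with the second moment by
    \<open>b2\<close>.\<close>
  have Eh: "expectation (\<lambda>\<omega>. (h k (D k \<omega>))\<^sup>2) \<le> (c k)\<^sup>2 * (4 * expectation (\<lambda>\<omega>. (norm (D k \<omega>))\<^sup>2))"
    if "k < n" for k
  proof -
    have "expectation (\<lambda>\<omega>. (h k (D k \<omega>))\<^sup>2)
       \<le> expectation (\<lambda>\<omega>. (c k)\<^sup>2 * (2 * (norm (D k \<omega>))\<^sup>2 + 2 * (b k)\<^sup>2))"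
      using h2 by (intro integral_mono h_int int2 that) auto
    also have "\<dots> = (c k)\<^sup>2 * (2 * expectation (\<lambda>\<omega>. (norm (D k \<omega>))\<^sup>2) + 2 * (b k)\<^sup>2)"
      using D2[OF that] by (simp add: prob_space)
    also have "\<dots> \<le> (c k)\<^sup>2 * (4 * expectation (\<lambda>\<omega>. (norm (D k \<omega>))\<^sup>2))"
      using b2[OF that] by (intro mult_left_mono) auto
    finally show ?thesis .
  qed
  have mart: "prob {\<omega> \<in> space M. \<exists>m\<le>n. l \<le> \<bar>\<Sum>k<m. F k (W k \<omega>) (D k \<omega>)\<bar>}
      \<le> (\<Sum>k<n. (c k)\<^sup>2 * (4 * expectation (\<lambda>\<omega>. (norm (D k \<omega>))\<^sup>2))) / l\<^sup>2"
  proof -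
    have "prob {\<omega> \<in> space M. \<exists>m\<le>n. l \<le> \<bar>\<Sum>k<m. F k (W k \<omega>) (D k \<omega>)\<bar>}
       \<le> (\<Sum>k<n. expectation (\<lambda>\<omega>. (h k (D k \<omega>))\<^sup>2)) / l\<^sup>2"
      unfolding W_def by (rule martingale_maximal[OF ind F_meas F_zero F_bound h_int \<open>0 < l\<close>])
    also have "\<dots> \<le> (\<Sum>k<n. (c k)\<^sup>2 * (4 * expectation (\<lambda>\<omega>. (norm (D k \<omega>))\<^sup>2))) / l\<^sup>2"
      using Eh by (intro divide_right_mono sum_mono) auto
    finally show ?thesis .
  qed
  define A where "A k \<omega> = G k (W k \<omega>) - \<phi> (W k \<omega>)" for k \<omega>
  have GW_int: "integrable M (\<lambda>\<omega>. G k (W k \<omega>))" if "k < n" for k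
  proof (rule Bochner_Integration.integrable_bound)
    show "integrable M (\<lambda>\<omega>. \<bar>X k \<omega>\<bar> + b k)" using X_int[of k] that by simp
    show "AE \<omega> in M. norm (G k (W k \<omega>)) \<le> norm (\<bar>X k \<omega>\<bar> + b k)"
    proof (intro AE_I2)
      fix \<omega> show "norm (G k (W k \<omega>)) \<le> norm (\<bar>X k \<omega>\<bar> + b k)"
        using G_le[OF that, of "W k \<omega>"] unfolding X_eq by simp
    qed
    show "random_variable borel (\<lambda>\<omega>. G k (W k \<omega>))"
      by (rule measurable_compose[OF W G_meas]) (use that in auto)
  qed
  have A_int: "integrable M (A k)" if "k < n" for k
    unfolding A_def using GW_int[OF that] X_int[of k] that by (simp add: X_eq[abs_def])
  have A_nonneg: "0 \<le> A k \<omega>" if "k < n" for k \<omega>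
    using G_ge[OF that] by (simp add: A_def)
  have W_Suc: "W (Suc k) \<omega> = W k \<omega> + D k \<omega>" for k \<omega>
    by (simp add: W_def)
  \<comment> \<open>The martingale part has mean 0, so the mean of the compensator is determined by
    the means of \<open>X\<close> alone. For Brownian motion these are explicit.\<close>
  have EA: "expectation (A k) = expectation (X (Suc k)) - expectation (X k)" if "k < n" for k
  proof -
    let ?d = "\<lambda>\<omega>. restrict (\<lambda>i. D i \<omega>) {..<k}"
    define f where "f = (\<lambda>(d, y). \<phi> ((\<Sum>i<k. d i) + y) - G k (\<Sum>i<k. d i))"
    have fd: "f (?d \<omega>, D k \<omega>) = \<phi> (W k \<omega> + D k \<omega>) - G k (W k \<omega>)" for \<omega>
      by (simp add: f_def W_def)
    have "expectation (\<lambda>\<omega>. f (?d \<omega>, D k \<omega>)) = 0"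
    proof (rule expectation_past_zero[OF ind that])
      show "f \<in> borel_measurable (Pi\<^sub>M {..<k} (\<lambda>_. borel) \<Otimes>\<^sub>M borel)"
        unfolding f_def using that by measurable
      show "integrable M (\<lambda>\<omega>. f (?d \<omega>, D k \<omega>))"
        unfolding fd using X_int[of "Suc k"] GW_int[OF that] that by (simp add: X_eq[abs_def] W_Suc)
      show "expectation (\<lambda>\<omega>. f (v, D k \<omega>)) = 0" for v
        using phi_int[OF that, of "\<Sum>i<k. v i"] by (simp add: f_def G_def prob_space)
    qed
    then have "expectation (\<lambda>\<omega>. \<phi> (W k \<omega> + D k \<omega>) - G k (W k \<omega>)) = 0"
      by (simp only: fd)
    then have "expectation (X (Suc k)) = expectation (\<lambda>\<omega>. G k (W k \<omega>))"
      using X_int[of "Suc k"] GW_int[OF that] that by (simp add: X_eq[abs_def] W_Suc)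
    then show ?thesis
      using GW_int[OF that] X_int[of k] that unfolding A_def by (simp add: X_eq[abs_def])
  qed
  \<comment> \<open>The sum of all \<open>\<bar>c k\<bar> * A k\<close> dominates every partial
    drift sum, so Markov's inequality for this one variable handles all \<open>m\<close>
    together.\<close>
  have drift: "prob {\<omega> \<in> space M. l \<le> (\<Sum>k<n. \<bar>c k\<bar> * A k \<omega>)}
      \<le> (\<Sum>k<n. \<bar>c k\<bar> * (expectation (X (Suc k)) - expectation (X k))) / l"
  proof -
    have "prob {\<omega> \<in> space M. l \<le> (\<Sum>k<n. \<bar>c k\<bar> * A k \<omega>)}
        \<le> expectation (\<lambda>\<omega>. \<Sum>k<n. \<bar>c k\<bar> * A k \<omega>) / l"
      using A_int A_nonneg \<open>0 < l\<close>
      by (intro integral_Markov_inequality_measure[of _ _ "{}"] AE_I2 sum_nonneg) auto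
    also have "expectation (\<lambda>\<omega>. \<Sum>k<n. \<bar>c k\<bar> * A k \<omega>) = (\<Sum>k<n. \<bar>c k\<bar> * expectation (A k))"
      using A_int by simp
    finally show ?thesis by (simp add: EA)
  qed
  have dec: "c k * (X (Suc k) \<omega> - X k \<omega>) = F k (W k \<omega>) (D k \<omega>) + c k * A k \<omega>" for k \<omega>
    by (simp add: X_eq W_Suc F_def A_def algebra_simps)
  let ?E1 = "{\<omega> \<in> space M. \<exists>m\<le>n. l \<le> \<bar>\<Sum>k<m. F k (W k \<omega>) (D k \<omega>)\<bar>}"
  let ?E2 = "{\<omega> \<in> space M. l \<le> (\<Sum>k<n. \<bar>c k\<bar> * A k \<omega>)}"
  have FW: "random_variable borel (\<lambda>\<omega>. F k (W k \<omega>) (D k \<omega>))" if "k < n" for k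
    unfolding F_def using that
    by (intro borel_measurable_times borel_measurable_const borel_measurable_diff
        measurable_compose[OF borel_measurable_add] measurable_compose[OF W G_meas]) auto
  have E1: "?E1 \<in> events"
  proof -
    have [measurable]: "random_variable borel (\<lambda>\<omega>. \<Sum>k<m. F k (W k \<omega>) (D k \<omega>))" if "m \<le> n" for m
      using FW that by (intro borel_measurable_sum) auto
    have "?E1 = (\<Union>m\<in>{..n}. {\<omega> \<in> space M. l \<le> \<bar>\<Sum>k<m. F k (W k \<omega>) (D k \<omega>)\<bar>})"
      by auto
    then show ?thesis by (simp add: sets.finite_UN)
  qed
  have E2: "?E2 \<in> events"
  proof -
    have "random_variable borel (\<lambda>\<omega>. \<Sum>k<n. \<bar>c k\<bar> * A k \<omega>)"
      using A_int by (intro borel_measurable_sum borel_measurable_times borel_measurable_const) auto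
    then show ?thesis by measurable
  qed
  \<comment> \<open>A partial sum at level \<open>2 * l\<close> with total drift below
    \<open>l\<close> forces its martingale part to level \<open>l\<close>.\<close>
  have "prob {\<omega> \<in> space M. \<exists>m\<le>n. 2 * l \<le> \<bar>\<Sum>k<m. c k * (X (Suc k) \<omega> - X k \<omega>)\<bar>} \<le> prob (?E1 \<union> ?E2)"
  proof (rule finite_measure_mono)
    show "{\<omega> \<in> space M. \<exists>m\<le>n. 2 * l \<le> \<bar>\<Sum>k<m. c k * (X (Suc k) \<omega> - X k \<omega>)\<bar>} \<subseteq> ?E1 \<union> ?E2"
    proof safe
      fix \<omega> m
      assume *: "\<omega> \<in> space M" "m \<le> n" "2 * l \<le> \<bar>\<Sum>k<m. c k * (X (Suc k) \<omega> - X k \<omega>)\<bar>"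
        "\<not> l \<le> (\<Sum>k<n. \<bar>c k\<bar> * A k \<omega>)"
      have "\<bar>\<Sum>k<m. c k * A k \<omega>\<bar> \<le> (\<Sum>k<m. \<bar>c k * A k \<omega>\<bar>)"
        by (rule sum_abs)
      also have "\<dots> = (\<Sum>k<m. \<bar>c k\<bar> * A k \<omega>)"
        using A_nonneg *(2) by (intro sum.cong) (auto simp: abs_mult)
      also have "\<dots> \<le> (\<Sum>k<n. \<bar>c k\<bar> * A k \<omega>)"
        using A_nonneg *(2) by (intro sum_mono2) auto
      finally have "\<bar>\<Sum>k<m. c k * A k \<omega>\<bar> < l" using *(4) by simp
      moreover have "(\<Sum>k<m. c k * (X (Suc k) \<omega> - X k \<omega>)) =
          (\<Sum>k<m. F k (W k \<omega>) (D k \<omega>)) + (\<Sum>k<m. c k * A k \<omega>)"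
        by (simp add: dec sum.distrib)
      ultimately have "l \<le> \<bar>\<Sum>k<m. F k (W k \<omega>) (D k \<omega>)\<bar>" using *(3) by linarith
      with *(2) show "\<exists>m\<le>n. l \<le> \<bar>\<Sum>k<m. F k (W k \<omega>) (D k \<omega>)\<bar>" by auto
    qed
    show "?E1 \<union> ?E2 \<in> events"
      using E1 E2 by (rule sets.Un)
  qed
  also have "\<dots> \<le> prob ?E1 + prob ?E2"
    using E1 E2 by (rule measure_Un_le)
  finally show ?thesis
    using mart drift by linarith
qed

text \<open>With an empty stopping set nothing is ever frozen, and \<open>frozen_sum_L2\<close>
  becomes the orthogonality of independent centred variables.\<close>

lemma indep_sum_L2:
  fixes D :: "nat \<Rightarrow> 'a \<Rightarrow> real"
  assumes ind: "indep_vars (\<lambda>_. borel) D {..<n}"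
    and zero: "\<And>k. k < n \<Longrightarrow> expectation (D k) = 0"
    and D2: "\<And>k. k < n \<Longrightarrow> integrable M (\<lambda>\<omega>. (D k \<omega>)\<^sup>2)"
  shows "integrable M (\<lambda>\<omega>. (\<Sum>k<n. c k * D k \<omega>)\<^sup>2)"
    and "expectation (\<lambda>\<omega>. (\<Sum>k<n. c k * D k \<omega>)\<^sup>2) \<le> (\<Sum>k<n. (c k)\<^sup>2 * expectation (\<lambda>\<omega>. (D k \<omega>)\<^sup>2))"
proof -
  define F where "F k x y = c k * y" for k and x y :: real
  have "(\<lambda>(x, y). F k x y) \<in> borel_measurable (borel \<Otimes>\<^sub>M borel)" for k
    unfolding F_def by measurable
  then have F: "(\<lambda>(x, y). F k x y) \<in> borel_measurable borel" for k
    by (simp add: borel_prod)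
  have "integrable M (\<lambda>\<omega>. (frozen_sum {} F n (\<lambda>i. D i \<omega>))\<^sup>2) \<and>
    expectation (\<lambda>\<omega>. (frozen_sum {} F n (\<lambda>i. D i \<omega>))\<^sup>2)
      \<le> (\<Sum>k<n. expectation (\<lambda>\<omega>. (\<bar>c k\<bar> * \<bar>D k \<omega>\<bar>)\<^sup>2))"
    by (rule frozen_sum_L2[OF ind F, where h = "\<lambda>k y. \<bar>c k\<bar> * \<bar>y\<bar>"])
      (use zero D2 in \<open>auto simp: F_def abs_mult power_mult_distrib\<close>)
  moreover have "frozen_sum {} F m d = (\<Sum>k<m. c k * d k)" for m d
    by (induction m) (auto simp: F_def)
  ultimately show "integrable M (\<lambda>\<omega>. (\<Sum>k<n. c k * D k \<omega>)\<^sup>2)"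
    "expectation (\<lambda>\<omega>. (\<Sum>k<n. c k * D k \<omega>)\<^sup>2) \<le> (\<Sum>k<n. (c k)\<^sup>2 * expectation (\<lambda>\<omega>. (D k \<omega>)\<^sup>2))"
    by (simp_all add: power_mult_distrib)
qed

end

section \<open>Gaussian estimates for Wiener measures\<close>

definition gauss :: "real \<Rightarrow> 'a::euclidean_space \<Rightarrow> real" where
  "gauss t x = (2 * pi * t) powr (- real DIM('a) / 2) * exp (- (norm x)\<^sup>2 / (2 * t))"

lemma gauss_nonneg [simp]: "0 \<le> gauss t x"
  by (simp add: gauss_def)

lemma gauss_minus [simp]: "gauss t (- x) = gauss t x"
  by (simp add: gauss_def)

lemma gauss_measurable [measurable]: "gauss t \<in> borel_measurable borel"
  unfolding gauss_def by measurable

lemma nn_integral_lborel_scale: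
  fixes g :: "'a::euclidean_space \<Rightarrow> ennreal"
  assumes [measurable]: "g \<in> borel_measurable borel" and c: "c \<noteq> 0"
  shows "(\<integral>\<^sup>+x. g x \<partial>lborel) = ennreal (\<bar>c\<bar> ^ DIM('a)) * (\<integral>\<^sup>+x. g (c *\<^sub>R x) \<partial>lborel)"
  by (subst lborel_affine[OF c, of 0])
    (simp add: nn_integral_density nn_integral_distr nn_integral_cmult)

lemma power_le_fact_mult_exp:
  assumes "0 \<le> (z::real)"
  shows "z ^ k \<le> fact k * exp z"
proof -
  have "z ^ k /\<^sub>R fact k \<le> (\<Sum>n. z ^ n /\<^sub>R fact n)"
    using sum_le_suminf[OF summable_exp_generic[of z], of "{k}"] assms by simp
  then have "z ^ k / fact k \<le> exp z"
    by (simp add: exp_def divide_inverse mult.commute)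
  then show ?thesis by (simp add: field_simps)
qed

text \<open>Half of the exponent absorbs the power: with \<open>z = norm x ^ 2 / (4 * t)\<close> one
  has \<open>z ^ k * exp (- z) \<le> fact k\<close>, and the other factor \<open>exp (- z)\<close>
  belongs to the Gaussian density of variance \<open>2 * t\<close>. The power of 2 is the ratio of
  the normalising constants. Integration then bounds all even moments.\<close>

lemma gauss_moment_pointwise:
  fixes x :: "'a::euclidean_space"
  assumes t: "0 < t"
  shows "gauss t x * norm x ^ (2 * k) \<le> 4 ^ k * fact k * 2 powr (real DIM('a) / 2) * t ^ k * gauss (2 * t) x"
proof -
  define z where "z = (norm x)\<^sup>2 / (4 * t)"
  have z: "0 \<le> z" using t by (simp add: z_def)
  have nx: "norm x ^ (2 * k) = 4 ^ k * t ^ k * z ^ k"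
    using t by (simp add: z_def power_mult power_divide power_mult_distrib)
  have e1: "exp (- (norm x)\<^sup>2 / (2 * t)) = exp (- z) * exp (- z)"
    using t by (simp add: z_def exp_add[symmetric] field_simps)
  have e2: "exp (- (norm x)\<^sup>2 / (2 * (2 * t))) = exp (- z)"
    by (simp add: z_def)
  have p: "(2 * pi * t) powr (- real DIM('a) / 2) =
      2 powr (real DIM('a) / 2) * (2 * pi * (2 * t)) powr (- real DIM('a) / 2)"
  proof -
    have "(2 * (2 * pi * t)) powr (- real DIM('a) / 2) =
        2 powr (- real DIM('a) / 2) * (2 * pi * t) powr (- real DIM('a) / 2)"
      using t by (intro powr_mult)
    moreover have "2 powr (real DIM('a) / 2) * 2 powr (- real DIM('a) / 2) = (1::real)"
      by (simp add: powr_add[symmetric])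
    ultimately show ?thesis by (simp add: mult.left_commute mult.assoc[symmetric])
  qed
  have "z ^ k * exp (- z) \<le> fact k"
    using mult_right_mono[OF power_le_fact_mult_exp[OF z, of k], of "exp (- z)"]
    by (simp add: exp_minus field_simps)
  then have "exp (- z) * exp (- z) * (4 ^ k * t ^ k * z ^ k) \<le> exp (- z) * (4 ^ k * t ^ k * fact k)"
    using t mult_left_mono[of "z ^ k * exp (- z)" "fact k" "exp (- z) * (4 ^ k * t ^ k)"]
    by (simp add: algebra_simps)
  then have "(2 * pi * t) powr (- real DIM('a) / 2) * (exp (- z) * exp (- z) * (4 ^ k * t ^ k * z ^ k))
      \<le> (2 * pi * t) powr (- real DIM('a) / 2) * (exp (- z) * (4 ^ k * t ^ k * fact k))"
    by (rule mult_left_mono) simp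
  then show ?thesis
    unfolding gauss_def e1 e2 nx p by (simp add: algebra_simps)
qed

lemma gauss_scale:
  fixes y :: "'a::euclidean_space"
  assumes "0 < t"
  shows "sqrt t ^ DIM('a) * gauss t (sqrt t *\<^sub>R y) = gauss 1 y"
proof -
  have "sqrt t ^ DIM('a) = t powr (real DIM('a) / 2)"
    using assms by (simp add: powr_half_sqrt[symmetric] powr_powr powr_realpow[symmetric])
  moreover have "t powr (real DIM('a) / 2) * t powr (- real DIM('a) / 2) = 1"
    using assms by (simp add: powr_minus)
  ultimately show ?thesis
    using assms by (simp add: gauss_def powr_mult power_mult_distrib)
qed

section \<open>Moments, symmetry, scaling and small balls for Brownian increments\<close>

lemma wiener_measureD:
  assumes "wiener_measure (\<mu> :: (real \<Rightarrow> 'a::euclidean_space) measure)"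
  shows "prob_space \<mu>" "sets \<mu> = sets (path_space {0..})" "AE w in \<mu>. w 0 = 0"
    "\<And>s t. 0 \<le> s \<Longrightarrow> s < t \<Longrightarrow> distributed \<mu> lborel (\<lambda>w. w t - w s) (\<lambda>x. ennreal (gauss (t - s) x))"
    "\<And>\<tau> n. 0 \<le> \<tau> 0 \<Longrightarrow> (\<And>i. i < n \<Longrightarrow> \<tau> i \<le> \<tau> (Suc i)) \<Longrightarrow>
        prob_space.indep_vars \<mu> (\<lambda>_. borel) (\<lambda>i w. w (\<tau> (Suc i)) - w (\<tau> i)) {..<n}"
  using assms by (auto simp: wiener_measure_def gauss_def)

lemma space_path_space: "space (path_space S) = {w \<in> extensional S. continuous_on S w}"
  by (auto simp: path_space_def space_restrict_space space_PiM PiE_def)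

lemma measurable_path_space_component:
  assumes "t \<in> S"
  shows "(\<lambda>w. w t) \<in> borel_measurable (path_space S)"
  unfolding path_space_def
  by (intro measurable_restrict_space1 measurable_component_singleton assms)

lemma measurable_path_spaceI:
  assumes "\<And>t. t \<in> S \<Longrightarrow> (\<lambda>x. f x t) \<in> borel_measurable M"
    and "\<And>x. x \<in> space M \<Longrightarrow> f x \<in> extensional S"
    and "\<And>x. x \<in> space M \<Longrightarrow> continuous_on S (f x)"
  shows "f \<in> measurable M (path_space S)"
  unfolding path_space_def
proof (rule measurable_restrict_space2)
  show "f \<in> space M \<rightarrow> {w. continuous_on S w}"
    using assms by auto
  show "f \<in> measurable M (Pi\<^sub>M S (\<lambda>_. borel))"
    by (rule measurable_PiM_single') (use assms in \<open>auto simp: PiE_def\<close>)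
qed

lemma wiener_component_measurable:
  assumes "wiener_measure (\<mu> :: (real \<Rightarrow> 'a::euclidean_space) measure)" "0 \<le> t"
  shows "(\<lambda>w. w t) \<in> borel_measurable \<mu>"
proof -
  have "(\<lambda>w. w t) \<in> borel_measurable (path_space {0..})"
    using assms by (intro measurable_path_space_component) auto
  then show ?thesis
    by (simp add: measurable_cong_sets[OF wiener_measureD(2)[OF assms(1)] refl])
qed

lemma wiener_space:
  assumes "wiener_measure (\<mu> :: (real \<Rightarrow> 'a::euclidean_space) measure)"
  shows "space \<mu> = {w \<in> extensional {0..}. continuous_on {0..} w}"
  using sets_eq_imp_space_eq[OF wiener_measureD(2)[OF assms]] by (simp add: space_path_space)

text \<open>The total mass is read off from an increment whose density is \<open>gauss t\<close>,
  rather than computed as a Gaussian integral.\<close>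

lemma gauss_mass:
  assumes "wiener_measure (\<mu> :: (real \<Rightarrow> 'a::euclidean_space) measure)" "0 < t"
  shows "(\<integral>\<^sup>+x. ennreal (gauss t (x::'a)) \<partial>lborel) = 1"
proof -
  interpret prob_space \<mu> by (rule wiener_measureD(1)[OF assms(1)])
  have "distributed \<mu> lborel (\<lambda>w. w t - w 0) (\<lambda>x. ennreal (gauss (t - 0) x))"
    using assms(2) by (intro wiener_measureD(4)[OF assms(1)]) auto
  from distributed_nn_integral[OF this, of "\<lambda>_. 1"] show ?thesis
    by (simp add: emeasure_space_1)
qed

lemma wiener_moment:
  assumes \<mu>: "wiener_measure (\<mu> :: (real \<Rightarrow> 'a::euclidean_space) measure)" and "0 \<le> s" "s < t"
  shows "integrable \<mu> (\<lambda>w. norm (w t - w s) ^ (2 * k))"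
    and "(\<integral>w. norm (w t - w s) ^ (2 * k) \<partial>\<mu>) \<le> 4 ^ k * fact k * 2 powr (real DIM('a) / 2) * (t - s) ^ k"
proof -
  let ?C = "4 ^ k * fact k * 2 powr (real DIM('a) / 2) * (t - s) ^ k"
  note d = wiener_measureD(4)[OF \<mu> assms(2,3)]
  have [measurable]: "(\<lambda>w. w t) \<in> borel_measurable \<mu>" "(\<lambda>w. w s) \<in> borel_measurable \<mu>"
    using assms by (auto intro: wiener_component_measurable)
  have "(\<integral>\<^sup>+w. ennreal (norm (w t - w s) ^ (2 * k)) \<partial>\<mu>)
      = (\<integral>\<^sup>+x. ennreal (gauss (t - s) x) * ennreal (norm (x::'a) ^ (2 * k)) \<partial>lborel)"
    using distributed_nn_integral[OF d, of "\<lambda>x. ennreal (norm x ^ (2 * k))"] by simp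
  also have "\<dots> \<le> (\<integral>\<^sup>+x. ennreal ?C * ennreal (gauss (2 * (t - s)) (x::'a)) \<partial>lborel)"
    using assms gauss_moment_pointwise[of "t - s" _ k]
    by (intro nn_integral_mono) (simp add: ennreal_mult[symmetric] ennreal_leI)
  also have "\<dots> = ennreal ?C"
    using gauss_mass[OF \<mu>, of "2 * (t - s)"] assms by (simp add: nn_integral_cmult)
  finally have *: "(\<integral>\<^sup>+w. ennreal (norm (w t - w s) ^ (2 * k)) \<partial>\<mu>) \<le> ennreal ?C" .
  then show int: "integrable \<mu> (\<lambda>w. norm (w t - w s) ^ (2 * k))"
    by (intro integrableI_bounded) (auto simp: top.not_eq_extremum intro: le_less_trans)
  have "ennreal (\<integral>w. norm (w t - w s) ^ (2 * k) \<partial>\<mu>) \<le> ennreal ?C"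
    using * by (subst (asm) nn_integral_eq_integral[OF int]) auto
  then show "(\<integral>w. norm (w t - w s) ^ (2 * k) \<partial>\<mu>) \<le> ?C"
    using assms by (subst (asm) ennreal_le_iff) auto
qed

lemma wiener_increment_symmetric:
  assumes \<mu>: "wiener_measure (\<mu> :: (real \<Rightarrow> 'a::euclidean_space) measure)" and "0 \<le> s" "s < t"
  shows "distr \<mu> borel (\<lambda>w. - (w t - w s)) = distr \<mu> borel (\<lambda>w. w t - w s)"
proof (rule measure_eqI)
  fix A assume "A \<in> sets (distr \<mu> borel (\<lambda>w. - (w t - w s)))"
  then have A [measurable]: "A \<in> sets borel" by simp
  note d = wiener_measureD(4)[OF \<mu> assms(2,3)]
  have [measurable]: "(\<lambda>w. w t) \<in> borel_measurable \<mu>" "(\<lambda>w. w s) \<in> borel_measurable \<mu>"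
    using assms by (auto intro: wiener_component_measurable)
  have "emeasure (distr \<mu> borel (\<lambda>w. - (w t - w s))) A = (\<integral>\<^sup>+w. indicator A (- (w t - w s)) \<partial>\<mu>)"
    by (subst nn_integral_indicator[symmetric], simp, subst nn_integral_distr) simp_all
  also have "\<dots> = (\<integral>\<^sup>+x. ennreal (gauss (t - s) x) * indicator A (- x) \<partial>lborel)"
    by (rule distributed_nn_integral[OF d, symmetric, of "\<lambda>x. indicator A (- x)"]) measurable
  also have "\<dots> = (\<integral>\<^sup>+x. ennreal (gauss (t - s) x) * indicator A x \<partial>lborel)"
    by (subst nn_integral_lborel_scale[of _ "-1"]) simp_all
  also have "\<dots> = (\<integral>\<^sup>+w. indicator A (w t - w s) \<partial>\<mu>)"
    by (rule distributed_nn_integral[OF d, of "indicator A"]) measurable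
  also have "\<dots> = emeasure (distr \<mu> borel (\<lambda>w. w t - w s)) A"
    by (subst nn_integral_indicator[symmetric], simp, subst nn_integral_distr) simp_all
  finally show "emeasure (distr \<mu> borel (\<lambda>w. - (w t - w s))) A
      = emeasure (distr \<mu> borel (\<lambda>w. w t - w s)) A" .
qed simp

text \<open>Brownian scaling, by the substitution \<open>x = sqrt t *\<^sub>R y\<close>. The square
  root is the origin of the weight \<open>1 / sqrt s\<close>: the mean compensator over a cell is a
  multiple of a difference of square roots, that is, of the integral of this weight.\<close>

lemma wiener_norm_mean:
  assumes \<mu>: "wiener_measure (\<mu> :: (real \<Rightarrow> 'a::euclidean_space) measure)"
  obtains \<kappa> where "0 \<le> \<kappa>" "\<And>t. 0 \<le> t \<Longrightarrow> (\<integral>w. norm (w t - w 0) \<partial>\<mu>) = \<kappa> * sqrt t"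
proof -
  interpret prob_space \<mu> by (rule wiener_measureD(1)[OF \<mu>])
  define \<kappa> where "\<kappa> = (\<integral>w. norm (w 1 - w 0) \<partial>\<mu>)"
  have int: "integrable \<mu> (\<lambda>w. norm (w t - w 0))" if "0 < t" for t
  proof (rule square_integrable_imp_integrable)
    have [measurable]: "(\<lambda>w. w t) \<in> borel_measurable \<mu>" "(\<lambda>w. w 0) \<in> borel_measurable \<mu>"
      using that by (auto intro: wiener_component_measurable[OF \<mu>])
    show "(\<lambda>w. norm (w t - w 0)) \<in> borel_measurable \<mu>"
      by measurable
    show "integrable \<mu> (\<lambda>w. (norm (w t - w 0))\<^sup>2)"
      using wiener_moment(1)[OF \<mu>, of 0 t 1] that by simp
  qed
  define K where "K = (\<integral>\<^sup>+y. ennreal (gauss 1 y) * ennreal (norm (y::'a)) \<partial>lborel)"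
  have nn: "(\<integral>\<^sup>+w. ennreal (norm (w t - w 0)) \<partial>\<mu>) = ennreal (sqrt t) * K" if t: "0 < t" for t
  proof -
    have d: "distributed \<mu> lborel (\<lambda>w. w t - w 0) (\<lambda>x. ennreal (gauss (t - 0) x))"
      using t by (intro wiener_measureD(4)[OF \<mu>]) auto
    have "(\<integral>\<^sup>+w. ennreal (norm (w t - w 0)) \<partial>\<mu>) =
        (\<integral>\<^sup>+x. ennreal (gauss t x) * ennreal (norm (x::'a)) \<partial>lborel)"
      using distributed_nn_integral[OF d, of "\<lambda>x. ennreal (norm x)"] by simp
    also have "\<dots> = ennreal (sqrt t ^ DIM('a)) *
        (\<integral>\<^sup>+y. ennreal (gauss t (sqrt t *\<^sub>R y)) * ennreal (norm (sqrt t *\<^sub>R (y::'a))) \<partial>lborel)"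
      using t by (subst nn_integral_lborel_scale[of _ "sqrt t"]) auto
    also have "\<dots> = (\<integral>\<^sup>+y. ennreal (sqrt t) * (ennreal (gauss 1 y) * ennreal (norm (y::'a))) \<partial>lborel)"
    proof -
      have "ennreal (sqrt t ^ DIM('a)) * (ennreal (gauss t (sqrt t *\<^sub>R y)) * ennreal (norm (sqrt t *\<^sub>R y)))
         = ennreal (sqrt t) * (ennreal (gauss 1 y) * ennreal (norm y))" for y :: 'a
        unfolding gauss_scale[OF t, symmetric]
        using t by (simp add: ennreal_mult[symmetric] ac_simps)
      then show ?thesis
        by (subst nn_integral_cmult[symmetric]) simp_all
    qed
    also have "\<dots> = ennreal (sqrt t) * K"
      unfolding K_def by (rule nn_integral_cmult) measurable
    finally show ?thesis .
  qed
  have K: "K = ennreal \<kappa>"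
    using nn[of 1] int[of 1] by (simp add: \<kappa>_def nn_integral_eq_integral)
  have "0 \<le> \<kappa>" by (simp add: \<kappa>_def)
  moreover have "(\<integral>w. norm (w t - w 0) \<partial>\<mu>) = \<kappa> * sqrt t" if "0 \<le> t" for t
  proof (cases "t = 0")
    case False
    then have t: "0 < t" using that by simp
    have "ennreal (\<integral>w. norm (w t - w 0) \<partial>\<mu>) = ennreal (\<kappa> * sqrt t)"
      using nn[OF t] int[OF t] \<open>0 \<le> \<kappa>\<close> t
      by (simp add: nn_integral_eq_integral K ennreal_mult[symmetric] mult.commute)
    then show ?thesis using \<open>0 \<le> \<kappa>\<close> t by (subst (asm) ennreal_inj) auto
  qed simp
  ultimately show ?thesis by (rule that)
qed

text \<open>The density is at most \<open>t powr (- d / 2)\<close> in dimension \<open>d\<close>,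
  and the ball has volume of order \<open>r ^ d\<close>. In dimension 3 the resulting cube of
  \<open>r / sqrt t\<close> makes the Bessel process leave small balls summably fast.\<close>

lemma wiener_small_ball:
  assumes \<mu>: "wiener_measure (\<mu> :: (real \<Rightarrow> 'a::euclidean_space) measure)" and "0 < t" "0 \<le> r"
  shows "emeasure \<mu> {w \<in> space \<mu>. norm (w t - w 0) \<le> r}
    \<le> ennreal (unit_ball_vol (real DIM('a)) * (r / sqrt t) ^ DIM('a))"
proof -
  have d: "distributed \<mu> lborel (\<lambda>w. w t - w 0) (\<lambda>x. ennreal (gauss (t - 0) x))"
    using assms by (intro wiener_measureD(4)[OF \<mu>]) auto
  have [measurable]: "(\<lambda>w. w t) \<in> borel_measurable \<mu>" "(\<lambda>w. w 0) \<in> borel_measurable \<mu>"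
    using assms by (auto intro: wiener_component_measurable)
  have le: "gauss t x \<le> (1 / sqrt t) ^ DIM('a)" for x :: 'a
  proof -
    have "exp (- (norm x)\<^sup>2 / (2 * t)) \<le> 1" using \<open>0 < t\<close> by simp
    note e = this
    have "gauss t x \<le> (2 * pi * t) powr (- real DIM('a) / 2)"
      unfolding gauss_def
      using mult_left_mono[OF e, of "(2 * pi * t) powr (- real DIM('a) / 2)"] by simp
    also have "\<dots> \<le> t powr (- real DIM('a) / 2)"
      using \<open>0 < t\<close> pi_ge_two by (intro powr_mono2') auto
    also have "\<dots> = (1 / sqrt t) ^ DIM('a)"
    proof -
      have "sqrt t ^ DIM('a) = t powr (real DIM('a) / 2)"
        using assms by (simp add: powr_half_sqrt[symmetric] powr_powr powr_realpow[symmetric])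
      moreover have "t powr (- real DIM('a) / 2) = inverse (t powr (real DIM('a) / 2))"
        using powr_minus[of t "real DIM('a) / 2"] by simp
      ultimately show ?thesis by (simp add: power_one_over inverse_eq_divide)
    qed
    finally show ?thesis .
  qed
  have "emeasure \<mu> {w \<in> space \<mu>. norm (w t - w 0) \<le> r}
      = (\<integral>\<^sup>+w. indicator {w \<in> space \<mu>. norm (w t - w 0) \<le> r} w \<partial>\<mu>)"
    by (rule nn_integral_indicator[symmetric]) measurable
  also have "\<dots> = (\<integral>\<^sup>+w. indicator (cball 0 r) (w t - w 0) \<partial>\<mu>)"
    by (intro nn_integral_cong) (simp add: indicator_def)
  also have "\<dots> = (\<integral>\<^sup>+x. ennreal (gauss t x) * indicator (cball (0::'a) r) x \<partial>lborel)"
    using distributed_nn_integral[OF d, of "indicator (cball 0 r)", symmetric] by (simp add: borel_measurable_indicator)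
  also have "\<dots> \<le> (\<integral>\<^sup>+x. ennreal ((1 / sqrt t) ^ DIM('a)) * indicator (cball (0::'a) r) x \<partial>lborel)"
    using le by (intro nn_integral_mono mult_right_mono) (auto intro: ennreal_leI)
  also have "\<dots> = ennreal ((1 / sqrt t) ^ DIM('a)) * emeasure lborel (cball (0::'a) r)"
    by (simp add: nn_integral_cmult_indicator)
  also have "\<dots> = ennreal (unit_ball_vol (real DIM('a)) * (r / sqrt t) ^ DIM('a))"
    using assms by (simp add: emeasure_cball ennreal_mult[symmetric] power_divide mult.commute)
  finally show ?thesis .
qed

section \<open>Norms of step functions and maximal inequalities\<close>

text \<open>The square of the norm on the half-line, with values in \<open>ennreal\<close> so that
  bounds carry no integrability conditions.\<close>

definition L2n :: "(real \<Rightarrow> real) \<Rightarrow> ennreal" where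
  "L2n g = (\<integral>\<^sup>+s\<in>{0..}. ennreal ((g s)\<^sup>2) \<partial>lborel)"

definition L1n :: "(real \<Rightarrow> real) \<Rightarrow> (real \<Rightarrow> real) \<Rightarrow> ennreal" where
  "L1n \<rho> g = (\<integral>\<^sup>+s\<in>{0..}. ennreal (\<bar>g s\<bar> * \<rho> s) \<partial>lborel)"

lemma nn_integral_inverse_sqrt:
  assumes "0 \<le> a" "a \<le> b"
  shows "(\<integral>\<^sup>+s\<in>{a..<b}. ennreal (1 / sqrt s) \<partial>lborel) = ennreal (2 * (sqrt b - sqrt a))"
proof -
  have "((\<lambda>s. 1 / sqrt s) has_integral (2 * sqrt b - 2 * sqrt a)) {a..b}"
  proof (rule fundamental_theorem_of_calculus_interior[OF assms(2)])
    show "continuous_on {a..b} (\<lambda>s. 2 * sqrt s)" by (intro continuous_intros)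
    fix x assume "x \<in> {a<..<b}"
    then have "0 < x" using assms by auto
    then have "((\<lambda>s. 2 * sqrt s) has_real_derivative 2 * (inverse (sqrt x) / 2)) (at x)"
      by (intro DERIV_cmult DERIV_real_sqrt)
    then show "((\<lambda>s. 2 * sqrt s) has_vector_derivative 1 / sqrt x) (at x)"
      by (simp add: has_real_derivative_iff_has_vector_derivative inverse_eq_divide)
  qed
  then have *: "((\<lambda>s. \<bar>1 / sqrt s\<bar>) has_integral (2 * sqrt b - 2 * sqrt a)) {a..b}"
    by (rule has_integral_eq[rotated]) (use assms in auto)
  have "(\<integral>\<^sup>+s. ennreal (indicator {a..b} s * \<bar>1 / sqrt s\<bar>) \<partial>lborel) = ennreal (2 * sqrt b - 2 * sqrt a)"
    by (rule nn_integral_has_integral_lebesgue[OF _ *]) simp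
  also have "(\<integral>\<^sup>+s. ennreal (indicator {a..b} s * \<bar>1 / sqrt s\<bar>) \<partial>lborel)
      = (\<integral>\<^sup>+s\<in>{a..<b}. ennreal (1 / sqrt s) \<partial>lborel)"
  proof (rule nn_integral_cong_AE)
    have "AE s in lborel. s \<noteq> b" by (rule AE_lborel_singleton)
    then show "AE s in lborel. ennreal (indicator {a..b} s * \<bar>1 / sqrt s\<bar>)
        = ennreal (1 / sqrt s) * indicator {a..<b} s"
      by eventually_elim (use assms in \<open>auto simp: indicator_def\<close>)
  qed
  finally show ?thesis by (simp add: algebra_simps)
qed

text \<open>The squared \<open>L2\<close> norm of the step function as a real number, see
  \<open>L2n_step_fun\<close>.\<close>

definition step_sq :: "step \<Rightarrow> real" where
  "step_sq = (\<lambda>(n, \<tau>, c). \<Sum>k<n. (c k)\<^sup>2 * (\<tau> (Suc k) - \<tau> k))"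

lemma is_step_diff_nonneg: "is_step (n, \<tau>, c) \<Longrightarrow> k < n \<Longrightarrow> 0 \<le> \<tau> (Suc k) - \<tau> k"
  by (auto simp: is_step_def less_imp_le)

lemma step_sq_nonneg: "is_step \<phi> \<Longrightarrow> 0 \<le> step_sq \<phi>"
  by (cases \<phi>) (auto simp: step_sq_def intro!: sum_nonneg mult_nonneg_nonneg is_step_diff_nonneg)

lemma L2n_step_fun:
  assumes "is_step \<phi>"
  shows "L2n (step_fun \<phi>) = ennreal (step_sq \<phi>)"
proof -
  obtain n \<tau> c where \<phi>: "\<phi> = (n, \<tau>, c)" by (cases \<phi>)
  have "L2n (step_fun \<phi>) = (\<integral>\<^sup>+s\<in>{0..}. ennreal ((step_fun (n, \<tau>, c) s)\<^sup>2) * 1 \<partial>lborel)"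
    by (simp add: L2n_def \<phi>)
  also have "\<dots> = (\<Sum>k<n. ennreal ((c k)\<^sup>2) * (\<integral>\<^sup>+s\<in>{\<tau> k..<\<tau> (Suc k)}. 1 \<partial>lborel))"
    using assms by (intro nn_integral_step_fun[where F = "\<lambda>x. ennreal (x\<^sup>2)"]) (auto simp: \<phi>)
  also have "\<dots> = (\<Sum>k<n. ennreal ((c k)\<^sup>2 * (\<tau> (Suc k) - \<tau> k)))"
    using is_step_diff_nonneg[of n \<tau> c] assms by (intro sum.cong) (auto simp: \<phi> ennreal_mult)
  also have "\<dots> = ennreal (step_sq \<phi>)"
    using is_step_diff_nonneg[of n \<tau> c] assms unfolding \<phi> step_sq_def prod.case
    by (intro sum_ennreal) auto
  finally show ?thesis .
qed

lemma L1n_step_fun: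
  assumes "is_step (n, \<tau>, c)"
  shows "L1n (\<lambda>s. 1 / sqrt s) (step_fun (n, \<tau>, c))
    = ennreal (\<Sum>k<n. \<bar>c k\<bar> * (2 * (sqrt (\<tau> (Suc k)) - sqrt (\<tau> k))))"
proof -
  have le: "\<tau> k \<le> \<tau> (Suc k)" if "k < n" for k
    using is_step_diff_nonneg[OF assms that] by simp
  have "L1n (\<lambda>s. 1 / sqrt s) (step_fun (n, \<tau>, c)) =
      (\<integral>\<^sup>+s\<in>{0..}. ennreal \<bar>step_fun (n, \<tau>, c) s\<bar> * ennreal (1 / sqrt s) \<partial>lborel)"
    unfolding L1n_def by (intro nn_integral_cong) (auto simp: ennreal_mult[symmetric] indicator_def)
  also have "\<dots> = (\<Sum>k<n. ennreal \<bar>c k\<bar> * (\<integral>\<^sup>+s\<in>{\<tau> k..<\<tau> (Suc k)}. ennreal (1 / sqrt s) \<partial>lborel))"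
    using assms by (intro nn_integral_step_fun[where F = "\<lambda>x. ennreal \<bar>x\<bar>"]) auto
  also have "\<dots> = (\<Sum>k<n. ennreal (\<bar>c k\<bar> * (2 * (sqrt (\<tau> (Suc k)) - sqrt (\<tau> k)))))"
  proof (intro sum.cong refl)
    fix k assume "k \<in> {..<n}"
    then have "k < n" by simp
    with le[OF this] is_step_nonneg[OF assms, of k]
    show "ennreal \<bar>c k\<bar> * (\<integral>\<^sup>+s\<in>{\<tau> k..<\<tau> (Suc k)}. ennreal (1 / sqrt s) \<partial>lborel)
        = ennreal (\<bar>c k\<bar> * (2 * (sqrt (\<tau> (Suc k)) - sqrt (\<tau> k))))"
      by (subst nn_integral_inverse_sqrt) (auto simp: ennreal_mult)
  qed
  also have "\<dots> = ennreal (\<Sum>k<n. \<bar>c k\<bar> * (2 * (sqrt (\<tau> (Suc k)) - sqrt (\<tau> k))))"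
    using le by (intro sum_ennreal) auto
  finally show ?thesis .
qed

lemma L2n_restrict_le:
  assumes "\<And>s. \<xi> s = indicator A s * \<phi> s"
  shows "L2n \<xi> \<le> L2n \<phi>"
  unfolding L2n_def assms by (intro nn_integral_mono) (auto simp: indicator_def)

lemma step_integral_stopped_measurable:
  assumes "is_step \<phi>" "0 \<le> t" "{0..t} \<subseteq> S"
  shows "(\<lambda>y. step_integral \<phi> (stopped t y)) \<in> borel_measurable (path_space S)"
proof -
  obtain n \<tau> c where \<phi>: "\<phi> = (n, \<tau>, c)" by (cases \<phi>)
  have m: "(\<lambda>y. y (min (\<tau> k) t)) \<in> borel_measurable (path_space S)" if "k \<le> n" for k
    using is_step_nonneg[of n \<tau> c k] that assms
    by (intro measurable_path_space_component) (auto simp: \<phi>)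
  show ?thesis
    unfolding \<phi> step_integral_triple stopped_def
    by (intro borel_measurable_sum borel_measurable_times borel_measurable_diff borel_measurable_const m) auto
qed

lemma step_integral_measurable:
  assumes "is_step \<phi>" "{0..step_end \<phi>} \<subseteq> S"
  shows "step_integral \<phi> \<in> borel_measurable (path_space S)"
proof -
  have "step_integral \<phi> = (\<lambda>y. step_integral \<phi> (stopped (step_end \<phi>) y))"
    using step_integral_stopped_ge[OF assms(1) order_refl] by auto
  then show ?thesis
    using step_integral_stopped_measurable[OF assms(1) step_end_nonneg assms(2)] assms(1) by simp
qed

lemma step_event_sets:
  assumes "is_step \<phi>" "finite Q" "\<And>t. t \<in> Q \<Longrightarrow> 0 \<le> t \<and> {0..t} \<subseteq> S"
  shows "{y \<in> space (path_space S). \<exists>t\<in>Q. l \<le> \<bar>step_integral \<phi> (stopped t y)\<bar>} \<in> sets (path_space S)"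
proof -
  have "{y \<in> space (path_space S). \<exists>t\<in>Q. l \<le> \<bar>step_integral \<phi> (stopped t y)\<bar>} =
      (\<Union>t\<in>Q. {y \<in> space (path_space S). l \<le> \<bar>step_integral \<phi> (stopped t y)\<bar>})"
    by auto
  also have "\<dots> \<in> sets (path_space S)"
  proof (intro sets.finite_UN assms(2))
    fix t assume "t \<in> Q"
    then have [measurable]: "(\<lambda>y. step_integral \<phi> (stopped t y)) \<in> borel_measurable (path_space S)"
      using assms by (intro step_integral_stopped_measurable) auto
    show "{y \<in> space (path_space S). l \<le> \<bar>step_integral \<phi> (stopped t y)\<bar>} \<in> sets (path_space S)"
      by measurable
  qed
  finally show ?thesis .
qed

text \<open>The constant of \<open>wiener_moment\<close> for \<open>k = 1\<close> in dimension
  \<open>d\<close>, with the factor \<open>t - s\<close> removed.\<close>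

definition wconst :: "nat \<Rightarrow> real" where
  "wconst d = 4 * 2 powr (real d / 2)"

lemma wconst_pos: "0 < wconst d"
  by (simp add: wconst_def)

lemma wiener_second_moment:
  assumes \<mu>: "wiener_measure (\<mu> :: (real \<Rightarrow> 'a::euclidean_space) measure)" and "0 \<le> s" "s < t"
  shows "integrable \<mu> (\<lambda>w. (norm (w t - w s))\<^sup>2)"
    and "(\<integral>w. (norm (w t - w s))\<^sup>2 \<partial>\<mu>) \<le> wconst DIM('a) * (t - s)"
  using wiener_moment[OF assms, of 1] by (simp_all add: wconst_def)

text \<open>The increments over the cells form a symmetric random walk. It is used with the norm for
  the Bessel process and with the identity for the bridge. Values are taken relative to
  \<open>w 0\<close> because the partial sums of the walk start exactly at 0, whereas
  \<open>w 0 = 0\<close> holds only almost everywhere.\<close>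

lemma wiener_maximal:
  fixes \<phi> :: "'a::euclidean_space \<Rightarrow> real"
  assumes \<mu>: "wiener_measure (\<mu> :: (real \<Rightarrow> 'a) measure)"
    and lip: "\<And>x y. \<bar>\<phi> x - \<phi> y\<bar> \<le> norm (x - y)"
    and conv: "\<And>x d. 2 * \<phi> x \<le> \<phi> (x + d) + \<phi> (x - d)"
    and step: "is_step (n, \<tau>, c)" and "0 < l"
  shows "measure \<mu> {w \<in> space \<mu>. \<exists>m\<le>n. 2 * l \<le> \<bar>\<Sum>k<m. c k * (\<phi> (w (\<tau> (Suc k)) - w 0) - \<phi> (w (\<tau> k) - w 0))\<bar>}
    \<le> 4 * wconst DIM('a) * step_sq (n, \<tau>, c) / l\<^sup>2
     + (\<Sum>k<n. \<bar>c k\<bar> * ((\<integral>w. \<phi> (w (\<tau> (Suc k)) - w 0) \<partial>\<mu>) - (\<integral>w. \<phi> (w (\<tau> k) - w 0) \<partial>\<mu>))) / l"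
proof -
  interpret prob_space \<mu> by (rule wiener_measureD(1)[OF \<mu>])
  have \<tau>0: "\<tau> 0 = 0" using step by (simp add: is_step_def)
  have \<tau>: "0 \<le> \<tau> k" "\<tau> k < \<tau> (Suc k)" if "k < n" for k
    using is_step_nonneg[OF step, of k] step that by (auto simp: is_step_def)
  define D where "D k w = w (\<tau> (Suc k)) - w (\<tau> k)" for k and w :: "real \<Rightarrow> 'a"
  have sum: "(\<Sum>i<k. D i w) = w (\<tau> k) - w 0" for k w
    unfolding D_def using sum_lessThan_telescope[of "\<lambda>i. w (\<tau> i)" k] by (simp add: \<tau>0)
  have ind: "indep_vars (\<lambda>_. borel) D {..<n}"
    unfolding D_def using \<tau> \<tau>0 by (intro wiener_measureD(5)[OF \<mu>]) (auto simp: less_imp_le)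
  have sym: "distr \<mu> borel (\<lambda>w. - D k w) = distr \<mu> borel (D k)" if "k < n" for k
    unfolding D_def using \<tau>[OF that] by (intro wiener_increment_symmetric[OF \<mu>])
  have D2: "integrable \<mu> (\<lambda>w. (norm (D k w))\<^sup>2)" if "k < n" for k
    unfolding D_def using \<tau>[OF that] by (intro wiener_second_moment[OF \<mu>])
  have ED2: "expectation (\<lambda>w. (norm (D k w))\<^sup>2) \<le> wconst DIM('a) * (\<tau> (Suc k) - \<tau> k)" if "k < n" for k
    unfolding D_def using \<tau>[OF that] by (intro wiener_second_moment[OF \<mu>])
  have "(\<Sum>k<n. (c k)\<^sup>2 * (4 * expectation (\<lambda>w. (norm (D k w))\<^sup>2)))
      \<le> (\<Sum>k<n. (c k)\<^sup>2 * (4 * (wconst DIM('a) * (\<tau> (Suc k) - \<tau> k))))"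
    using ED2 by (intro sum_mono mult_left_mono) auto
  also have "\<dots> = 4 * wconst DIM('a) * step_sq (n, \<tau>, c)"
    by (simp add: step_sq_def sum_distrib_left algebra_simps)
  finally have sq: "(\<Sum>k<n. (c k)\<^sup>2 * (4 * expectation (\<lambda>w. (norm (D k w))\<^sup>2))) / l\<^sup>2
      \<le> 4 * wconst DIM('a) * step_sq (n, \<tau>, c) / l\<^sup>2"
    by (intro divide_right_mono) auto
  show ?thesis
    using lipschitz_convex_maximal[OF ind sym D2 lip conv \<open>0 < l\<close>, of c] sq
    unfolding sum by linarith
qed

text \<open>One half of the Wiener isometry, with a constant: increments over disjoint cells are
  centred, by symmetry of their law, and independent.\<close>

lemma wiener_step_L2:
  assumes \<mu>: "wiener_measure (\<mu> :: (real \<Rightarrow> real) measure)" and step: "is_step \<sigma>"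
  shows "integrable \<mu> (\<lambda>w. (step_integral \<sigma> w)\<^sup>2)"
    and "(\<integral>w. (step_integral \<sigma> w)\<^sup>2 \<partial>\<mu>) \<le> wconst 1 * step_sq \<sigma>"
proof -
  interpret prob_space \<mu> by (rule wiener_measureD(1)[OF \<mu>])
  obtain n \<tau> c where \<sigma>: "\<sigma> = (n, \<tau>, c)" by (cases \<sigma>)
  note step = step[unfolded \<sigma>]
  have \<tau>: "0 \<le> \<tau> k" "\<tau> k < \<tau> (Suc k)" if "k < n" for k
    using is_step_nonneg[OF step, of k] step that by (auto simp: is_step_def)
  define D where "D k w = w (\<tau> (Suc k)) - w (\<tau> k)" for k and w :: "real \<Rightarrow> real"
  have ind: "indep_vars (\<lambda>_. borel) D {..<n}"
    unfolding D_def using \<tau> is_step_nonneg[OF step, of 0] by (intro wiener_measureD(5)[OF \<mu>]) (auto simp: less_imp_le)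
  have D2: "integrable \<mu> (\<lambda>w. (D k w)\<^sup>2)" if "k < n" for k
    unfolding D_def using wiener_second_moment(1)[OF \<mu> \<tau>[OF that]] by simp
  have ED2: "expectation (\<lambda>w. (D k w)\<^sup>2) \<le> wconst 1 * (\<tau> (Suc k) - \<tau> k)" if "k < n" for k
    unfolding D_def using wiener_second_moment(2)[OF \<mu> \<tau>[OF that]] by simp
  have D_meas [measurable]: "random_variable borel (D k)" if "k < n" for k
    using ind that by (auto simp: indep_vars_def)
  have zero: "expectation (D k) = 0" if "k < n" for k
  proof -
    have "expectation (\<lambda>w. - D k w) = integral\<^sup>L (distr \<mu> borel (\<lambda>w. - D k w)) (\<lambda>x. x)"
      using that by (subst integral_distr) auto
    also have "distr \<mu> borel (\<lambda>w. - D k w) = distr \<mu> borel (D k)"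
      unfolding D_def using \<tau>[OF that] by (intro wiener_increment_symmetric[OF \<mu>])
    also have "integral\<^sup>L (distr \<mu> borel (D k)) (\<lambda>x. x) = expectation (D k)"
      using that by (subst integral_distr) auto
    finally show ?thesis by simp
  qed
  have eq: "step_integral \<sigma> w = (\<Sum>k<n. c k * D k w)" for w
    by (simp add: \<sigma> step_integral_triple D_def)
  show "integrable \<mu> (\<lambda>w. (step_integral \<sigma> w)\<^sup>2)"
    unfolding eq by (rule indep_sum_L2(1)[OF ind zero D2])
  have "(\<integral>w. (step_integral \<sigma> w)\<^sup>2 \<partial>\<mu>) \<le> (\<Sum>k<n. (c k)\<^sup>2 * expectation (\<lambda>w. (D k w)\<^sup>2))"
    unfolding eq by (rule indep_sum_L2(2)[OF ind zero D2])
  also have "\<dots> \<le> (\<Sum>k<n. (c k)\<^sup>2 * (wconst 1 * (\<tau> (Suc k) - \<tau> k)))"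
    using ED2 by (intro sum_mono mult_left_mono) auto
  also have "\<dots> = wconst 1 * step_sq \<sigma>"
    by (simp add: \<sigma> step_sq_def sum_distrib_left algebra_simps)
  finally show "(\<integral>w. (step_integral \<sigma> w)\<^sup>2 \<partial>\<mu>) \<le> wconst 1 * step_sq \<sigma>" .
qed

text \<open>Cauchy-Schwarz against the constant function 1 on \<open>[0, u]\<close>. It controls the
  integral against a linear path, which is the form of the correction term in the bridge.\<close>

lemma step_variation_le:
  assumes "is_step (n, \<tau>, c)" "\<tau> n \<le> u"
  shows "(\<Sum>k<n. \<bar>c k\<bar> * (\<tau> (Suc k) - \<tau> k)) \<le> sqrt (u * step_sq (n, \<tau>, c))"
proof -
  define d where "d k = \<tau> (Suc k) - \<tau> k" for k
  have d: "0 \<le> d k" if "k < n" for k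
    using is_step_diff_nonneg[OF assms(1) that] by (simp add: d_def)
  have "(\<Sum>k<n. \<bar>c k\<bar> * d k) = (\<Sum>k<n. sqrt (d k) * (\<bar>c k\<bar> * sqrt (d k)))"
    using d by (intro sum.cong) auto
  then have "(\<Sum>k<n. \<bar>c k\<bar> * d k)\<^sup>2 \<le> (\<Sum>k<n. (sqrt (d k))\<^sup>2) * (\<Sum>k<n. (\<bar>c k\<bar> * sqrt (d k))\<^sup>2)"
    using Cauchy_Schwarz_ineq_sum[of "\<lambda>k. sqrt (d k)" "\<lambda>k. \<bar>c k\<bar> * sqrt (d k)" "{..<n}"] by simp
  also have "(\<Sum>k<n. (sqrt (d k))\<^sup>2) = (\<Sum>k<n. d k)"
    using d by (intro sum.cong) auto
  also have "(\<Sum>k<n. d k) = \<tau> n"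
    unfolding d_def using sum_lessThan_telescope[of \<tau> n] assms(1) by (simp add: is_step_def)
  also have "(\<Sum>k<n. (\<bar>c k\<bar> * sqrt (d k))\<^sup>2) = step_sq (n, \<tau>, c)"
    unfolding step_sq_def prod.case d_def[symmetric] using d
    by (intro sum.cong) (auto simp: power_mult_distrib)
  also have "\<tau> n * step_sq (n, \<tau>, c) \<le> u * step_sq (n, \<tau>, c)"
    using assms by (intro mult_right_mono step_sq_nonneg)
  finally show ?thesis
    unfolding d_def by (rule real_le_rsqrt)
qed

section \<open>The symmetrized Bessel process\<close>

text \<open>Putting \<open>Q\<close> into the grid makes every stopped integral with a time in
  \<open>Q\<close> a partial sum of one fixed sequence. Finitely many times are enough here; all
  rational times are reached later by monotone continuity of the measure.\<close>

lemma step_event_grid: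
  assumes "is_step \<sigma>" "finite Q" "Q \<subseteq> {0..}"
  obtains N p c where "is_step (N, p, c)"
    "\<And>s. step_fun (N, p, c) s = step_fun \<sigma> s"
    "\<And>Y. step_integral (N, p, c) Y = step_integral \<sigma> Y"
    "\<And>Y l. \<exists>t\<in>Q. l \<le> \<bar>step_integral \<sigma> (stopped t Y)\<bar> \<Longrightarrow>
       \<exists>m\<le>N. l \<le> \<bar>\<Sum>k<m. c k * (Y (p (Suc k)) - Y (p k))\<bar>"
proof -
  obtain N p where p: "\<And>c. is_step (N, p, c)" "Q \<subseteq> p ` {..N}"
    "\<And>Y. step_integral \<sigma> Y = step_integral (N, p, \<lambda>k. step_fun \<sigma> (p k)) Y"
    by (rule step_refine[OF assms]) blast
  define c where "c k = step_fun \<sigma> (p k)" for k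
  have eq: "step_integral (N, p, c) Y = step_integral \<sigma> Y" for Y
    unfolding c_def by (rule p(3)[symmetric])
  have fn: "step_fun (N, p, c) s = step_fun \<sigma> s" for s
    by (simp only: step_fun_eq_step_integral[OF p(1)] step_fun_eq_step_integral[OF assms(1)] eq)
  have "\<exists>m\<le>N. l \<le> \<bar>\<Sum>k<m. c k * (Y (p (Suc k)) - Y (p k))\<bar>"
    if ex: "\<exists>t\<in>Q. l \<le> \<bar>step_integral \<sigma> (stopped t Y)\<bar>" for Y l
  proof -
    obtain t where t: "t \<in> Q" "l \<le> \<bar>step_integral \<sigma> (stopped t Y)\<bar>" using ex by auto
    then obtain m where m: "m \<le> N" "p m = t" using p(2) by auto
    have "step_integral \<sigma> (stopped t Y) = (\<Sum>k<m. c k * (Y (p (Suc k)) - Y (p k)))"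
      unfolding eq[symmetric] m(2)[symmetric] by (rule step_integral_stopped_grid[OF p(1) m(1)])
    with t m show ?thesis by auto
  qed
  from that[OF p(1) fn eq this] show ?thesis .
qed

lemma step_integral_scaled: "step_integral \<phi> (\<lambda>b. Y b - a * Z b) = step_integral \<phi> Y - a * step_integral \<phi> Z"
  using step_integral_add[of \<phi> Y "\<lambda>b. (- a) * Z b"] step_integral_mult_right[of \<phi> "- a" Z] by simp

lemma continuous_on_restrict_iff: "continuous_on S (restrict f S) \<longleftrightarrow> continuous_on S f"
  by (rule continuous_on_cong) auto

lemma bessel3_lawD:
  assumes "bessel3_law P"
  obtains \<mu> :: "(real \<Rightarrow> real ^ 3) measure" where "wiener_measure \<mu>"
    "P = distr \<mu> Omega (\<lambda>w. \<lambda>t\<in>{0..}. norm (w t))"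
    "(\<lambda>w. \<lambda>t\<in>{0..}. norm (w t)) \<in> measurable \<mu> Omega"
proof -
  obtain \<mu> :: "(real \<Rightarrow> real ^ 3) measure" where \<mu>: "wiener_measure \<mu>"
    "P = distr \<mu> Omega (\<lambda>w. \<lambda>t\<in>{0..}. norm (w t))"
    using assms by (auto simp: bessel3_law_def)
  have "(\<lambda>w. \<lambda>t\<in>{0..}. norm (w t)) \<in> measurable \<mu> Omega"
  proof (rule measurable_path_spaceI)
    fix t :: real assume t: "t \<in> {0..}"
    then have "(\<lambda>w. w t) \<in> borel_measurable \<mu>"
      by (intro wiener_component_measurable[OF \<mu>(1)]) auto
    then show "(\<lambda>w. (\<lambda>t\<in>{0..}. norm (w t)) t) \<in> borel_measurable \<mu>"
      using t by simp
  next
    fix w assume "w \<in> space \<mu>"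
    then have "continuous_on {0..} (\<lambda>t. norm (w t))"
      by (auto simp: wiener_space[OF \<mu>(1)] intro: continuous_on_norm)
    then show "continuous_on {0..} (\<lambda>t\<in>{0..}. norm (w t))"
      by (simp only: continuous_on_restrict_iff)
  qed auto
  with \<mu> that show ?thesis by blast
qed

lemma bessel3_law_basic:
  assumes "bessel3_law P"
  shows "prob_space P" "sets P = sets Omega" "AE y in P. y 0 = 0"
proof -
  obtain \<mu> :: "(real \<Rightarrow> real ^ 3) measure" where \<mu>: "wiener_measure \<mu>"
    and P: "P = distr \<mu> Omega (\<lambda>w. \<lambda>t\<in>{0..}. norm (w t))"
    and m: "(\<lambda>w. \<lambda>t\<in>{0..}. norm (w t)) \<in> measurable \<mu> Omega"
    by (rule bessel3_lawD[OF assms])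
  interpret prob_space \<mu> by (rule wiener_measureD(1)[OF \<mu>])
  show "prob_space P" unfolding P by (rule prob_space_distr[OF m])
  show "sets P = sets Omega" unfolding P by simp
  have [measurable]: "(\<lambda>y. y 0) \<in> borel_measurable Omega"
    by (rule measurable_path_space_component) simp
  show "AE y in P. y 0 = 0"
    unfolding P using wiener_measureD(3)[OF \<mu>] by (subst AE_distr_iff[OF m]) auto
qed

text \<open>\<open>wiener_maximal\<close> for the norm, at level \<open>l / 2\<close>. The drift
  term has weights \<open>\<bar>c k\<bar>\<close> against differences of
  \<open>\<kappa> * sqrt\<close>, and by \<open>L1n_step_fun\<close> this is
  \<open>\<kappa> / 2\<close> times the \<open>L1(ds / sqrt s)\<close> norm of the step
  function.\<close>

lemma bessel3_maximal:
  assumes "bessel3_law P"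
  obtains K where "0 \<le> K" "\<And>\<sigma> Q l. is_step \<sigma> \<Longrightarrow> finite Q \<Longrightarrow> Q \<subseteq> {0..} \<Longrightarrow> 0 < l \<Longrightarrow>
    emeasure P {y \<in> space P. \<exists>t\<in>Q. l \<le> \<bar>step_integral \<sigma> (stopped t y)\<bar>}
      \<le> ennreal (K / l\<^sup>2) * L2n (step_fun \<sigma>) + ennreal (K / l) * L1n (\<lambda>s. 1 / sqrt s) (step_fun \<sigma>)"
proof -
  obtain \<mu> :: "(real \<Rightarrow> real ^ 3) measure" where \<mu>: "wiener_measure \<mu>"
    and P: "P = distr \<mu> Omega (\<lambda>w. \<lambda>t\<in>{0..}. norm (w t))"
    and m: "(\<lambda>w. \<lambda>t\<in>{0..}. norm (w t)) \<in> measurable \<mu> Omega"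
    by (rule bessel3_lawD[OF assms])
  interpret prob_space \<mu> by (rule wiener_measureD(1)[OF \<mu>])
  obtain \<kappa> where \<kappa>: "0 \<le> \<kappa>" "\<And>t. 0 \<le> t \<Longrightarrow> (\<integral>w. norm (w t - w 0) \<partial>\<mu>) = \<kappa> * sqrt t"
    by (rule wiener_norm_mean[OF \<mu>]) blast
  define C where "C = wconst DIM(real ^ 3)"
  have C: "0 < C" by (simp add: C_def wconst_pos)
  \<comment> \<open>The two coefficients are \<open>4 * C / (l / 2)\<^sup>2\<close> and
    \<open>(\<kappa> / 2) / (l / 2)\<close>; their numerators \<open>16 * C\<close> and
    \<open>\<kappa>\<close> are added to get one constant.\<close>
  define K where "K = 16 * C + \<kappa>"
  have K: "0 \<le> K" using C \<kappa> by (simp add: K_def)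
  show ?thesis
  proof (rule that[OF K])
    fix \<sigma> and Q :: "real set" and l :: real
    assume \<sigma>: "is_step \<sigma>" and Q: "finite Q" "Q \<subseteq> {0..}" and l: "0 < l"
    obtain N p c where g: "is_step (N, p, c)"
      "\<And>s. step_fun (N, p, c) s = step_fun \<sigma> s"
      "\<And>Y. step_integral (N, p, c) Y = step_integral \<sigma> Y"
      "\<And>Y l. \<exists>t\<in>Q. l \<le> \<bar>step_integral \<sigma> (stopped t Y)\<bar> \<Longrightarrow>
         \<exists>m\<le>N. l \<le> \<bar>\<Sum>k<m. c k * (Y (p (Suc k)) - Y (p k))\<bar>"
      by (rule step_event_grid[OF \<sigma> Q]) blast
    define V where "V = (\<Sum>k<N. \<bar>c k\<bar> * (2 * (sqrt (p (Suc k)) - sqrt (p k))))"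
    have p: "0 \<le> p k" "p k \<le> p (Suc k)" if "k < N" for k
      using is_step_nonneg[OF g(1), of k] is_step_diff_nonneg[OF g(1) that] that by auto
    have V0: "0 \<le> V" unfolding V_def using p by (intro sum_nonneg) auto
    have fun_eq: "step_fun \<sigma> = step_fun (N, p, c)" using g(2) by auto
    have L2: "L2n (step_fun \<sigma>) = ennreal (step_sq (N, p, c))"
      unfolding fun_eq by (rule L2n_step_fun[OF g(1)])
    have L1: "L1n (\<lambda>s. 1 / sqrt s) (step_fun \<sigma>) = ennreal V"
      unfolding fun_eq V_def by (rule L1n_step_fun[OF g(1)])
    let ?E = "{y \<in> space Omega. \<exists>t\<in>Q. l \<le> \<bar>step_integral \<sigma> (stopped t y)\<bar>}"
    let ?F = "{w \<in> space \<mu>. \<exists>m\<le>N. 2 * (l / 2) \<le> \<bar>\<Sum>k<m. c k * (norm (w (p (Suc k)) - w 0) - norm (w (p k) - w 0))\<bar>}"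
    have E: "?E \<in> sets Omega"
      using Q by (intro step_event_sets \<sigma>) auto
    have comp: "(\<lambda>w. w (p k)) \<in> borel_measurable \<mu>" if "k \<le> N" for k
      using is_step_nonneg[OF g(1) that] by (intro wiener_component_measurable[OF \<mu>])
    have comp0 [measurable]: "(\<lambda>w. w 0) \<in> borel_measurable \<mu>"
      by (intro wiener_component_measurable[OF \<mu>]) simp
    have F: "?F \<in> sets \<mu>"
    proof -
      have [measurable]: "(\<lambda>w. c k * (norm (w (p (Suc k)) - w 0) - norm (w (p k) - w 0))) \<in> borel_measurable \<mu>"
        if "k < N" for k
      proof -
        have [measurable]: "(\<lambda>w. w (p k)) \<in> borel_measurable \<mu>" "(\<lambda>w. w (p (Suc k))) \<in> borel_measurable \<mu>"
          using that by (auto intro: comp)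
        show ?thesis by measurable
      qed
      have [measurable]: "(\<lambda>w. \<Sum>k<m. c k * (norm (w (p (Suc k)) - w 0) - norm (w (p k) - w 0))) \<in> borel_measurable \<mu>"
        if "m \<le> N" for m
        using that by (intro borel_measurable_sum) auto
      have "?F = (\<Union>m\<in>{..N}. {w \<in> space \<mu>. 2 * (l / 2) \<le> \<bar>\<Sum>k<m. c k * (norm (w (p (Suc k)) - w 0) - norm (w (p k) - w 0))\<bar>})"
        by auto
      also have "\<dots> \<in> sets \<mu>"
        by (intro sets.finite_UN) auto
      finally show ?thesis .
    qed
    have "emeasure P {y \<in> space P. \<exists>t\<in>Q. l \<le> \<bar>step_integral \<sigma> (stopped t y)\<bar>} = emeasure P ?E"
      by (simp add: P)
    also have "\<dots> = emeasure \<mu> ((\<lambda>w. \<lambda>t\<in>{0..}. norm (w t)) -` ?E \<inter> space \<mu>)"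
      unfolding P by (rule emeasure_distr[OF m E])
    also have "\<dots> \<le> emeasure \<mu> ?F"
    proof (rule emeasure_mono_AE[OF _ F])
      show "AE w in \<mu>. w \<in> (\<lambda>w. \<lambda>t\<in>{0..}. norm (w t)) -` ?E \<inter> space \<mu> \<longrightarrow> w \<in> ?F"
        using wiener_measureD(3)[OF \<mu>]
      proof (eventually_elim, intro impI)
        fix w assume w0: "w 0 = 0" and w: "w \<in> (\<lambda>w. \<lambda>t\<in>{0..}. norm (w t)) -` ?E \<inter> space \<mu>"
        let ?Y = "\<lambda>t\<in>{0..}. norm (w t)"
        obtain m where m: "m \<le> N" "l \<le> \<bar>\<Sum>k<m. c k * (?Y (p (Suc k)) - ?Y (p k))\<bar>"
          using g(4)[of l ?Y] w by auto
        have "(\<Sum>k<m. c k * (?Y (p (Suc k)) - ?Y (p k))) =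
            (\<Sum>k<m. c k * (norm (w (p (Suc k)) - w 0) - norm (w (p k) - w 0)))"
        proof (intro sum.cong refl)
          fix k assume "k \<in> {..<m}"
          then have "k < N" using m by auto
          then have "0 \<le> p k" "0 \<le> p (Suc k)" using p[of k] by auto
          then show "c k * (?Y (p (Suc k)) - ?Y (p k)) =
            c k * (norm (w (p (Suc k)) - w 0) - norm (w (p k) - w 0))"
            by (simp add: w0)
        qed
        with m w show "w \<in> ?F" by auto
      qed
    qed
    also have "\<dots> = ennreal (prob ?F)" by (rule emeasure_eq_measure)
    also have "\<dots> \<le> ennreal (K / l\<^sup>2 * step_sq (N, p, c) + K / l * V)"
    proof (rule ennreal_leI)
      have conv: "2 * norm x \<le> norm (x + d) + norm (x - d)" for x d :: "real ^ 3"
      proof -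
        have "(x + d) + (x - d) = 2 *\<^sub>R x" by (simp add: scaleR_2)
        then show ?thesis
          using norm_triangle_ineq[of "x + d" "x - d"] by (metis norm_scaleR abs_numeral)
      qed
      have "prob ?F \<le> 4 * C * step_sq (N, p, c) / (l / 2)\<^sup>2
          + (\<Sum>k<N. \<bar>c k\<bar> * ((\<integral>w. norm (w (p (Suc k)) - w 0) \<partial>\<mu>) - (\<integral>w. norm (w (p k) - w 0) \<partial>\<mu>))) / (l / 2)"
        unfolding C_def using l
        by (intro wiener_maximal[OF \<mu> _ conv g(1)]) (auto intro: norm_triangle_ineq3)
      also have "(\<Sum>k<N. \<bar>c k\<bar> * ((\<integral>w. norm (w (p (Suc k)) - w 0) \<partial>\<mu>) - (\<integral>w. norm (w (p k) - w 0) \<partial>\<mu>)))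
          = (\<Sum>k<N. \<kappa> / 2 * (\<bar>c k\<bar> * (2 * (sqrt (p (Suc k)) - sqrt (p k)))))"
      proof (intro sum.cong refl)
        fix k assume "k \<in> {..<N}"
        then have "0 \<le> p k" "0 \<le> p (Suc k)" using p[of k] by auto
        then show "\<bar>c k\<bar> * ((\<integral>w. norm (w (p (Suc k)) - w 0) \<partial>\<mu>) - (\<integral>w. norm (w (p k) - w 0) \<partial>\<mu>))
          = \<kappa> / 2 * (\<bar>c k\<bar> * (2 * (sqrt (p (Suc k)) - sqrt (p k))))"
          by (simp add: \<kappa>(2) algebra_simps)
      qed
      also have "\<dots> = \<kappa> / 2 * V" by (simp only: V_def sum_distrib_left)
      also have "4 * C * step_sq (N, p, c) / (l / 2)\<^sup>2 + \<kappa> / 2 * V / (l / 2)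
          = 16 * C / l\<^sup>2 * step_sq (N, p, c) + \<kappa> / l * V"
        using l by (simp add: field_simps power2_eq_square)
      also have "\<dots> \<le> K / l\<^sup>2 * step_sq (N, p, c) + K / l * V"
        using C \<kappa>(1) l V0 step_sq_nonneg[OF g(1)] unfolding K_def
        by (intro add_mono mult_right_mono divide_right_mono) auto
      finally show "prob ?F \<le> K / l\<^sup>2 * step_sq (N, p, c) + K / l * V" .
    qed
    also have "\<dots> = ennreal (K / l\<^sup>2) * L2n (step_fun \<sigma>) + ennreal (K / l) * L1n (\<lambda>s. 1 / sqrt s) (step_fun \<sigma>)"
      unfolding L2 L1 using K l V0 step_sq_nonneg[OF g(1)]
      by (subst ennreal_plus) (auto simp: ennreal_mult[symmetric])
    finally show "emeasure P {y \<in> space P. \<exists>t\<in>Q. l \<le> \<bar>step_integral \<sigma> (stopped t y)\<bar>}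
      \<le> ennreal (K / l\<^sup>2) * L2n (step_fun \<sigma>) + ennreal (K / l) * L1n (\<lambda>s. 1 / sqrt s) (step_fun \<sigma>)" .
  qed
qed

lemma measurable_uminus_path: "(\<lambda>w. \<lambda>t\<in>{0..}. - w t) \<in> measurable Omega Omega"
proof (rule measurable_path_spaceI)
  fix t :: real assume t: "t \<in> {0..}"
  then have "(\<lambda>w. w t) \<in> borel_measurable Omega"
    by (intro measurable_path_space_component) auto
  then show "(\<lambda>w. (\<lambda>t\<in>{0..}. - w t) t) \<in> borel_measurable Omega"
    using t by simp
next
  fix w :: "real \<Rightarrow> real" assume "w \<in> space Omega"
  then have "continuous_on {0..} (\<lambda>t. - w t)"
    by (auto simp: space_path_space intro: continuous_on_minus)
  then show "continuous_on {0..} (\<lambda>t\<in>{0..}. - w t)"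
    by (simp only: continuous_on_restrict_iff)
qed auto

text \<open>\<open>symmetrize\<close> is built with \<open>measure_of\<close>, so its values are
  available only after the average of the two laws is known to be countably additive.\<close>

lemma symmetrize_emeasure:
  assumes P: "prob_space P" "sets P = sets Omega"
  shows "sets (symmetrize P) = sets Omega" "space (symmetrize P) = space Omega"
    "\<And>A. A \<in> sets Omega \<Longrightarrow> emeasure (symmetrize P) A
        = (emeasure P A + emeasure P ((\<lambda>w. \<lambda>t\<in>{0..}. - w t) -` A \<inter> space Omega)) / 2"
    "prob_space (symmetrize P)"
proof -
  interpret P: prob_space P by fact
  have m: "(\<lambda>w. \<lambda>t\<in>{0..}. - w t) \<in> measurable P Omega"
    using measurable_uminus_path by (simp add: measurable_cong_sets[OF P(2) refl])
  interpret N: prob_space "neg_law P"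
    unfolding neg_law_def by (rule P.prob_space_distr[OF m])
  have sN: "sets (neg_law P) = sets Omega" by (simp add: neg_law_def)
  show S: "sets (symmetrize P) = sets Omega" "space (symmetrize P) = space Omega"
    by (simp_all add: symmetrize_def sets.space_closed)
  let ?f = "\<lambda>A. (emeasure P A + emeasure (neg_law P) A) / 2"
  have ca: "countably_additive (sets Omega) ?f"
  proof (rule countably_additiveI)
    fix A :: "nat \<Rightarrow> (real \<Rightarrow> real) set"
    assume A: "range A \<subseteq> sets Omega" "disjoint_family A" "(\<Union>i. A i) \<in> sets Omega"
    have "(\<Sum>i. ?f (A i)) = (\<Sum>i. emeasure P (A i) + emeasure (neg_law P) (A i)) / 2"
      by (simp add: divide_ennreal_def ennreal_suminf_multc)
    also have "(\<Sum>i. emeasure P (A i) + emeasure (neg_law P) (A i))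
        = (\<Sum>i. emeasure P (A i)) + (\<Sum>i. emeasure (neg_law P) (A i))"
      by (rule suminf_add[symmetric]) auto
    also have "(\<Sum>i. emeasure P (A i)) = emeasure P (\<Union>i. A i)"
      using A P(2) by (intro suminf_emeasure) auto
    also have "(\<Sum>i. emeasure (neg_law P) (A i)) = emeasure (neg_law P) (\<Union>i. A i)"
      using A sN by (intro suminf_emeasure) auto
    finally show "(\<Sum>i. ?f (A i)) = ?f (\<Union>i. A i)" .
  qed
  have em: "emeasure (symmetrize P) A = ?f A" if "A \<in> sets Omega" for A
    unfolding symmetrize_def using that
    by (intro emeasure_measure_of_sigma sets.sigma_algebra_axioms ca) (auto simp: positive_def)
  show "emeasure (symmetrize P) A
      = (emeasure P A + emeasure P ((\<lambda>w. \<lambda>t\<in>{0..}. - w t) -` A \<inter> space Omega)) / 2" if "A \<in> sets Omega" for A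
    unfolding em[OF that] using that sets_eq_imp_space_eq[OF P(2)]
    by (simp add: neg_law_def emeasure_distr[OF m])
  show "prob_space (symmetrize P)"
  proof (rule prob_spaceI)
    have "emeasure (symmetrize P) (space Omega) = (1 + 1) / 2"
      unfolding em[OF sets.top]
      using P.emeasure_space_1 N.emeasure_space_1 sets_eq_imp_space_eq[OF P(2)] sets_eq_imp_space_eq[OF sN]
      by simp
    then show "emeasure (symmetrize P) (space (symmetrize P)) = 1"
      by (simp add: S)
  qed
qed

text \<open>The events of interest involve absolute values of step integrals or of path values and
  do not change under a sign flip. On such events the symmetrized law agrees with the Bessel law, so
  Bessel estimates carry over with the same constants.\<close>

lemma symmetrize_invariant:
  assumes P: "prob_space P" "sets P = sets Omega" and A: "A \<in> sets Omega"
    and inv: "\<And>w. w \<in> space Omega \<Longrightarrow> (\<lambda>t\<in>{0..}. - w t) \<in> A \<longleftrightarrow> w \<in> A"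
  shows "emeasure (symmetrize P) A = emeasure P A"
proof -
  have "(\<lambda>w. \<lambda>t\<in>{0..}. - w t) -` A \<inter> space Omega = A"
    using inv sets.sets_into_space[OF A] by auto
  then have "emeasure (symmetrize P) A = (emeasure P A + emeasure P A) / 2"
    unfolding symmetrize_emeasure(3)[OF P A] by simp
  also have "\<dots> = emeasure P A"
    by (simp add: mult_2[symmetric] ennreal_mult_divide_eq mult.commute[of 2])
  finally show ?thesis .
qed

lemma symmetrize_AE:
  assumes P: "prob_space P" "sets P = sets Omega" and A: "{w \<in> space Omega. \<not> Q w} \<in> sets Omega"
    and inv: "\<And>w. w \<in> space Omega \<Longrightarrow> Q (\<lambda>t\<in>{0..}. - w t) \<longleftrightarrow> Q w"
    and AE: "AE w in P. Q w"
  shows "AE w in symmetrize P. Q w"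
proof -
  have sp: "space P = space Omega" using sets_eq_imp_space_eq[OF P(2)] .
  have m: "(\<lambda>t\<in>{0..}. - w t) \<in> space Omega" if "w \<in> space Omega" for w
    using measurable_space[OF measurable_uminus_path that] .
  have "emeasure (symmetrize P) {w \<in> space Omega. \<not> Q w} = emeasure P {w \<in> space Omega. \<not> Q w}"
    using inv m by (intro symmetrize_invariant P A) auto
  also have "\<dots> = 0"
    using AE A P(2) sp by (subst (asm) AE_iff_measurable[OF _ refl]) auto
  finally have "{w \<in> space Omega. \<not> Q w} \<in> null_sets (symmetrize P)"
    using A by (auto simp: null_sets_def symmetrize_emeasure(1)[OF P])
  then show ?thesis
    by (rule AE_I') (auto simp: symmetrize_emeasure(2)[OF P])
qed

lemma symmetrized_bessel_start:
  assumes "bessel3_law P"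
  shows "AE y in symmetrize P. y 0 = 0"
proof (rule symmetrize_AE[OF bessel3_law_basic(1,2)[OF assms]])
  have [measurable]: "(\<lambda>y. y 0) \<in> borel_measurable Omega"
    by (rule measurable_path_space_component) simp
  show "{w \<in> space Omega. w 0 \<noteq> 0} \<in> sets Omega" by measurable
qed (use bessel3_law_basic(3)[OF assms] in auto)

lemma step_integral_uminus_path:
  assumes "is_step \<phi>" "0 \<le> t"
  shows "step_integral \<phi> (stopped t (\<lambda>t\<in>{0..}. - w t)) = - step_integral \<phi> (stopped t w)"
proof -
  have "step_integral \<phi> (stopped t (\<lambda>t\<in>{0..}. - w t)) = step_integral \<phi> (\<lambda>b. - stopped t w b)"
    using assms by (intro step_integral_cong) (auto simp: stopped_def)
  then show ?thesis by (simp add: step_integral_uminus)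
qed

lemma symmetrized_bessel_maximal:
  assumes "bessel3_law P"
  obtains K where "0 \<le> K" "\<And>\<sigma> Q l. is_step \<sigma> \<Longrightarrow> finite Q \<Longrightarrow> Q \<subseteq> {0..} \<Longrightarrow> 0 < l \<Longrightarrow>
    emeasure (symmetrize P) {y \<in> space Omega. \<exists>t\<in>Q. l \<le> \<bar>step_integral \<sigma> (stopped t y)\<bar>}
      \<le> ennreal (K / l\<^sup>2) * L2n (step_fun \<sigma>) + ennreal (K / l) * L1n (\<lambda>s. 1 / sqrt s) (step_fun \<sigma>)"
proof -
  note P = bessel3_law_basic(1,2)[OF assms]
  obtain K where K: "0 \<le> K" "\<And>\<sigma> Q l. is_step \<sigma> \<Longrightarrow> finite Q \<Longrightarrow> Q \<subseteq> {0..} \<Longrightarrow> 0 < l \<Longrightarrow>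
    emeasure P {y \<in> space P. \<exists>t\<in>Q. l \<le> \<bar>step_integral \<sigma> (stopped t y)\<bar>}
      \<le> ennreal (K / l\<^sup>2) * L2n (step_fun \<sigma>) + ennreal (K / l) * L1n (\<lambda>s. 1 / sqrt s) (step_fun \<sigma>)"
    by (rule bessel3_maximal[OF assms]) blast
  show ?thesis
  proof (rule that[OF K(1)])
    fix \<sigma> and Q :: "real set" and l :: real
    assume *: "is_step \<sigma>" "finite Q" "Q \<subseteq> {0..}" "0 < l"
    have "emeasure (symmetrize P) {y \<in> space Omega. \<exists>t\<in>Q. l \<le> \<bar>step_integral \<sigma> (stopped t y)\<bar>}
       = emeasure P {y \<in> space Omega. \<exists>t\<in>Q. l \<le> \<bar>step_integral \<sigma> (stopped t y)\<bar>}"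
    proof (rule symmetrize_invariant[OF P])
      show "{y \<in> space Omega. \<exists>t\<in>Q. l \<le> \<bar>step_integral \<sigma> (stopped t y)\<bar>} \<in> sets Omega"
        using * by (intro step_event_sets) auto
      fix w assume w: "w \<in> space Omega"
      then have "(\<lambda>t\<in>{0..}. - w t) \<in> space Omega"
        by (rule measurable_space[OF measurable_uminus_path])
      moreover have "step_integral \<sigma> (stopped t (\<lambda>t\<in>{0..}. - w t)) = - step_integral \<sigma> (stopped t w)"
        if "t \<in> Q" for t
        using * that by (intro step_integral_uminus_path) auto
      ultimately show "(\<lambda>t\<in>{0..}. - w t) \<in> {y \<in> space Omega. \<exists>t\<in>Q. l \<le> \<bar>step_integral \<sigma> (stopped t y)\<bar>}
        \<longleftrightarrow> w \<in> {y \<in> space Omega. \<exists>t\<in>Q. l \<le> \<bar>step_integral \<sigma> (stopped t y)\<bar>}"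
        using w by simp
    qed
    then show "emeasure (symmetrize P) {y \<in> space Omega. \<exists>t\<in>Q. l \<le> \<bar>step_integral \<sigma> (stopped t y)\<bar>}
      \<le> ennreal (K / l\<^sup>2) * L2n (step_fun \<sigma>) + ennreal (K / l) * L1n (\<lambda>s. 1 / sqrt s) (step_fun \<sigma>)"
      using K(2)[OF *] sets_eq_imp_space_eq[OF P(2)] by simp
  qed
qed

lemma symmetrized_bessel_small_ball:
  assumes "bessel3_law P"
  obtains C where "0 \<le> C" "\<And>t r. 0 < t \<Longrightarrow> 0 \<le> r \<Longrightarrow>
    emeasure (symmetrize P) {y \<in> space Omega. \<bar>y t\<bar> \<le> r} \<le> ennreal (C * (r / sqrt t) ^ 3)"
proof -
  note PP = bessel3_law_basic(1,2)[OF assms]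
  obtain \<mu> :: "(real \<Rightarrow> real ^ 3) measure" where \<mu>: "wiener_measure \<mu>"
    and P: "P = distr \<mu> Omega (\<lambda>w. \<lambda>t\<in>{0..}. norm (w t))"
    and m: "(\<lambda>w. \<lambda>t\<in>{0..}. norm (w t)) \<in> measurable \<mu> Omega"
    by (rule bessel3_lawD[OF assms])
  show ?thesis
  proof (rule that[of "unit_ball_vol (real DIM(real ^ 3))"])
    fix t r :: real assume t: "0 < t" and r: "0 \<le> r"
    have [measurable]: "(\<lambda>y. y t) \<in> borel_measurable Omega"
      using t by (intro measurable_path_space_component) auto
    have [measurable]: "(\<lambda>w. w t) \<in> borel_measurable \<mu>" "(\<lambda>w. w 0) \<in> borel_measurable \<mu>"
      using t by (auto intro: wiener_component_measurable[OF \<mu>])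
    have E: "{y \<in> space Omega. \<bar>y t\<bar> \<le> r} \<in> sets Omega" by measurable
    have "emeasure (symmetrize P) {y \<in> space Omega. \<bar>y t\<bar> \<le> r} = emeasure P {y \<in> space Omega. \<bar>y t\<bar> \<le> r}"
      using t measurable_space[OF measurable_uminus_path] by (intro symmetrize_invariant PP E) auto
    also have "\<dots> = emeasure \<mu> ((\<lambda>w. \<lambda>t\<in>{0..}. norm (w t)) -` {y \<in> space Omega. \<bar>y t\<bar> \<le> r} \<inter> space \<mu>)"
      unfolding P by (rule emeasure_distr[OF m E])
    also have "\<dots> \<le> emeasure \<mu> {w \<in> space \<mu>. norm (w t - w 0) \<le> r}"
    proof (rule emeasure_mono_AE)
      show "AE w in \<mu>. w \<in> (\<lambda>w. \<lambda>t\<in>{0..}. norm (w t)) -` {y \<in> space Omega. \<bar>y t\<bar> \<le> r} \<inter> space \<mu>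
          \<longrightarrow> w \<in> {w \<in> space \<mu>. norm (w t - w 0) \<le> r}"
        using wiener_measureD(3)[OF \<mu>] by eventually_elim (use t in auto)
      show "{w \<in> space \<mu>. norm (w t - w 0) \<le> r} \<in> sets \<mu>" by measurable
    qed
    also have "\<dots> \<le> ennreal (unit_ball_vol (real DIM(real ^ 3)) * (r / sqrt t) ^ DIM(real ^ 3))"
      by (rule wiener_small_ball[OF \<mu> t r])
    finally show "emeasure (symmetrize P) {y \<in> space Omega. \<bar>y t\<bar> \<le> r}
        \<le> ennreal (unit_ball_vol (real DIM(real ^ 3)) * (r / sqrt t) ^ 3)"
      by simp
  qed (simp add: unit_ball_vol_nonneg)
qed

section \<open>The Brownian bridge and uniqueness of Wiener measure\<close>

definition bridge :: "real \<Rightarrow> (real \<Rightarrow> real) \<Rightarrow> real \<Rightarrow> real" where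
  "bridge u w = (\<lambda>t\<in>{0..u}. w t - t / u * w u)"

lemma measurable_bridge:
  assumes "0 < u"
  shows "bridge u \<in> measurable Omega (path_space {0..u})"
proof (rule measurable_path_spaceI)
  fix t assume t: "t \<in> {0..u}"
  have [measurable]: "(\<lambda>w. w t) \<in> borel_measurable Omega" "(\<lambda>w. w u) \<in> borel_measurable Omega"
    using t assms by (auto intro!: measurable_path_space_component)
  show "(\<lambda>w. bridge u w t) \<in> borel_measurable Omega"
    unfolding bridge_def using t by simp
next
  fix w :: "real \<Rightarrow> real" assume "w \<in> space Omega"
  then have "continuous_on {0..} w" by (simp add: space_path_space)
  then have "continuous_on {0..u} w" by (rule continuous_on_subset) auto
  then have "continuous_on {0..u} (\<lambda>t. w t - t / u * w u)"
    using assms by (intro continuous_intros) auto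
  then show "continuous_on {0..u} (bridge u w)"
    unfolding bridge_def by (simp only: continuous_on_restrict_iff)
qed (simp add: bridge_def)

lemma bridge_lawD:
  assumes "brownian_bridge_law u P" "0 < u"
  obtains \<mu> where "wiener_measure \<mu>" "P = distr \<mu> (path_space {0..u}) (bridge u)"
    "bridge u \<in> measurable \<mu> (path_space {0..u})"
proof -
  obtain \<mu> where \<mu>: "wiener_measure \<mu>" "P = distr \<mu> (path_space {0..u}) (bridge u)"
    using assms(1) by (auto simp: brownian_bridge_law_def bridge_def[abs_def])
  moreover have "bridge u \<in> measurable \<mu> (path_space {0..u})"
    using measurable_bridge[OF assms(2)]
    by (simp add: measurable_cong_sets[OF wiener_measureD(2)[OF \<mu>(1)] refl])
  ultimately show ?thesis by (rule that)
qed

lemma bridge_law_basic: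
  assumes "brownian_bridge_law u P" "0 < u"
  shows "prob_space P" "sets P = sets (path_space {0..u})" "space P = space (path_space {0..u})"
    "AE x in P. x u = 0"
proof -
  obtain \<mu> where \<mu>: "wiener_measure \<mu>" and P: "P = distr \<mu> (path_space {0..u}) (bridge u)"
    and m: "bridge u \<in> measurable \<mu> (path_space {0..u})"
    by (rule bridge_lawD[OF assms])
  interpret prob_space \<mu> by (rule wiener_measureD(1)[OF \<mu>])
  show "prob_space P" unfolding P by (rule prob_space_distr[OF m])
  show "sets P = sets (path_space {0..u})" "space P = space (path_space {0..u})" unfolding P by simp_all
  have [measurable]: "(\<lambda>x. x u) \<in> borel_measurable (path_space {0..u})"
    using assms by (intro measurable_path_space_component) auto
  show "AE x in P. x u = 0"
    unfolding P using assms by (subst AE_distr_iff[OF m]) (auto simp: bridge_def)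
qed

lemma step_integral_bridge:
  assumes "is_step \<sigma>" "0 < u" "0 \<le> t" "t \<le> u"
  shows "step_integral \<sigma> (stopped t (bridge u w)) =
    step_integral \<sigma> (stopped t w) - w u / u * step_integral \<sigma> (stopped t (\<lambda>b. b))"
proof -
  have "step_integral \<sigma> (stopped t (bridge u w)) = step_integral \<sigma> (\<lambda>b. stopped t w b - w u / u * stopped t (\<lambda>b. b) b)"
    using assms by (intro step_integral_cong) (auto simp: stopped_def bridge_def)
  then show ?thesis by (simp only: step_integral_scaled)
qed

lemma step_integral_id_bound:
  assumes "is_step \<sigma>" "step_end \<sigma> \<le> u" "0 \<le> t"
  shows "\<bar>step_integral \<sigma> (stopped t (\<lambda>b. b))\<bar> \<le> sqrt (u * step_sq \<sigma>)"
proof -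
  obtain n \<tau> c where \<sigma>: "\<sigma> = (n, \<tau>, c)" by (cases \<sigma>)
  have "\<bar>step_integral \<sigma> (stopped t (\<lambda>b. b))\<bar> \<le> (\<Sum>k<n. \<bar>c k * (min (\<tau> (Suc k)) t - min (\<tau> k) t)\<bar>)"
    unfolding \<sigma> step_integral_triple stopped_def by (rule sum_abs)
  also have "\<dots> \<le> (\<Sum>k<n. \<bar>c k\<bar> * (\<tau> (Suc k) - \<tau> k))"
  proof (rule sum_mono)
    fix k assume "k \<in> {..<n}"
    then have "0 \<le> \<tau> (Suc k) - \<tau> k"
      using assms(1) is_step_diff_nonneg by (auto simp: \<sigma>)
    then have "\<bar>min (\<tau> (Suc k)) t - min (\<tau> k) t\<bar> \<le> \<tau> (Suc k) - \<tau> k"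
      by (auto simp: min_def)
    then show "\<bar>c k * (min (\<tau> (Suc k)) t - min (\<tau> k) t)\<bar> \<le> \<bar>c k\<bar> * (\<tau> (Suc k) - \<tau> k)"
      by (simp add: abs_mult mult_left_mono)
  qed
  also have "\<dots> \<le> sqrt (u * step_sq \<sigma>)"
    unfolding \<sigma> using assms by (intro step_variation_le) (auto simp: \<sigma> step_end_def)
  finally show ?thesis .
qed

lemma wiener_square_mean:
  assumes \<mu>: "wiener_measure (\<mu> :: (real \<Rightarrow> real) measure)" and "0 < u"
  shows "integrable \<mu> (\<lambda>w. (w u)\<^sup>2)" "(\<integral>w. (w u)\<^sup>2 \<partial>\<mu>) \<le> wconst 1 * u"
proof -
  have [measurable]: "(\<lambda>w. w u) \<in> borel_measurable \<mu>" "(\<lambda>w. w 0) \<in> borel_measurable \<mu>"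
    using assms by (auto intro: wiener_component_measurable[OF \<mu>])
  have eq: "AE w in \<mu>. (norm (w u - w 0))\<^sup>2 = (w u)\<^sup>2"
    using wiener_measureD(3)[OF \<mu>] by eventually_elim simp
  note m = wiener_second_moment[OF \<mu> order_refl assms(2)]
  show "integrable \<mu> (\<lambda>w. (w u)\<^sup>2)"
    by (rule integrable_cong_AE_imp[OF m(1)]) (use eq in auto)
  have "(\<integral>w. (w u)\<^sup>2 \<partial>\<mu>) = (\<integral>w. (norm (w u - w 0))\<^sup>2 \<partial>\<mu>)"
    using eq by (intro integral_cong_AE) auto
  with m(2) show "(\<integral>w. (w u)\<^sup>2 \<partial>\<mu>) \<le> wconst 1 * u" by simp
qed

text \<open>The bridge integral is the Brownian one minus \<open>w u / u\<close> times a
  deterministic integral \<open>I\<close> with \<open>I\<^sup>2 \<le> u * S\<close>. The factor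
  \<open>u\<close> cancels against the second moment of \<open>w u / u\<close>, which is of order
  \<open>1 / u\<close>, so the constant is the same for all \<open>u\<close>.\<close>

lemma bridge_L2:
  assumes "brownian_bridge_law u P" "0 < u" and \<sigma>: "is_step \<sigma>" "step_end \<sigma> \<le> u"
  shows "(\<integral>\<^sup>+x. ennreal ((step_integral \<sigma> x)\<^sup>2) \<partial>P) \<le> ennreal (4 * wconst 1) * L2n (step_fun \<sigma>)"
proof -
  obtain \<mu> where \<mu>: "wiener_measure \<mu>" and P: "P = distr \<mu> (path_space {0..u}) (bridge u)"
    and m: "bridge u \<in> measurable \<mu> (path_space {0..u})"
    by (rule bridge_lawD[OF assms(1,2)])
  define S where "S = step_sq \<sigma>"
  define I where "I = step_integral \<sigma> (\<lambda>b. b)"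
  have S: "0 \<le> S" by (simp add: S_def step_sq_nonneg \<sigma>)
  have I: "I\<^sup>2 \<le> u * S"
  proof -
    have "\<bar>I\<bar> \<le> sqrt (u * S)"
      using step_integral_id_bound[OF \<sigma>, of u] step_integral_stopped_ge[OF \<sigma>(1), of u] \<sigma> assms(2)
      by (simp add: I_def S_def)
    then have "\<bar>I\<bar>\<^sup>2 \<le> (sqrt (u * S))\<^sup>2" by (intro power_mono) auto
    then show ?thesis using S assms(2) by simp
  qed
  have meas: "(\<lambda>x. ennreal ((step_integral \<sigma> x)\<^sup>2)) \<in> borel_measurable (path_space {0..u})"
  proof -
    have [measurable]: "step_integral \<sigma> \<in> borel_measurable (path_space {0..u})"
      using \<sigma> by (intro step_integral_measurable) auto
    show ?thesis by measurable
  qed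
  have br: "step_integral \<sigma> (bridge u w) = step_integral \<sigma> w - w u / u * I" for w
    using step_integral_bridge[OF \<sigma>(1) assms(2), of u w] assms(2) step_integral_stopped_ge[OF \<sigma>, of "bridge u w"]
      step_integral_stopped_ge[OF \<sigma>, of w] step_integral_stopped_ge[OF \<sigma>, of "\<lambda>b. b"]
    by (simp add: I_def)
  have sq: "(step_integral \<sigma> (bridge u w))\<^sup>2 \<le> 2 * (step_integral \<sigma> w)\<^sup>2 + 2 * (S / u) * (w u)\<^sup>2" for w
  proof -
    have "(w u / u * I)\<^sup>2 = (w u)\<^sup>2 / u\<^sup>2 * I\<^sup>2" by (simp add: power_mult_distrib power_divide)
    also have "\<dots> \<le> (w u)\<^sup>2 / u\<^sup>2 * (u * S)" using I by (intro mult_left_mono) auto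
    also have "\<dots> = S / u * (w u)\<^sup>2" using assms(2) by (simp add: power2_eq_square)
    finally have "(w u / u * I)\<^sup>2 \<le> S / u * (w u)\<^sup>2" .
    moreover have sq: "(a - b)\<^sup>2 \<le> 2 * a\<^sup>2 + 2 * b\<^sup>2" for a b :: real
      using zero_le_power2[of "a + b"] by (simp add: power2_sum power2_diff)
    from sq[of "step_integral \<sigma> w" "w u / u * I"]
    have "(step_integral \<sigma> w - w u / u * I)\<^sup>2 \<le> 2 * (step_integral \<sigma> w)\<^sup>2 + 2 * (w u / u * I)\<^sup>2" .
    ultimately have "(step_integral \<sigma> w - w u / u * I)\<^sup>2
        \<le> 2 * (step_integral \<sigma> w)\<^sup>2 + 2 * (S / u * (w u)\<^sup>2)"
      by linarith
    then show ?thesis unfolding br by (simp only: mult.assoc)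
  qed
  note L = wiener_step_L2[OF \<mu> \<sigma>(1)] and W = wiener_square_mean[OF \<mu> assms(2)]
  have "(\<integral>\<^sup>+x. ennreal ((step_integral \<sigma> x)\<^sup>2) \<partial>P) = (\<integral>\<^sup>+w. ennreal ((step_integral \<sigma> (bridge u w))\<^sup>2) \<partial>\<mu>)"
    unfolding P by (rule nn_integral_distr[OF m]) (use meas in simp)
  also have "\<dots> \<le> (\<integral>\<^sup>+w. ennreal (2 * (step_integral \<sigma> w)\<^sup>2 + 2 * (S / u) * (w u)\<^sup>2) \<partial>\<mu>)"
    using sq by (intro nn_integral_mono ennreal_leI)
  also have "\<dots> = ennreal (\<integral>w. 2 * (step_integral \<sigma> w)\<^sup>2 + 2 * (S / u) * (w u)\<^sup>2 \<partial>\<mu>)"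
    using L(1) W(1) S assms(2) by (intro nn_integral_eq_integral) auto
  also have "\<dots> = ennreal (2 * (\<integral>w. (step_integral \<sigma> w)\<^sup>2 \<partial>\<mu>) + 2 * (S / u) * (\<integral>w. (w u)\<^sup>2 \<partial>\<mu>))"
    using L(1) W(1) by simp
  also have "\<dots> \<le> ennreal (2 * (wconst 1 * S) + 2 * (S / u) * (wconst 1 * u))"
    using L(2) W(2) S assms(2) by (intro ennreal_leI add_mono mult_left_mono) (auto simp: S_def)
  also have "2 * (wconst 1 * S) + 2 * (S / u) * (wconst 1 * u) = 4 * wconst 1 * S"
    using assms(2) by simp
  also have "ennreal (4 * wconst 1 * S) = ennreal (4 * wconst 1) * L2n (step_fun \<sigma>)"
    unfolding L2n_step_fun[OF \<sigma>(1)] S_def[symmetric] using S wconst_pos[of 1] by (simp add: ennreal_mult)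
  finally show ?thesis .
qed

text \<open>The correction term is bounded for all \<open>t\<close> simultaneously by a multiple of
  \<open>\<bar>w u\<bar>\<close>, so only the Brownian part requires a maximal inequality. The
  constant 68 is 64 from \<open>wiener_maximal\<close> at level \<open>l / 4\<close>, plus 4 from
  Markov's inequality for the correction at level \<open>l / 2\<close>.\<close>

lemma bridge_maximal:
  assumes "brownian_bridge_law u P" "0 < u" and \<sigma>: "is_step \<sigma>"
    and Q: "finite Q" "Q \<subseteq> {0..u}" and l: "0 < l"
  shows "emeasure P {x \<in> space (path_space {0..u}). \<exists>t\<in>Q. l \<le> \<bar>step_integral \<sigma> (stopped t x)\<bar>}
    \<le> ennreal (68 * wconst 1 / l\<^sup>2) * L2n (step_fun \<sigma>)"
proof -
  obtain \<mu> where \<mu>: "wiener_measure \<mu>" and P: "P = distr \<mu> (path_space {0..u}) (bridge u)"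
    and m: "bridge u \<in> measurable \<mu> (path_space {0..u})"
    by (rule bridge_lawD[OF assms(1,2)])
  interpret prob_space \<mu> by (rule wiener_measureD(1)[OF \<mu>])
  \<comment> \<open>\<open>\<sigma>\<close> may extend beyond \<open>u\<close>, while
    \<open>step_integral_id_bound\<close> needs a step that ends by \<open>u\<close>. Cutting at
    \<open>u\<close> changes no integral stopped at a time in \<open>Q\<close>.\<close>
  obtain \<xi> where \<xi>: "is_step \<xi>" "\<And>s. step_fun \<xi> s = indicator {0..<u} s * step_fun \<sigma> s"
    "\<And>Y. step_integral \<xi> Y = step_integral \<sigma> (stopped u Y)" "step_end \<xi> = u"
    using step_restrict[OF \<sigma>, of u] assms(2) by (metis less_imp_le)
  have \<xi>\<sigma>: "step_integral \<sigma> (stopped t Y) = step_integral \<xi> (stopped t Y)" if "t \<in> Q" for t Y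
  proof -
    have "t \<le> u" using that Q by auto
    then have "stopped u (stopped t Y) = stopped t Y"
      by (simp add: stopped_def fun_eq_iff min.assoc min_absorb2)
    then show ?thesis by (simp add: \<xi>(3))
  qed
  have "Q \<subseteq> {0..}" using Q by auto
  then obtain N p c where g: "is_step (N, p, c)"
    "\<And>s. step_fun (N, p, c) s = step_fun \<xi> s"
    "\<And>Y. step_integral (N, p, c) Y = step_integral \<xi> Y"
    "\<And>Y l. \<exists>t\<in>Q. l \<le> \<bar>step_integral \<xi> (stopped t Y)\<bar> \<Longrightarrow>
       \<exists>m\<le>N. l \<le> \<bar>\<Sum>k<m. c k * (Y (p (Suc k)) - Y (p k))\<bar>"
    by (rule step_event_grid[OF \<xi>(1) Q(1)]) blast
  define S where "S = step_sq \<xi>"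
  have S: "0 \<le> S" by (simp add: S_def step_sq_nonneg \<xi>(1))
  have L2: "L2n (step_fun \<xi>) = ennreal S" unfolding S_def by (rule L2n_step_fun[OF \<xi>(1)])
  have "step_fun (N, p, c) = step_fun \<xi>" using g(2) by auto
  then have "ennreal (step_sq (N, p, c)) = ennreal S"
    using L2n_step_fun[OF g(1)] L2 by simp
  then have Seq: "step_sq (N, p, c) = S"
    using S step_sq_nonneg[OF g(1)] by (subst (asm) ennreal_inj) auto
  let ?E = "{x \<in> space (path_space {0..u}). \<exists>t\<in>Q. l \<le> \<bar>step_integral \<sigma> (stopped t x)\<bar>}"
  let ?F = "{w \<in> space \<mu>. \<exists>m\<le>N. 2 * (l / 4) \<le> \<bar>\<Sum>k<m. c k * ((w (p (Suc k)) - w 0) - (w (p k) - w 0))\<bar>}"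
  let ?G = "{w \<in> space \<mu>. l\<^sup>2 / 4 \<le> S / u * (w u)\<^sup>2}"
  have E: "?E \<in> sets (path_space {0..u})"
    using Q by (intro step_event_sets \<sigma>) auto
  have F: "?F \<in> sets \<mu>"
  proof -
    have comp [measurable]: "(\<lambda>w. w (p k)) \<in> borel_measurable \<mu>" if "k \<le> N" for k
      using is_step_nonneg[OF g(1) that] by (intro wiener_component_measurable[OF \<mu>])
    have [measurable]: "(\<lambda>w. w 0) \<in> borel_measurable \<mu>"
      by (intro wiener_component_measurable[OF \<mu>]) simp
    have [measurable]: "(\<lambda>w. \<Sum>k<m. c k * ((w (p (Suc k)) - w 0) - (w (p k) - w 0))) \<in> borel_measurable \<mu>"
      if "m \<le> N" for m
      using that by (intro borel_measurable_sum) simp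
    have "?F = (\<Union>m\<in>{..N}. {w \<in> space \<mu>. 2 * (l / 4) \<le> \<bar>\<Sum>k<m. c k * ((w (p (Suc k)) - w 0) - (w (p k) - w 0))\<bar>})"
      by auto
    also have "\<dots> \<in> sets \<mu>"
      by (intro sets.finite_UN) auto
    finally show ?thesis .
  qed
  have [measurable]: "(\<lambda>w. w u) \<in> borel_measurable \<mu>"
    using assms by (intro wiener_component_measurable[OF \<mu>]) auto
  have G: "?G \<in> sets \<mu>" by measurable
  have "emeasure P ?E = emeasure \<mu> (bridge u -` ?E \<inter> space \<mu>)"
    unfolding P by (rule emeasure_distr[OF m E])
  also have "\<dots> \<le> emeasure \<mu> (?F \<union> ?G)"
  proof (rule emeasure_mono)
    show "bridge u -` ?E \<inter> space \<mu> \<subseteq> ?F \<union> ?G"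
    proof safe
      fix w t assume w: "w \<in> space \<mu>" "t \<in> Q" "l \<le> \<bar>step_integral \<sigma> (stopped t (bridge u w))\<bar>"
        and nG: "\<not> l\<^sup>2 / 4 \<le> S / u * (w u)\<^sup>2"
      let ?I = "step_integral \<xi> (stopped t (\<lambda>b. b))"
      have t: "0 \<le> t" "t \<le> u" using w(2) Q by auto
      have "\<bar>?I\<bar> \<le> sqrt (u * S)"
        using step_integral_id_bound[OF \<xi>(1), of u t] \<xi>(4) t by (simp add: S_def)
      then have "\<bar>?I\<bar>\<^sup>2 \<le> (sqrt (u * S))\<^sup>2" by (intro power_mono) auto
      then have "?I\<^sup>2 \<le> u * S" using S assms(2) by simp
      then have "(w u)\<^sup>2 / u\<^sup>2 * ?I\<^sup>2 \<le> (w u)\<^sup>2 / u\<^sup>2 * (u * S)"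
        by (intro mult_left_mono) auto
      also have "\<dots> = S / u * (w u)\<^sup>2" using assms(2) by (simp add: power2_eq_square)
      also have "\<dots> < l\<^sup>2 / 4" using nG by simp
      finally have "(w u / u * ?I)\<^sup>2 < (l / 2)\<^sup>2" by (simp add: power_mult_distrib power_divide)
      then have "\<bar>w u / u * ?I\<bar> < l / 2"
        using l by (metis abs_of_pos half_gt_zero power2_less_imp_less abs_ge_zero power2_abs less_imp_le)
      moreover have "step_integral \<sigma> (stopped t (bridge u w)) =
          step_integral \<xi> (stopped t w) - w u / u * ?I"
        unfolding \<xi>\<sigma>[OF w(2)] by (rule step_integral_bridge[OF \<xi>(1) assms(2) t])
      ultimately have "l / 2 \<le> \<bar>step_integral \<xi> (stopped t w)\<bar>"
        using w(3) by linarith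
      then obtain m where "m \<le> N" "l / 2 \<le> \<bar>\<Sum>k<m. c k * (w (p (Suc k)) - w (p k))\<bar>"
        using g(4)[of "l / 2" w] w(2) by blast
      then show "\<exists>m\<le>N. 2 * (l / 4) \<le> \<bar>\<Sum>k<m. c k * ((w (p (Suc k)) - w 0) - (w (p k) - w 0))\<bar>"
        by auto
    qed
    show "?F \<union> ?G \<in> sets \<mu>" using F G by (rule sets.Un)
  qed
  also have "\<dots> = ennreal (prob (?F \<union> ?G))" by (rule emeasure_eq_measure)
  also have "\<dots> \<le> ennreal (68 * wconst 1 / l\<^sup>2 * S)"
  proof (rule ennreal_leI)
    have "prob ?F \<le> 4 * wconst DIM(real) * step_sq (N, p, c) / (l / 4)\<^sup>2
      + (\<Sum>k<N. \<bar>c k\<bar> * ((\<integral>w. w (p (Suc k)) - w 0 \<partial>\<mu>) - (\<integral>w. w (p k) - w 0 \<partial>\<mu>))) / (l / 4)"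
      using l by (intro wiener_maximal[OF \<mu> _ _ g(1), of "\<lambda>x. x"]) auto
    \<comment> \<open>For the identity in place of the norm the drift vanishes, which is why the
      bridge bound contains the \<open>L2\<close> norm only.\<close>
    moreover have mean0: "(\<integral>w. w (p k) - w 0 \<partial>\<mu>) = 0" if "k \<le> N" for k
    proof (cases "p k = 0")
      case False
      then have pk: "0 < p k" using is_step_nonneg[OF g(1) that] by simp
      have [measurable]: "(\<lambda>w. w (p k)) \<in> borel_measurable \<mu>" "(\<lambda>w. w 0) \<in> borel_measurable \<mu>"
        using pk by (auto intro!: wiener_component_measurable[OF \<mu>])
      have "(\<integral>w. - (w (p k) - w 0) \<partial>\<mu>) = integral\<^sup>L (distr \<mu> borel (\<lambda>w. - (w (p k) - w 0))) (\<lambda>x. x)"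
        by (subst integral_distr) auto
      also have "distr \<mu> borel (\<lambda>w. - (w (p k) - w 0)) = distr \<mu> borel (\<lambda>w. w (p k) - w 0)"
        by (rule wiener_increment_symmetric[OF \<mu> order_refl pk])
      also have "integral\<^sup>L (distr \<mu> borel (\<lambda>w. w (p k) - w 0)) (\<lambda>x. x) = (\<integral>w. w (p k) - w 0 \<partial>\<mu>)"
        by (subst integral_distr) auto
      finally show ?thesis by (simp only: integral_minus)
    qed simp
    moreover have "(\<Sum>k<N. \<bar>c k\<bar> * ((\<integral>w. w (p (Suc k)) - w 0 \<partial>\<mu>) - (\<integral>w. w (p k) - w 0 \<partial>\<mu>))) = 0"
      using mean0 by (intro sum.neutral) auto
    ultimately have f: "prob ?F \<le> 64 * wconst 1 / l\<^sup>2 * S"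
      using l by (simp add: Seq power_divide)
    have "prob ?G \<le> (\<integral>w. S / u * (w u)\<^sup>2 \<partial>\<mu>) / (l\<^sup>2 / 4)"
      using wiener_square_mean(1)[OF \<mu> assms(2)] S l assms(2)
      by (intro integral_Markov_inequality_measure[of _ _ "{}"]) auto
    also have "\<dots> = S / u * (\<integral>w. (w u)\<^sup>2 \<partial>\<mu>) / (l\<^sup>2 / 4)" by simp
    also have "\<dots> \<le> S / u * (wconst 1 * u) / (l\<^sup>2 / 4)"
      using wiener_square_mean(2)[OF \<mu> assms(2)] S assms(2)
      by (intro divide_right_mono mult_left_mono) auto
    also have "\<dots> = 4 * wconst 1 / l\<^sup>2 * S" using assms(2) by simp
    finally have "prob ?G \<le> 4 * wconst 1 / l\<^sup>2 * S" .
    moreover have "prob (?F \<union> ?G) \<le> prob ?F + prob ?G" using F G by (rule measure_Un_le)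
    ultimately have "prob (?F \<union> ?G) \<le> 64 * wconst 1 / l\<^sup>2 * S + 4 * wconst 1 / l\<^sup>2 * S"
      using f by linarith
    also have "\<dots> = 68 * wconst 1 / l\<^sup>2 * S" by (simp add: field_simps)
    finally show "prob (?F \<union> ?G) \<le> 68 * wconst 1 / l\<^sup>2 * S" .
  qed
  also have "\<dots> = ennreal (68 * wconst 1 / l\<^sup>2) * L2n (step_fun \<xi>)"
    unfolding L2 using wconst_pos[of 1] S by (simp add: ennreal_mult[symmetric])
  also have "\<dots> \<le> ennreal (68 * wconst 1 / l\<^sup>2) * L2n (step_fun \<sigma>)"
    by (intro mult_left_mono L2n_restrict_le[OF \<xi>(2)]) simp
  finally show ?thesis .
qed

text \<open>Within one unit of time from its end the bridge is of order 1 uniformly in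
  \<open>u\<close>: its value at \<open>m\<close> is
  \<open>(1 - m / u) * (w m - w 0) - m / u * (w u - w m)\<close> with
  \<open>1 - m / u \<le> 1 / u\<close>. By Markov's inequality the event
  \<open>m \<le> x m ^ 8\<close> then has probability of order \<open>1 / m\<close>, which is
  integrable at infinity against \<open>du / sqrt u\<close>.\<close>

lemma bridge_eighth_moment:
  obtains C where "0 \<le> C" "\<And>u P m. brownian_bridge_law u P \<Longrightarrow> 1 \<le> u \<Longrightarrow> 0 < m \<Longrightarrow> m \<le> u \<Longrightarrow> u \<le> m + 1 \<Longrightarrow>
     (\<integral>\<^sup>+x. ennreal (x m ^ 8) \<partial>P) \<le> ennreal C"
proof -
  \<comment> \<open>The constant of \<open>wiener_moment\<close> for \<open>k = 4\<close> in
    dimension 1. The factor 512 is twice \<open>2 ^ 8\<close>, from the eighth power of a sum of two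
    terms.\<close>
  define c where "c = 4 ^ 4 * fact 4 * 2 powr (1 / 2 :: real)"
  have c: "0 \<le> c" by (simp add: c_def)
  show ?thesis
  proof (rule that[of "512 * c"])
    fix u P and m :: real
    assume law: "brownian_bridge_law u P" and u: "1 \<le> u" and m: "0 < m" "m \<le> u" "u \<le> m + 1"
    obtain \<mu> where \<mu>: "wiener_measure \<mu>" and P: "P = distr \<mu> (path_space {0..u}) (bridge u)"
      and br: "bridge u \<in> measurable \<mu> (path_space {0..u})"
      using u by (rule_tac bridge_lawD[OF law]) auto
    have [measurable]: "(\<lambda>w. w m) \<in> borel_measurable \<mu>" "(\<lambda>w. w u) \<in> borel_measurable \<mu>"
      "(\<lambda>w. w 0) \<in> borel_measurable \<mu>"
      using m u by (auto intro: wiener_component_measurable[OF \<mu>])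
    have mom: "integrable \<mu> (\<lambda>w. (w t - w s) ^ 8) \<and> (\<integral>w. (w t - w s) ^ 8 \<partial>\<mu>) \<le> c * (t - s) ^ 4"
      if st: "0 \<le> s" "s \<le> t" for s t
    proof (cases "s = t")
      case False
      then have st': "s < t" using st by simp
      show ?thesis
        using wiener_moment[OF \<mu> st(1) st', of 4] by (simp add: c_def)
    qed (simp)
    have b: "bridge u w m ^ 8 \<le> 256 * (1 / u) ^ 8 * (w m - w 0) ^ 8 + 256 * (w u - w m) ^ 8"
      if "w 0 = 0" for w
    proof -
      define a where "a = (1 - m / u) * (w m - w 0)"
      define d where "d = m / u * (w u - w m)"
      have "bridge u w m = a - d"
        using m u that by (simp add: bridge_def a_def d_def algebra_simps)
      moreover have "(a - d) ^ 8 \<le> 256 * (a ^ 8 + d ^ 8)"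
      proof -
        have "\<bar>a - d\<bar> \<le> 2 * max \<bar>a\<bar> \<bar>d\<bar>" by linarith
        then have "\<bar>a - d\<bar> ^ 8 \<le> (2 * max \<bar>a\<bar> \<bar>d\<bar>) ^ 8" by (intro power_mono) auto
        also have "\<dots> = 256 * max \<bar>a\<bar> \<bar>d\<bar> ^ 8" by (simp add: power_mult_distrib)
        also have "\<dots> \<le> 256 * (\<bar>a\<bar> ^ 8 + \<bar>d\<bar> ^ 8)" by (simp add: max_def)
        finally show ?thesis by simp
      qed
      moreover have "a ^ 8 \<le> (1 / u) ^ 8 * (w m - w 0) ^ 8"
      proof -
        have "1 - m / u = (u - m) / u" using u by (simp add: field_simps)
        also have "\<dots> \<le> 1 / u" using m u by (intro divide_right_mono) auto
        finally have "1 - m / u \<le> 1 / u" .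
        moreover have "0 \<le> 1 - m / u" using m u by simp
        ultimately have "(1 - m / u) ^ 8 \<le> (1 / u) ^ 8" by (intro power_mono) auto
        then show ?thesis unfolding a_def power_mult_distrib by (intro mult_right_mono) auto
      qed
      moreover have "d ^ 8 \<le> (w u - w m) ^ 8"
      proof -
        have "(m / u) ^ 8 \<le> 1 ^ 8" using m u by (intro power_mono) auto
        then show ?thesis unfolding d_def power_mult_distrib using mult_right_mono[of "(m / u) ^ 8" 1] by simp
      qed
      ultimately show ?thesis by simp
    qed
    have "(\<integral>\<^sup>+x. ennreal (x m ^ 8) \<partial>P) = (\<integral>\<^sup>+w. ennreal (bridge u w m ^ 8) \<partial>\<mu>)"
    proof -
      have [measurable]: "(\<lambda>x. x m) \<in> borel_measurable (path_space {0..u})"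
        using m by (intro measurable_path_space_component) auto
      show ?thesis unfolding P by (rule nn_integral_distr[OF br]) simp
    qed
    also have "\<dots> \<le> (\<integral>\<^sup>+w. ennreal (256 * (1 / u) ^ 8 * (w m - w 0) ^ 8 + 256 * (w u - w m) ^ 8) \<partial>\<mu>)"
    proof (rule nn_integral_mono_AE)
      show "AE w in \<mu>. ennreal (bridge u w m ^ 8)
          \<le> ennreal (256 * (1 / u) ^ 8 * (w m - w 0) ^ 8 + 256 * (w u - w m) ^ 8)"
        using wiener_measureD(3)[OF \<mu>] by eventually_elim (rule ennreal_leI, rule b)
    qed
    also have "\<dots> = ennreal (\<integral>w. 256 * (1 / u) ^ 8 * (w m - w 0) ^ 8 + 256 * (w u - w m) ^ 8 \<partial>\<mu>)"
      using mom[of 0 m] mom[of m u] m u by (intro nn_integral_eq_integral) auto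
    also have "\<dots> = ennreal (256 * (1 / u) ^ 8 * (\<integral>w. (w m - w 0) ^ 8 \<partial>\<mu>) + 256 * (\<integral>w. (w u - w m) ^ 8 \<partial>\<mu>))"
      using mom[of 0 m] mom[of m u] m by simp
    also have "\<dots> \<le> ennreal (256 * (1 / u) ^ 8 * (c * m ^ 4) + 256 * (c * (u - m) ^ 4))"
      using mom[of 0 m] mom[of m u] m u by (intro ennreal_leI add_mono mult_left_mono) auto
    also have "\<dots> \<le> ennreal (512 * c)"
    proof (rule ennreal_leI)
      have "m ^ 4 \<le> u ^ 4" using m by (intro power_mono) auto
      also have "\<dots> \<le> u ^ 8" using u by (intro power_increasing) auto
      finally have "(1 / u) ^ 8 * m ^ 4 \<le> 1" using u by (simp add: power_divide)
      moreover have "(u - m) ^ 4 \<le> 1 ^ 4" using m by (intro power_mono) auto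
      ultimately have "256 * c * ((1 / u) ^ 8 * m ^ 4) + 256 * c * (u - m) ^ 4 \<le> 256 * c * 1 + 256 * c * 1"
        using c by (intro add_mono mult_left_mono) auto
      then show "256 * (1 / u) ^ 8 * (c * m ^ 4) + 256 * (c * (u - m) ^ 4) \<le> 512 * c"
        by (simp add: algebra_simps)
    qed
    finally show "(\<integral>\<^sup>+x. ennreal (x m ^ 8) \<partial>P) \<le> ennreal (512 * c)" .
  qed (use c in simp)
qed

text \<open>The axioms determine the joint law of the increments over any grid, hence all cylinder
  probabilities. Uniqueness matters because \<open>brownian_bridge_law\<close> may involve a
  different Brownian motion for every \<open>u\<close>, while measurability in \<open>u\<close> of
  the concatenated laws is obtained from a common one.\<close>

lemma wiener_measure_unique:
  assumes \<mu>: "wiener_measure (\<mu> :: (real \<Rightarrow> 'a::euclidean_space) measure)" and \<nu>: "wiener_measure \<nu>"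
  shows "\<mu> = \<nu>"
proof -
  let ?PM = "Pi\<^sub>M {0::real..} (\<lambda>_. borel :: 'a measure)"
  have idm: "(\<lambda>w. w) \<in> measurable \<mu>' ?PM" if "wiener_measure \<mu>'" for \<mu>' :: "(real \<Rightarrow> 'a) measure"
  proof -
    have "(\<lambda>w. w) \<in> measurable (path_space {0..}) ?PM"
      unfolding path_space_def by (rule measurable_restrict_space1) simp
    then show ?thesis by (simp add: measurable_cong_sets[OF wiener_measureD(2)[OF that] refl])
  qed
  have sp: "space \<mu> = space \<nu>" by (simp add: wiener_space \<mu> \<nu>)
  have cyl: "emeasure \<mu>1 {w \<in> space \<mu>1. \<forall>j\<in>J. w j \<in> A j} \<le> emeasure \<mu>2 {w \<in> space \<mu>2. \<forall>j\<in>J. w j \<in> A j}"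
    if \<mu>1: "wiener_measure \<mu>1" and \<mu>2: "wiener_measure \<mu>2" and J: "finite J" "J \<subseteq> {0..}"
      and A: "\<And>j. j \<in> J \<Longrightarrow> A j \<in> sets borel"
    for \<mu>1 \<mu>2 :: "(real \<Rightarrow> 'a) measure" and J A
  proof -
    \<comment> \<open>The time 1 is inserted to guarantee at least one cell: the product form of
      independence is used for a nonempty index set.\<close>
    have "finite (insert 1 J)" "insert 1 J \<subseteq> {0..}" using J by auto
    then obtain N p where p0: "\<forall>c. is_step (N, p, c)" and sub: "insert 1 J \<subseteq> p ` {..N}"
      using ex_grid[of "insert 1 J"] by auto
    have p: "is_step (N, p, \<lambda>_. 0)" using p0 by auto
    have N: "{..<N} \<noteq> {}"
    proof
      assume "{..<N} = {}"
      then have "N = 0" by auto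
      moreover have "p 0 = 0" using p by (simp add: is_step_def)
      ultimately show False using sub by auto
    qed
    let ?D = "\<lambda>k (w :: real \<Rightarrow> 'a). w (p (Suc k)) - w (p k)"
    let ?DM = "\<lambda>w. \<lambda>k\<in>{..<N}. ?D k w"
    let ?PN = "Pi\<^sub>M {..<N} (\<lambda>_. borel :: 'a measure)"
    \<comment> \<open>The cylinder event in terms of increments, whose partial sums are the values
      at grid times. The translation uses \<open>w 0 = 0\<close> and hence is valid up to a null
      set.\<close>
    define S where "S = {d \<in> space ?PN. \<forall>m\<in>{..N}. p m \<in> J \<longrightarrow> (\<Sum>k<m. d k) \<in> A (p m)}"
    have S: "S \<in> sets ?PN"
    proof -
      have "{d \<in> space ?PN. p m \<in> J \<longrightarrow> (\<Sum>k<m. d k) \<in> A (p m)} \<in> sets ?PN" if "m \<le> N" for m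
      proof (cases "p m \<in> J")
        case True
        have [measurable]: "(\<lambda>d. \<Sum>k<m. d k) \<in> borel_measurable ?PN"
          using that by (intro borel_measurable_sum measurable_component_singleton) auto
        have "(\<lambda>d. \<Sum>k<m. d k) -` A (p m) \<inter> space ?PN \<in> sets ?PN"
          using A[OF True] by (rule measurable_sets[rotated]) measurable
        also have "(\<lambda>d. \<Sum>k<m. d k) -` A (p m) \<inter> space ?PN = {d \<in> space ?PN. p m \<in> J \<longrightarrow> (\<Sum>k<m. d k) \<in> A (p m)}"
          using True by auto
        finally show ?thesis .
      qed simp
      then have "space ?PN \<inter> (\<Inter>m\<in>{..N}. {d \<in> space ?PN. p m \<in> J \<longrightarrow> (\<Sum>k<m. d k) \<in> A (p m)}) \<in> sets ?PN"
        by (intro sets.Int sets.top sets.finite_INT) auto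
      also have "space ?PN \<inter> (\<Inter>m\<in>{..N}. {d \<in> space ?PN. p m \<in> J \<longrightarrow> (\<Sum>k<m. d k) \<in> A (p m)}) = S"
        unfolding S_def by auto
      finally show ?thesis .
    qed
    have pk: "0 \<le> p k" "p k < p (Suc k)" if "k < N" for k
      using is_step_nonneg[OF p, of k] is_step_strict_mono[OF p, of k "Suc k"] that by auto
    have Dm: "?D k \<in> borel_measurable \<mu>'" if "k < N" "wiener_measure \<mu>'" for k \<mu>'
      using pk[OF that(1)] by (intro borel_measurable_diff wiener_component_measurable[OF that(2)]) auto
    have DMm: "?DM \<in> measurable \<mu>' ?PN" if "wiener_measure \<mu>'" for \<mu>'
      using Dm that by (intro measurable_restrict) auto
    have law: "distr \<mu>' ?PN ?DM = Pi\<^sub>M {..<N} (\<lambda>k. density lborel (\<lambda>x. ennreal (gauss (p (Suc k) - p k) x)))"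
      if w: "wiener_measure \<mu>'" for \<mu>'
    proof -
      interpret prob_space \<mu>' by (rule wiener_measureD(1)[OF w])
      have "indep_vars (\<lambda>_. borel) ?D {..<N}"
        using pk is_step_nonneg[OF p, of 0] by (intro wiener_measureD(5)[OF w]) (auto simp: less_imp_le)
      then have "distr \<mu>' ?PN ?DM = Pi\<^sub>M {..<N} (\<lambda>k. distr \<mu>' borel (?D k))"
        using Dm[OF _ w] by (subst (asm) indep_vars_iff_distr_eq_PiM'[OF N]) auto
      also have "\<dots> = Pi\<^sub>M {..<N} (\<lambda>k. density lborel (\<lambda>x. ennreal (gauss (p (Suc k) - p k) x)))"
      proof (rule PiM_cong[OF refl])
        fix k assume "k \<in> {..<N}"
        then have k: "k < N" by simp
        have "distr \<mu>' lborel (?D k) = density lborel (\<lambda>x. ennreal (gauss (p (Suc k) - p k) x))"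
          using wiener_measureD(4)[OF w pk[OF k]] by (rule distributed_distr_eq_density)
        also have "distr \<mu>' lborel (?D k) = distr \<mu>' borel (?D k)"
          by (rule distr_cong) auto
        finally show "distr \<mu>' borel (?D k) = density lborel (\<lambda>x. ennreal (gauss (p (Suc k) - p k) x))" .
      qed
      finally show ?thesis .
    qed
    have char: "w \<in> {w \<in> space \<mu>'. \<forall>j\<in>J. w j \<in> A j} \<longleftrightarrow> w \<in> ?DM -` S \<inter> space \<mu>'"
      if w: "wiener_measure \<mu>'" and w0: "w 0 = 0" for \<mu>' w
    proof -
      have "p 0 = 0" using p by (simp add: is_step_def)
      then have sum: "(\<Sum>k<m. ?DM w k) = w (p m)" if "m \<le> N" for m
      proof -
        have "(\<Sum>k<m. ?DM w k) = (\<Sum>k<m. ?D k w)" using that by (intro sum.cong) auto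
        also have "\<dots> = w (p m) - w (p 0)" by (rule sum_lessThan_telescope)
        finally show ?thesis using \<open>p 0 = 0\<close> w0 by simp
      qed
      have "(\<forall>j\<in>J. w j \<in> A j) \<longleftrightarrow> (\<forall>m\<in>{..N}. p m \<in> J \<longrightarrow> w (p m) \<in> A (p m))"
        using sub by blast
      moreover have "?DM w \<in> space ?PN" by (auto simp: space_PiM)
      moreover have "(\<Sum>k<m. ?D k w) = w (p m)" for m
        using sum_lessThan_telescope[of "\<lambda>i. w (p i)" m] \<open>p 0 = 0\<close> w0 by simp
      ultimately show ?thesis by (auto simp: S_def sum)
    qed
    have cylm: "{w \<in> space \<mu>'. \<forall>j\<in>J. w j \<in> A j} \<in> sets \<mu>'" if w: "wiener_measure \<mu>'" for \<mu>'
    proof -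
      have "{w \<in> space \<mu>'. w j \<in> A j} \<in> sets \<mu>'" if "j \<in> J" for j
      proof -
        have "(\<lambda>w. w j) \<in> borel_measurable \<mu>'"
          using J that by (intro wiener_component_measurable[OF w]) auto
        from measurable_sets[OF this A[OF that]] show ?thesis
          by (simp add: vimage_def Int_def conj_commute)
      qed
      then show ?thesis
        using J(1) by (intro sets.sets_Collect_finite_All) auto
    qed
    have em: "emeasure \<mu>' {w \<in> space \<mu>'. \<forall>j\<in>J. w j \<in> A j} = emeasure (distr \<mu>' ?PN ?DM) S"
      if w: "wiener_measure \<mu>'" for \<mu>'
    proof -
      have "emeasure \<mu>' {w \<in> space \<mu>'. \<forall>j\<in>J. w j \<in> A j} = emeasure \<mu>' (?DM -` S \<inter> space \<mu>')"
      proof (rule emeasure_eq_AE)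
        show "AE w in \<mu>'. w \<in> {w \<in> space \<mu>'. \<forall>j\<in>J. w j \<in> A j} \<longleftrightarrow> w \<in> ?DM -` S \<inter> space \<mu>'"
          using wiener_measureD(3)[OF w] by eventually_elim (rule char[OF w])
      qed (use cylm[OF w] measurable_sets[OF DMm[OF w] S] in auto)
      also have "\<dots> = emeasure (distr \<mu>' ?PN ?DM) S"
        by (rule emeasure_distr[OF DMm[OF w] S, symmetric])
      finally show ?thesis .
    qed
    show ?thesis unfolding em[OF \<mu>1] em[OF \<mu>2] law[OF \<mu>1] law[OF \<mu>2] by simp
  qed
  \<comment> \<open>Both laws are pushed to the full product space, where agreement on cylinders is
    sufficient. Events of the path space are traces of product events, which brings the equality
    back.\<close>
  have "distr \<mu> ?PM (\<lambda>w. w) = distr \<nu> ?PM (\<lambda>w. w)"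
  proof (rule measure_eqI_PiM_infinite)
    fix A :: "real \<Rightarrow> 'a set" and J
    assume J: "finite J" "J \<subseteq> {0..}" and A: "\<And>i. i \<in> J \<Longrightarrow> A i \<in> sets borel"
    have B: "prod_emb {0..} (\<lambda>_. borel) J (Pi\<^sub>E J A) \<in> sets ?PM"
      using J A by (intro sets_PiM_I) auto
    have eq: "(\<lambda>w. w) -` prod_emb {0..} (\<lambda>_. borel) J (Pi\<^sub>E J A) \<inter> space \<mu>' = {w \<in> space \<mu>'. \<forall>j\<in>J. w j \<in> A j}"
      if "wiener_measure \<mu>'" for \<mu>'
      using J by (auto simp: wiener_space[OF that] prod_emb_def PiE_def space_PiM Pi_iff)
    show "emeasure (distr \<mu> ?PM (\<lambda>w. w)) (prod_emb {0..} (\<lambda>_. borel) J (Pi\<^sub>E J A))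
        = emeasure (distr \<nu> ?PM (\<lambda>w. w)) (prod_emb {0..} (\<lambda>_. borel) J (Pi\<^sub>E J A))"
      unfolding emeasure_distr[OF idm[OF \<mu>] B] emeasure_distr[OF idm[OF \<nu>] B] eq[OF \<mu>] eq[OF \<nu>]
      by (intro antisym cyl \<mu> \<nu> J A)
  next
    interpret prob_space \<mu> by (rule wiener_measureD(1)[OF \<mu>])
    show "finite_measure (distr \<mu> ?PM (\<lambda>w. w))"
      using prob_space_distr[OF idm[OF \<mu>]] by (rule prob_space.finite_measure)
  qed simp_all
  note eq = this
  show ?thesis
  proof (rule measure_eqI)
    show "sets \<mu> = sets \<nu>" by (simp add: wiener_measureD(2)[OF \<mu>] wiener_measureD(2)[OF \<nu>])
    fix A assume "A \<in> sets \<mu>"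
    then obtain B where B: "B \<in> sets ?PM" "A = {w. continuous_on {0..} w} \<inter> B"
      by (auto simp: wiener_measureD(2)[OF \<mu>] path_space_def sets_restrict_space)
    have sub: "B \<subseteq> space ?PM" using sets.sets_into_space[OF B(1)] .
    have A: "A = (\<lambda>w. w) -` B \<inter> space \<mu>'" if "wiener_measure \<mu>'" for \<mu>'
      using sub by (auto simp: B(2) wiener_space[OF that] space_PiM PiE_def)
    have "emeasure \<mu> A = emeasure (distr \<mu> ?PM (\<lambda>w. w)) B"
      by (simp only: emeasure_distr[OF idm[OF \<mu>] B(1)] A[OF \<mu>, symmetric])
    moreover have "emeasure \<nu> A = emeasure (distr \<nu> ?PM (\<lambda>w. w)) B"
      by (simp only: emeasure_distr[OF idm[OF \<nu>] B(1)] A[OF \<nu>, symmetric])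
    ultimately show "emeasure \<mu> A = emeasure \<nu> A" by (simp add: eq)
  qed
qed

section \<open>The concatenated law\<close>

text \<open>By uniqueness, the Brownian motion behind \<open>B 1\<close> serves for all
  \<open>u\<close>. \<open>B u\<close> becomes the image of a fixed law under a map that depends
  explicitly on \<open>u\<close>.\<close>

lemma bridge_law_eq:
  assumes "\<And>u. 0 < u \<Longrightarrow> brownian_bridge_law u (B u)"
  shows "\<exists>\<mu>. wiener_measure \<mu> \<and> (\<forall>u>0. B u = distr \<mu> (path_space {0..u}) (bridge u))"
proof -
  obtain \<mu> where \<mu>: "wiener_measure \<mu>" "B 1 = distr \<mu> (path_space {0..1}) (bridge 1)"
    by (rule bridge_lawD[OF assms[of 1]]) auto
  have "B u = distr \<mu> (path_space {0..u}) (bridge u)" if u: "0 < u" for u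
  proof -
    obtain \<nu> where \<nu>: "wiener_measure \<nu>" "B u = distr \<nu> (path_space {0..u}) (bridge u)"
      by (rule bridge_lawD[OF assms[OF u] u])
    have "\<nu> = \<mu>" by (rule wiener_measure_unique[OF \<nu>(1) \<mu>(1)])
    with \<nu>(2) show ?thesis by simp
  qed
  with \<mu>(1) show ?thesis by auto
qed

text \<open>Evaluation at a random time is a limit of evaluations at the times
  \<open>\<lceil>(n + 1) * t\<rceil> / (n + 1)\<close>, each with countably many values. These times
  stay in \<open>{0..}\<close>, where the paths are continuous.\<close>

lemma measurable_eval:
  assumes t: "t \<in> borel_measurable M" and x: "x \<in> measurable M Omega"
    and pos: "\<And>\<omega>. \<omega> \<in> space M \<Longrightarrow> 0 \<le> t \<omega>"
  shows "(\<lambda>\<omega>. x \<omega> (t \<omega>) :: real) \<in> borel_measurable M"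
proof (rule borel_measurable_LIMSEQ_real)
  define r where "r n \<omega> = real (nat \<lceil>real (Suc n) * t \<omega>\<rceil>) / real (Suc n)" for n \<omega>
  show "(\<lambda>\<omega>. x \<omega> (r n \<omega>)) \<in> borel_measurable M" for n
  proof -
    have "(\<lambda>\<omega>. (\<lambda>i \<omega>. x \<omega> (real i / real (Suc n))) (nat \<lceil>real (Suc n) * t \<omega>\<rceil>) \<omega>) \<in> borel_measurable M"
    proof (rule measurable_compose_countable[where f = "\<lambda>i \<omega>. x \<omega> (real i / real (Suc n))"
        and g = "\<lambda>\<omega>. nat \<lceil>real (Suc n) * t \<omega>\<rceil>"])
      fix i
      have "(\<lambda>y. y (real i / real (Suc n))) \<in> borel_measurable Omega"
        by (intro measurable_path_space_component) auto
      from measurable_compose[OF x this]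
      show "(\<lambda>\<omega>. x \<omega> (real i / real (Suc n))) \<in> borel_measurable M" .
    next
      show "(\<lambda>\<omega>. nat \<lceil>real (Suc n) * t \<omega>\<rceil>) \<in> measurable M (count_space UNIV)"
        using t by measurable
    qed
    then show ?thesis by (simp add: r_def)
  qed
  fix \<omega> assume \<omega>: "\<omega> \<in> space M"
  have "continuous_on {0..} (x \<omega>)"
    using measurable_space[OF x \<omega>] by (simp add: space_path_space)
  moreover have "(\<lambda>n. r n \<omega>) \<longlonglongrightarrow> t \<omega>"
  proof (rule tendsto_sandwich)
    show "\<forall>\<^sub>F n in sequentially. t \<omega> \<le> r n \<omega>"
    proof (intro always_eventually allI)
      fix n
      have "real (Suc n) * t \<omega> \<le> real (nat \<lceil>real (Suc n) * t \<omega>\<rceil>)"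
        by (rule real_nat_ceiling_ge)
      then show "t \<omega> \<le> r n \<omega>" by (simp add: r_def pos_le_divide_eq mult.commute)
    qed
    show "\<forall>\<^sub>F n in sequentially. r n \<omega> \<le> t \<omega> + 1 / real (Suc n)"
    proof (intro always_eventually allI)
      fix n
      have "0 \<le> real (Suc n) * t \<omega>" using pos[OF \<omega>] by simp
      then have "real (nat \<lceil>real (Suc n) * t \<omega>\<rceil>) \<le> real (Suc n) * t \<omega> + 1"
        by linarith
      then have "r n \<omega> \<le> (real (Suc n) * t \<omega> + 1) / real (Suc n)"
        unfolding r_def by (intro divide_right_mono) auto
      also have "\<dots> = t \<omega> + 1 / real (Suc n)" by (simp add: add_divide_distrib)
      finally show "r n \<omega> \<le> t \<omega> + 1 / real (Suc n)" .
    qed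
    show "(\<lambda>n. t \<omega> + 1 / real (Suc n)) \<longlonglongrightarrow> t \<omega>"
      using tendsto_add[OF tendsto_const[of "t \<omega>"] LIMSEQ_inverse_real_of_nat]
      by (simp add: inverse_eq_divide)
  qed simp
  moreover have "t \<omega> \<in> {0..}" using pos[OF \<omega>] by simp
  ultimately show "(\<lambda>n. x \<omega> (r n \<omega>)) \<longlonglongrightarrow> x \<omega> (t \<omega>)"
    by (rule continuous_on_tendsto_compose) (auto simp: r_def)
qed

lemma continuous_on_concat_path:
  assumes "continuous_on {0..u} x" "continuous_on {0..} y" "0 \<le> u"
  shows "continuous_on {0..} (concat_path u x y)"
proof -
  have "continuous_on {0..} (\<lambda>t. x (min t u) + (if x u = y 0 then y (max (t - u) 0) - y 0 else 0))"
  proof (cases "x u = y 0")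
    case True
    have "continuous_on {0..} (\<lambda>t. x (min t u))"
      using assms(3) by (intro continuous_on_compose2[OF assms(1)] continuous_intros) auto
    moreover have "continuous_on {0..} (\<lambda>t. y (max (t - u) 0))"
      by (intro continuous_on_compose2[OF assms(2)] continuous_intros) auto
    ultimately show ?thesis using True by (auto intro!: continuous_intros)
  next
    case False
    then show ?thesis
      using assms(3) by (auto intro!: continuous_on_compose2[OF assms(1)] continuous_intros)
  qed
  then show ?thesis
    by (rule iffD1[OF continuous_on_cong[OF refl], rotated]) (use assms in \<open>auto simp: concat_path_eq\<close>)
qed

lemma measurable_concat_path:
  assumes "0 < u"
  shows "(\<lambda>(x, y). concat_path u x y) \<in> measurable (path_space {0..u} \<Otimes>\<^sub>M Omega) Omega"
proof (rule measurable_path_spaceI)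
  fix t :: real assume t: "t \<in> {0..}"
  have [measurable]: "(\<lambda>x. x (min t u)) \<in> borel_measurable (path_space {0..u})"
    "(\<lambda>x. x u) \<in> borel_measurable (path_space {0..u})"
    "(\<lambda>y. y (max (t - u) 0)) \<in> borel_measurable Omega" "(\<lambda>y. y 0) \<in> borel_measurable Omega"
    using t assms by (auto intro!: measurable_path_space_component)
  have "(\<lambda>p. (case p of (x, y) \<Rightarrow> concat_path u x y) t) =
      (\<lambda>(x, y). x (min t u) + (if x u = y 0 then y (max (t - u) 0) - y 0 else 0))"
    using t assms by (auto simp: concat_path_eq fun_eq_iff)
  also have "\<dots> \<in> borel_measurable (path_space {0..u} \<Otimes>\<^sub>M Omega)"
    by measurable
  finally show "(\<lambda>p. (case p of (x, y) \<Rightarrow> concat_path u x y) t) \<in> borel_measurable (path_space {0..u} \<Otimes>\<^sub>M Omega)" .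
next
  fix p :: "(real \<Rightarrow> real) \<times> (real \<Rightarrow> real)" assume "p \<in> space (path_space {0..u} \<Otimes>\<^sub>M Omega)"
  then show "continuous_on {0..} (case p of (x, y) \<Rightarrow> concat_path u x y)"
    using assms by (cases p) (auto simp: space_pair_measure space_path_space intro!: continuous_on_concat_path)
qed (auto simp: concat_path_def)

text \<open>The first piece is parametrized by the whole Brownian path \<open>w\<close>, since the
  space of bridge paths changes with \<open>u\<close> and could not serve as a factor of one
  product.\<close>

lemma measurable_concat_bridge:
  "(\<lambda>(u, w, y). concat_path u (bridge u w) y)
     \<in> measurable (restrict_space lborel {0<..} \<Otimes>\<^sub>M (Omega \<Otimes>\<^sub>M Omega)) Omega"
  (is "_ \<in> measurable ?M _")
proof (rule measurable_path_spaceI)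
  fix t :: real assume t: "t \<in> {0..}"
  have u: "fst \<in> borel_measurable ?M"
    by (rule measurable_compose[OF measurable_fst]) (auto intro!: measurable_restrict_space1)
  have w: "(\<lambda>p. fst (snd p)) \<in> measurable ?M Omega" and y: "(\<lambda>p. snd (snd p)) \<in> measurable ?M Omega"
    by measurable
  have pos: "0 < fst p" if "p \<in> space ?M" for p
    using that by (auto simp: space_pair_measure space_restrict_space)
  have [measurable]: "fst \<in> borel_measurable ?M" by (rule u)
  have 1 [measurable]: "(\<lambda>p. fst (snd p) (min t (fst p))) \<in> borel_measurable ?M"
    by (rule measurable_eval[OF _ w]) (use t pos in \<open>auto simp: less_imp_le\<close>)
  have 2 [measurable]: "(\<lambda>p. fst (snd p) (fst p)) \<in> borel_measurable ?M"
    by (rule measurable_eval[OF u w]) (use pos in \<open>auto simp: less_imp_le\<close>)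
  have 3 [measurable]: "(\<lambda>p. snd (snd p) (max (t - fst p) 0)) \<in> borel_measurable ?M"
    by (rule measurable_eval[OF _ y]) auto
  have 4 [measurable]: "(\<lambda>p. snd (snd p) 0) \<in> borel_measurable ?M"
    by (rule measurable_eval[OF _ y]) auto
  have "(\<lambda>p. (fst (snd p) (min t (fst p)) - min t (fst p) / fst p * fst (snd p) (fst p))
      + (if 0 = snd (snd p) 0 then snd (snd p) (max (t - fst p) 0) - snd (snd p) 0 else 0)) \<in> borel_measurable ?M"
    by measurable
  then show "(\<lambda>p. (case p of (u, w, y) \<Rightarrow> concat_path u (bridge u w) y) t) \<in> borel_measurable ?M"
  proof (rule measurable_cong[THEN iffD1, rotated])
    fix p assume p: "p \<in> space ?M"
    then show "(fst (snd p) (min t (fst p)) - min t (fst p) / fst p * fst (snd p) (fst p))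
      + (if 0 = snd (snd p) 0 then snd (snd p) (max (t - fst p) 0) - snd (snd p) 0 else 0) =
      (case p of (u, w, y) \<Rightarrow> concat_path u (bridge u w) y) t"
      using t pos[OF p] by (cases p) (simp add: concat_path_eq bridge_def)
  qed
next
  fix p assume p: "p \<in> space ?M"
  obtain u w y where [simp]: "p = (u, w, y)" by (cases p)
  have "0 < u" "w \<in> space Omega" "y \<in> space Omega"
    using p by (auto simp: space_pair_measure space_restrict_space)
  then show "continuous_on {0..} (case p of (u, w, y) \<Rightarrow> concat_path u (bridge u w) y)"
    using measurable_space[OF measurable_bridge, of u w]
    by (auto simp: space_path_space intro!: continuous_on_concat_path)
  show "(case p of (u, w, y) \<Rightarrow> concat_path u (bridge u w) y) \<in> extensional {0..}"
    by (simp add: concat_path_def)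
qed

text \<open>All concatenated laws are images of the single product
  \<open>\<mu> \<Otimes>\<^sub>M R\<close> under the jointly measurable map of
  \<open>measurable_concat_bridge\<close>. The kernel property is what allows the monadic bind in
  \<open>W_measure\<close> to be computed as an integral over \<open>u\<close>.\<close>

lemma concat_law_kernel:
  assumes bridge: "\<And>u. 0 < u \<Longrightarrow> brownian_bridge_law u (B u)"
    and R: "prob_space R" "sets R = sets Omega"
  shows "(\<lambda>u. concat_law u (B u) R) \<in> measurable (restrict_space lborel {0<..}) (subprob_algebra Omega)"
proof -
  obtain \<mu> where \<mu>: "wiener_measure \<mu>" and B: "\<And>u. 0 < u \<Longrightarrow> B u = distr \<mu> (path_space {0..u}) (bridge u)"
    using bridge_law_eq[OF bridge] by auto
  interpret \<mu>: prob_space \<mu> by (rule wiener_measureD(1)[OF \<mu>])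
  interpret R: prob_space R by (rule R)
  interpret P: pair_prob_space \<mu> R ..
  have s\<mu>: "sets \<mu> = sets Omega" by (rule wiener_measureD(2)[OF \<mu>])
  have sP: "sets (\<mu> \<Otimes>\<^sub>M R) = sets (Omega \<Otimes>\<^sub>M Omega)"
    by (rule sets_pair_measure_cong[OF s\<mu> R(2)])
  have "(\<lambda>u. distr (\<mu> \<Otimes>\<^sub>M R) Omega ((\<lambda>u (w, y). concat_path u (bridge u w) y) u))
      \<in> measurable (restrict_space lborel {0<..}) (subprob_algebra Omega)"
  proof (rule measurable_distr2)
    show "(\<lambda>(u, p). (\<lambda>u (w, y). concat_path u (bridge u w) y) u p)
        \<in> measurable (restrict_space lborel {0<..} \<Otimes>\<^sub>M (Omega \<Otimes>\<^sub>M Omega)) Omega"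
      using measurable_concat_bridge by (simp add: case_prod_beta')
    show "(\<lambda>u. \<mu> \<Otimes>\<^sub>M R) \<in> measurable (restrict_space lborel {0<..}) (subprob_algebra (Omega \<Otimes>\<^sub>M Omega))"
      using P.subprob_space_axioms sP by (intro measurable_const) (simp add: space_subprob_algebra)
  qed
  then show ?thesis
  proof (rule measurable_cong[THEN iffD1, rotated])
    fix u :: real assume "u \<in> space (restrict_space lborel {0<..})"
    then have u: "0 < u" by (simp add: space_restrict_space)
    have br: "bridge u \<in> measurable \<mu> (path_space {0..u})"
      using measurable_bridge[OF u] by (simp add: measurable_cong_sets[OF s\<mu> refl])
    have idR: "distr R Omega (\<lambda>y. y) = R"
      by (rule distr_id2) (simp add: R(2))
    have idm: "(\<lambda>y. y) \<in> measurable R Omega" by (simp add: measurable_cong_sets[OF R(2) refl])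
    have cm: "(\<lambda>(x, y). concat_path u x y) \<in> measurable (path_space {0..u} \<Otimes>\<^sub>M Omega) Omega"
      by (rule measurable_concat_path[OF u])
    have "B u \<Otimes>\<^sub>M R = distr \<mu> (path_space {0..u}) (bridge u) \<Otimes>\<^sub>M distr R Omega (\<lambda>y. y)"
      by (simp add: B[OF u] idR)
    also have "\<dots> = distr (\<mu> \<Otimes>\<^sub>M R) (path_space {0..u} \<Otimes>\<^sub>M Omega) (\<lambda>(x, y). (bridge u x, y))"
      by (rule pair_measure_distr[OF br idm])
        (unfold idR, rule R.sigma_finite_measure_axioms)
    finally have "concat_law u (B u) R = distr (distr (\<mu> \<Otimes>\<^sub>M R) (path_space {0..u} \<Otimes>\<^sub>M Omega) (\<lambda>(x, y). (bridge u x, y))) Omega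
        (\<lambda>(x, y). concat_path u x y)"
      by (simp add: concat_law_def)
    also have "\<dots> = distr (\<mu> \<Otimes>\<^sub>M R) Omega ((\<lambda>(x, y). concat_path u x y) \<circ> (\<lambda>(x, y). (bridge u x, y)))"
    proof (rule distr_distr[OF cm])
      have [measurable]: "bridge u \<in> measurable \<mu> (path_space {0..u})" "(\<lambda>y. y) \<in> measurable R Omega"
        by (rule br, rule idm)
      show "(\<lambda>(x, y). (bridge u x, y)) \<in> measurable (\<mu> \<Otimes>\<^sub>M R) (path_space {0..u} \<Otimes>\<^sub>M Omega)"
        unfolding case_prod_beta'
        by (intro measurable_Pair measurable_compose[OF measurable_fst br] measurable_compose[OF measurable_snd idm])
    qed
    also have "(\<lambda>(x, y). concat_path u x y) \<circ> (\<lambda>(x, y). (bridge u x, y)) = (\<lambda>(w, y). concat_path u (bridge u w) y)"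
      by auto
    finally show "distr (\<mu> \<Otimes>\<^sub>M R) Omega ((\<lambda>u (w, y). concat_path u (bridge u w) y) u) = concat_law u (B u) R"
      by simp
  qed
qed

lemma concat_law_basic:
  assumes "brownian_bridge_law u P" "0 < u" and R: "prob_space R" "sets R = sets Omega"
  shows "prob_space (concat_law u P R)" "sets (concat_law u P R) = sets Omega"
    "space (concat_law u P R) = space Omega"
    "(\<lambda>(x, y). concat_path u x y) \<in> measurable (P \<Otimes>\<^sub>M R) Omega"
proof -
  note P = bridge_law_basic[OF assms(1,2)]
  interpret P: prob_space P by (rule P)
  interpret R: prob_space R by (rule R)
  interpret PR: pair_prob_space P R ..
  have "sets (P \<Otimes>\<^sub>M R) = sets (path_space {0..u} \<Otimes>\<^sub>M Omega)"
    by (rule sets_pair_measure_cong[OF P(2) R(2)])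
  then show m: "(\<lambda>(x, y). concat_path u x y) \<in> measurable (P \<Otimes>\<^sub>M R) Omega"
    using measurable_concat_path[OF assms(2)] by (subst measurable_cong_sets[OF _ refl])
  show "prob_space (concat_law u P R)"
    unfolding concat_law_def by (rule PR.prob_space_distr[OF m])
  show "sets (concat_law u P R) = sets Omega" "space (concat_law u P R) = space Omega"
    by (simp_all add: concat_law_def)
qed

lemma AE_pair_components:
  assumes "prob_space P" "prob_space R" "AE x in P. p x" "AE y in R. q y"
  shows "AE (x, y) in P \<Otimes>\<^sub>M R. p x \<and> q y"
proof -
  interpret P: prob_space P by fact
  interpret R: prob_space R by fact
  interpret PR: pair_prob_space P R ..
  have snd: "distr (P \<Otimes>\<^sub>M R) R snd = R"
  proof (rule measure_eqI)
    fix A assume "A \<in> sets (distr (P \<Otimes>\<^sub>M R) R snd)"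
    then have A: "A \<in> sets R" by simp
    have "snd -` A \<inter> space (P \<Otimes>\<^sub>M R) = space P \<times> A"
      using sets.sets_into_space[OF A] by (auto simp: space_pair_measure)
    then show "emeasure (distr (P \<Otimes>\<^sub>M R) R snd) A = emeasure R A"
      using A by (simp add: emeasure_distr R.emeasure_pair_measure_Times P.emeasure_space_1)
  qed simp
  have "AE z in P \<Otimes>\<^sub>M R. p (fst z)"
    by (rule AE_distrD[OF measurable_fst]) (simp only: R.distr_pair_fst assms(3))
  moreover have "AE z in P \<Otimes>\<^sub>M R. q (snd z)"
    by (rule AE_distrD[OF measurable_snd]) (simp only: snd assms(4))
  ultimately show ?thesis
    by eventually_elim auto
qed

text \<open>An almost sure property of a concatenation is reduced to almost sure properties of its
  two pieces, and the matching condition \<open>x u = 0 = y 0\<close> may be assumed, so the default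
  branch of \<open>concat_path\<close> never occurs.\<close>

lemma AE_concat_lawI:
  assumes law: "brownian_bridge_law u P" "0 < u" and R: "prob_space R" "sets R = sets Omega" "AE y in R. y 0 = 0"
    and Q: "{X \<in> space Omega. Q X} \<in> sets Omega"
    and AE: "AE x in P. p x" "AE y in R. q y"
    and imp: "\<And>x y. x \<in> space (path_space {0..u}) \<Longrightarrow> y \<in> space Omega \<Longrightarrow> x u = 0 \<Longrightarrow> y 0 = 0 \<Longrightarrow> p x \<Longrightarrow> q y
      \<Longrightarrow> concat_path u x y \<in> space Omega \<Longrightarrow> Q (concat_path u x y)"
  shows "AE X in concat_law u P R. Q X"
proof -
  note P = bridge_law_basic[OF law]
  note m = concat_law_basic(4)[OF law R(1,2)]
  have "AE x in P. p x \<and> x u = 0" using AE(1) P(4) by auto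
  moreover have "AE y in R. q y \<and> y 0 = 0" using AE(2) R(3) by auto
  ultimately have "AE (x, y) in P \<Otimes>\<^sub>M R. (p x \<and> x u = 0) \<and> (q y \<and> y 0 = 0)"
    by (rule AE_pair_components[OF P(1) R(1)])
  then have "AE z in P \<Otimes>\<^sub>M R. Q ((\<lambda>(x, y). concat_path u x y) z)"
    using AE_space
  proof eventually_elim
    fix z assume z: "case z of (x, y) \<Rightarrow> (p x \<and> x u = 0) \<and> (q y \<and> y 0 = 0)" "z \<in> space (P \<Otimes>\<^sub>M R)"
    then show "Q ((\<lambda>(x, y). concat_path u x y) z)"
      using imp[of "fst z" "snd z"] measurable_space[OF m z(2)] P(3) sets_eq_imp_space_eq[OF R(2)]
      by (auto simp: space_pair_measure)
  qed
  then show ?thesis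
    unfolding concat_law_def using Q by (subst AE_distr_iff[OF m]) auto
qed

section \<open>Convergence in measure and Borel-Cantelli arguments\<close>

lemma AE_tendsto_imp_emeasure_tendsto:
  fixes f :: "nat \<Rightarrow> 'a \<Rightarrow> real"
  assumes [measurable]: "\<And>n. f n \<in> borel_measurable M" "g \<in> borel_measurable M" "A \<in> sets M"
    and fin: "emeasure M A < \<infinity>"
    and lim: "AE x in M. x \<in> A \<longrightarrow> (\<lambda>n. f n x) \<longlonglongrightarrow> g x" and "0 < e"
  shows "(\<lambda>n. emeasure M (A \<inter> {x \<in> space M. e \<le> \<bar>f n x - g x\<bar>})) \<longlonglongrightarrow> 0"
proof -
  let ?E = "\<lambda>n. A \<inter> {x \<in> space M. e \<le> \<bar>f n x - g x\<bar>}"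
  have "(\<lambda>n. \<integral>\<^sup>+x. indicator (?E n) x \<partial>M) \<longlonglongrightarrow> (\<integral>\<^sup>+x. 0 \<partial>M)"
  proof (rule nn_integral_dominated_convergence[where w = "indicator A"])
    show "(\<integral>\<^sup>+x. indicator A x \<partial>M) < \<infinity>" using fin by simp
    show "AE x in M. (\<lambda>n. indicator (?E n) x :: ennreal) \<longlonglongrightarrow> 0"
      using lim
    proof eventually_elim
      fix x assume *: "x \<in> A \<longrightarrow> (\<lambda>n. f n x) \<longlonglongrightarrow> g x"
      show "(\<lambda>n. indicator (?E n) x :: ennreal) \<longlonglongrightarrow> 0"
      proof (cases "x \<in> A")
        case True
        with * have "(\<lambda>n. f n x) \<longlonglongrightarrow> g x" by simp
        from tendstoD[OF this \<open>0 < e\<close>]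
        have "\<forall>\<^sub>F n in sequentially. indicator (?E n) x = (0 :: ennreal)"
          by eventually_elim (auto simp: dist_real_def)
        then show ?thesis by (rule tendsto_eventually)
      qed simp
    qed
  qed (auto simp: indicator_def)
  then show ?thesis by simp
qed

lemma emeasure_limit_unique:
  fixes f :: "nat \<Rightarrow> 'a \<Rightarrow> real"
  assumes [measurable]: "\<And>n. f n \<in> borel_measurable M" "g \<in> borel_measurable M" "g' \<in> borel_measurable M" "A \<in> sets M"
    and 1: "\<And>e. 0 < e \<Longrightarrow> (\<lambda>n. emeasure M (A \<inter> {x \<in> space M. e \<le> \<bar>f n x - g x\<bar>})) \<longlonglongrightarrow> 0"
    and 2: "\<And>e. 0 < e \<Longrightarrow> (\<lambda>n. emeasure M (A \<inter> {x \<in> space M. e \<le> \<bar>f n x - g' x\<bar>})) \<longlonglongrightarrow> 0"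
  shows "AE x in M. x \<in> A \<longrightarrow> g x = g' x"
proof -
  have "emeasure M (A \<inter> {x \<in> space M. 1 / real (Suc k) \<le> \<bar>g x - g' x\<bar>}) = 0" for k
  proof -
    define e where "e = 1 / real (Suc k) / 2"
    have e: "0 < e" by (simp add: e_def)
    have "(\<lambda>n. emeasure M (A \<inter> {x \<in> space M. e \<le> \<bar>f n x - g x\<bar>}) + emeasure M (A \<inter> {x \<in> space M. e \<le> \<bar>f n x - g' x\<bar>}))
        \<longlonglongrightarrow> 0 + 0"
      by (intro tendsto_add 1 2 e)
    moreover have "emeasure M (A \<inter> {x \<in> space M. 1 / real (Suc k) \<le> \<bar>g x - g' x\<bar>})
        \<le> emeasure M (A \<inter> {x \<in> space M. e \<le> \<bar>f n x - g x\<bar>}) + emeasure M (A \<inter> {x \<in> space M. e \<le> \<bar>f n x - g' x\<bar>})" for n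
    proof -
      have "emeasure M (A \<inter> {x \<in> space M. 1 / real (Suc k) \<le> \<bar>g x - g' x\<bar>}) \<le>
          emeasure M ((A \<inter> {x \<in> space M. e \<le> \<bar>f n x - g x\<bar>}) \<union> (A \<inter> {x \<in> space M. e \<le> \<bar>f n x - g' x\<bar>}))"
      proof (rule emeasure_mono)
        have "e + e = 1 / real (Suc k)" unfolding e_def by (rule field_sum_of_halves)
        then show "A \<inter> {x \<in> space M. 1 / real (Suc k) \<le> \<bar>g x - g' x\<bar>} \<subseteq>
          (A \<inter> {x \<in> space M. e \<le> \<bar>f n x - g x\<bar>}) \<union> (A \<inter> {x \<in> space M. e \<le> \<bar>f n x - g' x\<bar>})"
          by (intro subsetI) (simp, linarith)
      qed measurable
      also have "\<dots> \<le> emeasure M (A \<inter> {x \<in> space M. e \<le> \<bar>f n x - g x\<bar>}) + emeasure M (A \<inter> {x \<in> space M. e \<le> \<bar>f n x - g' x\<bar>})"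
        by (rule emeasure_subadditive) measurable
      finally show ?thesis .
    qed
    ultimately have "emeasure M (A \<inter> {x \<in> space M. 1 / real (Suc k) \<le> \<bar>g x - g' x\<bar>}) \<le> 0 + 0"
      by (intro LIMSEQ_le_const) auto
    then show ?thesis by simp
  qed
  then have "AE x in M. x \<notin> A \<inter> {x \<in> space M. 1 / real (Suc k) \<le> \<bar>g x - g' x\<bar>}" for k
    by (intro AE_not_in) (auto simp: null_sets_def)
  then have "AE x in M. \<forall>k. x \<notin> A \<inter> {x \<in> space M. 1 / real (Suc k) \<le> \<bar>g x - g' x\<bar>}"
    by (subst AE_all_countable) auto
  then show ?thesis
    using AE_space
  proof eventually_elim
    fix x assume x: "\<forall>k. x \<notin> A \<inter> {x \<in> space M. 1 / real (Suc k) \<le> \<bar>g x - g' x\<bar>}" "x \<in> space M"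
    show "x \<in> A \<longrightarrow> g x = g' x"
    proof (intro impI, rule ccontr)
      assume "x \<in> A" "g x \<noteq> g' x"
      then have "0 < \<bar>g x - g' x\<bar>" by simp
      then obtain k where "inverse (real (Suc k)) < \<bar>g x - g' x\<bar>" using reals_Archimedean by blast
      then have "1 / real (Suc k) \<le> \<bar>g x - g' x\<bar>" by (simp add: inverse_eq_divide)
      with x \<open>x \<in> A\<close> show False by auto
    qed
  qed
qed

lemma AE_eventually_notin:
  assumes E: "\<And>n. E n \<in> sets M" and b: "\<And>n. emeasure M (E n) \<le> b n" and fin: "(\<Sum>n. b n) < \<infinity>"
  shows "AE x in M. \<forall>\<^sub>F n in sequentially. x \<notin> E n"
proof -
  have sum_fin: "(\<Sum>n. emeasure M (E n)) < \<infinity>"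
    using fin suminf_le[of "\<lambda>n. emeasure M (E n)" b] b by (auto intro: le_less_trans)
  have f: "emeasure M (E n) < \<infinity>" for n
  proof -
    have "emeasure M (E n) \<le> (\<Sum>n. emeasure M (E n))"
      using sum_le_suminf[of "\<lambda>n. emeasure M (E n)" "{n}"] by simp
    then show ?thesis using sum_fin by (rule le_less_trans)
  qed
  have eq: "emeasure M (E n) = ennreal (measure M (E n))" for n
    using f[of n] by (simp add: emeasure_eq_ennreal_measure)
  have "summable (\<lambda>n. measure M (E n))"
    using sum_fin unfolding eq by (intro summable_suminf_not_top) auto
  then have "AE x in M. eventually (\<lambda>n. x \<in> space M - E n) sequentially"
    using E f by (intro borel_cantelli_AE1) auto
  then show ?thesis
    by eventually_elim (auto elim: eventually_mono)
qed

text \<open>A countable set of times is an increasing union of finite ones. Continuity from below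
  transfers a bound that is uniform over finite sets of times, which is the form of the maximal
  inequalities.\<close>

lemma emeasure_countable_ex_le:
  assumes Q: "countable Q" "Q \<noteq> {}"
    and m: "\<And>t. t \<in> Q \<Longrightarrow> {x \<in> space M. p t x} \<in> sets M"
    and b: "\<And>F. finite F \<Longrightarrow> F \<subseteq> Q \<Longrightarrow> emeasure M {x \<in> space M. \<exists>t\<in>F. p t x} \<le> b"
  shows "{x \<in> space M. \<exists>t\<in>Q. p t x} \<in> sets M" "emeasure M {x \<in> space M. \<exists>t\<in>Q. p t x} \<le> b"
proof -
  define F where "F n = from_nat_into Q ` {..n}" for n :: nat
  have F: "finite (F n)" "F n \<subseteq> Q" for n
    using from_nat_into[OF Q(2)] by (auto simp: F_def)
  let ?A = "\<lambda>n. {x \<in> space M. \<exists>t\<in>F n. p t x}"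
  have A: "?A n \<in> sets M" for n
  proof -
    have "?A n = (\<Union>t\<in>F n. {x \<in> space M. p t x})" by auto
    then show ?thesis using F[of n] m by (auto intro!: sets.finite_UN)
  qed
  have eq: "{x \<in> space M. \<exists>t\<in>Q. p t x} = (\<Union>n. ?A n)"
  proof -
    have ex: "\<exists>n. t \<in> F n" if t: "t \<in> Q" for t
    proof -
      obtain i where "from_nat_into Q i = t" using from_nat_into_surj[OF Q(1) t] by blast
      then have "t \<in> F i" by (auto simp: F_def)
      then show ?thesis by blast
    qed
    show ?thesis
    proof (intro set_eqI iffI)
      fix x assume "x \<in> {x \<in> space M. \<exists>t\<in>Q. p t x}"
      then obtain t where t: "x \<in> space M" "t \<in> Q" "p t x" by auto
      moreover obtain n where "t \<in> F n" using ex[OF t(2)] by auto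
      ultimately have "x \<in> ?A n" by auto
      then show "x \<in> (\<Union>n. ?A n)" by (rule UN_I[OF UNIV_I])
    next
      fix x assume "x \<in> (\<Union>n. ?A n)"
      then obtain n where "x \<in> ?A n" by (elim UN_E)
      then obtain t where "x \<in> space M" "t \<in> F n" "p t x" by auto
      then show "x \<in> {x \<in> space M. \<exists>t\<in>Q. p t x}" using F(2)[of n] by auto
    qed
  qed
  show "{x \<in> space M. \<exists>t\<in>Q. p t x} \<in> sets M" unfolding eq using A by auto
  have "incseq ?A" by (auto simp: incseq_def F_def)
  then have "(SUP n. emeasure M (?A n)) = emeasure M (\<Union>n. ?A n)"
    using A by (intro SUP_emeasure_incseq) auto
  moreover have "(SUP n. emeasure M (?A n)) \<le> b"
    using b[OF F] by (intro SUP_least)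
  ultimately show "emeasure M {x \<in> space M. \<exists>t\<in>Q. p t x} \<le> b" by (simp add: eq)
qed

lemma convergent_of_geometric_increments:
  fixes s :: "nat \<Rightarrow> real"
  assumes "\<forall>\<^sub>F n in sequentially. \<bar>s (Suc n) - s n\<bar> \<le> (1 / 2) ^ n"
  shows "convergent s"
proof -
  have "summable (\<lambda>n. s (Suc n) - s n)"
    by (rule summable_comparison_test_ev[of _ "\<lambda>n. (1 / 2) ^ n"])
      (use assms in \<open>auto intro: summable_geometric\<close>)
  then have "convergent (\<lambda>n. \<Sum>i<n. s (Suc i) - s i)"
    using summable_iff_convergent by blast
  then have "convergent (\<lambda>n. s n - s 0)"
    by (simp add: sum_lessThan_telescope)
  then show ?thesis
    using convergent_add_const_right_iff[of s "- s 0"] by simp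
qed

section \<open>Elementary inequalities for the two norms, and the maximal inequality for
  concatenations\<close>

lemma L2n_cong_AE: "(AE s in lborel. 0 \<le> s \<longrightarrow> f s = g s) \<Longrightarrow> L2n f = L2n g"
  unfolding L2n_def by (intro nn_integral_cong_AE) (auto simp: indicator_def)

lemma L2n_diff_le:
  assumes [measurable]: "f \<in> borel_measurable borel" "g \<in> borel_measurable borel"
  shows "L2n (\<lambda>s. f s - g s) \<le> 2 * L2n f + 2 * L2n g"
proof -
  have "L2n (\<lambda>s. f s - g s) \<le> (\<integral>\<^sup>+s. 2 * (ennreal ((f s)\<^sup>2) * indicator {0..} s) + 2 * (ennreal ((g s)\<^sup>2) * indicator {0..} s) \<partial>lborel)"
    unfolding L2n_def
  proof (rule nn_integral_mono)
    fix s
    have "(f s - g s)\<^sup>2 \<le> 2 * (f s)\<^sup>2 + 2 * (g s)\<^sup>2"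
      using zero_le_power2[of "f s + g s"] by (simp add: power2_sum power2_diff)
    then have "ennreal ((f s - g s)\<^sup>2) \<le> ennreal (2 * (f s)\<^sup>2 + 2 * (g s)\<^sup>2)"
      by (rule ennreal_leI)
    also have "\<dots> = 2 * ennreal ((f s)\<^sup>2) + 2 * ennreal ((g s)\<^sup>2)"
      by (simp add: ennreal_plus ennreal_mult)
    finally have "ennreal ((f s - g s)\<^sup>2) \<le> 2 * ennreal ((f s)\<^sup>2) + 2 * ennreal ((g s)\<^sup>2)" .
    then show "ennreal ((f s - g s)\<^sup>2) * indicator {0..} s \<le>
        2 * (ennreal ((f s)\<^sup>2) * indicator {0..} s) + 2 * (ennreal ((g s)\<^sup>2) * indicator {0..} s)"
      by (cases "0 \<le> s") auto
  qed
  also have "\<dots> = 2 * L2n f + 2 * L2n g"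
    unfolding L2n_def by (simp add: nn_integral_add nn_integral_cmult)
  finally show ?thesis .
qed

lemma L1n_diff_le:
  assumes [measurable]: "f \<in> borel_measurable borel" "g \<in> borel_measurable borel" "\<rho> \<in> borel_measurable borel"
    and \<rho>: "\<And>s. 0 \<le> s \<Longrightarrow> 0 \<le> \<rho> s"
  shows "L1n \<rho> (\<lambda>s. f s - g s) \<le> L1n \<rho> f + L1n \<rho> g"
proof -
  have "L1n \<rho> (\<lambda>s. f s - g s) \<le> (\<integral>\<^sup>+s. ennreal (\<bar>f s\<bar> * \<rho> s) * indicator {0..} s + ennreal (\<bar>g s\<bar> * \<rho> s) * indicator {0..} s \<partial>lborel)"
    unfolding L1n_def
  proof (rule nn_integral_mono)
    fix s
    show "ennreal (\<bar>f s - g s\<bar> * \<rho> s) * indicator {0..} s \<le>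
        ennreal (\<bar>f s\<bar> * \<rho> s) * indicator {0..} s + ennreal (\<bar>g s\<bar> * \<rho> s) * indicator {0..} s"
    proof (cases "0 \<le> s")
      case True
      have "\<bar>f s - g s\<bar> * \<rho> s \<le> (\<bar>f s\<bar> + \<bar>g s\<bar>) * \<rho> s"
        using \<rho>[OF True] by (intro mult_right_mono) auto
      then show ?thesis
        using True \<rho>[OF True] by (simp add: ennreal_plus[symmetric] distrib_right ennreal_leI del: ennreal_plus)
    qed simp
  qed
  also have "\<dots> = L1n \<rho> f + L1n \<rho> g"
    unfolding L1n_def by (simp add: nn_integral_add)
  finally show ?thesis .
qed

lemma L2n_shift_le:
  assumes [measurable]: "g \<in> borel_measurable borel" and "0 \<le> u"
    and \<xi>: "\<And>s. \<xi> s = indicator {0..} s * g (s + u)"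
  shows "L2n \<xi> \<le> L2n g"
proof -
  have "L2n \<xi> = (\<integral>\<^sup>+s. ennreal ((g (u + 1 * s))\<^sup>2) * indicator {u..} (u + 1 * s) \<partial>lborel)"
    unfolding L2n_def \<xi> by (intro nn_integral_cong) (auto simp: indicator_def add.commute)
  also have "\<dots> = (\<integral>\<^sup>+v. ennreal ((g v)\<^sup>2) * indicator {u..} v \<partial>lborel)"
    by (subst nn_integral_real_affine[where c = 1 and t = u]) auto
  also have "\<dots> \<le> L2n g"
    unfolding L2n_def using \<open>0 \<le> u\<close> by (intro nn_integral_mono) (auto simp: indicator_def)
  finally show ?thesis .
qed

text \<open>If the integral along the concatenation reaches \<open>l\<close>, one of its two pieces
  reaches \<open>l / 2\<close>; a time \<open>t\<close> becomes \<open>min t u\<close> for the first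
  and \<open>max (t - u) 0\<close> for the second. The Bessel piece sees the integrand shifted by
  \<open>u\<close>, whence the shifted \<open>L1\<close> norm, while the shifted \<open>L2\<close>
  norm is dominated by the full one. \<open>K\<close> is uniform in \<open>u\<close>, as the later
  integration over \<open>u\<close> requires.\<close>

lemma concat_maximal:
  assumes "bessel3_law Rp"
  obtains K where "0 \<le> K"
    "\<And>u P \<sigma> Q l. brownian_bridge_law u P \<Longrightarrow> 0 < u \<Longrightarrow> is_step \<sigma> \<Longrightarrow> finite Q \<Longrightarrow> Q \<subseteq> {0..} \<Longrightarrow> 0 < l \<Longrightarrow>
      emeasure (concat_law u P (symmetrize Rp)) {X \<in> space Omega. \<exists>t\<in>Q. l \<le> \<bar>step_integral \<sigma> (stopped t X)\<bar>}
      \<le> ennreal (K / l\<^sup>2) * L2n (step_fun \<sigma>) + ennreal (K / l) * L1n (\<lambda>s. 1 / sqrt s) (\<lambda>s. step_fun \<sigma> (s + u))"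
proof -
  obtain K where K: "0 \<le> K" and max: "\<And>\<sigma> Q l. is_step \<sigma> \<Longrightarrow> finite Q \<Longrightarrow> Q \<subseteq> {0..} \<Longrightarrow> 0 < l \<Longrightarrow>
    emeasure (symmetrize Rp) {y \<in> space Omega. \<exists>t\<in>Q. l \<le> \<bar>step_integral \<sigma> (stopped t y)\<bar>}
      \<le> ennreal (K / l\<^sup>2) * L2n (step_fun \<sigma>) + ennreal (K / l) * L1n (\<lambda>s. 1 / sqrt s) (step_fun \<sigma>)"
    by (rule symmetrized_bessel_maximal[OF assms]) blast
  note Rp = bessel3_law_basic(1,2)[OF assms]
  define R where "R = symmetrize Rp"
  have R: "prob_space R" "sets R = sets Omega" "space R = space Omega" "AE y in R. y 0 = 0"
    unfolding R_def using symmetrize_emeasure[OF Rp] symmetrized_bessel_start[OF assms] by auto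
  interpret R: prob_space R by (rule R)
  \<comment> \<open>The factor 4 comes from applying \<open>bridge_maximal\<close> at level
    \<open>l / 2\<close>.\<close>
  define c where "c = 4 * (68 * wconst 1)"
  have c: "0 \<le> c" using wconst_pos[of 1] by (simp add: c_def)
  show ?thesis
  proof (rule that[of "c + 4 * K"])
    show "0 \<le> c + 4 * K" using c K by simp
    fix u P \<sigma> and Q :: "real set" and l :: real
    assume law: "brownian_bridge_law u P" "0 < u" and \<sigma>: "is_step \<sigma>"
      and Q: "finite Q" "Q \<subseteq> {0..}" and l: "0 < l"
    note P = bridge_law_basic[OF law]
    interpret P: prob_space P by (rule P)
    interpret PR: pair_prob_space P R ..
    note m = concat_law_basic(4)[OF law R(1,2)]
    obtain \<xi> where \<xi>: "is_step \<xi>" "\<And>s. step_fun \<xi> s = indicator {0..} s * step_fun \<sigma> (s + u)"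
      "\<And>Y. step_integral \<xi> Y = step_integral \<sigma> (\<lambda>b. Y (max (b - u) 0))"
      using step_shift[OF \<sigma>, of u] law(2) by (metis less_imp_le)
    let ?Q1 = "(\<lambda>t. min t u) ` Q" and ?Q2 = "(\<lambda>t. max (t - u) 0) ` Q"
    let ?E = "{X \<in> space Omega. \<exists>t\<in>Q. l \<le> \<bar>step_integral \<sigma> (stopped t X)\<bar>}"
    let ?F = "{x \<in> space (path_space {0..u}). \<exists>t\<in>?Q1. l / 2 \<le> \<bar>step_integral \<sigma> (stopped t x)\<bar>}"
    let ?G = "{y \<in> space Omega. \<exists>t\<in>?Q2. l / 2 \<le> \<bar>step_integral \<xi> (stopped t y)\<bar>}"
    have E: "?E \<in> sets Omega" using Q by (intro step_event_sets \<sigma>) auto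
    have F: "?F \<in> sets P" unfolding P(2) using Q law(2) by (intro step_event_sets \<sigma>) auto
    have G: "?G \<in> sets R" unfolding R(2) using Q by (intro step_event_sets \<xi>) auto
    have "emeasure (concat_law u P R) ?E = emeasure (P \<Otimes>\<^sub>M R) ((\<lambda>(x, y). concat_path u x y) -` ?E \<inter> space (P \<Otimes>\<^sub>M R))"
      unfolding concat_law_def by (rule emeasure_distr[OF m E])
    also have "\<dots> \<le> emeasure (P \<Otimes>\<^sub>M R) (?F \<times> space R \<union> space P \<times> ?G)"
    proof (rule emeasure_mono_AE)
      have "AE (x, y) in P \<Otimes>\<^sub>M R. x u = 0 \<and> y 0 = 0"
        by (rule AE_pair_components[OF P(1) R(1) P(4) R(4)])
      then show "AE z in P \<Otimes>\<^sub>M R. z \<in> (\<lambda>(x, y). concat_path u x y) -` ?E \<inter> space (P \<Otimes>\<^sub>M R)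
          \<longrightarrow> z \<in> ?F \<times> space R \<union> space P \<times> ?G"
      proof (eventually_elim, intro impI)
        fix z assume z0: "case z of (x, y) \<Rightarrow> x u = 0 \<and> y 0 = 0"
          and z: "z \<in> (\<lambda>(x, y). concat_path u x y) -` ?E \<inter> space (P \<Otimes>\<^sub>M R)"
        obtain x y where [simp]: "z = (x, y)" by (cases z)
        obtain t where t: "t \<in> Q" "l \<le> \<bar>step_integral \<sigma> (stopped t (concat_path u x y))\<bar>"
          using z by auto
        have "step_integral \<sigma> (stopped t (concat_path u x y)) =
            step_integral \<sigma> (stopped (min t u) x) + step_integral \<xi> (stopped (max (t - u) 0) y)"
          unfolding \<xi>(3) using t(1) Q z0 law(2) by (intro step_integral_concat[OF \<sigma>]) auto
        with t(2) have "l / 2 \<le> \<bar>step_integral \<sigma> (stopped (min t u) x)\<bar> \<or>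
            l / 2 \<le> \<bar>step_integral \<xi> (stopped (max (t - u) 0) y)\<bar>"
          by linarith
        then show "z \<in> ?F \<times> space R \<union> space P \<times> ?G"
          using z t(1) R(3) P(3) by (auto simp: space_pair_measure)
      qed
      show "?F \<times> space R \<union> space P \<times> ?G \<in> sets (P \<Otimes>\<^sub>M R)"
        using F G by (intro sets.Un pair_measureI sets.top)
    qed
    also have "\<dots> \<le> emeasure (P \<Otimes>\<^sub>M R) (?F \<times> space R) + emeasure (P \<Otimes>\<^sub>M R) (space P \<times> ?G)"
      using F G by (intro emeasure_subadditive pair_measureI sets.top)
    also have "emeasure (P \<Otimes>\<^sub>M R) (?F \<times> space R) = emeasure P ?F"
      using R.emeasure_pair_measure_Times[OF F sets.top] R.emeasure_space_1 by simp
    also have "emeasure (P \<Otimes>\<^sub>M R) (space P \<times> ?G) = emeasure R ?G"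
      using R.emeasure_pair_measure_Times[OF sets.top[of P] G] P.emeasure_space_1 by simp
    also have "emeasure P ?F + emeasure R ?G \<le>
        ennreal (68 * wconst 1 / (l / 2)\<^sup>2) * L2n (step_fun \<sigma>) +
        (ennreal (K / (l / 2)\<^sup>2) * L2n (step_fun \<xi>) + ennreal (K / (l / 2)) * L1n (\<lambda>s. 1 / sqrt s) (step_fun \<xi>))"
      unfolding R_def using l law(2) Q
      by (intro add_mono bridge_maximal[OF law \<sigma>] max[OF \<xi>(1)]) auto
    also have "L1n (\<lambda>s. 1 / sqrt s) (step_fun \<xi>) = L1n (\<lambda>s. 1 / sqrt s) (\<lambda>s. step_fun \<sigma> (s + u))"
      unfolding L1n_def \<xi>(2) by (intro nn_integral_cong) (auto simp: indicator_def)
    also have "ennreal (68 * wconst 1 / (l / 2)\<^sup>2) = ennreal (c / l\<^sup>2)"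
      by (simp add: c_def power_divide)
    also have "ennreal (c / l\<^sup>2) * L2n (step_fun \<sigma>) +
        (ennreal (K / (l / 2)\<^sup>2) * L2n (step_fun \<xi>) + ennreal (K / (l / 2)) * L1n (\<lambda>s. 1 / sqrt s) (\<lambda>s. step_fun \<sigma> (s + u)))
      \<le> ennreal (c / l\<^sup>2) * L2n (step_fun \<sigma>) +
        (ennreal (4 * K / l\<^sup>2) * L2n (step_fun \<sigma>) + ennreal ((c + 4 * K) / l) * L1n (\<lambda>s. 1 / sqrt s) (\<lambda>s. step_fun \<sigma> (s + u)))"
    proof (intro add_mono mult_mono order_refl ennreal_leI)
      show "K / (l / 2)\<^sup>2 \<le> 4 * K / l\<^sup>2" by (simp add: power_divide mult.commute)
      show "L2n (step_fun \<xi>) \<le> L2n (step_fun \<sigma>)"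
        using law(2) by (intro L2n_shift_le[OF _ _ \<xi>(2)]) auto
      have "K / (l / 2) = 2 * K / l" by simp
      also have "\<dots> \<le> (c + 4 * K) / l" using K c l by (intro divide_right_mono) auto
      finally show "K / (l / 2) \<le> (c + 4 * K) / l" .
    qed auto
    also have "\<dots> = ennreal ((c + 4 * K) / l\<^sup>2) * L2n (step_fun \<sigma>)
        + ennreal ((c + 4 * K) / l) * L1n (\<lambda>s. 1 / sqrt s) (\<lambda>s. step_fun \<sigma> (s + u))"
      using c K by (simp add: add_divide_distrib ennreal_plus distrib_right add.assoc)
    finally show "emeasure (concat_law u P (symmetrize Rp)) ?E
      \<le> ennreal ((c + 4 * K) / l\<^sup>2) * L2n (step_fun \<sigma>)
        + ennreal ((c + 4 * K) / l) * L1n (\<lambda>s. 1 / sqrt s) (\<lambda>s. step_fun \<sigma> (s + u))"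
      by (simp add: R_def)
  qed
qed

section \<open>Bridge and Bessel Wiener integrals as almost sure limits\<close>

text \<open>The definitions integrate over the completed measure and the estimates over
  \<open>lborel\<close>; nonnegative integrals do not distinguish the two.\<close>

lemma L2_tendsto_iff:
  assumes "S \<subseteq> {0..}"
  shows "L2_tendsto S \<phi> h \<longleftrightarrow> (\<lambda>n. L2n (\<lambda>s. indicator S s * (step_fun (\<phi> n) s - h s))) \<longlonglongrightarrow> 0"
proof -
  have "(\<integral>\<^sup>+s\<in>S. ennreal ((step_fun (\<phi> n) s - h s)\<^sup>2) \<partial>lebesgue) = L2n (\<lambda>s. indicator S s * (step_fun (\<phi> n) s - h s))" for n
    unfolding L2n_def nn_integral_completion using assms
    by (intro nn_integral_cong) (auto simp: indicator_def)
  then show ?thesis by (simp add: L2_tendsto_def)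
qed

lemma L2_tendsto_halfline: "L2_tendsto {0..} \<phi> h \<longleftrightarrow> (\<lambda>n. L2n (\<lambda>s. step_fun (\<phi> n) s - h s)) \<longlonglongrightarrow> 0"
proof -
  have "L2n (\<lambda>s. indicator {0..} s * (step_fun (\<phi> n) s - h s)) = L2n (\<lambda>s. step_fun (\<phi> n) s - h s)" for n
    unfolding L2n_def by (intro nn_integral_cong) (auto simp: indicator_def)
  then show ?thesis by (simp add: L2_tendsto_iff)
qed

lemma L1_tendsto_iff: "L1_tendsto \<rho> \<phi> h \<longleftrightarrow> (\<lambda>n. L1n \<rho> (\<lambda>s. step_fun (\<phi> n) s - h s)) \<longlonglongrightarrow> 0"
  unfolding L1_tendsto_def L1n_def nn_integral_completion ..

lemma ennreal_tendsto_0_le: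
  fixes f :: "nat \<Rightarrow> ennreal"
  assumes "\<And>n. f n \<le> g n" "g \<longlonglongrightarrow> 0"
  shows "f \<longlonglongrightarrow> 0"
  by (rule tendsto_sandwich[OF _ _ tendsto_const assms(2)]) (use assms(1) in auto)

lemma ennreal_tendsto_cmult_0:
  fixes f :: "nat \<Rightarrow> ennreal"
  assumes "f \<longlonglongrightarrow> 0" "c < \<infinity>"
  shows "(\<lambda>n. c * f n) \<longlonglongrightarrow> 0"
  using ennreal_tendsto_cmult[OF _ assms(1), of c] assms(2) by simp

lemma L2n_diff_tendsto_0:
  assumes [measurable]: "\<And>n. a n \<in> borel_measurable borel" "\<And>n. b n \<in> borel_measurable borel" "h \<in> borel_measurable borel"
    and "(\<lambda>n. L2n (\<lambda>s. a n s - h s)) \<longlonglongrightarrow> 0" "(\<lambda>n. L2n (\<lambda>s. b n s - h s)) \<longlonglongrightarrow> 0"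
  shows "(\<lambda>n. L2n (\<lambda>s. a n s - b n s)) \<longlonglongrightarrow> 0"
proof (rule ennreal_tendsto_0_le)
  fix n
  have "L2n (\<lambda>s. (a n s - h s) - (b n s - h s)) \<le> 2 * L2n (\<lambda>s. a n s - h s) + 2 * L2n (\<lambda>s. b n s - h s)"
    by (rule L2n_diff_le) measurable
  then show "L2n (\<lambda>s. a n s - b n s) \<le> 2 * L2n (\<lambda>s. a n s - h s) + 2 * L2n (\<lambda>s. b n s - h s)"
    by simp
next
  have "(\<lambda>n. 2 * L2n (\<lambda>s. a n s - h s) + 2 * L2n (\<lambda>s. b n s - h s)) \<longlonglongrightarrow> 0 + 0"
    using assms by (intro tendsto_add ennreal_tendsto_cmult_0) auto
  then show "(\<lambda>n. 2 * L2n (\<lambda>s. a n s - h s) + 2 * L2n (\<lambda>s. b n s - h s)) \<longlonglongrightarrow> 0" by simp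
qed

lemma L1n_diff_tendsto_0:
  assumes [measurable]: "\<And>n. a n \<in> borel_measurable borel" "\<And>n. b n \<in> borel_measurable borel" "h \<in> borel_measurable borel"
    "\<rho> \<in> borel_measurable borel"
    and \<rho>: "\<And>s. 0 \<le> s \<Longrightarrow> 0 \<le> \<rho> s"
    and "(\<lambda>n. L1n \<rho> (\<lambda>s. a n s - h s)) \<longlonglongrightarrow> 0" "(\<lambda>n. L1n \<rho> (\<lambda>s. b n s - h s)) \<longlonglongrightarrow> 0"
  shows "(\<lambda>n. L1n \<rho> (\<lambda>s. a n s - b n s)) \<longlonglongrightarrow> 0"
proof (rule ennreal_tendsto_0_le)
  fix n
  have "L1n \<rho> (\<lambda>s. (a n s - h s) - (b n s - h s)) \<le> L1n \<rho> (\<lambda>s. a n s - h s) + L1n \<rho> (\<lambda>s. b n s - h s)"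
    by (rule L1n_diff_le[OF _ _ _ \<rho>]) measurable
  then show "L1n \<rho> (\<lambda>s. a n s - b n s) \<le> L1n \<rho> (\<lambda>s. a n s - h s) + L1n \<rho> (\<lambda>s. b n s - h s)"
    by simp
next
  have "(\<lambda>n. L1n \<rho> (\<lambda>s. a n s - h s) + L1n \<rho> (\<lambda>s. b n s - h s)) \<longlonglongrightarrow> 0 + 0"
    using assms by (intro tendsto_add) auto
  then show "(\<lambda>n. L1n \<rho> (\<lambda>s. a n s - h s) + L1n \<rho> (\<lambda>s. b n s - h s)) \<longlonglongrightarrow> 0" by simp
qed

lemma emeasure_triangle_tendsto_0:
  fixes f g :: "nat \<Rightarrow> 'a \<Rightarrow> real" and h :: "'a \<Rightarrow> real"
  assumes [measurable]: "\<And>n. f n \<in> borel_measurable M" "\<And>n. g n \<in> borel_measurable M" "h \<in> borel_measurable M" "A \<in> sets M"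
    and 1: "\<And>e. 0 < e \<Longrightarrow> (\<lambda>n. emeasure M (A \<inter> {x \<in> space M. e \<le> \<bar>f n x - g n x\<bar>})) \<longlonglongrightarrow> 0"
    and 2: "\<And>e. 0 < e \<Longrightarrow> (\<lambda>n. emeasure M (A \<inter> {x \<in> space M. e \<le> \<bar>g n x - h x\<bar>})) \<longlonglongrightarrow> 0"
    and e: "0 < e"
  shows "(\<lambda>n. emeasure M (A \<inter> {x \<in> space M. e \<le> \<bar>f n x - h x\<bar>})) \<longlonglongrightarrow> 0"
proof (rule ennreal_tendsto_0_le)
  fix n
  have "emeasure M (A \<inter> {x \<in> space M. e \<le> \<bar>f n x - h x\<bar>}) \<le>
      emeasure M ((A \<inter> {x \<in> space M. e / 2 \<le> \<bar>f n x - g n x\<bar>}) \<union> (A \<inter> {x \<in> space M. e / 2 \<le> \<bar>g n x - h x\<bar>}))"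
  proof (rule emeasure_mono)
    show "A \<inter> {x \<in> space M. e \<le> \<bar>f n x - h x\<bar>} \<subseteq>
        (A \<inter> {x \<in> space M. e / 2 \<le> \<bar>f n x - g n x\<bar>}) \<union> (A \<inter> {x \<in> space M. e / 2 \<le> \<bar>g n x - h x\<bar>})"
    proof
      fix x assume x: "x \<in> A \<inter> {x \<in> space M. e \<le> \<bar>f n x - h x\<bar>}"
      then have "e \<le> \<bar>f n x - h x\<bar>" by simp
      then have "e / 2 \<le> \<bar>f n x - g n x\<bar> \<or> e / 2 \<le> \<bar>g n x - h x\<bar>" by linarith
      with x show "x \<in> (A \<inter> {x \<in> space M. e / 2 \<le> \<bar>f n x - g n x\<bar>}) \<union> (A \<inter> {x \<in> space M. e / 2 \<le> \<bar>g n x - h x\<bar>})"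
        by auto
    qed
  qed measurable
  also have "\<dots> \<le> emeasure M (A \<inter> {x \<in> space M. e / 2 \<le> \<bar>f n x - g n x\<bar>}) + emeasure M (A \<inter> {x \<in> space M. e / 2 \<le> \<bar>g n x - h x\<bar>})"
    by (rule emeasure_subadditive) measurable
  finally show "emeasure M (A \<inter> {x \<in> space M. e \<le> \<bar>f n x - h x\<bar>})
    \<le> emeasure M (A \<inter> {x \<in> space M. e / 2 \<le> \<bar>f n x - g n x\<bar>}) + emeasure M (A \<inter> {x \<in> space M. e / 2 \<le> \<bar>g n x - h x\<bar>})" .
next
  have "(\<lambda>n. emeasure M (A \<inter> {x \<in> space M. e / 2 \<le> \<bar>f n x - g n x\<bar>}) + emeasure M (A \<inter> {x \<in> space M. e / 2 \<le> \<bar>g n x - h x\<bar>})) \<longlonglongrightarrow> 0 + 0"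
    using e by (intro tendsto_add 1 2) auto
  then show "(\<lambda>n. emeasure M (A \<inter> {x \<in> space M. e / 2 \<le> \<bar>f n x - g n x\<bar>}) + emeasure M (A \<inter> {x \<in> space M. e / 2 \<le> \<bar>g n x - h x\<bar>})) \<longlonglongrightarrow> 0"
    by simp
qed

lemma step_integral_measurable_sets:
  assumes "is_step \<phi>" "sets M = sets (path_space S)" "{0..step_end \<phi>} \<subseteq> S"
  shows "step_integral \<phi> \<in> borel_measurable M"
  using step_integral_measurable[OF assms(1,3)] by (simp add: measurable_cong_sets[OF assms(2) refl])

text \<open>With \<open>step_end \<sigma>\<close> as the only time in \<open>Q\<close>, the stopped
  integral is the full one.\<close>

lemma symmetrized_bessel_weak_bound:
  assumes "bessel3_law P"
  obtains K where "0 \<le> K" "\<And>\<sigma> l. is_step \<sigma> \<Longrightarrow> 0 < l \<Longrightarrow>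
    emeasure (symmetrize P) {y \<in> space Omega. l \<le> \<bar>step_integral \<sigma> y\<bar>}
      \<le> ennreal (K / l\<^sup>2) * L2n (step_fun \<sigma>) + ennreal (K / l) * L1n (\<lambda>s. 1 / sqrt s) (step_fun \<sigma>)"
proof -
  obtain K where K: "0 \<le> K" and max: "\<And>\<sigma> Q l. is_step \<sigma> \<Longrightarrow> finite Q \<Longrightarrow> Q \<subseteq> {0..} \<Longrightarrow> 0 < l \<Longrightarrow>
    emeasure (symmetrize P) {y \<in> space Omega. \<exists>t\<in>Q. l \<le> \<bar>step_integral \<sigma> (stopped t y)\<bar>}
      \<le> ennreal (K / l\<^sup>2) * L2n (step_fun \<sigma>) + ennreal (K / l) * L1n (\<lambda>s. 1 / sqrt s) (step_fun \<sigma>)"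
    by (rule symmetrized_bessel_maximal[OF assms]) blast
  show ?thesis
  proof (rule that[OF K])
    fix \<sigma> and l :: real assume *: "is_step \<sigma>" "0 < l"
    show "emeasure (symmetrize P) {y \<in> space Omega. l \<le> \<bar>step_integral \<sigma> y\<bar>}
      \<le> ennreal (K / l\<^sup>2) * L2n (step_fun \<sigma>) + ennreal (K / l) * L1n (\<lambda>s. 1 / sqrt s) (step_fun \<sigma>)"
      using max[of \<sigma> "{step_end \<sigma>}" l] * step_end_nonneg[OF *(1)] step_integral_stopped_ge[OF *(1) order_refl]
      by simp
  qed
qed

lemma concat_weak_bound:
  assumes "bessel3_law Rp"
  obtains K where "0 \<le> K"
    "\<And>u P \<sigma> l. brownian_bridge_law u P \<Longrightarrow> 0 < u \<Longrightarrow> is_step \<sigma> \<Longrightarrow> 0 < l \<Longrightarrow>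
      emeasure (concat_law u P (symmetrize Rp)) {X \<in> space Omega. l \<le> \<bar>step_integral \<sigma> X\<bar>}
      \<le> ennreal (K / l\<^sup>2) * L2n (step_fun \<sigma>) + ennreal (K / l) * L1n (\<lambda>s. 1 / sqrt s) (\<lambda>s. step_fun \<sigma> (s + u))"
proof -
  obtain K where K: "0 \<le> K" and max: "\<And>u P \<sigma> Q l. brownian_bridge_law u P \<Longrightarrow> 0 < u \<Longrightarrow> is_step \<sigma> \<Longrightarrow> finite Q \<Longrightarrow> Q \<subseteq> {0..} \<Longrightarrow> 0 < l \<Longrightarrow>
      emeasure (concat_law u P (symmetrize Rp)) {X \<in> space Omega. \<exists>t\<in>Q. l \<le> \<bar>step_integral \<sigma> (stopped t X)\<bar>}
      \<le> ennreal (K / l\<^sup>2) * L2n (step_fun \<sigma>) + ennreal (K / l) * L1n (\<lambda>s. 1 / sqrt s) (\<lambda>s. step_fun \<sigma> (s + u))"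
    by (rule concat_maximal[OF assms]) blast
  show ?thesis
  proof (rule that[OF K])
    fix u P \<sigma> and l :: real assume *: "brownian_bridge_law u P" "0 < u" "is_step \<sigma>" "0 < l"
    show "emeasure (concat_law u P (symmetrize Rp)) {X \<in> space Omega. l \<le> \<bar>step_integral \<sigma> X\<bar>}
      \<le> ennreal (K / l\<^sup>2) * L2n (step_fun \<sigma>) + ennreal (K / l) * L1n (\<lambda>s. 1 / sqrt s) (\<lambda>s. step_fun \<sigma> (s + u))"
      using max[of u P \<sigma> "{step_end \<sigma>}" l] * step_end_nonneg[OF *(3)] step_integral_stopped_ge[OF *(3) order_refl]
      by simp
  qed
qed

text \<open>The pointwise limit along \<open>\<psi>\<close> has the defining property of the
  integral: another admissible sequence differs from \<open>\<psi>\<close> by steps that are small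
  in both norms, hence small in probability by the weak bound. So the predicate is inhabited, the
  chosen member satisfies it too, and both are limits in probability of the same sequence
  \<open>\<psi>\<close>.\<close>

lemma is_wiener_bessel_limit:
  assumes Rp: "bessel3_law Rp" and R_eq: "R = symmetrize Rp"
    and \<psi>: "\<And>n. is_step (\<psi> n)" and h [measurable]: "h \<in> borel_measurable borel"
    and L2: "(\<lambda>n. L2n (\<lambda>s. step_fun (\<psi> n) s - h s)) \<longlonglongrightarrow> 0"
    and L1: "(\<lambda>n. L1n (\<lambda>s. 1 / sqrt s) (\<lambda>s. step_fun (\<psi> n) s - h s)) \<longlonglongrightarrow> 0"
    and conv: "AE y in R. convergent (\<lambda>n. step_integral (\<psi> n) y)"
  shows "AE y in R. (\<lambda>n. step_integral (\<psi> n) y) \<longlonglongrightarrow> wiener_bessel R h y"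
    and "wiener_bessel R h \<in> borel_measurable R"
proof -
  note Rpb = bessel3_law_basic(1,2)[OF Rp]
  have R: "prob_space R" "sets R = sets Omega" "space R = space Omega"
    unfolding R_eq using symmetrize_emeasure[OF Rpb] by auto
  interpret prob_space R by (rule R)
  have meas [measurable]: "step_integral \<phi> \<in> borel_measurable R" if "is_step \<phi>" for \<phi>
    using that by (intro step_integral_measurable_sets[OF _ R(2)]) auto
  have \<psi>m [measurable]: "step_integral (\<psi> n) \<in> borel_measurable R" for n by (rule meas[OF \<psi>])
  obtain K where K: "0 \<le> K" and bd: "\<And>\<sigma> l. is_step \<sigma> \<Longrightarrow> 0 < l \<Longrightarrow>
    emeasure R {y \<in> space Omega. l \<le> \<bar>step_integral \<sigma> y\<bar>}
      \<le> ennreal (K / l\<^sup>2) * L2n (step_fun \<sigma>) + ennreal (K / l) * L1n (\<lambda>s. 1 / sqrt s) (step_fun \<sigma>)"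
    unfolding R_eq by (rule symmetrized_bessel_weak_bound[OF Rp]) blast
  define Z where "Z y = lim (\<lambda>n. step_integral (\<psi> n) y)" for y
  have Zm [measurable]: "Z \<in> borel_measurable R" unfolding Z_def by measurable
  have lim: "AE y in R. (\<lambda>n. step_integral (\<psi> n) y) \<longlonglongrightarrow> Z y"
    using conv by eventually_elim (simp add: Z_def convergent_LIMSEQ_iff)
  have lim_m: "(\<lambda>n. emeasure R (space R \<inter> {y \<in> space R. e \<le> \<bar>step_integral (\<psi> n) y - Z y\<bar>})) \<longlonglongrightarrow> 0" if "0 < e" for e
    using lim that by (intro AE_tendsto_imp_emeasure_tendsto) (auto simp: emeasure_space_1)
  have diff: "(\<lambda>n. emeasure R (space R \<inter> {y \<in> space R. e \<le> \<bar>step_integral (\<phi> n) y - step_integral (\<psi> n) y\<bar>})) \<longlonglongrightarrow> 0"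
    if \<phi>: "\<forall>n. is_step (\<phi> n)" "L2_tendsto {0..} \<phi> h" "L1_tendsto (\<lambda>s. 1 / sqrt s) \<phi> h" and e: "0 < e" for \<phi> e
  proof (rule ennreal_tendsto_0_le)
    fix n
    obtain \<xi> where \<xi>: "is_step \<xi>" "\<And>s. step_fun \<xi> s = step_fun (\<phi> n) s - step_fun (\<psi> n) s"
      "\<And>Y. step_integral \<xi> Y = step_integral (\<phi> n) Y - step_integral (\<psi> n) Y"
      using step_diff[of "\<phi> n" "\<psi> n"] \<phi>(1) \<psi> by metis
    have "step_fun \<xi> = (\<lambda>s. step_fun (\<phi> n) s - step_fun (\<psi> n) s)" using \<xi>(2) by auto
    then show "emeasure R (space R \<inter> {y \<in> space R. e \<le> \<bar>step_integral (\<phi> n) y - step_integral (\<psi> n) y\<bar>}) \<le>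
       ennreal (K / e\<^sup>2) * L2n (\<lambda>s. step_fun (\<phi> n) s - step_fun (\<psi> n) s)
       + ennreal (K / e) * L1n (\<lambda>s. 1 / sqrt s) (\<lambda>s. step_fun (\<phi> n) s - step_fun (\<psi> n) s)"
      using bd[OF \<xi>(1) e] by (simp add: \<xi>(3) R(3) Int_absorb1 Collect_restrict)
  next
    note \<phi>' = \<phi>(2,3)[unfolded L2_tendsto_halfline L1_tendsto_iff]
    have a: "(\<lambda>n. L2n (\<lambda>s. step_fun (\<phi> n) s - step_fun (\<psi> n) s)) \<longlonglongrightarrow> 0"
      by (rule L2n_diff_tendsto_0[OF _ _ h \<phi>'(1) L2]) auto
    have b: "(\<lambda>n. L1n (\<lambda>s. 1 / sqrt s) (\<lambda>s. step_fun (\<phi> n) s - step_fun (\<psi> n) s)) \<longlonglongrightarrow> 0"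
      by (rule L1n_diff_tendsto_0[OF _ _ h _ _ \<phi>'(2) L1]) auto
    have "(\<lambda>n. ennreal (K / e\<^sup>2) * L2n (\<lambda>s. step_fun (\<phi> n) s - step_fun (\<psi> n) s)
       + ennreal (K / e) * L1n (\<lambda>s. 1 / sqrt s) (\<lambda>s. step_fun (\<phi> n) s - step_fun (\<psi> n) s)) \<longlonglongrightarrow> 0 + 0"
      using a b by (intro tendsto_add ennreal_tendsto_cmult_0) auto
    then show "(\<lambda>n. ennreal (K / e\<^sup>2) * L2n (\<lambda>s. step_fun (\<phi> n) s - step_fun (\<psi> n) s)
       + ennreal (K / e) * L1n (\<lambda>s. 1 / sqrt s) (\<lambda>s. step_fun (\<phi> n) s - step_fun (\<psi> n) s)) \<longlonglongrightarrow> 0"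
      by simp
  qed
  \<comment> \<open>The definition speaks of \<open>measure\<close>, the general convergence lemmas
    of \<open>emeasure\<close> on a set \<open>A\<close>; here \<open>A\<close> is the whole
    space.\<close>
  have measure_iff: "(\<lambda>n. measure R {y \<in> space R. e \<le> \<bar>step_integral (\<phi> n) y - Z' y\<bar>}) \<longlonglongrightarrow> 0 \<longleftrightarrow>
      (\<lambda>n. emeasure R (space R \<inter> {y \<in> space R. e \<le> \<bar>step_integral (\<phi> n) y - Z' y\<bar>})) \<longlonglongrightarrow> 0" for \<phi> Z' e
  proof -
    have "space R \<inter> {y \<in> space R. e \<le> \<bar>step_integral (\<phi> n) y - Z' y\<bar>} = {y \<in> space R. e \<le> \<bar>step_integral (\<phi> n) y - Z' y\<bar>}" for n
      by auto
    then show ?thesis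
      by (simp add: emeasure_eq_measure ennreal_0[symmetric] tendsto_ennreal_iff del: ennreal_0)
  qed
  have "is_wiener_bessel R h Z"
    unfolding is_wiener_bessel_def measure_iff
  proof (intro conjI allI impI)
    fix \<phi> and e :: real
    assume \<phi>: "(\<forall>n. is_step (\<phi> n)) \<and> L2_tendsto {0..} \<phi> h \<and> L1_tendsto (\<lambda>s. 1 / sqrt s) \<phi> h" and e: "0 < e"
    have fm: "step_integral (\<phi> n) \<in> borel_measurable R" for n using \<phi> by (intro meas) auto
    have dif: "(\<lambda>n. emeasure R (space R \<inter> {y \<in> space R. e \<le> \<bar>step_integral (\<phi> n) y - step_integral (\<psi> n) y\<bar>})) \<longlonglongrightarrow> 0"
      if "0 < e" for e
      using \<phi> that by (intro diff) auto
    show "(\<lambda>n. emeasure R (space R \<inter> {y \<in> space R. e \<le> \<bar>step_integral (\<phi> n) y - Z y\<bar>})) \<longlonglongrightarrow> 0"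
      by (rule emeasure_triangle_tendsto_0[OF fm \<psi>m Zm sets.top dif lim_m e])
  qed measurable
  then have W: "is_wiener_bessel R h (wiener_bessel R h)"
    unfolding wiener_bessel_def by (rule someI[where P = "is_wiener_bessel R h"])
  have "AE y in R. y \<in> space R \<longrightarrow> Z y = wiener_bessel R h y"
  proof (rule emeasure_limit_unique[where f = "\<lambda>n. step_integral (\<psi> n)"])
    show "wiener_bessel R h \<in> borel_measurable R" using W by (simp add: is_wiener_bessel_def)
    fix e :: real assume e: "0 < e"
    have "(\<forall>n. is_step (\<psi> n)) \<and> L2_tendsto {0..} \<psi> h \<and> L1_tendsto (\<lambda>s. 1 / sqrt s) \<psi> h"
      using \<psi> L2 L1 by (simp add: L2_tendsto_halfline L1_tendsto_iff)
    then have "(\<lambda>n. measure R {y \<in> space R. e \<le> \<bar>step_integral (\<psi> n) y - wiener_bessel R h y\<bar>}) \<longlonglongrightarrow> 0"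
      using W e unfolding is_wiener_bessel_def by blast
    then show "(\<lambda>n. emeasure R (space R \<inter> {y \<in> space R. e \<le> \<bar>step_integral (\<psi> n) y - wiener_bessel R h y\<bar>})) \<longlonglongrightarrow> 0"
      by (simp only: measure_iff)
  qed (use lim_m in auto)
  with lim AE_space show "AE y in R. (\<lambda>n. step_integral (\<psi> n) y) \<longlonglongrightarrow> wiener_bessel R h y"
    by eventually_elim auto
  show "wiener_bessel R h \<in> borel_measurable R" using W by (simp add: is_wiener_bessel_def)
qed

text \<open>The same scheme in mean square. Fatou's lemma along \<open>\<psi>\<close> yields
  \<open>key\<close>, a bound between the limit and any single admissible step integral; it gives
  square integrability of the limit as well as convergence along every admissible sequence.\<close>

lemma is_wiener_bridge_limit:
  assumes law: "brownian_bridge_law u P" "0 < u"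
    and \<psi>: "\<And>n. is_step (\<psi> n)" "\<And>n. step_end (\<psi> n) \<le> u" and h [measurable]: "h \<in> borel_measurable borel"
    and h0: "\<And>s. u \<le> s \<Longrightarrow> h s = 0"
    and L2: "(\<lambda>n. L2n (\<lambda>s. step_fun (\<psi> n) s - h s)) \<longlonglongrightarrow> 0"
    and conv: "AE x in P. convergent (\<lambda>n. step_integral (\<psi> n) x)"
  shows "AE x in P. (\<lambda>n. step_integral (\<psi> n) x) \<longlonglongrightarrow> wiener_bridge P u h x"
    and "wiener_bridge P u h \<in> borel_measurable P"
proof -
  note P = bridge_law_basic[OF law]
  interpret prob_space P by (rule P)
  have meas [measurable]: "step_integral \<phi> \<in> borel_measurable P" if "is_step \<phi>" "step_end \<phi> \<le> u" for \<phi>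
    using that by (intro step_integral_measurable_sets[OF _ P(2)]) auto
  have \<psi>m [measurable]: "step_integral (\<psi> n) \<in> borel_measurable P" for n by (rule meas[OF \<psi>])
  define Z where "Z x = lim (\<lambda>n. step_integral (\<psi> n) x)" for x
  have Zm [measurable]: "Z \<in> borel_measurable P" unfolding Z_def by measurable
  have lim: "AE x in P. (\<lambda>n. step_integral (\<psi> n) x) \<longlonglongrightarrow> Z x"
    using conv by eventually_elim (simp add: Z_def convergent_LIMSEQ_iff)
  define C where "C = ennreal (4 * wconst 1)"
  have C: "C < \<infinity>" by (simp add: C_def)
  have key: "(\<integral>\<^sup>+x. ennreal ((step_integral \<phi> x - Z x)\<^sup>2) \<partial>P) \<le> C * (2 * L2n (\<lambda>s. step_fun \<phi> s - h s))"
    if \<phi>: "is_step \<phi>" "step_end \<phi> \<le> u" for \<phi>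
  proof -
    have [measurable]: "step_integral \<phi> \<in> borel_measurable P" by (rule meas[OF \<phi>])
    have "(\<integral>\<^sup>+x. ennreal ((step_integral \<phi> x - Z x)\<^sup>2) \<partial>P)
       = (\<integral>\<^sup>+x. liminf (\<lambda>n. ennreal ((step_integral \<phi> x - step_integral (\<psi> n) x)\<^sup>2)) \<partial>P)"
      using lim
    proof (intro nn_integral_cong_AE, eventually_elim)
      fix x assume "(\<lambda>n. step_integral (\<psi> n) x) \<longlonglongrightarrow> Z x"
      then have "(\<lambda>n. ennreal ((step_integral \<phi> x - step_integral (\<psi> n) x)\<^sup>2)) \<longlonglongrightarrow> ennreal ((step_integral \<phi> x - Z x)\<^sup>2)"
        by (intro tendsto_ennrealI tendsto_intros)
      then show "ennreal ((step_integral \<phi> x - Z x)\<^sup>2) = liminf (\<lambda>n. ennreal ((step_integral \<phi> x - step_integral (\<psi> n) x)\<^sup>2))"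
        by (intro lim_imp_Liminf[symmetric]) auto
    qed
    also have "\<dots> \<le> liminf (\<lambda>n. \<integral>\<^sup>+x. ennreal ((step_integral \<phi> x - step_integral (\<psi> n) x)\<^sup>2) \<partial>P)"
      by (rule nn_integral_liminf) measurable
    also have "\<dots> \<le> liminf (\<lambda>n. C * (2 * L2n (\<lambda>s. step_fun \<phi> s - h s) + 2 * L2n (\<lambda>s. step_fun (\<psi> n) s - h s)))"
    proof (intro Liminf_mono always_eventually allI)
      fix n
      obtain \<xi> where \<xi>: "is_step \<xi>" "\<And>s. step_fun \<xi> s = step_fun \<phi> s - step_fun (\<psi> n) s"
        "\<And>Y. step_integral \<xi> Y = step_integral \<phi> Y - step_integral (\<psi> n) Y" "step_end \<xi> \<le> max (step_end \<phi>) (step_end (\<psi> n))"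
        by (rule step_diff[OF \<phi>(1) \<psi>(1)[of n]]) blast
      have "step_end \<xi> \<le> u" using \<xi>(4) \<phi>(2) \<psi>(2)[of n] by auto
      from bridge_L2[OF law \<xi>(1) this]
      have "(\<integral>\<^sup>+x. ennreal ((step_integral \<phi> x - step_integral (\<psi> n) x)\<^sup>2) \<partial>P) \<le> C * L2n (step_fun \<xi>)"
        by (simp add: \<xi>(3) C_def)
      also have "step_fun \<xi> = (\<lambda>s. (step_fun \<phi> s - h s) - (step_fun (\<psi> n) s - h s))" using \<xi>(2) by auto
      also have "C * L2n \<dots> \<le> C * (2 * L2n (\<lambda>s. step_fun \<phi> s - h s) + 2 * L2n (\<lambda>s. step_fun (\<psi> n) s - h s))"
        by (intro mult_left_mono L2n_diff_le) auto
      finally show "(\<integral>\<^sup>+x. ennreal ((step_integral \<phi> x - step_integral (\<psi> n) x)\<^sup>2) \<partial>P)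
         \<le> C * (2 * L2n (\<lambda>s. step_fun \<phi> s - h s) + 2 * L2n (\<lambda>s. step_fun (\<psi> n) s - h s))" .
    qed
    also have "\<dots> = C * (2 * L2n (\<lambda>s. step_fun \<phi> s - h s) + 0)"
      using C by (intro lim_imp_Liminf ennreal_tendsto_cmult tendsto_add tendsto_const ennreal_tendsto_cmult_0 L2) auto
    finally show ?thesis by simp
  qed
  \<comment> \<open>The steps and \<open>h\<close> all vanish beyond \<open>u\<close>, so the norm
    on \<open>{0..u}\<close> and the norm on the half-line agree on the differences.\<close>
  have restr: "L2_tendsto {0..u} \<phi> h \<longleftrightarrow> (\<lambda>n. L2n (\<lambda>s. step_fun (\<phi> n) s - h s)) \<longlonglongrightarrow> 0"
    if "\<And>n. is_step (\<phi> n)" "\<And>n. step_end (\<phi> n) \<le> u" for \<phi>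
  proof -
    have "L2n (\<lambda>s. indicator {0..u} s * (step_fun (\<phi> n) s - h s)) = L2n (\<lambda>s. step_fun (\<phi> n) s - h s)" for n
    proof (rule L2n_cong_AE, intro AE_I2 impI)
      fix s :: real assume "0 \<le> s"
      then show "indicator {0..u} s * (step_fun (\<phi> n) s - h s) = step_fun (\<phi> n) s - h s"
        using step_fun_beyond[OF that(1), of n s] that(2)[of n] h0[of s] by (cases "s \<le> u") auto
    qed
    then show ?thesis by (subst L2_tendsto_iff) auto
  qed
  have "is_wiener_bridge P u h Z"
    unfolding is_wiener_bridge_def
  proof (intro conjI allI impI)
    show "integrable P (\<lambda>x. (Z x)\<^sup>2)"
    proof (rule integrableI_bounded)
      \<comment> \<open>One index with distance below 1 is enough: \<open>Z\<close> is then square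
        integrable as a perturbation of a single step integral.\<close>
      have "\<forall>\<^sub>F n in sequentially. L2n (\<lambda>s. step_fun (\<psi> n) s - h s) < 1"
        using order_tendstoD(2)[OF L2, of 1] by simp
      then obtain n where n: "L2n (\<lambda>s. step_fun (\<psi> n) s - h s) < 1"
        by (auto simp: eventually_sequentially)
      have "(\<integral>\<^sup>+x. ennreal (norm ((Z x)\<^sup>2)) \<partial>P) \<le>
         (\<integral>\<^sup>+x. 2 * ennreal ((step_integral (\<psi> n) x - Z x)\<^sup>2) + 2 * ennreal ((step_integral (\<psi> n) x)\<^sup>2) \<partial>P)"
      proof (rule nn_integral_mono)
        fix x
        define a where "a = step_integral (\<psi> n) x"
        have "(Z x)\<^sup>2 \<le> 2 * (a - Z x)\<^sup>2 + 2 * a\<^sup>2"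
          using zero_le_power2[of "2 * a - Z x"] by (simp add: power2_diff power_mult_distrib algebra_simps)
        then have "ennreal ((Z x)\<^sup>2) \<le> ennreal (2 * (a - Z x)\<^sup>2 + 2 * a\<^sup>2)" by (rule ennreal_leI)
        also have "\<dots> = 2 * ennreal ((a - Z x)\<^sup>2) + 2 * ennreal (a\<^sup>2)" by (simp add: ennreal_plus ennreal_mult)
        finally show "ennreal (norm ((Z x)\<^sup>2)) \<le> 2 * ennreal ((step_integral (\<psi> n) x - Z x)\<^sup>2) + 2 * ennreal ((step_integral (\<psi> n) x)\<^sup>2)"
          by (simp add: a_def)
      qed
      also have "\<dots> = 2 * (\<integral>\<^sup>+x. ennreal ((step_integral (\<psi> n) x - Z x)\<^sup>2) \<partial>P) + 2 * (\<integral>\<^sup>+x. ennreal ((step_integral (\<psi> n) x)\<^sup>2) \<partial>P)"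
        by (simp add: nn_integral_add nn_integral_cmult)
      also have "\<dots> \<le> 2 * (C * (2 * 1)) + 2 * (C * L2n (step_fun (\<psi> n)))"
      proof (intro add_mono mult_left_mono)
        have "(\<integral>\<^sup>+x. ennreal ((step_integral (\<psi> n) x - Z x)\<^sup>2) \<partial>P) \<le> C * (2 * L2n (\<lambda>s. step_fun (\<psi> n) s - h s))"
          by (rule key[OF \<psi>])
        also have "\<dots> \<le> C * (2 * 1)" using n by (intro mult_left_mono) auto
        finally show "(\<integral>\<^sup>+x. ennreal ((step_integral (\<psi> n) x - Z x)\<^sup>2) \<partial>P) \<le> C * (2 * 1)" .
        show "(\<integral>\<^sup>+x. ennreal ((step_integral (\<psi> n) x)\<^sup>2) \<partial>P) \<le> C * L2n (step_fun (\<psi> n))"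
          unfolding C_def by (rule bridge_L2[OF law \<psi>])
      qed auto
      also have "\<dots> < \<infinity>"
        using C by (simp add: L2n_step_fun[OF \<psi>(1)] ennreal_mult_less_top ennreal_add_eq_top less_top[symmetric] ennreal_mult_eq_top_iff)
      finally show "(\<integral>\<^sup>+x. ennreal (norm ((Z x)\<^sup>2)) \<partial>P) < \<infinity>" .
    qed measurable
    fix \<phi>
    assume \<phi>: "(\<forall>n. is_step (\<phi> n) \<and> step_end (\<phi> n) \<le> u) \<and> L2_tendsto {0..u} \<phi> h"
    show "(\<lambda>n. \<integral>\<^sup>+x. ennreal ((step_integral (\<phi> n) x - Z x)\<^sup>2) \<partial>P) \<longlonglongrightarrow> 0"
    proof (rule ennreal_tendsto_0_le)
      show "(\<integral>\<^sup>+x. ennreal ((step_integral (\<phi> n) x - Z x)\<^sup>2) \<partial>P) \<le> C * (2 * L2n (\<lambda>s. step_fun (\<phi> n) s - h s))" for n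
        using \<phi> by (intro key) auto
      show "(\<lambda>n. C * (2 * L2n (\<lambda>s. step_fun (\<phi> n) s - h s))) \<longlonglongrightarrow> 0"
        using \<phi> restr[of \<phi>] C by (intro ennreal_tendsto_cmult_0) auto
    qed
  qed measurable
  then have W: "is_wiener_bridge P u h (wiener_bridge P u h)"
    unfolding wiener_bridge_def by (rule someI[where P = "is_wiener_bridge P u h"])
  have Wm [measurable]: "wiener_bridge P u h \<in> borel_measurable P"
    using W by (simp add: is_wiener_bridge_def)
  have "(\<forall>n. is_step (\<psi> n) \<and> step_end (\<psi> n) \<le> u) \<and> L2_tendsto {0..u} \<psi> h"
    using \<psi> L2 restr[of \<psi>] by simp
  then have WL: "(\<lambda>n. \<integral>\<^sup>+x. ennreal ((step_integral (\<psi> n) x - wiener_bridge P u h x)\<^sup>2) \<partial>P) \<longlonglongrightarrow> 0"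
    using W unfolding is_wiener_bridge_def by blast
  have "(\<integral>\<^sup>+x. ennreal ((Z x - wiener_bridge P u h x)\<^sup>2) \<partial>P) = 0"
  proof -
    have "(\<integral>\<^sup>+x. ennreal ((Z x - wiener_bridge P u h x)\<^sup>2) \<partial>P)
       = (\<integral>\<^sup>+x. liminf (\<lambda>n. ennreal ((step_integral (\<psi> n) x - wiener_bridge P u h x)\<^sup>2)) \<partial>P)"
      using lim
    proof (intro nn_integral_cong_AE, eventually_elim)
      fix x assume "(\<lambda>n. step_integral (\<psi> n) x) \<longlonglongrightarrow> Z x"
      then have "(\<lambda>n. ennreal ((step_integral (\<psi> n) x - wiener_bridge P u h x)\<^sup>2)) \<longlonglongrightarrow> ennreal ((Z x - wiener_bridge P u h x)\<^sup>2)"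
        by (intro tendsto_ennrealI tendsto_intros)
      then show "ennreal ((Z x - wiener_bridge P u h x)\<^sup>2) = liminf (\<lambda>n. ennreal ((step_integral (\<psi> n) x - wiener_bridge P u h x)\<^sup>2))"
        by (intro lim_imp_Liminf[symmetric]) auto
    qed
    also have "\<dots> \<le> liminf (\<lambda>n. \<integral>\<^sup>+x. ennreal ((step_integral (\<psi> n) x - wiener_bridge P u h x)\<^sup>2) \<partial>P)"
      by (rule nn_integral_liminf) measurable
    also have "\<dots> = 0" using WL by (intro lim_imp_Liminf) auto
    finally show ?thesis by simp
  qed
  then have "AE x in P. ennreal ((Z x - wiener_bridge P u h x)\<^sup>2) = 0"
    by (subst (asm) nn_integral_0_iff_AE) auto
  with lim show "AE x in P. (\<lambda>n. step_integral (\<psi> n) x) \<longlonglongrightarrow> wiener_bridge P u h x"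
    by eventually_elim (auto simp: ennreal_eq_0_iff)
  show "wiener_bridge P u h \<in> borel_measurable P" by (rule Wm)
qed

section \<open>Shifted norms and approximation by step functions\<close>

text \<open>One of \<open>u\<close> and \<open>v - u\<close> is at least \<open>v / 2\<close>, and
  the corresponding factor is at most \<open>sqrt (2 / v)\<close>. This separates the two
  singularities of the beta integrand.\<close>

lemma inverse_sqrt_product_le:
  assumes "0 < u" "u < v"
  shows "1 / sqrt u * (1 / sqrt (v - u)) \<le> sqrt (2 / v) * (1 / sqrt u + 1 / sqrt (v - u))"
proof -
  have v: "0 < v" using assms by simp
  have half: "1 / sqrt w \<le> sqrt (2 / v)" if "v / 2 \<le> w" for w
  proof -
    have "0 < w" using v that by linarith
    then have "1 / w \<le> 2 / v" using that v by (simp add: field_simps)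
    then have "sqrt (1 / w) \<le> sqrt (2 / v)" by simp
    then show ?thesis by (simp add: real_sqrt_divide)
  qed
  have a: "0 < 1 / sqrt u" "0 < 1 / sqrt (v - u)" using assms by auto
  have s: "0 \<le> sqrt (2 / v)" using v by simp
  show ?thesis
  proof (cases "v / 2 \<le> u")
    case True
    have "1 / sqrt u * (1 / sqrt (v - u)) \<le> sqrt (2 / v) * (1 / sqrt (v - u))"
      using half[OF True] a by (intro mult_right_mono) auto
    also have "\<dots> \<le> sqrt (2 / v) * (1 / sqrt u + 1 / sqrt (v - u))"
      using a s by (intro mult_left_mono) auto
    finally show ?thesis .
  next
    case False
    then have "v / 2 \<le> v - u" by simp
    from half[OF this] have "1 / sqrt u * (1 / sqrt (v - u)) \<le> 1 / sqrt u * sqrt (2 / v)"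
      using a by (intro mult_left_mono) auto
    also have "\<dots> = sqrt (2 / v) * (1 / sqrt u)" by (rule mult.commute)
    also have "\<dots> \<le> sqrt (2 / v) * (1 / sqrt u + 1 / sqrt (v - u))"
      using a s by (intro mult_left_mono) auto
    finally show ?thesis .
  qed
qed

text \<open>A truncated beta integral. For \<open>v\<close> below \<open>K\<close> it stays bounded,
  for \<open>v\<close> far above \<open>K\<close> it decays like \<open>sqrt K / sqrt v\<close>; the
  weight \<open>1 / (1 + sqrt v)\<close> accounts for both regimes.\<close>

lemma nn_integral_beta_le:
  assumes "0 \<le> v" "0 < K"
  shows "(\<integral>\<^sup>+u. ennreal (1 / sqrt u * (1 / sqrt (v - u))) * indicator ({0<..<K} \<inter> {..v}) u \<partial>lborel)
    \<le> ennreal (4 * sqrt 2 * (1 + sqrt K) * (1 / (1 + sqrt v)))"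
proof (cases "v = 0")
  case True
  then have "(\<integral>\<^sup>+u. ennreal (1 / sqrt u * (1 / sqrt (v - u))) * indicator ({0<..<K} \<inter> {..v}) u \<partial>lborel) = (\<integral>\<^sup>+u. 0 \<partial>(lborel :: real measure))"
    by (intro nn_integral_cong) (auto simp: indicator_def)
  then show ?thesis by simp
next
  case False
  then have v: "0 < v" using assms by simp
  define m where "m = min v K"
  have m: "0 < m" "m \<le> v" "m \<le> K" using v assms by (auto simp: m_def)
  have "(\<integral>\<^sup>+u. ennreal (1 / sqrt u * (1 / sqrt (v - u))) * indicator ({0<..<K} \<inter> {..v}) u \<partial>lborel)
      \<le> (\<integral>\<^sup>+u. ennreal (sqrt (2 / v)) * (ennreal (1 / sqrt u) * indicator {0..<m} u + ennreal (1 / sqrt (v - u)) * indicator {0<..<m} u) \<partial>lborel)"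
  proof (intro nn_integral_mono)
    fix u :: real
    show "ennreal (1 / sqrt u * (1 / sqrt (v - u))) * indicator ({0<..<K} \<inter> {..v}) u \<le>
       ennreal (sqrt (2 / v)) * (ennreal (1 / sqrt u) * indicator {0..<m} u + ennreal (1 / sqrt (v - u)) * indicator {0<..<m} u)"
    proof (cases "0 < u \<and> u < m")
      case True
      then have u: "0 < u" "u < v" "u < K" using m by auto
      have "ennreal (1 / sqrt u * (1 / sqrt (v - u))) \<le> ennreal (sqrt (2 / v) * (1 / sqrt u + 1 / sqrt (v - u)))"
        using inverse_sqrt_product_le[OF u(1,2)] by (rule ennreal_leI)
      also have "\<dots> = ennreal (sqrt (2 / v)) * (ennreal (1 / sqrt u) + ennreal (1 / sqrt (v - u)))"
        using u v by (simp add: ennreal_mult ennreal_plus del: real_sqrt_divide)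
      finally show ?thesis using True u by simp
    next
      case False
      have z: "ennreal (1 / sqrt u * (1 / sqrt (v - u))) * indicator ({0<..<K} \<inter> {..v}) u = 0"
        using False by (auto simp: m_def indicator_def min_def split: if_splits)
      show ?thesis unfolding z by (rule zero_le)
    qed
  qed
  also have "\<dots> = ennreal (sqrt (2 / v)) * ((\<integral>\<^sup>+u. ennreal (1 / sqrt u) * indicator {0..<m} u \<partial>lborel) +
      (\<integral>\<^sup>+u. ennreal (1 / sqrt (v - u)) * indicator {0<..<m} u \<partial>lborel))"
    by (subst nn_integral_cmult, measurable, subst nn_integral_add, measurable)
  also have "(\<integral>\<^sup>+u. ennreal (1 / sqrt u) * indicator {0..<m} u \<partial>lborel) = ennreal (2 * sqrt m)"
    using nn_integral_inverse_sqrt[of 0 m] m by simp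
  also have "(\<integral>\<^sup>+u. ennreal (1 / sqrt (v - u)) * indicator {0<..<m} u \<partial>lborel) \<le> ennreal (2 * sqrt m)"
  proof -
    have "(\<integral>\<^sup>+u. ennreal (1 / sqrt (v - u)) * indicator {0<..<m} u \<partial>lborel)
       = (\<integral>\<^sup>+s. ennreal (1 / sqrt s) * indicator {0<..<m} (v - s) \<partial>lborel)"
      by (subst nn_integral_real_affine[where c = "-1" and t = v]) auto
    also have "\<dots> \<le> (\<integral>\<^sup>+s. ennreal (1 / sqrt s) * indicator {v - m..<v} s \<partial>lborel)"
      by (intro nn_integral_mono) (auto simp: indicator_def)
    also have "\<dots> = ennreal (2 * (sqrt v - sqrt (v - m)))"
      using m by (intro nn_integral_inverse_sqrt) auto
    also have "\<dots> \<le> ennreal (2 * sqrt m)"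
    proof (rule ennreal_leI)
      have "sqrt (m + (v - m)) \<le> sqrt m + sqrt (v - m)"
        using m by (intro sqrt_add_le_add_sqrt) auto
      then show "2 * (sqrt v - sqrt (v - m)) \<le> 2 * sqrt m" by simp
    qed
    finally show ?thesis .
  qed
  also have "ennreal (sqrt (2 / v)) * (ennreal (2 * sqrt m) + ennreal (2 * sqrt m)) = ennreal (4 * sqrt 2 * (sqrt m / sqrt v))"
    using m v by (simp add: ennreal_plus[symmetric] ennreal_mult[symmetric] real_sqrt_divide del: ennreal_plus)
  also have "\<dots> \<le> ennreal (4 * sqrt 2 * (1 + sqrt K) * (1 / (1 + sqrt v)))"
  proof (rule ennreal_leI)
    have "sqrt m * (1 + sqrt v) = sqrt m + sqrt m * sqrt v" by (simp add: distrib_left)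
    also have "\<dots> \<le> sqrt v + sqrt K * sqrt v"
      using m by (intro add_mono mult_right_mono) auto
    finally have "sqrt m * (1 + sqrt v) \<le> (1 + sqrt K) * sqrt v" by (simp add: distrib_right)
    moreover have "0 < sqrt v" "0 < 1 + sqrt v" using v by (auto intro: add_pos_pos)
    ultimately have "sqrt m / sqrt v \<le> (1 + sqrt K) / (1 + sqrt v)"
      by (simp add: pos_divide_le_eq pos_le_divide_eq)
    then have "4 * sqrt 2 * (sqrt m / sqrt v) \<le> 4 * sqrt 2 * ((1 + sqrt K) / (1 + sqrt v))"
      by (intro mult_left_mono) auto
    then show "4 * sqrt 2 * (sqrt m / sqrt v) \<le> 4 * sqrt 2 * (1 + sqrt K) * (1 / (1 + sqrt v))" by simp
  qed
  finally show ?thesis by (simp add: add_left_mono mult_left_mono)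
qed

text \<open>Tonelli after the substitution \<open>v = s + u\<close>. For fixed \<open>v\<close> the
  integral over \<open>u\<close> is the truncated beta integral, which turns the Bessel weight into
  the weight of the integral under \<open>W\<close>.\<close>

lemma L1n_shift_average:
  assumes g [measurable]: "g \<in> borel_measurable borel" and K: "0 < K"
  shows "(\<integral>\<^sup>+u\<in>{0<..<K}. ennreal (1 / sqrt u) * L1n (\<lambda>s. 1 / sqrt s) (\<lambda>s. g (s + u)) \<partial>lborel)
    \<le> ennreal (4 * sqrt 2 * (1 + sqrt K)) * L1n (\<lambda>v. 1 / (1 + sqrt v)) g"
proof -
  have shift: "L1n (\<lambda>s. 1 / sqrt s) (\<lambda>s. g (s + u)) = (\<integral>\<^sup>+v. ennreal (\<bar>g v\<bar> * (1 / sqrt (v - u))) * indicator {u..} v \<partial>lborel)" for u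
  proof -
    have "(\<integral>\<^sup>+v. ennreal (\<bar>g v\<bar> * (1 / sqrt (v - u))) * indicator {u..} v \<partial>lborel) =
        (\<integral>\<^sup>+s. ennreal (\<bar>g (u + 1 * s)\<bar> * (1 / sqrt (u + 1 * s - u))) * indicator {u..} (u + 1 * s) \<partial>lborel)"
      by (subst nn_integral_real_affine[where c = 1 and t = u]) auto
    also have "\<dots> = L1n (\<lambda>s. 1 / sqrt s) (\<lambda>s. g (s + u))"
      unfolding L1n_def by (intro nn_integral_cong) (auto simp: indicator_def add.commute)
    finally show ?thesis by simp
  qed
  let ?h = "\<lambda>u v. ennreal (1 / sqrt u) * indicator {0<..<K} u * (ennreal (\<bar>g v\<bar> * (1 / sqrt (v - u))) * indicator {p. fst p \<le> snd p} (u, v))"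
  have [measurable]: "{p :: real \<times> real. fst p \<le> snd p} \<in> sets (borel \<Otimes>\<^sub>M borel)"
  proof -
    have "{p :: real \<times> real. fst p \<le> snd p} = {p \<in> space (borel \<Otimes>\<^sub>M borel). fst p \<le> snd p}"
      by (simp add: space_pair_measure)
    also have "\<dots> \<in> sets (borel \<Otimes>\<^sub>M borel)" by measurable
    finally show ?thesis .
  qed
  have hm [measurable]: "(\<lambda>(u, v). ?h u v) \<in> borel_measurable (lborel \<Otimes>\<^sub>M lborel)"
    by measurable
  have "(\<integral>\<^sup>+u\<in>{0<..<K}. ennreal (1 / sqrt u) * L1n (\<lambda>s. 1 / sqrt s) (\<lambda>s. g (s + u)) \<partial>lborel) =
      (\<integral>\<^sup>+u. (\<integral>\<^sup>+v. ?h u v \<partial>lborel) \<partial>lborel)"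
  proof (intro nn_integral_cong)
    fix u :: real
    have "ennreal (1 / sqrt u) * L1n (\<lambda>s. 1 / sqrt s) (\<lambda>s. g (s + u)) * indicator {0<..<K} u =
        (ennreal (1 / sqrt u) * indicator {0<..<K} u) * L1n (\<lambda>s. 1 / sqrt s) (\<lambda>s. g (s + u))"
      by (simp add: ac_simps)
    also have "\<dots> = (\<integral>\<^sup>+v. (ennreal (1 / sqrt u) * indicator {0<..<K} u) * (ennreal (\<bar>g v\<bar> * (1 / sqrt (v - u))) * indicator {u..} v) \<partial>lborel)"
      unfolding shift by (rule nn_integral_cmult[symmetric]) measurable
    also have "\<dots> = (\<integral>\<^sup>+v. ?h u v \<partial>lborel)"
      by (intro nn_integral_cong) (auto simp: indicator_def)
    finally show "ennreal (1 / sqrt u) * L1n (\<lambda>s. 1 / sqrt s) (\<lambda>s. g (s + u)) * indicator {0<..<K} u = (\<integral>\<^sup>+v. ?h u v \<partial>lborel)" .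
  qed
  also have "\<dots> = (\<integral>\<^sup>+v. (\<integral>\<^sup>+u. ?h u v \<partial>lborel) \<partial>lborel)"
    by (rule lborel_pair.Fubini'[OF hm, symmetric])
  also have "\<dots> \<le> (\<integral>\<^sup>+v. ennreal (4 * sqrt 2 * (1 + sqrt K)) * (ennreal (\<bar>g v\<bar> * (1 / (1 + sqrt v))) * indicator {0..} v) \<partial>lborel)"
  proof (intro nn_integral_mono)
    fix v :: real
    show "(\<integral>\<^sup>+u. ?h u v \<partial>lborel) \<le> ennreal (4 * sqrt 2 * (1 + sqrt K)) * (ennreal (\<bar>g v\<bar> * (1 / (1 + sqrt v))) * indicator {0..} v)"
    proof (cases "0 \<le> v")
      case True
      have "(\<integral>\<^sup>+u. ?h u v \<partial>lborel) = (\<integral>\<^sup>+u. ennreal \<bar>g v\<bar> * (ennreal (1 / sqrt u * (1 / sqrt (v - u))) * indicator ({0<..<K} \<inter> {..v}) u) \<partial>lborel)"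
        by (intro nn_integral_cong) (auto simp: indicator_def ennreal_mult[symmetric] ac_simps)
      also have "\<dots> = ennreal \<bar>g v\<bar> * (\<integral>\<^sup>+u. ennreal (1 / sqrt u * (1 / sqrt (v - u))) * indicator ({0<..<K} \<inter> {..v}) u \<partial>lborel)"
        by (rule nn_integral_cmult) measurable
      also have "\<dots> \<le> ennreal \<bar>g v\<bar> * ennreal (4 * sqrt 2 * (1 + sqrt K) * (1 / (1 + sqrt v)))"
        by (intro mult_left_mono nn_integral_beta_le[OF True K]) simp
      also have "\<dots> = ennreal (4 * sqrt 2 * (1 + sqrt K)) * (ennreal (\<bar>g v\<bar> * (1 / (1 + sqrt v))) * indicator {0..} v)"
        using True K by (simp add: ennreal_mult[symmetric] ac_simps)
      finally show ?thesis .
    next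
      case False
      then have "(\<integral>\<^sup>+u. ?h u v \<partial>lborel) = (\<integral>\<^sup>+u. 0 \<partial>(lborel :: real measure))"
        by (intro nn_integral_cong) (auto simp: indicator_def)
      then show ?thesis by simp
    qed
  qed
  also have "\<dots> = ennreal (4 * sqrt 2 * (1 + sqrt K)) * L1n (\<lambda>v. 1 / (1 + sqrt v)) g"
    unfolding L1n_def by (rule nn_integral_cmult) measurable
  finally show ?thesis .
qed

text \<open>Pointwise, \<open>\<bar>g\<bar> \<le> g\<^sup>2 / d + d\<close>; choosing \<open>d\<close> of the order of the \<open>L\<^sup>2\<close> norm replaces Cauchy-Schwarz.\<close>

lemma L1n_le_of_L2n_le:
  assumes g [measurable]: "g \<in> borel_measurable borel" and supp: "\<And>s. T \<le> s \<Longrightarrow> g s = 0"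
    and d: "0 < d" and T: "0 \<le> T" and le: "L2n g \<le> ennreal (d\<^sup>2)"
  shows "L1n (\<lambda>s. 1 / (1 + sqrt s)) g \<le> ennreal ((1 + T) * d)"
proof -
  have "L1n (\<lambda>s. 1 / (1 + sqrt s)) g \<le> (\<integral>\<^sup>+s. ennreal (1 / d) * (ennreal ((g s)\<^sup>2) * indicator {0..} s) + ennreal d * indicator {0..T} s \<partial>lborel)"
    unfolding L1n_def
  proof (rule nn_integral_mono)
    fix s :: real
    show "ennreal (\<bar>g s\<bar> * (1 / (1 + sqrt s))) * indicator {0..} s \<le>
        ennreal (1 / d) * (ennreal ((g s)\<^sup>2) * indicator {0..} s) + ennreal d * indicator {0..T} s"
    proof (cases "0 \<le> s \<and> s \<le> T")
      case True
      have "0 < 1 + sqrt s" using True by (intro add_pos_nonneg) auto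
      then have "\<bar>g s\<bar> * (1 / (1 + sqrt s)) \<le> \<bar>g s\<bar> * 1"
        using True by (intro mult_left_mono) (auto simp: divide_le_eq_1_pos)
      also have "\<dots> \<le> 1 / d * (g s)\<^sup>2 + d"
      proof -
        have "0 \<le> (\<bar>g s\<bar> - d)\<^sup>2" by simp
        then have "2 * (\<bar>g s\<bar> * d) \<le> (g s)\<^sup>2 + d\<^sup>2" by (simp add: power2_diff)
        moreover have "0 \<le> \<bar>g s\<bar> * d" using d by simp
        ultimately have "\<bar>g s\<bar> * d \<le> (g s)\<^sup>2 + d\<^sup>2" by linarith
        then show ?thesis using d by (simp add: field_simps power2_eq_square)
      qed
      finally have "ennreal (\<bar>g s\<bar> * (1 / (1 + sqrt s))) \<le> ennreal (1 / d * (g s)\<^sup>2 + d)" by (rule ennreal_leI)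
      also have "\<dots> = ennreal (1 / d) * ennreal ((g s)\<^sup>2) + ennreal d"
        using d by (simp add: ennreal_plus ennreal_mult[symmetric])
      finally show ?thesis using True by simp
    next
      case False
      then show ?thesis using supp[of s] by (auto simp: indicator_def)
    qed
  qed
  also have "\<dots> = ennreal (1 / d) * L2n g + ennreal d * ennreal T"
    unfolding L2n_def using T by (simp add: nn_integral_add nn_integral_cmult nn_integral_cmult_indicator)
  also have "\<dots> \<le> ennreal (1 / d) * ennreal (d\<^sup>2) + ennreal d * ennreal T"
    by (intro add_mono mult_left_mono le) auto
  also have "\<dots> = ennreal ((1 + T) * d)"
    using d T by (simp add: ennreal_mult[symmetric] ennreal_plus[symmetric] power2_eq_square algebra_simps del: ennreal_plus)
  finally show ?thesis .
qed

section \<open>Density of step functions in \<open>L2\<close>\<close>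

definition step_approx :: "real \<Rightarrow> (real \<Rightarrow> real) \<Rightarrow> bool" where
  "step_approx T h \<longleftrightarrow> (\<forall>e>0. \<exists>\<phi>. is_step \<phi> \<and> step_end \<phi> \<le> T \<and> L2n (\<lambda>s. step_fun \<phi> s - h s) \<le> ennreal e)"

lemma step_approx_limit:
  assumes [measurable]: "h \<in> borel_measurable borel" "\<And>n. g n \<in> borel_measurable borel"
    and g: "\<And>n. step_approx T (g n)" and lim: "(\<lambda>n. L2n (\<lambda>s. g n s - h s)) \<longlonglongrightarrow> 0"
  shows "step_approx T h"
  unfolding step_approx_def
proof (intro allI impI)
  fix e :: real assume e: "0 < e"
  have "\<forall>\<^sub>F n in sequentially. L2n (\<lambda>s. g n s - h s) < ennreal (e / 4)"
    using order_tendstoD(2)[OF lim, of "ennreal (e / 4)"] e by simp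
  then obtain n where n: "L2n (\<lambda>s. g n s - h s) < ennreal (e / 4)"
    by (auto simp: eventually_sequentially)
  obtain \<phi> where \<phi>: "is_step \<phi>" "step_end \<phi> \<le> T" "L2n (\<lambda>s. step_fun \<phi> s - g n s) \<le> ennreal (e / 4)"
    using g[of n] e by (auto simp: step_approx_def dest!: spec[of _ "e / 4"])
  have neg: "L2n (\<lambda>s. h s - g n s) = L2n (\<lambda>s. g n s - h s)"
    unfolding L2n_def by (simp add: power2_commute)
  have "L2n (\<lambda>s. (step_fun \<phi> s - g n s) - (h s - g n s)) \<le> 2 * L2n (\<lambda>s. step_fun \<phi> s - g n s) + 2 * L2n (\<lambda>s. h s - g n s)"
    by (rule L2n_diff_le) measurable
  also have "\<dots> \<le> 2 * ennreal (e / 4) + 2 * ennreal (e / 4)"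
    unfolding neg using \<phi>(3) n by (intro add_mono mult_left_mono) auto
  also have "\<dots> = ennreal e"
    using e by (simp add: mult_2 ennreal_plus[symmetric] del: ennreal_plus)
  finally show "\<exists>\<phi>. is_step \<phi> \<and> step_end \<phi> \<le> T \<and> L2n (\<lambda>s. step_fun \<phi> s - h s) \<le> ennreal e"
    using \<phi> by (intro exI[of _ \<phi>]) simp
qed

lemma L2n_dominated:
  assumes [measurable]: "h \<in> borel_measurable borel" "\<And>n. g n \<in> borel_measurable borel" "w \<in> borel_measurable borel"
    and fin: "L2n w < \<infinity>" and le: "\<And>n s. 0 \<le> s \<Longrightarrow> \<bar>g n s - h s\<bar> \<le> \<bar>w s\<bar>"
    and lim: "AE s in lborel. 0 \<le> s \<longrightarrow> (\<lambda>n. g n s) \<longlonglongrightarrow> h s"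
  shows "(\<lambda>n. L2n (\<lambda>s. g n s - h s)) \<longlonglongrightarrow> 0"
proof -
  have "(\<lambda>n. \<integral>\<^sup>+s. ennreal ((g n s - h s)\<^sup>2) * indicator {0..} s \<partial>lborel) \<longlonglongrightarrow> (\<integral>\<^sup>+s. 0 \<partial>(lborel :: real measure))"
  proof (rule nn_integral_dominated_convergence[where w = "\<lambda>s. ennreal ((w s)\<^sup>2) * indicator {0..} s"])
    show "(\<integral>\<^sup>+s. ennreal ((w s)\<^sup>2) * indicator {0..} s \<partial>lborel) < \<infinity>"
      using fin by (simp add: L2n_def)
    show "AE s in lborel. ennreal ((g n s - h s)\<^sup>2) * indicator {0..} s \<le> ennreal ((w s)\<^sup>2) * indicator {0..} s" for n
    proof (intro AE_I2)
      fix s :: real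
      show "ennreal ((g n s - h s)\<^sup>2) * indicator {0..} s \<le> ennreal ((w s)\<^sup>2) * indicator {0..} s"
        using le[of s n] by (cases "0 \<le> s") (auto intro!: ennreal_leI simp: abs_le_square_iff)
    qed
    show "AE s in lborel. (\<lambda>n. ennreal ((g n s - h s)\<^sup>2) * indicator {0..} s) \<longlonglongrightarrow> 0"
      using lim
    proof eventually_elim
      fix s :: real assume *: "0 \<le> s \<longrightarrow> (\<lambda>n. g n s) \<longlonglongrightarrow> h s"
      show "(\<lambda>n. ennreal ((g n s - h s)\<^sup>2) * indicator {0..} s) \<longlonglongrightarrow> 0"
      proof (cases "0 \<le> s")
        case True
        then have "(\<lambda>n. ennreal ((g n s - h s)\<^sup>2)) \<longlonglongrightarrow> ennreal ((h s - h s)\<^sup>2)"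
          using * by (intro tendsto_ennrealI tendsto_intros) auto
        then show ?thesis using True by simp
      qed simp
    qed
  qed measurable
  then show ?thesis by (simp add: L2n_def)
qed

text \<open>Sampling at the left ends of \<open>n + 1\<close> equal cells. The bound
  \<open>M\<close> supplies a dominating function on \<open>[0, T)\<close>, so pointwise convergence
  is enough.\<close>

lemma step_approx_continuous:
  assumes g: "continuous_on UNIV g" and bd: "\<And>s. \<bar>g s\<bar> \<le> M" and T: "0 < T"
  shows "step_approx T (\<lambda>s. indicator {0..<T} s * g s)"
proof -
  have gm [measurable]: "g \<in> borel_measurable borel" using g by (rule borel_measurable_continuous_onI)
  have M: "0 \<le> M" using bd[of 0] by (rule order_trans[OF abs_ge_zero])
  define \<phi> where "\<phi> n = (Suc n, \<lambda>k. real k * T / real (Suc n), \<lambda>k. g (real k * T / real (Suc n)))" for n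
  have st: "is_step (\<phi> n)" for n
    using T by (auto simp: \<phi>_def is_step_def divide_strict_right_mono)
  have en: "step_end (\<phi> n) = T" for n by (simp add: \<phi>_def step_end_def)
  have cell: "\<exists>r. step_fun (\<phi> n) s = g r \<and> r \<le> s \<and> s < r + T / real (Suc n)" if s: "0 \<le> s" "s < T" for n s
  proof -
    define k where "k = nat \<lfloor>s * real (Suc n) / T\<rfloor>"
    have pos: "0 \<le> s * real (Suc n) / T" using s T by simp
    have k1: "real k \<le> s * real (Suc n) / T" using pos by (simp add: k_def)
    have k2: "s * real (Suc n) / T < real k + 1" using pos by (simp add: k_def)
    have "s * real (Suc n) < T * real (Suc n)" using s by (intro mult_strict_right_mono) auto
    then have "s * real (Suc n) / T < real (Suc n)"
      using T by (simp only: pos_divide_less_eq mult.commute)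
    then have kn: "k < Suc n" using k1 by linarith
    have lo: "real k * T / real (Suc n) \<le> s" using k1 T by (simp add: field_simps)
    have hi: "s < real (Suc k) * T / real (Suc n)" using k2 T by (simp add: field_simps)
    have "step_fun (\<phi> n) s = g (real k * T / real (Suc n))"
      unfolding \<phi>_def using step_fun_cell[OF st[of n, unfolded \<phi>_def] kn lo hi] .
    moreover have "real (Suc k) * T / real (Suc n) = real k * T / real (Suc n) + T / real (Suc n)"
      by (simp add: add_divide_distrib distrib_right)
    ultimately show ?thesis using lo hi by auto
  qed
  have lim: "(\<lambda>n. step_fun (\<phi> n) s) \<longlonglongrightarrow> g s" if s: "0 \<le> s" "s < T" for s
  proof -
    obtain r where r: "\<And>n. step_fun (\<phi> n) s = g (r n)" "\<And>n. r n \<le> s" "\<And>n. s < r n + T / real (Suc n)"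
      using cell[OF s] by metis
    have "r \<longlonglongrightarrow> s"
    proof (rule tendsto_sandwich)
      show "\<forall>\<^sub>F n in sequentially. s - T * inverse (real (Suc n)) \<le> r n"
        using r(3) by (intro always_eventually allI) (simp add: divide_inverse less_imp_le diff_le_eq)
      show "\<forall>\<^sub>F n in sequentially. r n \<le> s" using r(2) by simp
      have "(\<lambda>n. s - T * inverse (real (Suc n))) \<longlonglongrightarrow> s - T * 0"
        by (intro tendsto_intros LIMSEQ_inverse_real_of_nat)
      then show "(\<lambda>n. s - T * inverse (real (Suc n))) \<longlonglongrightarrow> s" by simp
    qed simp
    then have "(\<lambda>n. g (r n)) \<longlonglongrightarrow> g s"
      using g by (intro continuous_on_tendsto_compose[of UNIV g]) auto
    then show ?thesis by (simp add: r(1))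
  qed
  show ?thesis
  proof (rule step_approx_limit[where g = "\<lambda>n. step_fun (\<phi> n)"])
    show "step_approx T (step_fun (\<phi> n))" for n
      unfolding step_approx_def
      using st en by (intro allI impI exI[of _ "\<phi> n"]) (simp add: L2n_def)
    show "(\<lambda>n. L2n (\<lambda>s. step_fun (\<phi> n) s - indicator {0..<T} s * g s)) \<longlonglongrightarrow> 0"
    proof (rule L2n_dominated[where w = "\<lambda>s. indicator {0..<T} s * (2 * M)"])
      have "L2n (\<lambda>s. indicator {0..<T} s * (2 * M)) = (\<integral>\<^sup>+s. ennreal ((2 * M)\<^sup>2) * indicator {0..<T} s \<partial>lborel)"
        unfolding L2n_def by (intro nn_integral_cong) (auto simp: indicator_def)
      also have "\<dots> < \<infinity>" using T by (simp add: nn_integral_cmult_indicator ennreal_mult_less_top)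
      finally show "L2n (\<lambda>s. indicator {0..<T} s * (2 * M)) < \<infinity>" .
      fix n s assume s: "(0::real) \<le> s"
      show "\<bar>step_fun (\<phi> n) s - indicator {0..<T} s * g s\<bar> \<le> \<bar>indicator {0..<T} s * (2 * M)\<bar>"
      proof (cases "s < T")
        case True
        then obtain r where "step_fun (\<phi> n) s = g r" using cell[OF s] by blast
        then show ?thesis using bd[of r] bd[of s] s True M by simp
      next
        case False
        then show ?thesis using step_fun_beyond[OF st[of n], of s] en by simp
      qed
    next
      show "AE s in lborel. 0 \<le> s \<longrightarrow> (\<lambda>n. step_fun (\<phi> n) s) \<longlonglongrightarrow> indicator {0..<T} s * g s"
      proof (intro AE_I2 impI)
        fix s :: real assume s: "0 \<le> s"
        show "(\<lambda>n. step_fun (\<phi> n) s) \<longlonglongrightarrow> indicator {0..<T} s * g s"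
        proof (cases "s < T")
          case True then show ?thesis using lim[OF s] s by simp
        next
          case False
          then have "step_fun (\<phi> n) s = 0" for n using step_fun_beyond[OF st[of n], of s] en by simp
          then show ?thesis using False by simp
        qed
      qed
    qed measurable
  qed measurable
qed

text \<open>Measurability in the sense of \<open>measurable_on\<close> provides continuous functions
  that converge off a negligible set. Clipping them at \<open>M\<close> preserves the limit, since
  \<open>h\<close> is bounded by \<open>M\<close>, and makes them uniformly bounded.\<close>

lemma step_approx_bounded:
  assumes h [measurable]: "h \<in> borel_measurable borel" and bd: "\<And>s. \<bar>h s\<bar> \<le> M" and T: "0 < T"
  shows "step_approx T (\<lambda>s. indicator {0..<T} s * h s)"
proof -
  have M: "0 \<le> M" using bd[of 0] by (rule order_trans[OF abs_ge_zero])
  have "h \<in> borel_measurable lebesgue" using h by (simp add: measurable_completion)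
  then have "h measurable_on UNIV"
    using lebesgue_measurable_imp_measurable_on_real[of h UNIV] by simp
  then obtain N g where N: "negligible N" and g: "\<And>n. continuous_on UNIV (g n)"
    and lim: "\<And>s. s \<notin> N \<Longrightarrow> (\<lambda>n. g n s) \<longlonglongrightarrow> h s"
    unfolding measurable_on_def by auto
  define g' where "g' n s = max (- M) (min M (g n s))" for n :: nat and s
  have g'c: "continuous_on UNIV (g' n)" for n
    unfolding g'_def using g by (intro continuous_on_max continuous_on_min continuous_on_const)
  have g'm [measurable]: "g' n \<in> borel_measurable borel" for n
    using g'c by (rule borel_measurable_continuous_onI)
  have g'b: "\<bar>g' n s\<bar> \<le> M" for n s using M by (auto simp: g'_def)
  have AEN: "AE s in lborel. s \<notin> N"
    using N unfolding negligible_iff_null_sets AE_completion_iff[symmetric, of _ lborel]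
    by (rule AE_not_in)
  show ?thesis
  proof (rule step_approx_limit[where g = "\<lambda>n s. indicator {0..<T} s * g' n s"])
    show "step_approx T (\<lambda>s. indicator {0..<T} s * g' n s)" for n
      by (rule step_approx_continuous[OF g'c g'b T])
    show "(\<lambda>n. L2n (\<lambda>s. indicator {0..<T} s * g' n s - indicator {0..<T} s * h s)) \<longlonglongrightarrow> 0"
    proof (rule L2n_dominated[where w = "\<lambda>s. indicator {0..<T} s * (2 * M)"])
      have "L2n (\<lambda>s. indicator {0..<T} s * (2 * M)) = (\<integral>\<^sup>+s. ennreal ((2 * M)\<^sup>2) * indicator {0..<T} s \<partial>lborel)"
        unfolding L2n_def by (intro nn_integral_cong) (auto simp: indicator_def)
      also have "\<dots> < \<infinity>" using T by (simp add: nn_integral_cmult_indicator ennreal_mult_less_top)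
      finally show "L2n (\<lambda>s. indicator {0..<T} s * (2 * M)) < \<infinity>" .
      show "\<bar>indicator {0..<T} s * g' n s - indicator {0..<T} s * h s\<bar> \<le> \<bar>indicator {0..<T} s * (2 * M)\<bar>" for n s
        using g'b[of n s] bd[of s] M by (cases "s \<in> {0..<T}") auto
      show "AE s in lborel. 0 \<le> s \<longrightarrow> (\<lambda>n. indicator {0..<T} s * g' n s) \<longlonglongrightarrow> indicator {0..<T} s * h s"
        using AEN
      proof eventually_elim
        fix s assume "s \<notin> N"
        from lim[OF this] have "(\<lambda>n. g' n s) \<longlonglongrightarrow> max (- M) (min M (h s))"
          unfolding g'_def by (intro tendsto_intros)
        also have "max (- M) (min M (h s)) = h s" using bd[of s] by auto
        finally show "0 \<le> s \<longrightarrow> (\<lambda>n. indicator {0..<T} s * g' n s) \<longlonglongrightarrow> indicator {0..<T} s * h s"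
          by (intro impI tendsto_intros)
      qed
    qed measurable
  qed measurable
qed

text \<open>Values above \<open>n\<close> are replaced by 0; the error is dominated by
  \<open>h\<close> itself.\<close>

lemma step_approx_L2:
  assumes h [measurable]: "h \<in> borel_measurable borel" and fin: "L2n h < \<infinity>" and T: "0 < T"
    and supp: "\<And>s. T \<le> s \<Longrightarrow> h s = 0"
  shows "step_approx T h"
proof -
  define g where "g n s = (if \<bar>h s\<bar> \<le> real n then h s else 0)" for n :: nat and s
  have gm [measurable]: "g n \<in> borel_measurable borel" for n unfolding g_def by measurable
  show ?thesis
  proof (rule step_approx_limit[where g = "\<lambda>n s. indicator {0..<T} s * g n s"])
    show "step_approx T (\<lambda>s. indicator {0..<T} s * g n s)" for n
      by (rule step_approx_bounded[of _ "real n"]) (auto simp: g_def T)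
    show "(\<lambda>n. L2n (\<lambda>s. indicator {0..<T} s * g n s - h s)) \<longlonglongrightarrow> 0"
    proof (rule L2n_dominated[where w = h])
      show "\<bar>indicator {0..<T} s * g n s - h s\<bar> \<le> \<bar>h s\<bar>" if "0 \<le> s" for n s
        using that supp[of s] by (cases "s < T") (auto simp: g_def)
      show "AE s in lborel. 0 \<le> s \<longrightarrow> (\<lambda>n. indicator {0..<T} s * g n s) \<longlonglongrightarrow> h s"
      proof (intro AE_I2 impI)
        fix s :: real assume s: "0 \<le> s"
        have "\<forall>\<^sub>F n in sequentially. indicator {0..<T} s * g n s = h s"
          using eventually_ge_at_top[of "nat \<lceil>\<bar>h s\<bar>\<rceil>"]
        proof eventually_elim
          fix n assume "nat \<lceil>\<bar>h s\<bar>\<rceil> \<le> n"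
          then have "\<bar>h s\<bar> \<le> real n" by linarith
          then show "indicator {0..<T} s * g n s = h s" using s supp[of s] by (cases "s < T") (auto simp: g_def)
        qed
        then show "(\<lambda>n. indicator {0..<T} s * g n s) \<longlonglongrightarrow> h s" by (rule tendsto_eventually)
      qed
    qed (use fin in \<open>auto intro!: borel_measurable_times gm h\<close>)
  qed measurable
qed

section \<open>The sigma-finite measure\<close>

lemma nn_integral_powr_tail:
  assumes "0 < a"
  shows "(\<integral>\<^sup>+u\<in>{a..}. ennreal (1 / (u * sqrt u)) \<partial>lborel) = ennreal (2 / sqrt a)"
proof -
  have "(\<integral>\<^sup>+u. ennreal (1 / (u * sqrt u)) * indicator {a..} u \<partial>lborel) = ennreal (0 - (- 2 / sqrt a))"
  proof (rule nn_integral_FTC_atLeast)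
    fix u assume "a \<le> u"
    then have u: "0 < u" using assms by simp
    have "((\<lambda>u. - 2 / sqrt u) has_real_derivative - (- 2 * (inverse (sqrt u) / 2)) / (sqrt u)\<^sup>2) (at u)"
      using u by (auto intro!: derivative_eq_intros simp: power2_eq_square field_simps)
    then show "((\<lambda>u. - 2 / sqrt u) has_real_derivative 1 / (u * sqrt u)) (at u)"
      using u by (simp add: field_simps)
    show "0 \<le> 1 / (u * sqrt u)" using u by simp
  next
    have "((\<lambda>u. - 2 * inverse (sqrt u)) \<longlongrightarrow> - 2 * 0) at_top"
      by (intro tendsto_intros tendsto_inverse_0_at_top sqrt_at_top)
    then show "((\<lambda>u. - 2 / sqrt u) \<longlongrightarrow> 0) at_top"
      by (simp add: divide_inverse)
  qed measurable
  then show ?thesis by simp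
qed

text \<open>A limit in \<open>n\<close> for fixed \<open>k\<close>, followed by one in
  \<open>k\<close>: the upper limit of \<open>f\<close> is at most \<open>tail k\<close> for every
  \<open>k\<close>.\<close>

lemma convergent_tail_bound:
  fixes f :: "nat \<Rightarrow> ennreal"
  assumes le: "\<And>k n. f n \<le> tail k + g k n" and tail: "tail \<longlonglongrightarrow> 0" and g: "\<And>k. g k \<longlonglongrightarrow> 0"
  shows "f \<longlonglongrightarrow> 0"
proof -
  have "limsup f \<le> tail k" for k
  proof -
    have "limsup f \<le> limsup (\<lambda>n. tail k + g k n)"
      using le by (intro Limsup_mono always_eventually allI)
    also have "(\<lambda>n. tail k + g k n) \<longlonglongrightarrow> tail k + 0"
      by (intro tendsto_add tendsto_const g)
    then have "limsup (\<lambda>n. tail k + g k n) = tail k"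
      by (intro lim_imp_Limsup) auto
    finally show ?thesis .
  qed
  then have "limsup f \<le> 0"
    using tail by (intro LIMSEQ_le_const[OF tail]) auto
  then have "limsup f = 0" by simp
  moreover have "liminf f = 0"
    using Liminf_le_Limsup[of sequentially f] \<open>limsup f = 0\<close> by simp
  ultimately show ?thesis
    by (subst tendsto_iff_Liminf_eq_Limsup) auto
qed

locale bessel_bridge_setup =
  fixes B :: "real \<Rightarrow> (real \<Rightarrow> real) measure" and Rplus R W :: "(real \<Rightarrow> real) measure"
  assumes bridge: "\<And>u. 0 < u \<Longrightarrow> brownian_bridge_law u (B u)"
    and bessel: "bessel3_law Rplus"
    and R_eq: "R = symmetrize Rplus"
    and W_eq: "W = W_measure B R"
begin

abbreviation C :: "real \<Rightarrow> (real \<Rightarrow> real) measure" where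
  "C u \<equiv> concat_law u (B u) R"

lemma R_basic: "prob_space R" "sets R = sets Omega" "space R = space Omega" "AE y in R. y 0 = 0"
  unfolding R_eq
  using symmetrize_emeasure[OF bessel3_law_basic(1,2)[OF bessel]] symmetrized_bessel_start[OF bessel]
  by auto

lemma C_basic:
  assumes "0 < u"
  shows "prob_space (C u)" "sets (C u) = sets Omega" "space (C u) = space Omega"
  using concat_law_basic[OF bridge[OF assms] assms R_basic(1,2)] by auto

lemma kernel: "C \<in> measurable (restrict_space lborel {0<..}) (subprob_algebra Omega)"
  by (rule concat_law_kernel[OF bridge R_basic(1,2)])

lemma emeasure_C_measurable:
  assumes "A \<in> sets Omega"
  shows "(\<lambda>u. emeasure (C u) A * indicator {0<..} u) \<in> borel_measurable borel"
proof -
  have "(\<lambda>u. emeasure (C u) A) \<in> borel_measurable (restrict_space lborel {0<..})"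
    by (rule measurable_compose[OF kernel measurable_emeasure_subprob_algebra[OF assms]])
  then show ?thesis
    by (subst (asm) borel_measurable_restrict_space_iff_ennreal) auto
qed

definition base :: "real measure" where
  "base = density (restrict_space lborel {0<..}) (\<lambda>u. ennreal (1 / sqrt (2 * pi * u)))"

lemma kernel_base: "C \<in> measurable base (subprob_algebra Omega)"
  using kernel by (simp add: base_def)

lemma space_base: "space base \<noteq> {}"
proof -
  have "1 \<in> space base" by (simp add: base_def space_restrict_space)
  then show ?thesis by auto
qed

lemma W_bind: "W = Giry_Monad.bind base C"
  by (simp add: W_eq W_measure_def base_def)

lemma W_sets: "sets W = sets Omega" "space W = space Omega"
proof -
  show "sets W = sets Omega"
    unfolding W_bind by (rule sets_bind_measurable[OF kernel_base space_base])
  then show "space W = space Omega" by (rule sets_eq_imp_space_eq)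
qed

lemma nn_integral_base:
  assumes "f \<in> borel_measurable (restrict_space lborel {0<..})"
  shows "(\<integral>\<^sup>+u. f u \<partial>base) = (\<integral>\<^sup>+u\<in>{0<..}. ennreal (1 / sqrt (2 * pi * u)) * f u \<partial>lborel)"
proof -
  have [measurable]: "(\<lambda>u. ennreal (1 / sqrt (2 * pi * u))) \<in> borel_measurable (restrict_space lborel {0<..})"
    by (rule measurable_restrict_space1) measurable
  have "(\<integral>\<^sup>+u. f u \<partial>base) = (\<integral>\<^sup>+u. ennreal (1 / sqrt (2 * pi * u)) * f u \<partial>restrict_space lborel {0<..})"
    unfolding base_def by (rule nn_integral_density) (use assms in measurable)
  also have "\<dots> = (\<integral>\<^sup>+u\<in>{0<..}. ennreal (1 / sqrt (2 * pi * u)) * f u \<partial>lborel)"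
    by (rule nn_integral_restrict_space) simp
  finally show ?thesis .
qed

lemma emeasure_W:
  assumes "A \<in> sets Omega"
  shows "emeasure W A = (\<integral>\<^sup>+u\<in>{0<..}. ennreal (1 / sqrt (2 * pi * u)) * emeasure (C u) A \<partial>lborel)"
proof -
  have "emeasure W A = (\<integral>\<^sup>+u. emeasure (C u) A \<partial>base)"
    unfolding W_bind by (rule emeasure_bind[OF space_base kernel_base assms])
  also have "\<dots> = (\<integral>\<^sup>+u\<in>{0<..}. ennreal (1 / sqrt (2 * pi * u)) * emeasure (C u) A \<partial>lborel)"
    by (rule nn_integral_base) (rule measurable_compose[OF kernel measurable_emeasure_subprob_algebra[OF assms]])
  finally show ?thesis .
qed

text \<open>A set that is null under almost every \<open>C u\<close> has zero integral in
  \<open>emeasure_W\<close>. Almost sure statements pass to \<open>W\<close> through this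
  rule.\<close>

lemma AE_W:
  assumes Q: "{X \<in> space Omega. Q X} \<in> sets Omega" and AE: "AE u in lborel. 0 < u \<longrightarrow> (AE X in C u. Q X)"
  shows "AE X in W. Q X"
proof -
  let ?N = "{X \<in> space Omega. \<not> Q X}"
  have "?N = space Omega - {X \<in> space Omega. Q X}" by auto
  then have N: "?N \<in> sets Omega" using Q by auto
  have "emeasure W ?N = (\<integral>\<^sup>+u. 0 \<partial>(lborel :: real measure))"
    unfolding emeasure_W[OF N]
  proof (rule nn_integral_cong_AE)
    show "AE u in lborel. ennreal (1 / sqrt (2 * pi * u)) * emeasure (C u) ?N * indicator {0<..} u = 0"
      using AE
    proof eventually_elim
      fix u assume *: "0 < u \<longrightarrow> (AE X in C u. Q X)"
      show "ennreal (1 / sqrt (2 * pi * u)) * emeasure (C u) ?N * indicator {0<..} u = 0"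
      proof (cases "0 < u")
        case True
        then have "AE X in C u. Q X" using * by simp
        then have "emeasure (C u) ?N = 0"
          using C_basic[OF True] N by (subst (asm) AE_iff_measurable[OF _ refl]) auto
        then show ?thesis by simp
      qed simp
    qed
  qed
  then have "?N \<in> null_sets W" using N by (simp add: null_sets_def W_sets)
  then show ?thesis by (rule AE_I') (auto simp: W_sets)
qed

text \<open>These sets have finite measure and exhaust the space up to a null set: the bridge has bounded
  fluctuations near its endpoint, while the Bessel process escapes faster than \<open>m powr (1 / 8)\<close>.\<close>

definition escape :: "nat \<Rightarrow> (real \<Rightarrow> real) set" where
  "escape N = {X \<in> space Omega. \<forall>m\<ge>N. real m \<le> X (real m) ^ 8}"

lemma escape_sets: "escape N \<in> sets Omega"
proof -
  have "{X \<in> space Omega. real m \<le> X (real m) ^ 8} \<in> sets Omega" for m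
  proof -
    have [measurable]: "(\<lambda>X. X (real m)) \<in> borel_measurable Omega"
      by (intro measurable_path_space_component) auto
    show ?thesis by measurable
  qed
  then have "(\<Inter>m\<in>{N..}. {X \<in> space Omega. real m \<le> X (real m) ^ 8}) \<in> sets Omega"
    by (intro sets.countable_INT') auto
  also have "(\<Inter>m\<in>{N..}. {X \<in> space Omega. real m \<le> X (real m) ^ 8}) = escape N"
    by (auto simp: escape_def)
  finally show ?thesis .
qed

lemma C_bridge_event:
  assumes u: "0 < u" and A: "A \<in> sets Omega" and F: "F \<in> sets (path_space {0..u})"
    and imp: "\<And>x y. x u = 0 \<Longrightarrow> y 0 = 0 \<Longrightarrow> x \<in> space (path_space {0..u}) \<Longrightarrow> concat_path u x y \<in> A \<Longrightarrow> x \<in> F"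
  shows "emeasure (C u) A \<le> emeasure (B u) F"
proof -
  note law = bridge[OF u] u
  note P = bridge_law_basic[OF law] and m = concat_law_basic(4)[OF law R_basic(1,2)]
  interpret P: prob_space "B u" by (rule P)
  interpret R: prob_space R by (rule R_basic)
  have "emeasure (C u) A = emeasure (B u \<Otimes>\<^sub>M R) ((\<lambda>(x, y). concat_path u x y) -` A \<inter> space (B u \<Otimes>\<^sub>M R))"
    unfolding concat_law_def by (rule emeasure_distr[OF m A])
  also have "\<dots> \<le> emeasure (B u \<Otimes>\<^sub>M R) (F \<times> space R)"
  proof (rule emeasure_mono_AE)
    have "AE (x, y) in B u \<Otimes>\<^sub>M R. x u = 0 \<and> y 0 = 0"
      by (rule AE_pair_components[OF P(1) R_basic(1) P(4) R_basic(4)])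
    then show "AE z in B u \<Otimes>\<^sub>M R. z \<in> (\<lambda>(x, y). concat_path u x y) -` A \<inter> space (B u \<Otimes>\<^sub>M R) \<longrightarrow> z \<in> F \<times> space R"
      by eventually_elim (use imp P(3) in \<open>auto simp: space_pair_measure\<close>)
    show "F \<times> space R \<in> sets (B u \<Otimes>\<^sub>M R)"
      using F P(2) by (intro pair_measureI sets.top) auto
  qed
  also have "\<dots> = emeasure (B u) F"
    using R.emeasure_pair_measure_Times[of F "B u" "space R"] F P(2) R.emeasure_space_1 by simp
  finally show ?thesis .
qed

text \<open>For \<open>u \<ge> N + 1\<close> the constraint at the integer part \<open>m\<close> of
  \<open>u\<close> concerns the bridge within one unit of its end. By the eighth moment it has
  probability at most \<open>2 * c / u\<close>, integrable at infinity against
  \<open>du / sqrt u\<close>. For smaller \<open>u\<close> the probability is bounded by 1 and the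
  weight is integrable near 0.\<close>

lemma emeasure_W_escape:
  assumes N: "1 \<le> N"
  shows "emeasure W (escape N) < \<infinity>"
proof -
  obtain c where c: "0 \<le> c" and mom: "\<And>u P m. brownian_bridge_law u P \<Longrightarrow> 1 \<le> u \<Longrightarrow> 0 < m \<Longrightarrow> m \<le> u \<Longrightarrow> u \<le> m + 1 \<Longrightarrow>
     (\<integral>\<^sup>+x. ennreal (x m ^ 8) \<partial>P) \<le> ennreal c"
    by (rule bridge_eighth_moment) blast
  define a where "a = real N + 1"
  have a: "2 \<le> a" using N by (simp add: a_def)
  have late: "emeasure (C u) (escape N) \<le> ennreal (2 * c / u)" if u: "a \<le> u" for u
  proof -
    define m where "m = nat \<lfloor>u\<rfloor>"
    have mu: "real m \<le> u" "u < real m + 1" and mN: "N \<le> m" "1 \<le> real m"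
      using u a N by (auto simp: m_def a_def) linarith+
    have u0: "0 < u" "1 \<le> u" using u a by auto
    let ?F = "{x \<in> space (path_space {0..u}). real m \<le> x (real m) ^ 8}"
    have [measurable]: "(\<lambda>x. x (real m)) \<in> borel_measurable (path_space {0..u})"
      using mu by (intro measurable_path_space_component) auto
    have F: "?F \<in> sets (path_space {0..u})" by measurable
    have "emeasure (C u) (escape N) \<le> emeasure (B u) ?F"
    proof (rule C_bridge_event[OF u0(1) escape_sets F])
      fix x y assume *: "x u = 0" "y 0 = 0" "x \<in> space (path_space {0..u})" "concat_path u x y \<in> escape N"
      have "concat_path u x y (real m) = x (real m)"
        using mu u0 * by (subst concat_path_eq) auto
      then show "x \<in> ?F" using * mN by (auto simp: escape_def)
    qed
    also have "\<dots> \<le> ennreal (1 / real m) * (\<integral>\<^sup>+x. ennreal (x (real m) ^ 8) * indicator (space (B u)) x \<partial>B u)"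
    proof -
      note P = bridge_law_basic[OF bridge[OF u0(1)] u0(1)]
      have meas: "(\<lambda>x. x (real m)) \<in> borel_measurable (B u)"
        using \<open>(\<lambda>x. x (real m)) \<in> borel_measurable (path_space {0..u})\<close>
        by (subst measurable_cong_sets[OF P(2) refl])
      have "emeasure (B u) ({x \<in> space (B u). 1 \<le> ennreal (1 / real m) * ennreal (x (real m) ^ 8)}) \<le>
        ennreal (1 / real m) * (\<integral>\<^sup>+x. ennreal (x (real m) ^ 8) * indicator (space (B u)) x \<partial>B u)"
        by (intro nn_integral_Markov_inequality borel_measurable_times_ennreal borel_measurable_indicator
            sets.top measurable_compose[OF borel_measurable_power[OF meas] measurable_ennreal])
      also have "{x \<in> space (B u). 1 \<le> ennreal (1 / real m) * ennreal (x (real m) ^ 8)} = ?F"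
      proof -
        have "1 \<le> ennreal (1 / real m) * ennreal (x (real m) ^ 8) \<longleftrightarrow> real m \<le> x (real m) ^ 8" for x :: "real \<Rightarrow> real"
        proof -
          have "ennreal (1 / real m) * ennreal (x (real m) ^ 8) = ennreal (x (real m) ^ 8 / real m)"
            by (simp add: ennreal_mult[symmetric])
          moreover have "1 \<le> ennreal (x (real m) ^ 8 / real m) \<longleftrightarrow> 1 \<le> x (real m) ^ 8 / real m"
            by simp
          ultimately show ?thesis using mN by (simp add: pos_le_divide_eq)
        qed
        then show ?thesis using P(3) by simp
      qed
      finally show ?thesis .
    qed
    also have "(\<integral>\<^sup>+x. ennreal (x (real m) ^ 8) * indicator (space (B u)) x \<partial>B u) = (\<integral>\<^sup>+x. ennreal (x (real m) ^ 8) \<partial>B u)"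
      by (intro nn_integral_cong) simp
    also have "ennreal (1 / real m) * \<dots> \<le> ennreal (1 / real m) * ennreal c"
      using mu mN by (intro mult_left_mono mom[OF bridge[OF u0(1)] u0(2)]) auto
    also have "\<dots> = ennreal (c / real m)" using c by (simp add: ennreal_mult[symmetric])
    also have "\<dots> \<le> ennreal (2 * c / u)"
    proof (rule ennreal_leI)
      have "u \<le> 2 * real m" using mu mN by linarith
      then have "c * u \<le> c * (2 * real m)" using c by (intro mult_left_mono) auto
      then show "c / real m \<le> 2 * c / u" using u0 mN by (simp add: field_simps)
    qed
    finally show ?thesis .
  qed
  have w: "1 / sqrt (2 * pi * u) \<le> 1 / sqrt u" if "0 < u" for u
  proof -
    have "1 * u \<le> 2 * pi * u" using that pi_ge_two by (intro mult_right_mono) auto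
    then show ?thesis using that by (intro divide_left_mono) auto
  qed
  have "emeasure W (escape N) \<le> (\<integral>\<^sup>+u. ennreal (1 / sqrt u) * indicator {0..<a} u + ennreal (2 * c) * (ennreal (1 / (u * sqrt u)) * indicator {a..} u) \<partial>lborel)"
    unfolding emeasure_W[OF escape_sets]
  proof (rule nn_integral_mono)
    fix u :: real
    show "ennreal (1 / sqrt (2 * pi * u)) * emeasure (C u) (escape N) * indicator {0<..} u
       \<le> ennreal (1 / sqrt u) * indicator {0..<a} u + ennreal (2 * c) * (ennreal (1 / (u * sqrt u)) * indicator {a..} u)"
    proof (cases "0 < u")
      case u: True
      interpret C: prob_space "C u" by (rule C_basic[OF u])
      show ?thesis
      proof (cases "u < a")
        case True
        have "ennreal (1 / sqrt (2 * pi * u)) * emeasure (C u) (escape N) \<le> ennreal (1 / sqrt u) * 1"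
          using w[OF u] C.emeasure_le_1 by (intro mult_mono ennreal_leI) auto
        then show ?thesis using u True by simp
      next
        case False
        have "ennreal (1 / sqrt (2 * pi * u)) * emeasure (C u) (escape N) \<le> ennreal (1 / sqrt u) * ennreal (2 * c / u)"
          using w[OF u] late[of u] False by (intro mult_mono ennreal_leI) auto
        also have "\<dots> = ennreal (2 * c) * ennreal (1 / (u * sqrt u))"
          using u c by (simp add: ennreal_mult[symmetric] mult.commute)
        finally show ?thesis using u False by simp
      qed
    qed simp
  qed
  also have "\<dots> = (\<integral>\<^sup>+u\<in>{0..<a}. ennreal (1 / sqrt u) \<partial>lborel) + ennreal (2 * c) * (\<integral>\<^sup>+u\<in>{a..}. ennreal (1 / (u * sqrt u)) \<partial>lborel)"
    by (subst nn_integral_add, measurable, subst nn_integral_cmult, measurable)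
  also have "\<dots> = ennreal (2 * (sqrt a - sqrt 0)) + ennreal (2 * c) * ennreal (2 / sqrt a)"
    using a nn_integral_inverse_sqrt[of 0 a] nn_integral_powr_tail[of a] by simp
  also have "\<dots> < \<infinity>"
    by (simp add: ennreal_mult_less_top)
  finally show ?thesis .
qed

text \<open>Small balls of radius \<open>m powr (1 / 8)\<close> around 0 have Bessel probability of
  order \<open>m powr (3 * (1 / 8 - 1 / 2)) = m powr (- 9 / 8)\<close>, which is summable, so
  Borel-Cantelli applies. A radius \<open>m powr a\<close> would need \<open>a < 1 / 6\<close>, and
  8 is the first even power beyond 6.\<close>

lemma AE_C_escape:
  assumes u: "0 < u"
  shows "AE X in C u. \<exists>N\<ge>1. X \<in> escape N"
proof -
  obtain c where c: "0 \<le> c" and ball: "\<And>t r. 0 < t \<Longrightarrow> 0 \<le> r \<Longrightarrow>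
    emeasure R {y \<in> space Omega. \<bar>y t\<bar> \<le> r} \<le> ennreal (c * (r / sqrt t) ^ 3)"
    unfolding R_eq by (rule symmetrized_bessel_small_ball[OF bessel]) blast
  \<comment> \<open>The event is empty for \<open>m < 2 * u\<close>, so that
    \<open>m - u \<ge> m / 2\<close> whenever the small-ball bound is used.\<close>
  define E where "E m = (if real m < 2 * u then {} else {y \<in> space Omega. \<bar>y (real m - u)\<bar> \<le> real m powr (1 / 8)})" for m
  have E: "E m \<in> sets R" for m
  proof (cases "real m < 2 * u")
    case False
    have [measurable]: "(\<lambda>y. y (real m - u)) \<in> borel_measurable Omega"
      using False u by (intro measurable_path_space_component) auto
    have "{y \<in> space Omega. \<bar>y (real m - u)\<bar> \<le> real m powr (1 / 8)} \<in> sets Omega" by measurable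
    then show ?thesis using False by (simp add: E_def R_basic)
  qed (simp add: E_def)
  have Eb: "emeasure R (E m) \<le> ennreal (c * 2 powr (3 / 2) * real m powr (- 9 / 8))" for m
  proof (cases "real m < 2 * u")
    case False
    then have mu: "2 * u \<le> real m" "0 < real m" "0 < real m - u" "real m / 2 \<le> real m - u"
      using u by auto
    have "emeasure R (E m) \<le> ennreal (c * (real m powr (1 / 8) / sqrt (real m - u)) ^ 3)"
      using False mu by (simp add: E_def ball)
    also have "\<dots> \<le> ennreal (c * 2 powr (3 / 2) * real m powr (- 9 / 8))"
    proof (rule ennreal_leI)
      have "real m powr (1 / 8) / sqrt (real m - u) \<le> real m powr (1 / 8) / sqrt (real m / 2)"
        using mu by (intro divide_left_mono) auto
      also have "sqrt (real m / 2) = (real m / 2) powr (1 / 2)" using mu by (simp add: powr_half_sqrt)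
      also have "real m powr (1 / 8) / (real m / 2) powr (1 / 2) = 2 powr (1 / 2) * real m powr (- 3 / 8)"
      proof -
        have "real m powr (1 / 8) = real m powr (1 / 2) * real m powr (- 3 / 8)"
          using mu by (simp add: powr_add[symmetric])
        then show ?thesis using mu by (simp add: powr_divide)
      qed
      finally have "(real m powr (1 / 8) / sqrt (real m - u)) ^ 3 \<le> (2 powr (1 / 2) * real m powr (- 3 / 8)) ^ 3"
        using mu by (intro power_mono) auto
      also have "\<dots> = 2 powr (3 / 2) * real m powr (- 9 / 8)"
        using mu by (simp add: power_mult_distrib powr_power)
      finally show "c * (real m powr (1 / 8) / sqrt (real m - u)) ^ 3 \<le> c * 2 powr (3 / 2) * real m powr (- 9 / 8)"
        using c by (simp add: mult.assoc mult_left_mono)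
    qed
    finally show ?thesis .
  qed (simp add: E_def)
  have sm: "summable (\<lambda>m. c * 2 powr (3 / 2) * real m powr (- 9 / 8))"
    by (intro summable_mult) (simp add: summable_real_powr_iff)
  have "(\<Sum>m. ennreal (c * 2 powr (3 / 2) * real m powr (- 9 / 8))) \<noteq> top"
    by (rule ennreal_suminf_neq_top[OF sm]) (use c in simp)
  then have "(\<Sum>m. ennreal (c * 2 powr (3 / 2) * real m powr (- 9 / 8))) < \<infinity>"
    by (simp only: less_top infinity_ennreal_def)
  from AE_eventually_notin[OF E Eb this]
  have q: "AE y in R. \<forall>\<^sub>F m in sequentially. y \<notin> E m" .
  show ?thesis
  proof (rule AE_concat_lawI[OF bridge[OF u] u R_basic(1,2,4) _ AE_I2[of _ "\<lambda>_. True"] q])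
    have "{X \<in> space Omega. \<exists>N\<ge>1. X \<in> escape N} = (\<Union>N\<in>{1..}. escape N)"
      by (auto simp: escape_def)
    then show "{X \<in> space Omega. \<exists>N\<ge>1. X \<in> escape N} \<in> sets Omega"
      using escape_sets by auto
    fix x y assume xy: "y \<in> space Omega" "x u = 0" "y 0 = 0" "\<forall>\<^sub>F m in sequentially. y \<notin> E m"
      "concat_path u x y \<in> space Omega"
    obtain N0 where N0: "\<And>m. N0 \<le> m \<Longrightarrow> y \<notin> E m"
      using xy(4) by (auto simp: eventually_sequentially)
    define N where "N = max 1 (max N0 (nat \<lceil>2 * u\<rceil>))"
    have "real m \<le> concat_path u x y (real m) ^ 8" if m: "N \<le> m" for m
    proof -
      have mu: "2 * u \<le> real m" "N0 \<le> m" "1 \<le> m" using m by (auto simp: N_def)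
      then have big: "real m powr (1 / 8) < \<bar>y (real m - u)\<bar>"
        using N0[of m] xy(1) by (auto simp: E_def)
      have "real m = (real m powr (1 / 8)) ^ 8" using mu by (simp add: powr_power)
      also have "\<dots> \<le> \<bar>y (real m - u)\<bar> ^ 8" using big by (intro power_mono) auto
      also have "\<dots> = concat_path u x y (real m) ^ 8"
        using mu u xy by (subst concat_path_eq) auto
      finally show ?thesis .
    qed
    then show "\<exists>N\<ge>1. concat_path u x y \<in> escape N"
      using xy(5) by (intro exI[of _ N]) (auto simp: escape_def N_def)
  qed simp
qed

lemma AE_W_escape: "AE X in W. \<exists>N\<ge>1. X \<in> escape N"
proof (rule AE_W)
  have "{X \<in> space Omega. \<exists>N\<ge>1. X \<in> escape N} = (\<Union>N\<in>{1..}. escape N)"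
    by (auto simp: escape_def)
  then show "{X \<in> space Omega. \<exists>N\<ge>1. X \<in> escape N} \<in> sets Omega"
    using escape_sets by auto
  show "AE u in lborel. 0 < u \<longrightarrow> (AE X in C u. \<exists>N\<ge>1. X \<in> escape N)"
    using AE_C_escape by auto
qed

text \<open>Local convergence determines the limit on each set of finite mass, and countably many
  sets \<open>escape N\<close> cover almost the whole space. The index is \<open>Suc N\<close>
  because finiteness is available for \<open>1 \<le> N\<close>.\<close>

lemma W_local_limit_unique:
  fixes f :: "nat \<Rightarrow> (real \<Rightarrow> real) \<Rightarrow> real"
  assumes "\<And>n. f n \<in> borel_measurable W" "g \<in> borel_measurable W" "g' \<in> borel_measurable W"
    and 1: "\<And>A e. A \<in> sets W \<Longrightarrow> emeasure W A < \<infinity> \<Longrightarrow> 0 < e \<Longrightarrow>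
      (\<lambda>n. emeasure W (A \<inter> {x \<in> space W. e \<le> \<bar>f n x - g x\<bar>})) \<longlonglongrightarrow> 0"
    and 2: "\<And>A e. A \<in> sets W \<Longrightarrow> emeasure W A < \<infinity> \<Longrightarrow> 0 < e \<Longrightarrow>
      (\<lambda>n. emeasure W (A \<inter> {x \<in> space W. e \<le> \<bar>f n x - g' x\<bar>})) \<longlonglongrightarrow> 0"
  shows "AE X in W. g X = g' X"
proof -
  have "AE X in W. X \<in> escape (Suc N) \<longrightarrow> g X = g' X" for N
    using assms escape_sets[of "Suc N"] emeasure_W_escape[of "Suc N"]
    by (intro emeasure_limit_unique[where f = f]) (auto simp: W_sets)
  then have "AE X in W. \<forall>N. X \<in> escape (Suc N) \<longrightarrow> g X = g' X"
    by (subst AE_all_countable) auto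
  with AE_W_escape show ?thesis
  proof eventually_elim
    fix X assume "\<exists>N\<ge>1. X \<in> escape N" and *: "\<forall>N. X \<in> escape (Suc N) \<longrightarrow> g X = g' X"
    then obtain N where "1 \<le> N" "X \<in> escape N" by auto
    then have "X \<in> escape (Suc (N - 1))" by simp
    with * show "g X = g' X" by blast
  qed
qed

lemma step_integral_W_measurable: "is_step \<phi> \<Longrightarrow> step_integral \<phi> \<in> borel_measurable W"
  by (rule step_integral_measurable_sets[OF _ W_sets(1)]) auto

text \<open>The integral over \<open>u\<close> is split at \<open>Suc k\<close>. Below, the weak
  bound under \<open>C u\<close> is integrated and \<open>L1n_shift_average\<close> turns the
  shifted norms into the given \<open>L1\<close> norm, with a factor that depends on
  \<open>k\<close>. Above, the mass of \<open>A\<close> itself is used; its tail vanishes because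
  \<open>A\<close> has finite mass.\<close>

lemma step_integral_tendsto_0_locally:
  assumes d: "\<And>n. is_step (d n)" and L2: "(\<lambda>n. L2n (step_fun (d n))) \<longlonglongrightarrow> 0"
    and L1: "(\<lambda>n. L1n (\<lambda>s. 1 / (1 + sqrt s)) (step_fun (d n))) \<longlonglongrightarrow> 0"
    and A: "A \<in> sets Omega" "emeasure W A < \<infinity>" and e: "0 < e"
  shows "(\<lambda>n. emeasure W (A \<inter> {X \<in> space Omega. e \<le> \<bar>step_integral (d n) X\<bar>})) \<longlonglongrightarrow> 0"
proof -
  obtain K where K: "0 \<le> K" and bd: "\<And>u P \<sigma> l. brownian_bridge_law u P \<Longrightarrow> 0 < u \<Longrightarrow> is_step \<sigma> \<Longrightarrow> 0 < l \<Longrightarrow>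
      emeasure (concat_law u P R) {X \<in> space Omega. l \<le> \<bar>step_integral \<sigma> X\<bar>}
      \<le> ennreal (K / l\<^sup>2) * L2n (step_fun \<sigma>) + ennreal (K / l) * L1n (\<lambda>s. 1 / sqrt s) (\<lambda>s. step_fun \<sigma> (s + u))"
    unfolding R_eq by (rule concat_weak_bound[OF bessel]) blast
  let ?E = "\<lambda>n. {X \<in> space Omega. e \<le> \<bar>step_integral (d n) X\<bar>}"
  have E [measurable]: "?E n \<in> sets Omega" for n
  proof -
    have [measurable]: "step_integral (d n) \<in> borel_measurable Omega"
      by (rule step_integral_measurable[OF d]) auto
    show ?thesis by measurable
  qed
  \<comment> \<open>\<open>a\<close> is the density in \<open>u\<close> of the \<open>W\<close>-mass
    of \<open>A\<close>, so its integral is the mass of \<open>A\<close>.\<close>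
  define a where "a u = ennreal (1 / sqrt (2 * pi * u)) * (emeasure (C u) A * indicator {0<..} u)" for u
  have am [measurable]: "a \<in> borel_measurable borel"
    unfolding a_def using emeasure_C_measurable[OF A(1)] by measurable
  have a_fin: "(\<integral>\<^sup>+u. a u \<partial>lborel) < \<infinity>"
    using A(2) unfolding emeasure_W[OF A(1)] a_def by (simp add: mult.assoc)
  define tail where "tail k = (\<integral>\<^sup>+u\<in>{real (Suc k)..}. a u \<partial>lborel)" for k :: nat
  define g where "g k n = ennreal (K / e\<^sup>2) * (ennreal (2 * sqrt (real (Suc k))) * L2n (step_fun (d n))) +
      ennreal (K / e) * (ennreal (4 * sqrt 2 * (1 + sqrt (real (Suc k)))) * L1n (\<lambda>s. 1 / (1 + sqrt s)) (step_fun (d n)))" for k n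
  show ?thesis
  proof (rule convergent_tail_bound[where tail = tail and g = g])
    show "g k \<longlonglongrightarrow> 0" for k
    proof -
      have "g k \<longlonglongrightarrow> 0 + 0"
        unfolding g_def using L2 L1 by (intro tendsto_add ennreal_tendsto_cmult_0) auto
      then show ?thesis by simp
    qed
    have "(\<lambda>k. \<integral>\<^sup>+u. a u * indicator {real (Suc k)..} u \<partial>lborel) \<longlonglongrightarrow> (\<integral>\<^sup>+u. 0 \<partial>(lborel :: real measure))"
    proof (rule nn_integral_dominated_convergence[where w = a])
      show "AE u in lborel. (\<lambda>k. a u * indicator {real (Suc k)..} u) \<longlonglongrightarrow> 0"
      proof (intro AE_I2)
        fix u :: real
        have "\<forall>\<^sub>F k in sequentially. a u * indicator {real (Suc k)..} u = 0"
          using eventually_ge_at_top[of "nat \<lceil>u\<rceil>"]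
        proof eventually_elim
          fix k assume "nat \<lceil>u\<rceil> \<le> k"
          then have "u < real (Suc k)" by linarith
          then show "a u * indicator {real (Suc k)..} u = 0" by simp
        qed
        then show "(\<lambda>k. a u * indicator {real (Suc k)..} u) \<longlonglongrightarrow> 0" by (rule tendsto_eventually)
      qed
      show "AE u in lborel. a u * indicator {real (Suc k)..} u \<le> a u" for k
        by (intro AE_I2) (simp add: indicator_def)
    qed (use a_fin in auto)
    then show "tail \<longlonglongrightarrow> 0" by (simp add: tail_def[abs_def])
    fix k n
    define k' where "k' = real (Suc k)"
    have k': "0 < k'" by (simp add: k'_def)
    have w: "1 / sqrt (2 * pi * u) \<le> 1 / sqrt u" if "0 < u" for u
    proof -
      have "1 * u \<le> 2 * pi * u" using that pi_ge_two by (intro mult_right_mono) auto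
      then show ?thesis using that by (intro divide_left_mono) auto
    qed
    let ?b = "\<lambda>u. ennreal (K / e\<^sup>2) * L2n (step_fun (d n)) * (ennreal (1 / sqrt u) * indicator {0..<k'} u)"
    let ?c = "\<lambda>u. ennreal (K / e) * (ennreal (1 / sqrt u) * L1n (\<lambda>s. 1 / sqrt s) (\<lambda>s. step_fun (d n) (s + u)) * indicator {0<..<k'} u)"
    have L1m: "(\<lambda>u. L1n (\<lambda>s. 1 / sqrt s) (\<lambda>s. step_fun (d n) (s + u))) \<in> borel_measurable borel"
    proof -
      have "(\<lambda>u. \<integral>\<^sup>+s. ennreal (\<bar>step_fun (d n) (s + u)\<bar> * (1 / sqrt s)) * indicator {0..} s \<partial>lborel) \<in> borel_measurable borel"
        by measurable
      then show ?thesis unfolding L1n_def .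
    qed
    have "emeasure W (A \<inter> ?E n) \<le> (\<integral>\<^sup>+u. a u * indicator {k'..} u + (?b u + ?c u) \<partial>lborel)"
      unfolding emeasure_W[OF sets.Int[OF A(1) E]]
    proof (rule nn_integral_mono)
      fix u :: real
      show "ennreal (1 / sqrt (2 * pi * u)) * emeasure (C u) (A \<inter> ?E n) * indicator {0<..} u
          \<le> a u * indicator {k'..} u + (?b u + ?c u)"
      proof (cases "0 < u")
        case u: True
        show ?thesis
        proof (cases "u < k'")
          case False
          have "emeasure (C u) (A \<inter> ?E n) \<le> emeasure (C u) A"
            using A by (intro emeasure_mono) (auto simp: C_basic[OF u])
          then have "ennreal (1 / sqrt (2 * pi * u)) * emeasure (C u) (A \<inter> ?E n) * indicator {0<..} u \<le> a u * indicator {k'..} u"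
            unfolding a_def using u False by (simp add: mult_left_mono)
          then show ?thesis by (rule order_trans) simp
        next
          case True
          have "emeasure (C u) (A \<inter> ?E n) \<le> emeasure (C u) (?E n)"
            using E by (intro emeasure_mono) (auto simp: C_basic[OF u])
          also have "\<dots> \<le> ennreal (K / e\<^sup>2) * L2n (step_fun (d n)) + ennreal (K / e) * L1n (\<lambda>s. 1 / sqrt s) (\<lambda>s. step_fun (d n) (s + u))"
            by (rule bd[OF bridge[OF u] u d e])
          finally have "ennreal (1 / sqrt (2 * pi * u)) * emeasure (C u) (A \<inter> ?E n)
             \<le> ennreal (1 / sqrt u) * (ennreal (K / e\<^sup>2) * L2n (step_fun (d n)) + ennreal (K / e) * L1n (\<lambda>s. 1 / sqrt s) (\<lambda>s. step_fun (d n) (s + u)))"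
            using w[OF u] by (intro mult_mono ennreal_leI) auto
          also have "\<dots> = ?b u + ?c u"
            using u True by (simp add: distrib_left ac_simps)
          finally show ?thesis using u by (simp add: add_increasing)
        qed
      qed simp
    qed
    also have "\<dots> = tail k + ((\<integral>\<^sup>+u. ?b u \<partial>lborel) + (\<integral>\<^sup>+u. ?c u \<partial>lborel))"
      using L1m unfolding tail_def k'_def[symmetric]
      by (subst nn_integral_add, measurable, subst nn_integral_add, measurable)
    also have "(\<integral>\<^sup>+u. ?b u \<partial>lborel) = ennreal (K / e\<^sup>2) * L2n (step_fun (d n)) * ennreal (2 * (sqrt k' - sqrt 0))"
      using nn_integral_inverse_sqrt[of 0 k'] k' by (subst nn_integral_cmult) auto
    also have "\<dots> = ennreal (K / e\<^sup>2) * (ennreal (2 * sqrt k') * L2n (step_fun (d n)))"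
      by (simp add: ac_simps)
    also have "(\<integral>\<^sup>+u. ?c u \<partial>lborel) \<le> ennreal (K / e) * (ennreal (4 * sqrt 2 * (1 + sqrt k')) * L1n (\<lambda>s. 1 / (1 + sqrt s)) (step_fun (d n)))"
      using L1m L1n_shift_average[of "step_fun (d n)" k'] k'
      by (subst nn_integral_cmult) (auto intro!: mult_left_mono)
    finally show "emeasure W (A \<inter> ?E n) \<le> tail k + g k n"
      unfolding g_def k'_def by (simp add: add_left_mono)
  qed
qed

end

section \<open>The functional\<close>

lemma AE_lborel_shift:
  fixes P :: "real \<Rightarrow> bool"
  assumes "AE s in lborel. P s"
  shows "AE s in lborel. P (s + u)"
proof -
  obtain N where N: "N \<in> null_sets lborel" "{s \<in> space lborel. \<not> P s} \<subseteq> N"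
    using assms by (auto simp: eventually_ae_filter)
  have "N \<in> sets borel" using N(1) by (auto simp: null_sets_def)
  then have "Measurable.pred borel (\<lambda>s. s \<notin> N)" by measurable
  then have "AE s in lborel. u + 1 * s \<notin> N"
    using AE_not_in[OF N(1)] by (intro AE_borel_affine) auto
  then show ?thesis
    by eventually_elim (use N(2) in \<open>auto simp: add.commute\<close>)
qed

lemma L2_tendsto_cong_AE:
  assumes "AE s in lborel. h s = h' s"
  shows "L2_tendsto S \<phi> h = L2_tendsto S \<phi> h'"
proof -
  have "(\<integral>\<^sup>+s\<in>S. ennreal ((step_fun (\<phi> n) s - h s)\<^sup>2) \<partial>lebesgue) =
      (\<integral>\<^sup>+s\<in>S. ennreal ((step_fun (\<phi> n) s - h' s)\<^sup>2) \<partial>lebesgue)" for n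
    unfolding nn_integral_completion using assms by (intro nn_integral_cong_AE) auto
  then show ?thesis by (simp add: L2_tendsto_def)
qed

lemma L1_tendsto_cong_AE:
  assumes "AE s in lborel. h s = h' s"
  shows "L1_tendsto \<rho> \<phi> h = L1_tendsto \<rho> \<phi> h'"
proof -
  have "(\<integral>\<^sup>+s\<in>{0..}. ennreal (\<bar>step_fun (\<phi> n) s - h s\<bar> * \<rho> s) \<partial>lebesgue) =
      (\<integral>\<^sup>+s\<in>{0..}. ennreal (\<bar>step_fun (\<phi> n) s - h' s\<bar> * \<rho> s) \<partial>lebesgue)" for n
    unfolding nn_integral_completion using assms by (intro nn_integral_cong_AE) auto
  then show ?thesis by (simp add: L1_tendsto_def)
qed

text \<open>The defining predicates depend on \<open>h\<close> only through Lebesgue integrals.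
  Integrands that agree almost everywhere give the same predicate and thus literally the same
  choice, so these are equalities of functions and not merely almost sure ones.\<close>

lemma wiener_cong_AE:
  assumes "AE s in lborel. h s = h' s"
  shows "wiener_W W h = wiener_W W h'" "wiener_bridge P u h = wiener_bridge P u h'"
    "wiener_bessel R h = wiener_bessel R h'"
  unfolding wiener_W_def is_wiener_W_def wiener_bridge_def is_wiener_bridge_def
    wiener_bessel_def is_wiener_bessel_def
    L2_tendsto_cong_AE[OF assms] L1_tendsto_cong_AE[OF assms] by simp_all

lemma ennreal_suminf_tendsto_0:
  fixes f :: "nat \<Rightarrow> ennreal"
  assumes "(\<Sum>n. f n) < \<infinity>"
  shows "f \<longlonglongrightarrow> 0"
proof -
  have fin: "f n < top" for n
  proof -
    have "f n \<le> (\<Sum>n. f n)" using sum_le_suminf[of f "{n}"] by simp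
    then show ?thesis using assms by (auto intro: le_less_trans)
  qed
  then have eq: "f n = ennreal (enn2real (f n))" for n by simp
  have "(\<Sum>n. ennreal (enn2real (f n))) \<noteq> top"
    using assms eq by (simp add: less_top[symmetric])
  then have "summable (\<lambda>n. enn2real (f n))"
    by (rule summable_suminf_not_top[rotated]) simp
  then have "(\<lambda>n. enn2real (f n)) \<longlonglongrightarrow> 0" by (rule summable_LIMSEQ_zero)
  then have "(\<lambda>n. ennreal (enn2real (f n))) \<longlonglongrightarrow> ennreal 0" by (rule tendsto_ennrealI)
  then show ?thesis using eq by simp
qed

lemma ennreal_suminf_geometric_finite:
  fixes f :: "nat \<Rightarrow> ennreal"
  assumes "\<And>n. f n \<le> ennreal (c * q ^ n)" "0 \<le> c" "0 \<le> q" "q < 1"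
  shows "(\<Sum>n. f n) < \<infinity>"
proof -
  have sm: "summable (\<lambda>n. c * q ^ n)"
    using assms by (intro summable_mult summable_geometric) auto
  have "(\<Sum>n. f n) \<le> (\<Sum>n. ennreal (c * q ^ n))"
    using assms by (intro suminf_le) auto
  also have "\<dots> \<noteq> top"
    by (rule ennreal_suminf_neq_top[OF sm]) (use assms in auto)
  then have "(\<Sum>n. ennreal (c * q ^ n)) < top" by (simp only: less_top)
  finally show ?thesis by simp
qed

lemma borel_measurable_L1n_shift:
  assumes [measurable]: "g \<in> borel_measurable borel"
  shows "(\<lambda>u. L1n (\<lambda>s. 1 / sqrt s) (\<lambda>s. g (s + u))) \<in> borel_measurable borel"
proof -
  have "(\<lambda>u. \<integral>\<^sup>+s. ennreal (\<bar>g (s + u)\<bar> * (1 / sqrt s)) * indicator {0..} s \<partial>lborel) \<in> borel_measurable borel"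
    by measurable
  then show ?thesis unfolding L1n_def .
qed

text \<open>The series is integrated over \<open>0 < u < K\<close> with weight
  \<open>1 / sqrt u\<close>. By \<open>L1n_shift_average\<close> its terms become
  \<open>2^n * 8^-n = 4^-n\<close> up to a constant, so it is finite for almost every such
  \<open>u\<close>; then \<open>K\<close> runs through the positive integers.\<close>

lemma AE_L1n_shift_summable:
  assumes g [measurable]: "\<And>n. g n \<in> borel_measurable borel"
    and le: "\<And>n. L1n (\<lambda>s. 1 / (1 + sqrt s)) (g n) \<le> ennreal (c * (1 / 8) ^ n)" and c: "0 \<le> c"
  shows "AE u in lborel. 0 < u \<longrightarrow> (\<Sum>n. ennreal (2 ^ n) * L1n (\<lambda>s. 1 / sqrt s) (\<lambda>s. g n (s + u))) < \<infinity>"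
proof -
  have [measurable]: "(\<lambda>u. L1n (\<lambda>s. 1 / sqrt s) (\<lambda>s. g n (s + u))) \<in> borel_measurable borel" for n
    by (rule borel_measurable_L1n_shift[OF g])
  let ?s = "\<lambda>u. \<Sum>n. ennreal (2 ^ n) * L1n (\<lambda>s. 1 / sqrt s) (\<lambda>s. g n (s + u))"
  have "AE u in lborel. 0 < u \<and> u < real (Suc k) \<longrightarrow> ?s u < \<infinity>" for k
  proof -
    define K where "K = real (Suc k)"
    have K: "0 < K" by (simp add: K_def)
    have "(\<integral>\<^sup>+u. ennreal (1 / sqrt u) * ?s u * indicator {0<..<K} u \<partial>lborel)
       = (\<integral>\<^sup>+u. (\<Sum>n. ennreal (2 ^ n) * (ennreal (1 / sqrt u) * L1n (\<lambda>s. 1 / sqrt s) (\<lambda>s. g n (s + u)) * indicator {0<..<K} u)) \<partial>lborel)"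
    proof (intro nn_integral_cong)
      fix u :: real
      have "ennreal (1 / sqrt u) * ?s u * indicator {0<..<K} u = (ennreal (1 / sqrt u) * indicator {0<..<K} u) * ?s u"
        by (simp only: ac_simps)
      also have "\<dots> = (\<Sum>n. (ennreal (1 / sqrt u) * indicator {0<..<K} u) * (ennreal (2 ^ n) * L1n (\<lambda>s. 1 / sqrt s) (\<lambda>s. g n (s + u))))"
        by (rule ennreal_suminf_cmult[symmetric])
      also have "\<dots> = (\<Sum>n. ennreal (2 ^ n) * (ennreal (1 / sqrt u) * L1n (\<lambda>s. 1 / sqrt s) (\<lambda>s. g n (s + u)) * indicator {0<..<K} u))"
        by (simp only: ac_simps)
      finally show "ennreal (1 / sqrt u) * ?s u * indicator {0<..<K} u = (\<Sum>n. ennreal (2 ^ n) * (ennreal (1 / sqrt u) * L1n (\<lambda>s. 1 / sqrt s) (\<lambda>s. g n (s + u)) * indicator {0<..<K} u))" .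
    qed
    also have "\<dots> = (\<Sum>n. ennreal (2 ^ n) * (\<integral>\<^sup>+u\<in>{0<..<K}. ennreal (1 / sqrt u) * L1n (\<lambda>s. 1 / sqrt s) (\<lambda>s. g n (s + u)) \<partial>lborel))"
      by (subst nn_integral_suminf, measurable, intro suminf_cong nn_integral_cmult, measurable)
    also have "\<dots> < \<infinity>"
    proof (rule ennreal_suminf_geometric_finite[where c = "4 * sqrt 2 * (1 + sqrt K) * c" and q = "1 / 4"])
      fix n
      have "ennreal (2 ^ n) * (\<integral>\<^sup>+u\<in>{0<..<K}. ennreal (1 / sqrt u) * L1n (\<lambda>s. 1 / sqrt s) (\<lambda>s. g n (s + u)) \<partial>lborel)
        \<le> ennreal (2 ^ n) * (ennreal (4 * sqrt 2 * (1 + sqrt K)) * ennreal (c * (1 / 8) ^ n))"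
        by (intro mult_left_mono order_trans[OF L1n_shift_average[OF g K]] le) auto
      also have "\<dots> = ennreal (2 ^ n * (4 * sqrt 2 * (1 + sqrt K) * (c * (1 / 8) ^ n)))"
        using K c by (simp add: ennreal_mult)
      also have "2 ^ n * (4 * sqrt 2 * (1 + sqrt K) * (c * (1 / 8) ^ n)) = 4 * sqrt 2 * (1 + sqrt K) * c * (2 ^ n * (1 / 8) ^ n)"
        by (simp only: ac_simps)
      also have "(2 ^ n * (1 / 8) ^ n :: real) = (1 / 4) ^ n"
        by (simp add: power_mult_distrib[symmetric])
      finally show "ennreal (2 ^ n) * (\<integral>\<^sup>+u\<in>{0<..<K}. ennreal (1 / sqrt u) * L1n (\<lambda>s. 1 / sqrt s) (\<lambda>s. g n (s + u)) \<partial>lborel)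
        \<le> ennreal (4 * sqrt 2 * (1 + sqrt K) * c * (1 / 4) ^ n)" .
    qed (use K c in auto)
    finally have "AE u in lborel. ennreal (1 / sqrt u) * ?s u * indicator {0<..<K} u \<noteq> \<infinity>"
      by (intro nn_integral_PInf_AE) auto
    then show ?thesis
    proof eventually_elim
      fix u assume *: "ennreal (1 / sqrt u) * ?s u * indicator {0<..<K} u \<noteq> \<infinity>"
      show "0 < u \<and> u < real (Suc k) \<longrightarrow> ?s u < \<infinity>"
      proof
        assume u: "0 < u \<and> u < real (Suc k)"
        then have "ennreal (1 / sqrt u) * ?s u \<noteq> top" using * by (simp add: K_def)
        moreover have "ennreal (1 / sqrt u) \<noteq> 0" using u by simp
        ultimately have "?s u \<noteq> top" by (auto simp: ennreal_mult_eq_top_iff)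
        then show "?s u < \<infinity>" by (simp only: less_top infinity_ennreal_def)
      qed
    qed
  qed
  then have "AE u in lborel. \<forall>k. 0 < u \<and> u < real (Suc k) \<longrightarrow> ?s u < \<infinity>"
    by (subst AE_all_countable) auto
  then show ?thesis
  proof eventually_elim
    fix u assume *: "\<forall>k. 0 < u \<and> u < real (Suc k) \<longrightarrow> ?s u < \<infinity>"
    show "0 < u \<longrightarrow> ?s u < \<infinity>"
    proof
      assume "0 < u"
      moreover have "u < real (Suc (nat \<lceil>u\<rceil>))" by linarith
      ultimately show "?s u < \<infinity>" using * by blast
    qed
  qed
qed

lemma continuous_on_step_integral_stopped:
  assumes "is_step \<phi>" "continuous_on {0..} X"
  shows "continuous_on {0..} (\<lambda>t. step_integral \<phi> (stopped t X))"
proof -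
  obtain n \<tau> c where \<phi>: "\<phi> = (n, \<tau>, c)" by (cases \<phi>)
  have "continuous_on {0..} (\<lambda>t. X (min (\<tau> k) t))" if "k \<le> n" for k
    using is_step_nonneg[of n \<tau> c k] assms(1) that
    by (intro continuous_on_compose2[OF assms(2)] continuous_intros) (auto simp: \<phi>)
  then show ?thesis
    unfolding \<phi> step_integral_triple stopped_def
    by (intro continuous_on_sum continuous_on_mult continuous_on_const continuous_on_diff) auto
qed

lemma rationals_dense_interval:
  fixes t T :: real
  assumes "0 < T" "t \<in> {0..T}"
  shows "t \<in> closure (\<rat> \<inter> {0..T})"
proof (rule iffD2[OF closure_approachable], intro allI impI)
  fix e :: real assume e: "0 < e"
  show "\<exists>q\<in>\<rat> \<inter> {0..T}. dist q t < e"
  proof (cases "t < T")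
    case True
    then obtain q where "q \<in> \<rat>" "t < q" "q < min T (t + e)"
      using Rats_dense_in_real[of t "min T (t + e)"] e by auto
    then show ?thesis using assms by (intro bexI[of _ q]) (auto simp: dist_real_def)
  next
    case False
    then have "t = T" using assms by auto
    obtain q where "q \<in> \<rat>" "max 0 (T - e) < q" "q < T"
      using Rats_dense_in_real[of "max 0 (T - e)" T] e assms by auto
    then show ?thesis using \<open>t = T\<close> by (intro bexI[of _ q]) (auto simp: dist_real_def)
  qed
qed

section \<open>Fast approximation, good paths and the limit functional\<close>

locale wiener_approximation = bessel_bridge_setup +
  fixes T :: real and f :: "real \<Rightarrow> real" and \<phi> :: "nat \<Rightarrow> step"
  assumes T: "0 < T" and f [measurable]: "f \<in> borel_measurable borel"
    and supp: "\<And>s. T \<le> s \<Longrightarrow> f s = 0"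
    and step: "\<And>n. is_step (\<phi> n)" and step_end: "\<And>n. step_end (\<phi> n) \<le> T"
    and approx: "\<And>n. L2n (\<lambda>s. step_fun (\<phi> n) s - f s) \<le> ennreal (((1 / 8) ^ n)\<^sup>2)"
begin

lemma step_fun_late: "T \<le> s \<Longrightarrow> step_fun (\<phi> n) s = 0"
  using step_fun_beyond[OF step] step_end[of n] by auto

lemma incr_ex: "\<exists>d. \<forall>n. is_step (d n) \<and> (\<forall>s. step_fun (d n) s = step_fun (\<phi> (Suc n)) s - step_fun (\<phi> n) s)
    \<and> (\<forall>Y. step_integral (d n) Y = step_integral (\<phi> (Suc n)) Y - step_integral (\<phi> n) Y)"
proof (intro choice allI)
  fix n
  obtain \<xi> where "is_step \<xi>" "\<And>s. step_fun \<xi> s = step_fun (\<phi> (Suc n)) s - step_fun (\<phi> n) s"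
    "\<And>Y. step_integral \<xi> Y = step_integral (\<phi> (Suc n)) Y - step_integral (\<phi> n) Y"
    by (rule step_diff[OF step step, of "Suc n" n]) blast
  then show "\<exists>x. is_step x \<and> (\<forall>s. step_fun x s = step_fun (\<phi> (Suc n)) s - step_fun (\<phi> n) s)
    \<and> (\<forall>Y. step_integral x Y = step_integral (\<phi> (Suc n)) Y - step_integral (\<phi> n) Y)"
    by blast
qed

text \<open>The increment of the approximating sequence as a step of its own; the choice fixes one
  common representation for its function and its integrals.\<close>

definition d :: "nat \<Rightarrow> step" where
  "d = (SOME d. \<forall>n. is_step (d n) \<and> (\<forall>s. step_fun (d n) s = step_fun (\<phi> (Suc n)) s - step_fun (\<phi> n) s)
    \<and> (\<forall>Y. step_integral (d n) Y = step_integral (\<phi> (Suc n)) Y - step_integral (\<phi> n) Y))"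

lemma d: "is_step (d n)" "step_fun (d n) s = step_fun (\<phi> (Suc n)) s - step_fun (\<phi> n) s"
  "step_integral (d n) Y = step_integral (\<phi> (Suc n)) Y - step_integral (\<phi> n) Y"
  using someI_ex[OF incr_ex] unfolding d_def[symmetric] by auto

lemma L2n_d: "L2n (step_fun (d n)) \<le> ennreal ((2 * (1 / 8) ^ n)\<^sup>2)"
proof -
  have "step_fun (d n) = (\<lambda>s. (step_fun (\<phi> (Suc n)) s - f s) - (step_fun (\<phi> n) s - f s))"
    using d(2) by auto
  then have "L2n (step_fun (d n)) \<le> 2 * L2n (\<lambda>s. step_fun (\<phi> (Suc n)) s - f s) + 2 * L2n (\<lambda>s. step_fun (\<phi> n) s - f s)"
    using L2n_diff_le[of "\<lambda>s. step_fun (\<phi> (Suc n)) s - f s" "\<lambda>s. step_fun (\<phi> n) s - f s"] by simp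
  also have "\<dots> \<le> 2 * ennreal (((1 / 8) ^ n)\<^sup>2) + 2 * ennreal (((1 / 8) ^ n)\<^sup>2)"
  proof (intro add_mono mult_left_mono approx)
    have "((1 / 8) ^ Suc n :: real) \<le> (1 / 8) ^ n" by (intro power_decreasing) auto
    then have "(((1 / 8) ^ Suc n)\<^sup>2 :: real) \<le> ((1 / 8) ^ n)\<^sup>2" by (intro power_mono) auto
    then show "L2n (\<lambda>s. step_fun (\<phi> (Suc n)) s - f s) \<le> ennreal (((1 / 8) ^ n)\<^sup>2)"
      by (intro order_trans[OF approx] ennreal_leI)
  qed auto
  also have "\<dots> = ennreal (2 * ((1 / 8) ^ n)\<^sup>2 + 2 * ((1 / 8) ^ n)\<^sup>2)"
  proof -
    have "2 * ennreal (((1 / 8) ^ n)\<^sup>2) = ennreal (2 * ((1 / 8) ^ n)\<^sup>2)"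
      by (simp add: ennreal_mult)
    then show ?thesis by (subst ennreal_plus) simp_all
  qed
  also have "2 * ((1 / 8) ^ n)\<^sup>2 + 2 * ((1 / 8) ^ n)\<^sup>2 = (2 * (1 / 8) ^ n :: real)\<^sup>2"
    by (simp add: power_mult_distrib)
  finally show ?thesis .
qed

lemma L1n_d: "L1n (\<lambda>s. 1 / (1 + sqrt s)) (step_fun (d n)) \<le> ennreal ((1 + T) * 2 * (1 / 8) ^ n)"
proof -
  have "L1n (\<lambda>s. 1 / (1 + sqrt s)) (step_fun (d n)) \<le> ennreal ((1 + T) * (2 * (1 / 8) ^ n))"
    using T by (intro L1n_le_of_L2n_le L2n_d) (auto simp: d(2) step_fun_late)
  then show ?thesis by (simp only: mult.assoc)
qed

lemma L1n_approx: "L1n (\<lambda>s. 1 / (1 + sqrt s)) (\<lambda>s. step_fun (\<phi> n) s - f s) \<le> ennreal ((1 + T) * (1 / 8) ^ n)"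
  using L1n_le_of_L2n_le[of "\<lambda>s. step_fun (\<phi> n) s - f s" T "(1 / 8) ^ n"] approx[of n] T
  by (simp add: supp step_fun_late)

lemma approx_tendsto:
  "(\<lambda>n. L2n (\<lambda>s. step_fun (\<phi> n) s - f s)) \<longlonglongrightarrow> 0"
  "(\<lambda>n. L1n (\<lambda>s. 1 / (1 + sqrt s)) (\<lambda>s. step_fun (\<phi> n) s - f s)) \<longlonglongrightarrow> 0"
proof -
  have *: "(\<lambda>n. (1 / 8) ^ n :: real) \<longlonglongrightarrow> 0" by (intro LIMSEQ_power_zero) simp
  have "(\<lambda>n. ennreal (((1 / 8) ^ n)\<^sup>2)) \<longlonglongrightarrow> ennreal (0\<^sup>2)"
    by (intro tendsto_ennrealI tendsto_power *)
  then show "(\<lambda>n. L2n (\<lambda>s. step_fun (\<phi> n) s - f s)) \<longlonglongrightarrow> 0"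
    by (intro ennreal_tendsto_0_le[OF approx]) simp
  have "(\<lambda>n. ennreal ((1 + T) * (1 / 8) ^ n)) \<longlonglongrightarrow> ennreal ((1 + T) * 0)"
    by (intro tendsto_ennrealI tendsto_mult tendsto_const *)
  then show "(\<lambda>n. L1n (\<lambda>s. 1 / (1 + sqrt s)) (\<lambda>s. step_fun (\<phi> n) s - f s)) \<longlonglongrightarrow> 0"
    by (intro ennreal_tendsto_0_le[OF L1n_approx]) simp
qed

text \<open>The \<open>u\<close> for which the exceptional events are summable under
  \<open>C u\<close>, and for which the shift of \<open>f\<close> by \<open>u\<close> is a limit of
  the shifted steps in the \<open>L1\<close> norm of the Bessel integral. The weight
  \<open>2^n\<close> is the reciprocal of the threshold in \<open>bad\<close>.\<close>

definition regular :: "real \<Rightarrow> bool" where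
  "regular u \<longleftrightarrow> 0 < u \<and>
     (\<Sum>n. ennreal (2 ^ n) * L1n (\<lambda>s. 1 / sqrt s) (\<lambda>s. step_fun (d n) (s + u))) < \<infinity> \<and>
     (\<lambda>n. L1n (\<lambda>s. 1 / sqrt s) (\<lambda>s. step_fun (\<phi> n) (s + u) - f (s + u))) \<longlonglongrightarrow> 0"

lemma AE_regular: "AE u in lborel. 0 < u \<longrightarrow> regular u"
proof -
  have 1: "AE u in lborel. 0 < u \<longrightarrow> (\<Sum>n. ennreal (2 ^ n) * L1n (\<lambda>s. 1 / sqrt s) (\<lambda>s. step_fun (d n) (s + u))) < \<infinity>"
    using T by (intro AE_L1n_shift_summable[OF _ L1n_d]) auto
  have 2: "AE u in lborel. 0 < u \<longrightarrow> (\<Sum>n. ennreal (2 ^ n) * L1n (\<lambda>s. 1 / sqrt s) (\<lambda>s. step_fun (\<phi> n) (s + u) - f (s + u))) < \<infinity>"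
    using T by (intro AE_L1n_shift_summable[of "\<lambda>n s. step_fun (\<phi> n) s - f s", OF _ L1n_approx]) auto
  from 1 2 show ?thesis
  proof eventually_elim
    fix u
    let ?l = "\<lambda>n. L1n (\<lambda>s. 1 / sqrt s) (\<lambda>s. step_fun (\<phi> n) (s + u) - f (s + u))"
    assume *: "0 < u \<longrightarrow> (\<Sum>n. ennreal (2 ^ n) * L1n (\<lambda>s. 1 / sqrt s) (\<lambda>s. step_fun (d n) (s + u))) < \<infinity>"
      "0 < u \<longrightarrow> (\<Sum>n. ennreal (2 ^ n) * ?l n) < \<infinity>"
    show "0 < u \<longrightarrow> regular u"
    proof
      assume u: "0 < u"
      have "(\<lambda>n. ennreal (2 ^ n) * ?l n) \<longlonglongrightarrow> 0"
        using *(2) u by (intro ennreal_suminf_tendsto_0) auto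
      then have "?l \<longlonglongrightarrow> 0"
      proof (rule ennreal_tendsto_0_le[rotated])
        fix n
        have "(1::real) \<le> 2 ^ n" by simp
        then have "ennreal 1 \<le> ennreal (2 ^ n)" by (rule ennreal_leI)
        then have "1 * ?l n \<le> ennreal (2 ^ n) * ?l n" by (intro mult_right_mono) auto
        then show "?l n \<le> ennreal (2 ^ n) * ?l n" by simp
      qed
      then show "regular u" using *(1) u by (simp add: regular_def)
    qed
  qed
qed

text \<open>The level \<open>2^-n\<close> is inserted into the maximal inequality. The
  \<open>L2\<close> part is at most \<open>4 * K\<close> times the square of
  \<open>8^-n / 2^-n\<close>, that is \<open>4 * K * 16^-n\<close>; the \<open>L1\<close> part is
  \<open>K\<close> times the series in the definition of \<open>regular\<close>.\<close>

lemma threshold_bound_finite: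
  assumes "regular u" "0 \<le> K"
  shows "(\<Sum>n. ennreal (K / ((1 / 2) ^ n)\<^sup>2) * L2n (step_fun (d n)) +
      ennreal (K / (1 / 2) ^ n) * L1n (\<lambda>s. 1 / sqrt s) (\<lambda>s. step_fun (d n) (s + u))) < \<infinity>"
proof -
  have "(\<Sum>n. ennreal (K / ((1 / 2) ^ n)\<^sup>2) * L2n (step_fun (d n))) < \<infinity>"
  proof (rule ennreal_suminf_geometric_finite[where c = "4 * K" and q = "1 / 16"])
    fix n
    have "ennreal (K / ((1 / 2) ^ n)\<^sup>2) * L2n (step_fun (d n)) \<le> ennreal (K / ((1 / 2) ^ n)\<^sup>2) * ennreal ((2 * (1 / 8) ^ n)\<^sup>2)"
      by (intro mult_left_mono L2n_d) simp
    also have "\<dots> = ennreal (K / ((1 / 2) ^ n)\<^sup>2 * (2 * (1 / 8) ^ n)\<^sup>2)"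
      by (rule ennreal_mult[symmetric]) (use assms(2) in auto)
    also have "K / ((1 / 2) ^ n)\<^sup>2 * (2 * (1 / 8) ^ n)\<^sup>2 = 4 * K * ((1 / 8) ^ n / (1 / 2) ^ n)\<^sup>2"
      by (simp add: power_divide power_mult_distrib)
    also have "((1 / 8) ^ n / (1 / 2) ^ n :: real) = (1 / 4) ^ n"
      by (simp add: power_divide[symmetric])
    also have "((1 / 4) ^ n)\<^sup>2 = (1 / 16 :: real) ^ n"
      by (simp add: power2_eq_square power_mult_distrib[symmetric])
    finally show "ennreal (K / ((1 / 2) ^ n)\<^sup>2) * L2n (step_fun (d n)) \<le> ennreal (4 * K * (1 / 16) ^ n)" .
  qed (use assms in auto)
  moreover have "(\<Sum>n. ennreal (K / (1 / 2) ^ n) * L1n (\<lambda>s. 1 / sqrt s) (\<lambda>s. step_fun (d n) (s + u))) < \<infinity>"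
  proof -
    have "ennreal (K / (1 / 2) ^ n) = ennreal K * ennreal (2 ^ n)" for n
      using assms(2) by (simp add: ennreal_mult power_one_over)
    then have "(\<Sum>n. ennreal (K / (1 / 2) ^ n) * L1n (\<lambda>s. 1 / sqrt s) (\<lambda>s. step_fun (d n) (s + u)))
       = ennreal K * (\<Sum>n. ennreal (2 ^ n) * L1n (\<lambda>s. 1 / sqrt s) (\<lambda>s. step_fun (d n) (s + u)))"
      by (simp add: mult.assoc ennreal_suminf_cmult)
    also have "\<dots> < \<infinity>"
      using assms(1) by (simp add: regular_def ennreal_mult_less_top)
    finally show ?thesis .
  qed
  ultimately show ?thesis
    by (subst suminf_add[symmetric]) (auto simp: ennreal_add_eq_top less_top)
qed

abbreviation Q :: "real set" where "Q \<equiv> \<rat> \<inter> {0..T}"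

text \<open>Rational times keep the event measurable; by continuity of the stopped integrals in
  \<open>t\<close> they control all of \<open>[0, T]\<close>.\<close>

definition bad :: "nat \<Rightarrow> (real \<Rightarrow> real) set" where
  "bad n = {X \<in> space Omega. \<exists>t\<in>Q. (1 / 2) ^ n \<le> \<bar>step_integral (d n) (stopped t X)\<bar>}"

text \<open>The paths on which the Borel-Cantelli argument succeeds. The set is described by the
  path alone and so has full measure under every regular \<open>C u\<close> and under
  \<open>W\<close> alike.\<close>

definition good :: "(real \<Rightarrow> real) set" where
  "good = {X \<in> space Omega. \<forall>\<^sub>F n in sequentially. X \<notin> bad n}"

lemma Q: "countable Q" "Q \<noteq> {}" "Q \<subseteq> {0..}"
proof -
  show "countable Q" using countable_rat by (rule countable_subset[rotated]) auto
  have "0 \<in> Q" using T by simp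
  then show "Q \<noteq> {}" by blast
qed auto

lemma bad_sets: "bad n \<in> sets Omega"
  and bad_le: "sets M = sets Omega \<Longrightarrow>
    (\<And>F. finite F \<Longrightarrow> F \<subseteq> {0..} \<Longrightarrow>
      emeasure M {X \<in> space Omega. \<exists>t\<in>F. (1 / 2) ^ n \<le> \<bar>step_integral (d n) (stopped t X)\<bar>} \<le> b) \<Longrightarrow>
    emeasure M (bad n) \<le> b"
proof -
  have ev: "{X \<in> space Omega. (1 / 2) ^ n \<le> \<bar>step_integral (d n) (stopped t X)\<bar>} \<in> sets Omega" if "t \<in> Q" for t
    using step_event_sets[of "d n" "{t}" "{0..}"] d(1) that by simp
  show "bad n \<in> sets Omega"
    unfolding bad_def by (rule emeasure_countable_ex_le(1)[OF Q(1,2), where b = top]) (use ev in auto)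
  assume M: "sets M = sets Omega"
    and b: "\<And>F. finite F \<Longrightarrow> F \<subseteq> {0..} \<Longrightarrow>
      emeasure M {X \<in> space Omega. \<exists>t\<in>F. (1 / 2) ^ n \<le> \<bar>step_integral (d n) (stopped t X)\<bar>} \<le> b"
  have sp: "space M = space Omega" using M by (rule sets_eq_imp_space_eq)
  show "emeasure M (bad n) \<le> b"
    unfolding bad_def sp[symmetric]
  proof (rule emeasure_countable_ex_le(2)[OF Q(1,2)])
    show "{X \<in> space M. (1 / 2) ^ n \<le> \<bar>step_integral (d n) (stopped t X)\<bar>} \<in> sets M" if "t \<in> Q" for t
      using ev[OF that] by (simp add: M sp)
    show "emeasure M {X \<in> space M. \<exists>t\<in>F. (1 / 2) ^ n \<le> \<bar>step_integral (d n) (stopped t X)\<bar>} \<le> b"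
      if "finite F" "F \<subseteq> Q" for F
      using b[of F] that Q(3) by (auto simp: sp)
  qed
qed

lemma good_sets: "good \<in> sets Omega"
proof -
  have "good = (\<Union>N. \<Inter>n\<in>{N..}. space Omega - bad n)"
    by (auto simp: good_def eventually_sequentially)
  also have "\<dots> \<in> sets Omega"
    using bad_sets by (intro sets.countable_UN sets.countable_INT' image_subsetI) auto
  finally show ?thesis .
qed

lemma AE_C_good:
  assumes u: "regular u"
  shows "AE X in C u. X \<in> good"
proof -
  have u0: "0 < u" using u by (simp add: regular_def)
  obtain K where K: "0 \<le> K" and max: "\<And>u P \<sigma> Q l. brownian_bridge_law u P \<Longrightarrow> 0 < u \<Longrightarrow> is_step \<sigma> \<Longrightarrow> finite Q \<Longrightarrow> Q \<subseteq> {0..} \<Longrightarrow> 0 < l \<Longrightarrow>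
      emeasure (concat_law u P R) {X \<in> space Omega. \<exists>t\<in>Q. l \<le> \<bar>step_integral \<sigma> (stopped t X)\<bar>}
      \<le> ennreal (K / l\<^sup>2) * L2n (step_fun \<sigma>) + ennreal (K / l) * L1n (\<lambda>s. 1 / sqrt s) (\<lambda>s. step_fun \<sigma> (s + u))"
    unfolding R_eq by (rule concat_maximal[OF bessel]) blast
  have "emeasure (C u) (bad n) \<le> ennreal (K / ((1 / 2) ^ n)\<^sup>2) * L2n (step_fun (d n)) +
      ennreal (K / (1 / 2) ^ n) * L1n (\<lambda>s. 1 / sqrt s) (\<lambda>s. step_fun (d n) (s + u))" for n
    by (rule bad_le[OF C_basic(2)[OF u0]]) (rule max[OF bridge[OF u0] u0 d(1)], auto)
  then have "AE X in C u. \<forall>\<^sub>F n in sequentially. X \<notin> bad n"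
    using bad_sets threshold_bound_finite[OF u K] C_basic(2)[OF u0]
    by (intro AE_eventually_notin[where b = "\<lambda>n. ennreal (K / ((1 / 2) ^ n)\<^sup>2) * L2n (step_fun (d n)) +
      ennreal (K / (1 / 2) ^ n) * L1n (\<lambda>s. 1 / sqrt s) (\<lambda>s. step_fun (d n) (s + u))"]) auto
  with AE_space show ?thesis
    by eventually_elim (simp add: good_def C_basic(3)[OF u0])
qed

lemma AE_W_good: "AE X in W. X \<in> good"
proof (rule AE_W)
  have "{X \<in> space Omega. X \<in> good} = good" by (auto simp: good_def)
  then show "{X \<in> space Omega. X \<in> good} \<in> sets Omega" using good_sets by simp
  show "AE u in lborel. 0 < u \<longrightarrow> (AE X in C u. X \<in> good)"
    using AE_regular by eventually_elim (auto intro: AE_C_good)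
qed

text \<open>The value 0 off \<open>good\<close> makes \<open>t \<mapsto> J t X\<close> continuous
  for every path, as \<open>is_wiener_W_process\<close> demands on the whole space.\<close>

definition J :: "real \<Rightarrow> (real \<Rightarrow> real) \<Rightarrow> real" where
  "J t X = (if X \<in> good then step_integral (\<phi> 0) (stopped t X) + (\<Sum>n. step_integral (d n) (stopped t X)) else 0)"

lemma partial_sums: "step_integral (\<phi> n) Y = step_integral (\<phi> 0) Y + (\<Sum>i<n. step_integral (d i) Y)"
  by (induction n) (simp_all add: d(3))

text \<open>Weierstrass test with \<open>2^-n\<close>: outside \<open>bad n\<close> the bound holds
  at rational times and extends to their closure because the stopped integral is continuous in
  \<open>t\<close>.\<close>

lemma good_uniform:
  assumes X: "X \<in> good"
  shows "uniform_limit {0..T} (\<lambda>n t. \<Sum>i<n. step_integral (d i) (stopped t X))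
    (\<lambda>t. \<Sum>i. step_integral (d i) (stopped t X)) sequentially"
proof (rule Weierstrass_m_test_ev)
  have c: "continuous_on {0..} X" and Xs: "X \<in> space Omega"
    using X by (auto simp: good_def space_path_space)
  have "\<forall>\<^sub>F n in sequentially. X \<notin> bad n" using X by (simp add: good_def)
  then show "\<forall>\<^sub>F n in sequentially. \<forall>t\<in>{0..T}. norm (step_integral (d n) (stopped t X)) \<le> (1 / 2) ^ n"
  proof eventually_elim
    fix n assume n: "X \<notin> bad n"
    show "\<forall>t\<in>{0..T}. norm (step_integral (d n) (stopped t X)) \<le> (1 / 2) ^ n"
    proof
      fix t assume "t \<in> {0..T}"
      then have t: "t \<in> closure Q" by (rule rationals_dense_interval[OF T])
      have "closure Q \<subseteq> {0..T}" by (rule closure_minimal) auto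
      then have "continuous_on (closure Q) (\<lambda>t. \<bar>step_integral (d n) (stopped t X)\<bar>)"
        by (intro continuous_on_rabs continuous_on_subset[OF continuous_on_step_integral_stopped[OF d(1) c]]) auto
      then have "\<bar>step_integral (d n) (stopped t X)\<bar> \<le> (1 / 2) ^ n"
        by (rule continuous_le_on_closure[OF _ t]) (use n Xs in \<open>auto simp: bad_def not_le less_imp_le\<close>)
      then show "norm (step_integral (d n) (stopped t X)) \<le> (1 / 2) ^ n" by simp
    qed
  qed
qed (simp add: summable_geometric)

lemma good_limit:
  assumes "X \<in> good" "t \<in> {0..T}"
  shows "(\<lambda>n. step_integral (\<phi> n) (stopped t X)) \<longlonglongrightarrow> J t X"
proof -
  have "(\<lambda>n. \<Sum>i<n. step_integral (d i) (stopped t X)) \<longlonglongrightarrow> (\<Sum>i. step_integral (d i) (stopped t X))"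
    by (rule tendsto_uniform_limitI[OF good_uniform[OF assms(1)] assms(2)])
  then have "(\<lambda>n. step_integral (\<phi> 0) (stopped t X) + (\<Sum>i<n. step_integral (d i) (stopped t X))) \<longlonglongrightarrow> J t X"
    unfolding J_def using assms(1) by (simp add: tendsto_add[OF tendsto_const])
  then show ?thesis by (simp only: partial_sums[symmetric])
qed

lemma J_continuous: "continuous_on {0..T} (\<lambda>t. J t X)"
proof (cases "X \<in> good")
  case True
  then have c: "continuous_on {0..} X" by (auto simp: good_def space_path_space)
  have sc: "continuous_on {0..T} (\<lambda>t. step_integral \<sigma> (stopped t X))" if "is_step \<sigma>" for \<sigma>
    by (rule continuous_on_subset[OF continuous_on_step_integral_stopped[OF that c]]) auto
  have "continuous_on {0..T} (\<lambda>t. \<Sum>i. step_integral (d i) (stopped t X))"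
    by (rule uniform_limit_theorem[OF _ good_uniform[OF True]])
      (auto intro!: always_eventually continuous_on_sum sc d(1))
  then show ?thesis
    using True sc[OF step] by (simp add: J_def continuous_on_add)
qed (simp add: J_def)

text \<open>Both the time and the path are measurable functions on an arbitrary space. This covers
  joint measurability on a product and, with constant time, measurability of each
  \<open>J t\<close>.\<close>

lemma J_measurable:
  assumes t: "t \<in> borel_measurable M" and X: "X \<in> measurable M Omega"
    and pos: "\<And>\<omega>. \<omega> \<in> space M \<Longrightarrow> 0 \<le> t \<omega>"
  shows "(\<lambda>\<omega>. J (t \<omega>) (X \<omega>)) \<in> borel_measurable M"
proof -
  note [measurable] = t
  have st [measurable]: "(\<lambda>\<omega>. step_integral \<sigma> (stopped (t \<omega>) (X \<omega>))) \<in> borel_measurable M" if \<sigma>: "is_step \<sigma>" for \<sigma>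
  proof -
    obtain n \<tau> c where eq: "\<sigma> = (n, \<tau>, c)" by (cases \<sigma>)
    have ev: "(\<lambda>\<omega>. X \<omega> (min (\<tau> k) (t \<omega>))) \<in> borel_measurable M" if "k \<le> n" for k
      using is_step_nonneg[of n \<tau> c k] \<sigma> that pos
      by (intro measurable_eval[OF _ X]) (auto simp: eq)
    show ?thesis
      unfolding eq step_integral_triple stopped_def
      by (intro borel_measurable_sum borel_measurable_times borel_measurable_diff borel_measurable_const ev) auto
  qed
  have 1 [measurable]: "(\<lambda>\<omega>. step_integral (\<phi> 0) (stopped (t \<omega>) (X \<omega>))) \<in> borel_measurable M" by (rule st[OF step])
  have 2 [measurable]: "(\<lambda>\<omega>. step_integral (d n) (stopped (t \<omega>) (X \<omega>))) \<in> borel_measurable M" for n by (rule st[OF d(1)])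
  have "{\<omega> \<in> space M. X \<omega> \<in> good} = X -` good \<inter> space M" by auto
  then have [measurable]: "{\<omega> \<in> space M. X \<omega> \<in> good} \<in> sets M"
    using measurable_sets[OF X good_sets] by simp
  show ?thesis
    unfolding J_def by measurable
qed

lemma J_W_measurable: "t \<in> {0..T} \<Longrightarrow> J t \<in> borel_measurable W"
  by (rule J_measurable) (auto simp: measurable_cong_sets[OF W_sets(1) refl])

lemma restricted_steps:
  assumes "t \<in> {0..T}"
  obtains g where "\<And>n. is_step (g n)" "\<And>n Y. step_integral (g n) Y = step_integral (\<phi> n) (stopped t Y)"
    "(\<lambda>n. L2n (\<lambda>s. step_fun (g n) s - indicator {0..<t} s * f s)) \<longlonglongrightarrow> 0"
    "(\<lambda>n. L1n (\<lambda>s. 1 / (1 + sqrt s)) (\<lambda>s. step_fun (g n) s - indicator {0..<t} s * f s)) \<longlonglongrightarrow> 0"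
proof -
  have "\<exists>g. \<forall>n. is_step (g n) \<and> (\<forall>s. step_fun (g n) s = indicator {0..<t} s * step_fun (\<phi> n) s)
      \<and> (\<forall>Y. step_integral (g n) Y = step_integral (\<phi> n) (stopped t Y))"
  proof (intro choice allI)
    fix n
    obtain \<xi> where "is_step \<xi>" "\<And>s. step_fun \<xi> s = indicator {0..<t} s * step_fun (\<phi> n) s"
      "\<And>Y. step_integral \<xi> Y = step_integral (\<phi> n) (stopped t Y)"
      using assms by (rule_tac step_restrict[OF step[of n], of t]) auto
    then show "\<exists>x. is_step x \<and> (\<forall>s. step_fun x s = indicator {0..<t} s * step_fun (\<phi> n) s)
      \<and> (\<forall>Y. step_integral x Y = step_integral (\<phi> n) (stopped t Y))"
      by blast
  qed
  then obtain g where g: "\<And>n. is_step (g n)" "\<And>n s. step_fun (g n) s = indicator {0..<t} s * step_fun (\<phi> n) s"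
    "\<And>n Y. step_integral (g n) Y = step_integral (\<phi> n) (stopped t Y)"
    by blast
  have eq: "step_fun (g n) s - indicator {0..<t} s * f s = indicator {0..<t} s * (step_fun (\<phi> n) s - f s)" for n s
    by (simp add: g(2) algebra_simps)
  show ?thesis
  proof (rule that[OF g(1,3)])
    show "(\<lambda>n. L2n (\<lambda>s. step_fun (g n) s - indicator {0..<t} s * f s)) \<longlonglongrightarrow> 0"
      unfolding eq by (rule ennreal_tendsto_0_le[OF L2n_restrict_le[where A = "{0..<t}"] approx_tendsto(1)]) simp
    show "(\<lambda>n. L1n (\<lambda>s. 1 / (1 + sqrt s)) (\<lambda>s. step_fun (g n) s - indicator {0..<t} s * f s)) \<longlonglongrightarrow> 0"
      unfolding eq
    proof (rule ennreal_tendsto_0_le[OF _ approx_tendsto(2)])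
      show "L1n (\<lambda>s. 1 / (1 + sqrt s)) (\<lambda>s. indicator {0..<t} s * (step_fun (\<phi> n) s - f s))
          \<le> L1n (\<lambda>s. 1 / (1 + sqrt s)) (\<lambda>s. step_fun (\<phi> n) s - f s)" for n
        unfolding L1n_def by (intro nn_integral_mono) (auto simp: indicator_def)
    qed
  qed
qed

text \<open>The argument of \<open>is_wiener_bessel_limit\<close> for a measure of infinite mass:
  \<open>J t\<close> is a local limit along every admissible sequence, so the predicate is
  inhabited, and \<open>W_local_limit_unique\<close> identifies the chosen member with
  \<open>J t\<close>.\<close>

lemma wiener_W_eq_J:
  assumes t: "t \<in> {0..T}"
  shows "AE X in W. J t X = wiener_W W (\<lambda>s. indicator {0..<t} s * f s) X"
proof -
  let ?h = "\<lambda>s. indicator {0..<t} s * f s"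
  obtain g where g: "\<And>n. is_step (g n)" "\<And>n Y. step_integral (g n) Y = step_integral (\<phi> n) (stopped t Y)"
    "(\<lambda>n. L2n (\<lambda>s. step_fun (g n) s - ?h s)) \<longlonglongrightarrow> 0"
    "(\<lambda>n. L1n (\<lambda>s. 1 / (1 + sqrt s)) (\<lambda>s. step_fun (g n) s - ?h s)) \<longlonglongrightarrow> 0"
    by (rule restricted_steps[OF t]) blast
  have gm: "step_integral (g n) \<in> borel_measurable W" for n
    by (rule step_integral_W_measurable[OF g(1)])
  note Jm = J_W_measurable[OF t]
  have h: "?h \<in> borel_measurable borel" by measurable
  have lim: "AE X in W. (\<lambda>n. step_integral (g n) X) \<longlonglongrightarrow> J t X"
    using AE_W_good by eventually_elim (simp add: g(2) good_limit[OF _ t])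
  have gJ: "(\<lambda>n. emeasure W (A \<inter> {X \<in> space W. e \<le> \<bar>step_integral (g n) X - J t X\<bar>})) \<longlonglongrightarrow> 0"
    if "A \<in> sets W" "emeasure W A < \<infinity>" "0 < e" for A e
    by (rule AE_tendsto_imp_emeasure_tendsto[OF gm Jm that(1,2) _ that(3)]) (use lim in auto)
  have J: "is_wiener_W W ?h (J t)"
    unfolding is_wiener_W_def
  proof (intro conjI allI impI ballI Jm)
    fix \<eta> and e :: real and A
    assume \<eta>: "(\<forall>n. is_step (\<eta> n)) \<and> L2_tendsto {0..} \<eta> ?h \<and> L1_tendsto (\<lambda>s. 1 / (1 + sqrt s)) \<eta> ?h"
      and e: "0 < e" and A: "A \<in> sets W" "emeasure W A < \<infinity>"
    have st: "is_step (\<eta> n)" for n using \<eta> by simp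
    have \<eta>m: "step_integral (\<eta> n) \<in> borel_measurable W" for n
      by (rule step_integral_W_measurable[OF st])
    have "\<exists>x. \<forall>n. is_step (x n) \<and> (\<forall>s. step_fun (x n) s = step_fun (\<eta> n) s - step_fun (g n) s)
      \<and> (\<forall>Y. step_integral (x n) Y = step_integral (\<eta> n) Y - step_integral (g n) Y)"
    proof (intro choice allI)
      fix n
      obtain \<xi> where "is_step \<xi>" "\<And>s. step_fun \<xi> s = step_fun (\<eta> n) s - step_fun (g n) s"
        "\<And>Y. step_integral \<xi> Y = step_integral (\<eta> n) Y - step_integral (g n) Y"
        by (rule step_diff[OF st[of n] g(1)[of n]]) blast
      then show "\<exists>x. is_step x \<and> (\<forall>s. step_fun x s = step_fun (\<eta> n) s - step_fun (g n) s)
        \<and> (\<forall>Y. step_integral x Y = step_integral (\<eta> n) Y - step_integral (g n) Y)"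
        by blast
    qed
    then obtain x where x: "\<And>n. is_step (x n)" "\<And>n s. step_fun (x n) s = step_fun (\<eta> n) s - step_fun (g n) s"
      "\<And>n Y. step_integral (x n) Y = step_integral (\<eta> n) Y - step_integral (g n) Y"
      by blast
    have xf: "step_fun (x n) = (\<lambda>s. step_fun (\<eta> n) s - step_fun (g n) s)" for n using x(2) by auto
    have L2: "(\<lambda>n. L2n (step_fun (x n))) \<longlonglongrightarrow> 0"
      unfolding xf
      by (rule L2n_diff_tendsto_0[OF _ _ h _ g(3)]) (use \<eta> in \<open>auto simp: L2_tendsto_halfline\<close>)
    have L1: "(\<lambda>n. L1n (\<lambda>s. 1 / (1 + sqrt s)) (step_fun (x n))) \<longlonglongrightarrow> 0"
      unfolding xf
      by (rule L1n_diff_tendsto_0[OF _ _ h _ _ _ g(4)]) (use \<eta> in \<open>auto simp: L1_tendsto_iff\<close>)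
    have "(\<lambda>n. emeasure W (A \<inter> {X \<in> space W. e \<le> \<bar>step_integral (\<eta> n) X - step_integral (g n) X\<bar>})) \<longlonglongrightarrow> 0"
      if "0 < e" for e
      using step_integral_tendsto_0_locally[OF x(1) L2 L1 _ A(2) that] A(1)
      by (simp add: x(3) W_sets)
    then show "(\<lambda>n. emeasure W (A \<inter> {X \<in> space W. e \<le> \<bar>step_integral (\<eta> n) X - J t X\<bar>})) \<longlonglongrightarrow> 0"
      by (rule emeasure_triangle_tendsto_0[OF \<eta>m gm Jm A(1) _ gJ[OF A] e])
  qed
  then have Ww: "is_wiener_W W ?h (wiener_W W ?h)"
    unfolding wiener_W_def by (rule someI[where P = "is_wiener_W W ?h"])
  have "(\<forall>n. is_step (g n)) \<and> L2_tendsto {0..} g ?h \<and> L1_tendsto (\<lambda>s. 1 / (1 + sqrt s)) g ?h"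
    using g by (simp add: L2_tendsto_halfline L1_tendsto_iff)
  then have gW: "(\<lambda>n. emeasure W (A \<inter> {X \<in> space W. e \<le> \<bar>step_integral (g n) X - wiener_W W ?h X\<bar>})) \<longlonglongrightarrow> 0"
    if "A \<in> sets W" "emeasure W A < \<infinity>" "0 < e" for A e
    using Ww that unfolding is_wiener_W_def by blast
  have "wiener_W W ?h \<in> borel_measurable W" using Ww by (simp add: is_wiener_W_def)
  then show ?thesis
    by (rule W_local_limit_unique[OF gm Jm _ gJ gW])
qed

text \<open>On matching pieces the approximants split exactly by
  \<open>step_integral_concat\<close>. The two summands converge almost surely to the bridge and the
  Bessel integral, and on a good path the sum converges to \<open>J t\<close>, so uniqueness of real
  limits gives the identity.\<close>

lemma decomposition:
  assumes u: "regular u" and t: "t \<in> {0..T}"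
  shows "AE X in C u. J t X =
     wiener_bridge (B u) u (\<lambda>s. indicator {0..<min u t} s * f s) (restrict X {0..u}) +
     wiener_bessel R (\<lambda>s. indicator {0..<max (t - u) 0} s * f (s + u)) (shift_path u X)"
proof -
  have u0: "0 < u" using u by (simp add: regular_def)
  note law = bridge[OF u0] u0
  note P = bridge_law_basic[OF law]
  let ?h1 = "\<lambda>s. indicator {0..<min u t} s * f s"
  let ?h2 = "\<lambda>s. indicator {0..<max (t - u) 0} s * f (s + u)"
  have t1: "0 \<le> min u t" "min u t \<le> u" "0 \<le> max (t - u) 0" using t u0 by auto
  have "\<exists>\<xi>. \<forall>n. is_step (\<xi> n) \<and> (\<forall>s. step_fun (\<xi> n) s = indicator {0..<min u t} s * step_fun (\<phi> n) s)
      \<and> (\<forall>Y. step_integral (\<xi> n) Y = step_integral (\<phi> n) (stopped (min u t) Y)) \<and> step_end (\<xi> n) \<le> u"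
  proof (intro choice allI)
    fix n
    obtain \<xi> where "is_step \<xi>" "\<And>s. step_fun \<xi> s = indicator {0..<min u t} s * step_fun (\<phi> n) s"
      "\<And>Y. step_integral \<xi> Y = step_integral (\<phi> n) (stopped (min u t) Y)" "step_end \<xi> = min u t"
      by (rule step_restrict[OF step[of n] t1(1)]) blast
    then show "\<exists>\<xi>. is_step \<xi> \<and> (\<forall>s. step_fun \<xi> s = indicator {0..<min u t} s * step_fun (\<phi> n) s)
      \<and> (\<forall>Y. step_integral \<xi> Y = step_integral (\<phi> n) (stopped (min u t) Y)) \<and> step_end \<xi> \<le> u"
      by (intro exI[of _ \<xi>]) auto
  qed
  then obtain \<xi> where \<xi>: "\<And>n. is_step (\<xi> n)" "\<And>n s. step_fun (\<xi> n) s = indicator {0..<min u t} s * step_fun (\<phi> n) s"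
    "\<And>n Y. step_integral (\<xi> n) Y = step_integral (\<phi> n) (stopped (min u t) Y)" "\<And>n. step_end (\<xi> n) \<le> u"
    by blast
  have "\<exists>\<zeta>. \<forall>n. is_step (\<zeta> n) \<and> (\<forall>s. step_fun (\<zeta> n) s = indicator {0..<max (t - u) 0} s * step_fun (\<phi> n) (s + u))
      \<and> (\<forall>Y. step_integral (\<zeta> n) Y = step_integral (\<phi> n) (\<lambda>b. stopped (max (t - u) 0) Y (max (b - u) 0)))"
  proof (intro choice allI)
    fix n
    obtain \<sigma> where \<sigma>: "is_step \<sigma>" "\<And>s. step_fun \<sigma> s = indicator {0..} s * step_fun (\<phi> n) (s + u)"
      "\<And>Y. step_integral \<sigma> Y = step_integral (\<phi> n) (\<lambda>b. Y (max (b - u) 0))"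
      by (rule step_shift[OF step[of n], of u]) (use u0 in auto)
    obtain \<zeta> where "is_step \<zeta>" "\<And>s. step_fun \<zeta> s = indicator {0..<max (t - u) 0} s * step_fun \<sigma> s"
      "\<And>Y. step_integral \<zeta> Y = step_integral \<sigma> (stopped (max (t - u) 0) Y)"
      by (rule step_restrict[OF \<sigma>(1) t1(3)]) blast
    then show "\<exists>\<zeta>. is_step \<zeta> \<and> (\<forall>s. step_fun \<zeta> s = indicator {0..<max (t - u) 0} s * step_fun (\<phi> n) (s + u))
      \<and> (\<forall>Y. step_integral \<zeta> Y = step_integral (\<phi> n) (\<lambda>b. stopped (max (t - u) 0) Y (max (b - u) 0)))"
      by (intro exI[of _ \<zeta>]) (auto simp: \<sigma> indicator_def)
  qed
  then obtain \<zeta> where \<zeta>: "\<And>n. is_step (\<zeta> n)" "\<And>n s. step_fun (\<zeta> n) s = indicator {0..<max (t - u) 0} s * step_fun (\<phi> n) (s + u)"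
    "\<And>n Y. step_integral (\<zeta> n) Y = step_integral (\<phi> n) (\<lambda>b. stopped (max (t - u) 0) Y (max (b - u) 0))"
    by blast
  \<comment> \<open>\<open>\<delta> n\<close> is the shifted increment without truncation.
    Increments of \<open>\<zeta>\<close> are its integrals stopped at \<open>max (t - u) 0\<close>,
    the form in which the maximal inequality bounds them.\<close>
  have "\<exists>\<delta>. \<forall>n. is_step (\<delta> n) \<and> (\<forall>s. step_fun (\<delta> n) s = indicator {0..} s * step_fun (d n) (s + u))
      \<and> (\<forall>Y. step_integral (\<delta> n) Y = step_integral (d n) (\<lambda>b. Y (max (b - u) 0)))"
  proof (intro choice allI)
    fix n
    obtain \<delta> where "is_step \<delta>" "\<And>s. step_fun \<delta> s = indicator {0..} s * step_fun (d n) (s + u)"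
      "\<And>Y. step_integral \<delta> Y = step_integral (d n) (\<lambda>b. Y (max (b - u) 0))"
      by (rule step_shift[OF d(1)[of n], of u]) (use u0 in auto)
    then show "\<exists>\<delta>. is_step \<delta> \<and> (\<forall>s. step_fun \<delta> s = indicator {0..} s * step_fun (d n) (s + u))
      \<and> (\<forall>Y. step_integral \<delta> Y = step_integral (d n) (\<lambda>b. Y (max (b - u) 0)))"
      by blast
  qed
  then obtain \<delta> where \<delta>: "\<And>n. is_step (\<delta> n)" "\<And>n s. step_fun (\<delta> n) s = indicator {0..} s * step_fun (d n) (s + u)"
    "\<And>n Y. step_integral (\<delta> n) Y = step_integral (d n) (\<lambda>b. Y (max (b - u) 0))"
    by blast
  have conv1: "AE x in B u. convergent (\<lambda>n. step_integral (\<xi> n) x)"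
  proof -
    let ?E = "\<lambda>n. {x \<in> space (path_space {0..u}). \<exists>r\<in>{min u t}. (1 / 2) ^ n \<le> \<bar>step_integral (d n) (stopped r x)\<bar>}"
    have K: "0 \<le> 68 * wconst 1" using wconst_pos[of 1] by simp
    have "AE x in B u. \<forall>\<^sub>F n in sequentially. x \<notin> ?E n"
    proof (rule AE_eventually_notin)
      show "?E n \<in> sets (B u)" for n
        unfolding P(2) using t1 by (intro step_event_sets d(1)) auto
      \<comment> \<open>The bridge bound has only an \<open>L2\<close> term; the \<open>L1\<close>
        term is added so that \<open>threshold_bound_finite\<close> covers this series too.\<close>
      show "emeasure (B u) (?E n) \<le> ennreal (68 * wconst 1 / ((1 / 2) ^ n)\<^sup>2) * L2n (step_fun (d n)) +
        ennreal (68 * wconst 1 / (1 / 2) ^ n) * L1n (\<lambda>s. 1 / sqrt s) (\<lambda>s. step_fun (d n) (s + u))" for n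
        using bridge_maximal[OF law d(1)[of n], of "{min u t}" "(1 / 2) ^ n"] t1
        by (intro order_trans[OF _ add_increasing2[OF zero_le order_refl]]) auto
      show "(\<Sum>n. ennreal (68 * wconst 1 / ((1 / 2) ^ n)\<^sup>2) * L2n (step_fun (d n)) +
        ennreal (68 * wconst 1 / (1 / 2) ^ n) * L1n (\<lambda>s. 1 / sqrt s) (\<lambda>s. step_fun (d n) (s + u))) < \<infinity>"
        by (rule threshold_bound_finite[OF u K])
    qed
    with AE_space show ?thesis
    proof eventually_elim
      fix x assume x: "x \<in> space (B u)" and ev: "\<forall>\<^sub>F n in sequentially. x \<notin> ?E n"
      have "\<forall>\<^sub>F n in sequentially. \<bar>step_integral (\<xi> (Suc n)) x - step_integral (\<xi> n) x\<bar> \<le> (1 / 2) ^ n"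
        using ev by eventually_elim (use x in \<open>auto simp: \<xi>(3) d(3)[symmetric] P(3) not_le less_imp_le\<close>)
      then show "convergent (\<lambda>n. step_integral (\<xi> n) x)" by (rule convergent_of_geometric_increments)
    qed
  qed
  have conv2: "AE y in R. convergent (\<lambda>n. step_integral (\<zeta> n) y)"
  proof -
    obtain K where K: "0 \<le> K" and max: "\<And>\<sigma> Q l. is_step \<sigma> \<Longrightarrow> finite Q \<Longrightarrow> Q \<subseteq> {0..} \<Longrightarrow> 0 < l \<Longrightarrow>
      emeasure R {y \<in> space Omega. \<exists>t\<in>Q. l \<le> \<bar>step_integral \<sigma> (stopped t y)\<bar>}
      \<le> ennreal (K / l\<^sup>2) * L2n (step_fun \<sigma>) + ennreal (K / l) * L1n (\<lambda>s. 1 / sqrt s) (step_fun \<sigma>)"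
      unfolding R_eq by (rule symmetrized_bessel_maximal[OF bessel]) blast
    let ?E = "\<lambda>n. {y \<in> space Omega. \<exists>r\<in>{max (t - u) 0}. (1 / 2) ^ n \<le> \<bar>step_integral (\<delta> n) (stopped r y)\<bar>}"
    have "AE y in R. \<forall>\<^sub>F n in sequentially. y \<notin> ?E n"
    proof (rule AE_eventually_notin)
      show "?E n \<in> sets R" for n
        unfolding R_basic(2) by (intro step_event_sets \<delta>(1)) auto
      show "emeasure R (?E n) \<le> ennreal (K / ((1 / 2) ^ n)\<^sup>2) * L2n (step_fun (d n)) +
        ennreal (K / (1 / 2) ^ n) * L1n (\<lambda>s. 1 / sqrt s) (\<lambda>s. step_fun (d n) (s + u))" for n
      proof -
        have "emeasure R (?E n) \<le> ennreal (K / ((1 / 2) ^ n)\<^sup>2) * L2n (step_fun (\<delta> n)) +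
          ennreal (K / (1 / 2) ^ n) * L1n (\<lambda>s. 1 / sqrt s) (step_fun (\<delta> n))"
          by (rule max[OF \<delta>(1)]) auto
        also have "L1n (\<lambda>s. 1 / sqrt s) (step_fun (\<delta> n)) = L1n (\<lambda>s. 1 / sqrt s) (\<lambda>s. step_fun (d n) (s + u))"
          unfolding L1n_def \<delta>(2) by (intro nn_integral_cong) (auto simp: indicator_def)
        also have "ennreal (K / ((1 / 2) ^ n)\<^sup>2) * L2n (step_fun (\<delta> n)) \<le> ennreal (K / ((1 / 2) ^ n)\<^sup>2) * L2n (step_fun (d n))"
          using u0 by (intro mult_left_mono L2n_shift_le[OF _ _ \<delta>(2)]) auto
        finally show ?thesis by (simp add: add_right_mono)
      qed
      show "(\<Sum>n. ennreal (K / ((1 / 2) ^ n)\<^sup>2) * L2n (step_fun (d n)) +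
        ennreal (K / (1 / 2) ^ n) * L1n (\<lambda>s. 1 / sqrt s) (\<lambda>s. step_fun (d n) (s + u))) < \<infinity>"
        by (rule threshold_bound_finite[OF u K])
    qed
    with AE_space show ?thesis
    proof eventually_elim
      fix y assume y: "y \<in> space R" and ev: "\<forall>\<^sub>F n in sequentially. y \<notin> ?E n"
      have "\<forall>\<^sub>F n in sequentially. \<bar>step_integral (\<zeta> (Suc n)) y - step_integral (\<zeta> n) y\<bar> \<le> (1 / 2) ^ n"
        using ev by eventually_elim (use y in \<open>auto simp: \<zeta>(3) \<delta>(3) d(3)[symmetric] R_basic(3) not_le less_imp_le\<close>)
      then show "convergent (\<lambda>n. step_integral (\<zeta> n) y)" by (rule convergent_of_geometric_increments)
    qed
  qed
  have h1 [measurable]: "?h1 \<in> borel_measurable borel" and h2 [measurable]: "?h2 \<in> borel_measurable borel"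
    by measurable
  have eq1: "step_fun (\<xi> n) s - ?h1 s = indicator {0..<min u t} s * (step_fun (\<phi> n) s - f s)" for n s
    by (simp add: \<xi>(2) algebra_simps)
  have eq2: "step_fun (\<zeta> n) s - ?h2 s = indicator {0..<max (t - u) 0} s * (step_fun (\<phi> n) (s + u) - f (s + u))" for n s
    by (simp add: \<zeta>(2) algebra_simps)
  have L1: "(\<lambda>n. L2n (\<lambda>s. step_fun (\<xi> n) s - ?h1 s)) \<longlonglongrightarrow> 0"
    unfolding eq1 by (rule ennreal_tendsto_0_le[OF L2n_restrict_le[where A = "{0..<min u t}"] approx_tendsto(1)]) simp
  have L2: "(\<lambda>n. L2n (\<lambda>s. step_fun (\<zeta> n) s - ?h2 s)) \<longlonglongrightarrow> 0"
  proof (rule ennreal_tendsto_0_le[OF _ approx_tendsto(1)])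
    fix n
    have "L2n (\<lambda>s. step_fun (\<zeta> n) s - ?h2 s) \<le> L2n (\<lambda>s. indicator {0..} s * (step_fun (\<phi> n) (s + u) - f (s + u)))"
      unfolding eq2 L2n_def by (intro nn_integral_mono) (auto simp: indicator_def)
    also have "\<dots> \<le> L2n (\<lambda>s. step_fun (\<phi> n) s - f s)"
      using u0 by (intro L2n_shift_le[of "\<lambda>s. step_fun (\<phi> n) s - f s" u]) auto
    finally show "L2n (\<lambda>s. step_fun (\<zeta> n) s - ?h2 s) \<le> L2n (\<lambda>s. step_fun (\<phi> n) s - f s)" .
  qed
  have L3: "(\<lambda>n. L1n (\<lambda>s. 1 / sqrt s) (\<lambda>s. step_fun (\<zeta> n) s - ?h2 s)) \<longlonglongrightarrow> 0"
  proof (rule ennreal_tendsto_0_le)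
    show "L1n (\<lambda>s. 1 / sqrt s) (\<lambda>s. step_fun (\<zeta> n) s - ?h2 s) \<le> L1n (\<lambda>s. 1 / sqrt s) (\<lambda>s. step_fun (\<phi> n) (s + u) - f (s + u))" for n
      unfolding eq2 L1n_def by (intro nn_integral_mono) (auto simp: indicator_def)
    show "(\<lambda>n. L1n (\<lambda>s. 1 / sqrt s) (\<lambda>s. step_fun (\<phi> n) (s + u) - f (s + u))) \<longlonglongrightarrow> 0"
      using u by (simp add: regular_def)
  qed
  have h10: "?h1 s = 0" if "u \<le> s" for s using that by simp
  note lim1 = is_wiener_bridge_limit[OF law \<xi>(1,4) h1 h10 L1 conv1]
  note lim2 = is_wiener_bessel_limit[OF bessel R_eq \<zeta>(1) h2 L2 L3 conv2]
  let ?D = "\<lambda>X. wiener_bridge (B u) u ?h1 (restrict X {0..u}) + wiener_bessel R ?h2 (shift_path u X)"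
  \<comment> \<open>Being good is a property of the whole concatenation and not of one of its
    pieces. It enters as a premise here and is discharged by \<open>AE_C_good\<close> at the
    end.\<close>
  have "AE X in C u. X \<in> good \<longrightarrow> J t X = ?D X"
  proof (rule AE_concat_lawI[OF law R_basic(1,2,4) _ lim1(1) lim2(1)])
    have m1: "(\<lambda>X. restrict X {0..u}) \<in> measurable Omega (path_space {0..u})"
    proof (rule measurable_path_spaceI)
      fix s assume s: "s \<in> {0..u}"
      then have "(\<lambda>X. X s) \<in> borel_measurable Omega" by (intro measurable_path_space_component) auto
      then show "(\<lambda>X. restrict X {0..u} s) \<in> borel_measurable Omega" using s by simp
    next
      fix X :: "real \<Rightarrow> real" assume "X \<in> space Omega"
      then have "continuous_on {0..u} X"
        by (auto simp: space_path_space intro: continuous_on_subset)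
      then show "continuous_on {0..u} (restrict X {0..u})" by (simp only: continuous_on_restrict_iff)
    qed auto
    have m2: "shift_path u \<in> measurable Omega Omega"
    proof (rule measurable_path_spaceI)
      fix s :: real assume s: "s \<in> {0..}"
      then have "(\<lambda>X. X (u + s)) \<in> borel_measurable Omega"
        using u0 by (intro measurable_path_space_component) auto
      then show "(\<lambda>X. shift_path u X s) \<in> borel_measurable Omega" using s by (simp add: shift_path_def)
    next
      fix X :: "real \<Rightarrow> real" assume "X \<in> space Omega"
      then have "continuous_on {0..} (\<lambda>s. X (u + s))"
        using u0 by (auto simp: space_path_space intro!: continuous_on_compose2[of "{0..}" X] continuous_intros)
      then show "continuous_on {0..} (shift_path u X)"
        unfolding shift_path_def by (simp only: continuous_on_restrict_iff)
    qed (simp add: shift_path_def)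
    have b1: "wiener_bridge (B u) u ?h1 \<in> borel_measurable (path_space {0..u})"
      using lim1(2) by (simp only: measurable_cong_sets[OF P(2) refl])
    have b2: "wiener_bessel R ?h2 \<in> borel_measurable Omega"
      using lim2(2) by (simp only: measurable_cong_sets[OF R_basic(2) refl])
    have Dm: "?D \<in> borel_measurable Omega"
      by (rule borel_measurable_add[OF measurable_compose[OF m1 b1] measurable_compose[OF m2 b2]])
    have Jm: "J t \<in> borel_measurable Omega"
      using t by (intro J_measurable) auto
    have "{X \<in> space Omega. X \<in> good \<longrightarrow> J t X = ?D X} = (space Omega - good) \<union> {X \<in> space Omega. J t X = ?D X}"
      by auto
    also have "\<dots> \<in> sets Omega"
    proof (intro sets.Un sets.Diff sets.top good_sets)
      show "{X \<in> space Omega. J t X = ?D X} \<in> sets Omega"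
        by (rule borel_measurable_eq[OF Jm Dm])
    qed
    finally show "{X \<in> space Omega. X \<in> good \<longrightarrow> J t X = ?D X} \<in> sets Omega" .
    fix x y
    assume xs: "x \<in> space (path_space {0..u})" and ys: "y \<in> space Omega" and x0: "x u = 0" and y0: "y 0 = 0"
      and p: "(\<lambda>n. step_integral (\<xi> n) x) \<longlonglongrightarrow> wiener_bridge (B u) u ?h1 x"
      and q: "(\<lambda>n. step_integral (\<zeta> n) y) \<longlonglongrightarrow> wiener_bessel R ?h2 y"
    let ?X = "concat_path u x y"
    have X: "?X s = x (min s u) + y (max (s - u) 0)" if "0 \<le> s" for s
      using that u0 x0 y0 by (simp add: concat_path_eq)
    \<comment> \<open>The chosen integrals are functions on paths about which nothing pointwise is
      known, so the pieces must be recovered as functions on all of \<real>; off the time set this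
      rests on extensionality.\<close>
    have rx: "restrict ?X {0..u} = x"
    proof (rule ext)
      fix s show "restrict ?X {0..u} s = x s"
      proof (cases "s \<in> {0..u}")
        case True
        then have "min s u = s" "max (s - u) 0 = 0" by auto
        then show ?thesis using True X[of s] y0 by simp
      next
        case False
        have "x \<in> extensional {0..u}" using xs by (simp add: space_path_space)
        from extensional_arb[OF this False] show ?thesis using False by (simp only: restrict_apply if_False)
      qed
    qed
    have sy: "shift_path u ?X = y"
    proof (rule ext)
      fix s show "shift_path u ?X s = y s"
      proof (cases "0 \<le> s")
        case True
        then have "min (u + s) u = u" "max (u + s - u) 0 = s" by auto
        then show ?thesis using True X[of "u + s"] x0 u0 by (simp add: shift_path_def)
      next
        case False
        have "y \<in> extensional {0..}" using ys by (simp add: space_path_space)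
        from extensional_arb[OF this, of s] show ?thesis using False by (simp add: shift_path_def)
      qed
    qed
    show "?X \<in> good \<longrightarrow> J t ?X = ?D ?X"
    proof
      assume g: "?X \<in> good"
      have "step_integral (\<phi> n) (stopped t ?X) = step_integral (\<xi> n) x + step_integral (\<zeta> n) y" for n
        unfolding \<xi>(3) \<zeta>(3) using t u0 x0 y0
        by (subst step_integral_concat[OF step]) (auto simp: min.commute)
      then have "(\<lambda>n. step_integral (\<phi> n) (stopped t ?X)) \<longlonglongrightarrow> wiener_bridge (B u) u ?h1 x + wiener_bessel R ?h2 y"
        using tendsto_add[OF p q] by simp
      then show "J t ?X = ?D ?X"
        unfolding rx sy by (rule LIMSEQ_unique[OF good_limit[OF g t]])
    qed
  qed
  with AE_C_good[OF u] show ?thesis by eventually_elim simp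
qed

end

theorem theorem1p4:
  fixes T :: real and f :: "real \<Rightarrow> real"
    and B :: "real \<Rightarrow> (real \<Rightarrow> real) measure"
    and Rplus R W :: "(real \<Rightarrow> real) measure"
  assumes bridge: "\<And>u. 0 < u \<Longrightarrow> brownian_bridge_law u (B u)"
    and bessel: "bessel3_law Rplus"
    and R_eq: "R = symmetrize Rplus"
    and W_eq: "W = W_measure B R"
    and T_pos: "0 < T"
    and f_meas: "set_borel_measurable lebesgue {0..T} f"
    and f_L2: "set_integrable lebesgue {0..T} (\<lambda>s. (f s)\<^sup>2)"
    and f_ext: "\<And>s. s \<notin> {0..T} \<Longrightarrow> f s = 0"
  shows "\<exists>I :: real \<Rightarrow> real \<Rightarrow> (real \<Rightarrow> real) \<Rightarrow> real.
    (\<lambda>(t, u, X). I t u X) \<in> borel_measurable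
       (restrict_space borel {0..T} \<Otimes>\<^sub>M (restrict_space borel {0..} \<Otimes>\<^sub>M Omega)) \<and>
    (AE u in lborel. 0 \<le> u \<longrightarrow>
       (AE X in concat_law u (B u) R. continuous_on {0..T} (\<lambda>t. I t u X))) \<and>
    (\<forall>t\<in>{0..T}. AE X in W. wiener_W_process W T f t X = I t (last_exit X) X) \<and>
    (\<forall>t\<in>{0..T}. AE u in lborel. 0 \<le> u \<longrightarrow>
       (AE X in concat_law u (B u) R.
          I t u X =
            wiener_bridge (B u) u (\<lambda>s. indicator {0..<min u t} s * f s) (restrict X {0..u}) +
            wiener_bessel R (\<lambda>s. indicator {0..<max (t - u) 0} s * f (s + u)) (shift_path u X)))"
proof -
  have ind: "indicator {0..T} s *\<^sub>R f s = f s" for s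
    using f_ext[of s] by (cases "s \<in> {0..T}") auto
  have "f \<in> borel_measurable lebesgue"
    using f_meas by (simp only: set_borel_measurable_def ind)
  then obtain f' where f': "f' \<in> borel_measurable lborel" "AE s in lborel. f s = f' s"
    using completion_ex_borel_measurable_real by blast
  \<comment> \<open>A Borel version of \<open>f\<close> that vanishes from \<open>T\<close> on. The
    point \<open>T\<close> is removed because steps live on half-open cells and end by
    \<open>T\<close>.\<close>
  define f0 where "f0 s = indicator {0..<T} s * f' s" for s
  have f0m [measurable]: "f0 \<in> borel_measurable borel"
    using f'(1) unfolding f0_def by simp
  have ff0: "AE s in lborel. f s = f0 s"
    using f'(2) AE_lborel_singleton[of T]
  proof eventually_elim
    fix s assume "f s = f' s" "s \<noteq> T"
    then show "f s = f0 s" using f_ext[of s] by (cases "s \<in> {0..<T}") (auto simp: f0_def)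
  qed
  have fin: "L2n f0 < \<infinity>"
  proof -
    have "integrable lebesgue (\<lambda>s. (f s)\<^sup>2)"
    proof -
      have "indicator {0..T} s *\<^sub>R (f s)\<^sup>2 = (f s)\<^sup>2" for s
        using f_ext[of s] by (cases "s \<in> {0..T}") auto
      then show ?thesis using f_L2 by (simp only: set_integrable_def)
    qed
    then have "(\<integral>\<^sup>+s. ennreal (norm ((f s)\<^sup>2)) \<partial>lebesgue) < \<infinity>"
      by (simp add: integrable_iff_bounded)
    moreover have "L2n f0 \<le> (\<integral>\<^sup>+s. ennreal (norm ((f s)\<^sup>2)) \<partial>lborel)"
      unfolding L2n_def using ff0 by (intro nn_integral_mono_AE) (auto simp: indicator_def)
    ultimately show ?thesis
      unfolding nn_integral_completion by (rule le_less_trans[rotated])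
  qed
  have "step_approx T f0"
    by (rule step_approx_L2[OF f0m fin T_pos]) (simp add: f0_def)
  then have "\<exists>\<phi>. is_step \<phi> \<and> step_end \<phi> \<le> T \<and> L2n (\<lambda>s. step_fun \<phi> s - f0 s) \<le> ennreal (((1 / 8) ^ n)\<^sup>2)" for n
    unfolding step_approx_def by simp
  then obtain \<phi> where \<phi>: "\<And>n. is_step (\<phi> n)" "\<And>n. step_end (\<phi> n) \<le> T"
    "\<And>n. L2n (\<lambda>s. step_fun (\<phi> n) s - f0 s) \<le> ennreal (((1 / 8) ^ n)\<^sup>2)"
    by metis
  interpret wiener_approximation B Rplus R W T f0 \<phi>
    by unfold_locales (use bridge bessel R_eq W_eq T_pos \<phi> in \<open>auto simp: f0_def[abs_def] intro: f0m[unfolded f0_def[abs_def]]\<close>)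
  have cong: "AE s in lborel. indicator A s * f s = indicator A s * f0 s" for A
    using ff0 by eventually_elim simp
  have cong_shift: "AE s in lborel. indicator A s * f (s + u) = indicator A s * f0 (s + u)" for A u
    using AE_lborel_shift[OF ff0, of u] by eventually_elim simp
  \<comment> \<open>Exhibiting \<open>J\<close> makes the choice \<open>wiener_W_process\<close>
    meaningful. At each fixed \<open>t\<close> the chosen process and \<open>J\<close> are almost
    everywhere equal to the same Wiener integral, hence to each other.\<close>
  have proc: "is_wiener_W_process W T f J"
    unfolding is_wiener_W_process_def wiener_cong_AE(1)[OF cong]
    using J_W_measurable J_continuous wiener_W_eq_J by auto
  then have "is_wiener_W_process W T f (wiener_W_process W T f)"
    unfolding wiener_W_process_def by (rule someI[where P = "is_wiener_W_process W T f"])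
  then have wp: "AE X in W. wiener_W_process W T f t X = wiener_W W (\<lambda>s. indicator {0..<t} s * f0 s) X"
    if "t \<in> {0..T}" for t
    using that unfolding is_wiener_W_process_def wiener_cong_AE(1)[OF cong] by auto
  show ?thesis
  \<comment> \<open>The witness is constant in \<open>u\<close>, so substituting
    \<open>last_exit X\<close> leaves \<open>J t X\<close>, and the identity under \<open>W\<close>
    is the agreement of two modifications at a fixed time.\<close>
  proof (intro exI[of _ "\<lambda>t u X. J t X"] conjI ballI)
    let ?M = "restrict_space borel {0..T} \<Otimes>\<^sub>M (restrict_space borel {0..} \<Otimes>\<^sub>M Omega)"
    have "(\<lambda>p. J (fst p) (snd (snd p))) \<in> borel_measurable ?M"
    proof (rule J_measurable)
      show "fst \<in> borel_measurable ?M"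
        by (rule measurable_compose[OF measurable_fst]) (auto intro!: measurable_restrict_space1)
      show "(\<lambda>p. snd (snd p)) \<in> measurable ?M Omega" by measurable
      show "0 \<le> fst p" if "p \<in> space ?M" for p
        using that by (auto simp: space_pair_measure space_restrict_space)
    qed
    then show "(\<lambda>(t, u, X). J t X) \<in> borel_measurable ?M"
      by (simp add: case_prod_beta')
    show "AE u in lborel. 0 \<le> u \<longrightarrow> (AE X in C u. continuous_on {0..T} (\<lambda>t. J t X))"
      using J_continuous by auto
    fix t assume t: "t \<in> {0..T}"
    show "AE X in W. wiener_W_process W T f t X = J t X"
      using wp[OF t] wiener_W_eq_J[OF t] by eventually_elim simp
    \<comment> \<open>The claim ranges over \<open>0 \<le> u\<close>, while bridge laws are given
      for \<open>0 < u\<close>; the point 0 is discarded as a null set.\<close>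
    have "AE u in lborel. u \<noteq> (0::real)" by (rule AE_lborel_singleton)
    with AE_regular show "AE u in lborel. 0 \<le> u \<longrightarrow>
       (AE X in C u. J t X =
            wiener_bridge (B u) u (\<lambda>s. indicator {0..<min u t} s * f s) (restrict X {0..u}) +
            wiener_bessel R (\<lambda>s. indicator {0..<max (t - u) 0} s * f (s + u)) (shift_path u X))"
      unfolding wiener_cong_AE(2)[OF cong] wiener_cong_AE(3)[OF cong_shift]
      by eventually_elim (use decomposition[OF _ t] in auto)
  qed
qed

end
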